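(* Let $(\mathcal{C},\mathbb{E},\mathfrak{s})$ be an extriangulated category satisfying Condition (WIC), and let $\xi$ be a proper class of $\mathbb{E}$-triangles in $\mathcal{C}$ such that $\mathcal{C}$ has enough $\xi$-projectives and enough $\xi$-injectives. Let $N$ be an object in $\mathcal{C}$ and let $\mathbf{M}:\ M\xrightarrow{x}M'\xrightarrow{y}M''\dashrightarrow^{\delta}$ be a $\mathcal{C}(\mathcal{GP}(\xi),-)$-exact $\mathbb{E}$-triangle in $\xi$ such that $\xi\text{-}\mathcal{G}\mathrm{pd}M<\infty$ and $\xi\text{-}\mathcal{G}\mathrm{pd}M''<\infty$. (1) There are homomorphisms $\varepsilon^i_{\mathcal{GP}}(\mathbf{M},N):\xi\mathrm{xt}^{i}_{\mathcal{GP}(\xi)}(M,N)\to \xi\mathrm{xt}^{i+1}_{\mathcal{GP}(\xi)}(M'',N)$, natural in $\mathbf{M}$ and $N$, such that the following sequence is exact: $$0\to \xi\mathrm{xt}^0_{\mathcal{GP}(\xi)}(M'',N)\to\xi\mathrm{xt}^0_{\mathcal{GP}(\xi)}(M',N)\to\xi\mathrm{xt}^0_{\mathcal{GP}(\xi)}(M,N)\to \xi\mathrm{xt}^1_{\mathcal{GP}(\xi)}(M'',N)\to\cdots$$ $$\cdots\to \xi\mathrm{xt}^{n-1}_{\mathcal{GP}(\xi)}(M,N)\to \xi\mathrm{xt}^{n}_{\mathcal{GP}(\xi)}(M'',N)\to\xi\mathrm{xt}^n_{\mathcal{GP}(\xi)}(M',N)\to\xi\mathrm{xt}^n_{\mathcal{GP}(\xi)}(M,N)\to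 \cdots.$$ (2) There are maps $\delta^{i}(M,N): \xi\mathrm{xt}^{i}_{\mathcal{GP}(\xi)}(M,N)\to \xi\mathrm{xt}^{i}_{\xi}(M,N)$ and $\delta^{i}(M'',N): \xi\mathrm{xt}^{i}_{\mathcal{GP}(\xi)}(M'',N)\to \xi\mathrm{xt}^{i}_{\xi}(M'',N)$ such that for each $i\ge0$ the diagram $$\begin{array}{ccc}\xi\mathrm{xt}^{i}_{\mathcal{GP}(\xi)}(M,N)&\xrightarrow{\ \varepsilon^i_{\mathcal{GP}}(\mathbf{M},N)\ }&\xi\mathrm{xt}^{i+1}_{\mathcal{GP}(\xi)}(M'',N)\\ {\scriptstyle\delta^{i}(M,N)}\downarrow&&\downarrow{\scriptstyle\delta^{i+1}(M'',N)}\\ \xi\mathrm{xt}^{i}_{\xi}(M,N)&\xrightarrow{\ \varepsilon^i_{\mathcal{P}}(\mathbf{M},N)\ }&\xi\mathrm{xt}^{i+1}_{\xi}(M'',N)\end{array}$$ is commutative.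
   Context: **Extriangulated categories (Nakaoka--Palu).** Let $\mathcal{C}$ be an additive category with an additive bifunctor $\mathbb{E}:\mathcal{C}^{\mathrm{op}}\times\mathcal{C}\to\mathrm{Ab}$. An element $\delta\in\mathbb{E}(C,A)$ is an $\mathbb{E}$-extension; for $a:A\to A'$ and $c:C'\to C$ put $a_*\delta=\mathbb{E}(C,a)(\delta)$, $c^*\delta=\mathbb{E}(c,A)(\delta)$. A morphism from $\delta\in\mathbb{E}(C,A)$ to $\delta'\in\mathbb{E}(C',A')$ is a pair $(a:A\to A',\,c:C\to C')$ with $a_*\delta=c^*\delta'$. Sequences $A\to B\to C$ and $A\to B'\to C$ are equivalent if there is an isomorphism $B\cong B'$ compatible with the identities of $A$ and $C$. A realization $\mathfrak{s}$ assigns to each $\delta\in\mathbb{E}(C,A)$ an equivalence class $\mathfrak{s}(\delta)=[A\xrightarrow{x}B\xrightarrow{y}C]$ such that for every morphism $(a,c):\delta\to\delta'$, with $\mathfrak{s}(\delta')=[A'\xrightarrow{x'}B'\xrightarrow{y'}C']$, there is $b:B\to B'$ with $bx=x'a$, $y'b=cy$ (then $(a,b,c)$ realizes $(a,c)$). It is additive if $\mathfrak{s}(0)=[A\to A\oplus C\to C]$ and $\mathfrak{s}(\delta\oplus\delta')=\mathfrak{s}(\delta)\oplus\mathfrak{s}(\delta')$. $(\mathcal{C},\mathbb{E},\mathfrak{s})$ is extriangulated if $\mathfrak{s}$ is an additive realization and: (ET3) if $\mathfrak{s}(\delta)=[A\xrightarrow{x}B\xrightarrow{y}C]$, $\mathfrak{s}(\delta')=[A'\xrightarrow{x'}B'\xrightarrow{y'}C']$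 and $bx=x'a$, there is $c:C\to C'$ with $cy=y'b$ and $a_*\delta=c^*\delta'$; (ET3)$^{\mathrm{op}}$ the dual; (ET4) if $\delta\in\mathbb{E}(D,A)$ and $\delta'\in\mathbb{E}(F,B)$ are realized by $A\xrightarrow{f}B\xrightarrow{f'}D$ and $B\xrightarrow{g}C\xrightarrow{g'}F$, there are an object $E$, morphisms $h'\colon C\to E$, $d\colon D\to E$, $e\colon E\to F$ with $h'g=df'$, $eh'=g'$, and $\delta''\in\mathbb{E}(E,A)$ realized by $A\xrightarrow{gf}C\xrightarrow{h'}E$, such that $D\xrightarrow{d}E\xrightarrow{e}F$ realizes $f'_*\delta'$, $d^*\delta''=\delta$ and $f_*\delta''=e^*\delta'$; (ET4)$^{\mathrm{op}}$ the dual. If $\mathfrak{s}(\delta)=[A\xrightarrow{x}B\xrightarrow{y}C]$, one calls $x$ an inflation, $y$ a deflation, and $A\xrightarrow{x}B\xrightarrow{y}C\dashrightarrow^{\delta}$ an $\mathbb{E}$-triangle; it is split if $\delta=0$. A morphism of $\mathbb{E}$-triangles is a triple $(a,b,c)$ realizing a morphism of $\mathbb{E}$-extensions. **Condition (WIC).** For composable $f,g$: if $gf$ is an inflation, so is $f$; if $gf$ is a deflation, so is $g$. **Proper class.** A class $\xi$ of $\mathbb{E}$-triangles closed under isomorphisms is proper if: it is closed under finite coproducts and contains all split $\mathbb{E}$-triangles; it is closed under base change and cobase change (if the $\mathbb{E}$-triangle of $\delta$ is in $\xi$, so are all $\mathbb{E}$-triangles realizing $c^*\delta$ or $a_*\delta$);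 and it is saturated: for $\mathbb{E}$-triangles $A_i\xrightarrow{x_i}B_i\xrightarrow{y_i}C\dashrightarrow^{\delta_i}$ ($i=1,2$), if the $\mathbb{E}$-triangle of $\delta_2$ and the $\mathbb{E}$-triangle $A_1\to M\to B_2$ realizing $y_2^*\delta_1$ are in $\xi$, then the $\mathbb{E}$-triangle of $\delta_1$ is in $\xi$. **Projectives and injectives.** $P$ is $\xi$-projective if $0\to\mathcal{C}(P,A)\to\mathcal{C}(P,B)\to\mathcal{C}(P,C)\to0$ is exact for every $A\to B\to C\dashrightarrow$ in $\xi$; $\xi$-injective is dual. $\mathcal{P}(\xi)$, $\mathcal{I}(\xi)$ denote these classes. Enough $\xi$-projectives: each object $A$ fits in an $\mathbb{E}$-triangle $K\to P\to A\dashrightarrow$ in $\xi$ with $P\in\mathcal{P}(\xi)$; enough $\xi$-injectives: dual. **Exactness.** For a class $\mathcal{W}$ of objects, an $\mathbb{E}$-triangle $A\to B\to C\dashrightarrow$ in $\xi$ is $\mathcal{C}(-,\mathcal{W})$-exact if $0\to\mathcal{C}(C,W)\to\mathcal{C}(B,W)\to\mathcal{C}(A,W)\to0$ is exact for all $W\in\mathcal{W}$, and $\mathcal{C}(\mathcal{W},-)$-exact if $0\to\mathcal{C}(W,A)\to\mathcal{C}(W,B)\to\mathcal{C}(W,C)\to0$ is exact for all $W\in\mathcal{W}$. A complex $\cdots\to X_1\xrightarrow{d_1}X_0\xrightarrow{d_0}X_{-1}\to\cdots$ is $\xi$-exact if there are $\mathbb{E}$-triangles $K_{n+1}\xrightarrow{g_n}X_n\xrightarrow{f_n}K_n\dashrightarrow$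 in $\xi$ with $d_n=g_{n-1}f_n$ for all $n$; it is $\mathcal{C}(-,\mathcal{W})$-exact if these can be chosen $\mathcal{C}(-,\mathcal{W})$-exact. **Gorenstein objects and dimension.** A complete $\xi$-projective resolution is a $\mathcal{C}(-,\mathcal{P}(\xi))$-exact complex with all terms in $\mathcal{P}(\xi)$; the objects $K_n$ in its $\mathcal{C}(-,\mathcal{P}(\xi))$-exact $\mathbb{E}$-triangles are called $\xi$-$\mathcal{G}$projective, and form the class $\mathcal{GP}(\xi)$. $\xi$-$\mathcal{G}\mathrm{pd}A=0$ if $A\in\mathcal{GP}(\xi)$; for $n>0$, $\xi$-$\mathcal{G}\mathrm{pd}A\le n$ if there is an $\mathbb{E}$-triangle $K\to G\to A\dashrightarrow$ in $\xi$ with $G\in\mathcal{GP}(\xi)$ and $\xi$-$\mathcal{G}\mathrm{pd}K\le n-1$; $\xi$-$\mathcal{G}\mathrm{pd}A$ is the least such $n$, or $\infty$. **$\xi$-cohomology.** A $\xi$-projective resolution $\pi:\mathbf{P}\to M$ is a $\xi$-exact complex $\cdots\to P_1\to P_0\to M\to0$ with all $P_n\in\mathcal{P}(\xi)$; $\mathbf{P}$ is the deleted complex $\cdots\to P_1\to P_0\to0$. Define $\xi\mathrm{xt}^n_{\xi}(M,N)=H^n(\mathcal{C}(\mathbf{P},N))$ for $n\ge0$ (independent of the choice of $\mathbf{P}$). For an $\mathbb{E}$-triangle $\mathbf{M}:M\to M'\to M''\dashrightarrow$ in $\xi$, $\varepsilon^i_{\mathcal{P}}(\mathbf{M},N):\xi\mathrm{xt}^i_\xi(M,N)\to\xi\mathrm{xt}^{i+1}_\xi(M'',N)$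 denotes the usual connecting map, i.e. the one of the short exact sequence $0\to\mathcal{C}(\mathbf{P}'',N)\to\mathcal{C}(\mathbf{P}',N)\to\mathcal{C}(\mathbf{P},N)\to0$ coming from a degreewise split sequence $\mathbf{P}\to\mathbf{P}'\to\mathbf{P}''$ of $\xi$-projective resolutions of $M,M',M''$ lifting $M\to M'\to M''$ (Horseshoe Lemma). **$\xi$-Gorenstein cohomology.** A $\xi$-$\mathcal{G}$projective resolution $\mathbf{G}\to M$ is a $\xi$-exact complex $\cdots\to G_1\to G_0\to M\to0$ with $G_i\in\mathcal{GP}(\xi)$ whose $\mathbb{E}$-triangles $K_{i+1}\to G_i\to K_i\dashrightarrow$ ($i\ge0$, $K_0=M$) are in $\xi$ and $\mathcal{C}(\mathcal{GP}(\xi),-)$-exact. For an object $M$ admitting such a resolution (in particular whenever $\xi$-$\mathcal{G}\mathrm{pd}M<\infty$; also for the middle term $M'$ of $\mathbf{M}$ as in the claim) and $i\ge0$, define $\xi\mathrm{xt}^i_{\mathcal{GP}(\xi)}(M,N)=H^i(\mathcal{C}(\mathbf{G},N))$ with $\mathbf{G}$ the deleted complex (independent of the choice). *)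

theory Defs
  imports "HOL-Algebra.Exact_Sequence" "HOL-Library.Extended_Nat"
begin

section \<open>Additive categories\<close>

text \<open>
  Abelian groups are, as usual in HOL-Algebra, multiplicatively written commutative groups:
  \<open>\<otimes>\<close> on \<open>Hom A B\<close> is the sum of morphisms and \<open>\<one>\<close> is the zero morphism.
  The sets \<open>Hom A B\<close> need not be disjoint; source and target are always carried explicitly.
  \<open>g \<cdot> f\<close> is \<open>g\<close> after \<open>f\<close>.
\<close>

record ('o, 'm) precat =
  Obj :: "'o set"
  Hom :: "'o \<Rightarrow> 'o \<Rightarrow> 'm monoid"
  Idm :: "'o \<Rightarrow> 'm"
  Cmp :: "'m \<Rightarrow> 'm \<Rightarrow> 'm"  (infixl \<open>\<cdot>\<index>\<close> 75)

abbreviation Mor :: "('o, 'm, 'z) precat_scheme \<Rightarrow> 'o \<Rightarrow> 'o \<Rightarrow> 'm set"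
  where "Mor X A B \<equiv> carrier (Hom X A B)"

context
  fixes X :: "('o, 'm, 'z) precat_scheme" (structure)
begin

definition cat_iso :: "'o \<Rightarrow> 'o \<Rightarrow> 'm \<Rightarrow> bool" where
  "cat_iso A B f \<longleftrightarrow> f \<in> Mor X A B \<and> (\<exists>g \<in> Mor X B A. g \<cdot> f = Idm X A \<and> f \<cdot> g = Idm X B)"

text \<open>\<open>biprod A B (S, i, j, p, q)\<close>: \<open>S = A \<oplus> B\<close> with injections \<open>i, j\<close> and projections \<open>p, q\<close>.\<close>

fun biprod :: "'o \<Rightarrow> 'o \<Rightarrow> 'o \<times> 'm \<times> 'm \<times> 'm \<times> 'm \<Rightarrow> bool" where
  "biprod A B (S, i, j, p, q) \<longleftrightarrow>
     A \<in> Obj X \<and> B \<in> Obj X \<and> S \<in> Obj X \<and>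
     i \<in> Mor X A S \<and> j \<in> Mor X B S \<and> p \<in> Mor X S A \<and> q \<in> Mor X S B \<and>
     p \<cdot> i = Idm X A \<and> q \<cdot> j = Idm X B \<and>
     q \<cdot> i = \<one>\<^bsub>Hom X A B\<^esub> \<and> p \<cdot> j = \<one>\<^bsub>Hom X B A\<^esub> \<and>
     (i \<cdot> p) \<otimes>\<^bsub>Hom X S S\<^esub> (j \<cdot> q) = Idm X S"

text \<open>The morphism \<open>f \<oplus> g\<close> between two biproducts.\<close>

fun mor_sum :: "'o \<times> 'm \<times> 'm \<times> 'm \<times> 'm \<Rightarrow> 'o \<times> 'm \<times> 'm \<times> 'm \<times> 'm \<Rightarrow> 'm \<Rightarrow> 'm \<Rightarrow> 'm" where
  "mor_sum (S, i, j, p, q) (S', i', j', p', q') f g =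
     (i' \<cdot> f \<cdot> p) \<otimes>\<^bsub>Hom X S S'\<^esub> (j' \<cdot> g \<cdot> q)"

text \<open>Sequences \<open>A \<rightarrow> B \<rightarrow> C\<close> with fixed ends are triples \<open>(B, x, y)\<close>.\<close>

definition seqs :: "'o \<Rightarrow> 'o \<Rightarrow> ('o \<times> 'm \<times> 'm) set" where
  "seqs A C = {(B, x, y). B \<in> Obj X \<and> x \<in> Mor X A B \<and> y \<in> Mor X B C}"

definition seq_equiv :: "'o \<Rightarrow> 'o \<Rightarrow> (('o \<times> 'm \<times> 'm) \<times> ('o \<times> 'm \<times> 'm)) set" where
  "seq_equiv A C = {((B, x, y), (B', x', y')).
     (B, x, y) \<in> seqs A C \<and> (B', x', y') \<in> seqs A C \<and>
     (\<exists>b. cat_iso B B' b \<and> b \<cdot> x = x' \<and> y' \<cdot> b = y)}"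

end

locale additive_category =
  fixes X :: "('o, 'm, 'z) precat_scheme" (structure)
  assumes hom_comm_group: "\<lbrakk>A \<in> Obj X; B \<in> Obj X\<rbrakk> \<Longrightarrow> comm_group (Hom X A B)"
    and id_closed: "A \<in> Obj X \<Longrightarrow> Idm X A \<in> Mor X A A"
    and cmp_closed:
      "\<lbrakk>A \<in> Obj X; B \<in> Obj X; C \<in> Obj X; f \<in> Mor X A B; g \<in> Mor X B C\<rbrakk> \<Longrightarrow> g \<cdot> f \<in> Mor X A C"
    and cmp_assoc:
      "\<lbrakk>A \<in> Obj X; B \<in> Obj X; C \<in> Obj X; D \<in> Obj X;
        f \<in> Mor X A B; g \<in> Mor X B C; h \<in> Mor X C D\<rbrakk> \<Longrightarrow> (h \<cdot> g) \<cdot> f = h \<cdot> (g \<cdot> f)"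
    and id_left: "\<lbrakk>A \<in> Obj X; B \<in> Obj X; f \<in> Mor X A B\<rbrakk> \<Longrightarrow> Idm X B \<cdot> f = f"
    and id_right: "\<lbrakk>A \<in> Obj X; B \<in> Obj X; f \<in> Mor X A B\<rbrakk> \<Longrightarrow> f \<cdot> Idm X A = f"
    and cmp_add_left:
      "\<lbrakk>A \<in> Obj X; B \<in> Obj X; C \<in> Obj X; f \<in> Mor X A B; g \<in> Mor X B C; g' \<in> Mor X B C\<rbrakk>
        \<Longrightarrow> (g \<otimes>\<^bsub>Hom X B C\<^esub> g') \<cdot> f = (g \<cdot> f) \<otimes>\<^bsub>Hom X A C\<^esub> (g' \<cdot> f)"
    and cmp_add_right:
      "\<lbrakk>A \<in> Obj X; B \<in> Obj X; C \<in> Obj X; f \<in> Mor X A B; f' \<in> Mor X A B; g \<in> Mor X B C\<rbrakk>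
        \<Longrightarrow> g \<cdot> (f \<otimes>\<^bsub>Hom X A B\<^esub> f') = (g \<cdot> f) \<otimes>\<^bsub>Hom X A C\<^esub> (g \<cdot> f')"
    and zero_object:
      "\<exists>Z \<in> Obj X. \<forall>A \<in> Obj X. Mor X Z A = {\<one>\<^bsub>Hom X Z A\<^esub>} \<and> Mor X A Z = {\<one>\<^bsub>Hom X A Z\<^esub>}"
    and biproducts: "\<lbrakk>A \<in> Obj X; B \<in> Obj X\<rbrakk> \<Longrightarrow> \<exists>S. biprod X A B S"

section \<open>Extriangulated categories\<close>

text \<open>
  \<open>Ext C A\<close> is the group of extensions of \<open>C\<close> by \<open>A\<close> (first argument contravariant),
  \<open>ExtMap c a\<close> the action of the bifunctor on the pair \<open>(c, a)\<close>, and \<open>Rlz C A \<delta>\<close> the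
  equivalence class of sequences assigned to \<open>\<delta> \<in> Ext C A\<close> by the realization.
\<close>

record ('o, 'm, 'e) extricat = "('o, 'm) precat" +
  Ext :: "'o \<Rightarrow> 'o \<Rightarrow> 'e monoid"
  ExtMap :: "'m \<Rightarrow> 'm \<Rightarrow> 'e \<Rightarrow> 'e"
  Rlz :: "'o \<Rightarrow> 'o \<Rightarrow> 'e \<Rightarrow> ('o \<times> 'm \<times> 'm) set"

text \<open>\<open>(A, B, C, x, y, \<delta>)\<close> stands for \<open>A \<rightarrow>\<^sup>x B \<rightarrow>\<^sup>y C\<close> with extension class \<open>\<delta>\<close>.\<close>

type_synonym ('o, 'm, 'e) tri = "'o \<times> 'o \<times> 'o \<times> 'm \<times> 'm \<times> 'e"

context
  fixes X :: "('o, 'm, 'e, 'z) extricat_scheme" (structure)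
begin

text \<open>
  For \<open>\<delta> \<in> Ext C A\<close>, \<open>a : A \<rightarrow> A'\<close> and \<open>c : C' \<rightarrow> C\<close>: \<open>push C a \<delta> \<in> Ext C A'\<close> is the cobase change
  of \<open>\<delta>\<close> along \<open>a\<close> and \<open>pull A c \<delta> \<in> Ext C' A\<close> its base change along \<open>c\<close>.
\<close>

definition push :: "'o \<Rightarrow> 'm \<Rightarrow> 'e \<Rightarrow> 'e" where
  "push C a \<delta> = ExtMap X (Idm X C) a \<delta>"

definition pull :: "'o \<Rightarrow> 'm \<Rightarrow> 'e \<Rightarrow> 'e" where
  "pull A c \<delta> = ExtMap X c (Idm X A) \<delta>"

text \<open>\<open>\<delta> \<oplus> \<delta>'\<close>: the extension with components \<open>\<delta>, 0, 0, \<delta>'\<close>; the biproducts are those of the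
  ends \<open>C, C'\<close> and of the starts \<open>A, A'\<close>.\<close>

fun ext_sum :: "'o \<times> 'm \<times> 'm \<times> 'm \<times> 'm \<Rightarrow> 'o \<times> 'm \<times> 'm \<times> 'm \<times> 'm \<Rightarrow> 'e \<Rightarrow> 'e \<Rightarrow> 'e" where
  "ext_sum (SC, iC, jC, pC, qC) (SA, iA, jA, pA, qA) \<delta> \<delta>' =
     ExtMap X pC iA \<delta> \<otimes>\<^bsub>Ext X SC SA\<^esub> ExtMap X qC jA \<delta>'"

fun etri :: "('o, 'm, 'e) tri \<Rightarrow> bool" where
  "etri (A, B, C, x, y, \<delta>) \<longleftrightarrow>
     A \<in> Obj X \<and> C \<in> Obj X \<and> \<delta> \<in> carrier (Ext X C A) \<and> (B, x, y) \<in> Rlz X C A \<delta>"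

fun tri_mor :: "('o, 'm, 'e) tri \<Rightarrow> ('o, 'm, 'e) tri \<Rightarrow> 'm \<times> 'm \<times> 'm \<Rightarrow> bool" where
  "tri_mor (A, B, C, x, y, \<delta>) (A', B', C', x', y', \<delta>') (a, b, c) \<longleftrightarrow>
     a \<in> Mor X A A' \<and> b \<in> Mor X B B' \<and> c \<in> Mor X C C' \<and>
     b \<cdot> x = x' \<cdot> a \<and> y' \<cdot> b = c \<cdot> y \<and> push C a \<delta> = pull A' c \<delta>'"

fun tri_iso :: "('o, 'm, 'e) tri \<Rightarrow> ('o, 'm, 'e) tri \<Rightarrow> bool" where
  "tri_iso (A, B, C, x, y, \<delta>) (A', B', C', x', y', \<delta>') \<longleftrightarrow>
     (\<exists>a b c. tri_mor (A, B, C, x, y, \<delta>) (A', B', C', x', y', \<delta>') (a, b, c) \<and>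
        cat_iso X A A' a \<and> cat_iso X B B' b \<and> cat_iso X C C' c)"

definition inflation :: "'o \<Rightarrow> 'o \<Rightarrow> 'm \<Rightarrow> bool" where
  "inflation A B x \<longleftrightarrow> (\<exists>C y \<delta>. etri (A, B, C, x, y, \<delta>))"

definition deflation :: "'o \<Rightarrow> 'o \<Rightarrow> 'm \<Rightarrow> bool" where
  "deflation B C y \<longleftrightarrow> (\<exists>A x \<delta>. etri (A, B, C, x, y, \<delta>))"

definition WIC :: bool where
  "WIC \<longleftrightarrow> (\<forall>A \<in> Obj X. \<forall>B \<in> Obj X. \<forall>C \<in> Obj X. \<forall>f \<in> Mor X A B. \<forall>g \<in> Mor X B C.
     (inflation A C (g \<cdot> f) \<longrightarrow> inflation A B f) \<and> (deflation A C (g \<cdot> f) \<longrightarrow> deflation B C g))"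

end

locale extriangulated_category = additive_category X
  for X :: "('o, 'm, 'e, 'z) extricat_scheme" (structure) +
  assumes ext_comm_group: "\<lbrakk>A \<in> Obj X; C \<in> Obj X\<rbrakk> \<Longrightarrow> comm_group (Ext X C A)"
    and ext_map_hom:
      "\<lbrakk>A \<in> Obj X; A' \<in> Obj X; C \<in> Obj X; C' \<in> Obj X; a \<in> Mor X A A'; c \<in> Mor X C' C\<rbrakk>
        \<Longrightarrow> ExtMap X c a \<in> hom (Ext X C A) (Ext X C' A')"
    and ext_map_id:
      "\<lbrakk>A \<in> Obj X; C \<in> Obj X; \<delta> \<in> carrier (Ext X C A)\<rbrakk> \<Longrightarrow> ExtMap X (Idm X C) (Idm X A) \<delta> = \<delta>"
    and ext_map_cmp:
      "\<lbrakk>A \<in> Obj X; A' \<in> Obj X; A'' \<in> Obj X; C \<in> Obj X; C' \<in> Obj X; C'' \<in> Obj X;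
        a \<in> Mor X A A'; a' \<in> Mor X A' A''; c \<in> Mor X C' C; c' \<in> Mor X C'' C';
        \<delta> \<in> carrier (Ext X C A)\<rbrakk>
        \<Longrightarrow> ExtMap X (c \<cdot> c') (a' \<cdot> a) \<delta> = ExtMap X c' a' (ExtMap X c a \<delta>)"
    and ext_map_add_left:
      "\<lbrakk>A \<in> Obj X; A' \<in> Obj X; C \<in> Obj X; C' \<in> Obj X;
        a \<in> Mor X A A'; c \<in> Mor X C' C; c' \<in> Mor X C' C; \<delta> \<in> carrier (Ext X C A)\<rbrakk>
        \<Longrightarrow> ExtMap X (c \<otimes>\<^bsub>Hom X C' C\<^esub> c') a \<delta> = ExtMap X c a \<delta> \<otimes>\<^bsub>Ext X C' A'\<^esub> ExtMap X c' a \<delta>"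
    and ext_map_add_right:
      "\<lbrakk>A \<in> Obj X; A' \<in> Obj X; C \<in> Obj X; C' \<in> Obj X;
        a \<in> Mor X A A'; a' \<in> Mor X A A'; c \<in> Mor X C' C; \<delta> \<in> carrier (Ext X C A)\<rbrakk>
        \<Longrightarrow> ExtMap X c (a \<otimes>\<^bsub>Hom X A A'\<^esub> a') \<delta> = ExtMap X c a \<delta> \<otimes>\<^bsub>Ext X C' A'\<^esub> ExtMap X c a' \<delta>"
    and rlz_class:
      "\<lbrakk>A \<in> Obj X; C \<in> Obj X; \<delta> \<in> carrier (Ext X C A)\<rbrakk>
        \<Longrightarrow> Rlz X C A \<delta> \<in> seqs X A C // seq_equiv X A C"
    and rlz_mor:
      "\<lbrakk>etri X (A, B, C, x, y, \<delta>); etri X (A', B', C', x', y', \<delta>');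
        a \<in> Mor X A A'; c \<in> Mor X C C'; push X C a \<delta> = pull X A' c \<delta>'\<rbrakk>
        \<Longrightarrow> \<exists>b \<in> Mor X B B'. b \<cdot> x = x' \<cdot> a \<and> y' \<cdot> b = c \<cdot> y"
    and rlz_zero:
      "biprod X A C (S, i, j, p, q)
        \<Longrightarrow> Rlz X C A \<one>\<^bsub>Ext X C A\<^esub> = seq_equiv X A C `` {(S, i, q)}"
    and rlz_sum:
      "\<lbrakk>etri X (A, B, C, x, y, \<delta>); etri X (A', B', C', x', y', \<delta>');
        biprod X A A' SA; biprod X B B' SB; biprod X C C' SC\<rbrakk>
        \<Longrightarrow> Rlz X (fst SC) (fst SA) (ext_sum X SC SA \<delta> \<delta>') =
            seq_equiv X (fst SA) (fst SC) `` {(fst SB, mor_sum X SA SB x x', mor_sum X SB SC y y')}"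
    and ET3:
      "\<lbrakk>etri X (A, B, C, x, y, \<delta>); etri X (A', B', C', x', y', \<delta>');
        a \<in> Mor X A A'; b \<in> Mor X B B'; b \<cdot> x = x' \<cdot> a\<rbrakk>
        \<Longrightarrow> \<exists>c \<in> Mor X C C'. c \<cdot> y = y' \<cdot> b \<and> push X C a \<delta> = pull X A' c \<delta>'"
    and ET3_op:
      "\<lbrakk>etri X (A, B, C, x, y, \<delta>); etri X (A', B', C', x', y', \<delta>');
        b \<in> Mor X B B'; c \<in> Mor X C C'; c \<cdot> y = y' \<cdot> b\<rbrakk>
        \<Longrightarrow> \<exists>a \<in> Mor X A A'. b \<cdot> x = x' \<cdot> a \<and> push X C a \<delta> = pull X A' c \<delta>'"
    and ET4:
      "\<lbrakk>etri X (A, B, D, f, f', \<delta>); etri X (B, C, F, g, g', \<delta>')\<rbrakk>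
        \<Longrightarrow> \<exists>E h' d e \<delta>''. E \<in> Obj X \<and>
              h' \<in> Mor X C E \<and> d \<in> Mor X D E \<and> e \<in> Mor X E F \<and>
              h' \<cdot> g = d \<cdot> f' \<and> e \<cdot> h' = g' \<and>
              etri X (A, C, E, g \<cdot> f, h', \<delta>'') \<and>
              etri X (D, E, F, d, e, push X F f' \<delta>') \<and>
              pull X A d \<delta>'' = \<delta> \<and> push X E f \<delta>'' = pull X B e \<delta>'"
    and ET4_op:
      "\<lbrakk>etri X (D, B, A, f', f, \<delta>); etri X (F, C, B, g', g, \<delta>')\<rbrakk>
        \<Longrightarrow> \<exists>E h' d e \<delta>''. E \<in> Obj X \<and>
              h' \<in> Mor X E C \<and> d \<in> Mor X E D \<and> e \<in> Mor X F E \<and>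
              g \<cdot> h' = f' \<cdot> d \<and> h' \<cdot> e = g' \<and>
              etri X (E, C, A, h', f \<cdot> g, \<delta>'') \<and>
              etri X (F, E, D, e, d, pull X F f' \<delta>') \<and>
              push X A d \<delta>'' = \<delta> \<and> pull X E f \<delta>'' = push X B e \<delta>'"

section \<open>Proper classes\<close>

locale proper_class = extriangulated_category X
  for X :: "('o, 'm, 'e, 'z) extricat_scheme" (structure) +
  fixes \<xi> :: "('o, 'm, 'e) tri set"
  assumes xi_etri: "T \<in> \<xi> \<Longrightarrow> etri X T"
    and xi_iso: "\<lbrakk>T \<in> \<xi>; etri X T'; tri_iso X T T'\<rbrakk> \<Longrightarrow> T' \<in> \<xi>"
    and xi_sum:
      "\<lbrakk>(A, B, C, x, y, \<delta>) \<in> \<xi>; (A', B', C', x', y', \<delta>') \<in> \<xi>;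
        biprod X A A' SA; biprod X B B' SB; biprod X C C' SC\<rbrakk>
        \<Longrightarrow> (fst SA, fst SB, fst SC, mor_sum X SA SB x x', mor_sum X SB SC y y',
              ext_sum X SC SA \<delta> \<delta>') \<in> \<xi>"
    and xi_split: "etri X (A, B, C, x, y, \<one>\<^bsub>Ext X C A\<^esub>) \<Longrightarrow> (A, B, C, x, y, \<one>\<^bsub>Ext X C A\<^esub>) \<in> \<xi>"
    and xi_base_change:
      "\<lbrakk>(A, B, C, x, y, \<delta>) \<in> \<xi>; C' \<in> Obj X; c \<in> Mor X C' C;
        etri X (A, B', C', x', y', pull X A c \<delta>)\<rbrakk>
        \<Longrightarrow> (A, B', C', x', y', pull X A c \<delta>) \<in> \<xi>"
    and xi_cobase_change:
      "\<lbrakk>(A, B, C, x, y, \<delta>) \<in> \<xi>; A' \<in> Obj X; a \<in> Mor X A A';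
        etri X (A', B', C, x', y', push X C a \<delta>)\<rbrakk>
        \<Longrightarrow> (A', B', C, x', y', push X C a \<delta>) \<in> \<xi>"
    and xi_saturated:
      "\<lbrakk>etri X (A1, B1, C, x1, y1, \<delta>1); (A2, B2, C, x2, y2, \<delta>2) \<in> \<xi>;
        (A1, M, B2, m, e, pull X A1 y2 \<delta>1) \<in> \<xi>\<rbrakk>
        \<Longrightarrow> (A1, B1, C, x1, y1, \<delta>1) \<in> \<xi>"

section \<open>Projectives, injectives, Gorenstein projectives\<close>

text \<open>The library's \<open>short_exact_sequence\<close> lists its groups from right to left.\<close>

context
  fixes X :: "('o, 'm, 'e, 'z) extricat_scheme" (structure)
begin

text \<open>Exactness of the triangle under \<open>Hom W _\<close> and under \<open>Hom _ W\<close>.\<close>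

fun cov_exact :: "'o \<Rightarrow> ('o, 'm, 'e) tri \<Rightarrow> bool" where
  "cov_exact W (A, B, C, x, y, \<delta>) \<longleftrightarrow>
     short_exact_sequence (Hom X W C) (Hom X W B) (Hom X W A) (\<lambda>h. y \<cdot> h) (\<lambda>h. x \<cdot> h)"

fun contra_exact :: "'o \<Rightarrow> ('o, 'm, 'e) tri \<Rightarrow> bool" where
  "contra_exact W (A, B, C, x, y, \<delta>) \<longleftrightarrow>
     short_exact_sequence (Hom X A W) (Hom X B W) (Hom X C W) (\<lambda>h. h \<cdot> x) (\<lambda>h. h \<cdot> y)"

definition xi_proj :: "('o, 'm, 'e) tri set \<Rightarrow> 'o set" where
  "xi_proj \<xi> = {P \<in> Obj X. \<forall>T \<in> \<xi>. cov_exact P T}"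

definition xi_inj :: "('o, 'm, 'e) tri set \<Rightarrow> 'o set" where
  "xi_inj \<xi> = {I \<in> Obj X. \<forall>T \<in> \<xi>. contra_exact I T}"

definition enough_xi_proj :: "('o, 'm, 'e) tri set \<Rightarrow> bool" where
  "enough_xi_proj \<xi> \<longleftrightarrow> (\<forall>A \<in> Obj X. \<exists>K P x y \<delta>. (K, P, A, x, y, \<delta>) \<in> \<xi> \<and> P \<in> xi_proj \<xi>)"

definition enough_xi_inj :: "('o, 'm, 'e) tri set \<Rightarrow> bool" where
  "enough_xi_inj \<xi> \<longleftrightarrow> (\<forall>A \<in> Obj X. \<exists>I K x y \<delta>. (A, I, K, x, y, \<delta>) \<in> \<xi> \<and> I \<in> xi_inj \<xi>)"

text \<open>
  The unbounded complex \<open>\<dots> \<rightarrow> Y (n+1) \<rightarrow> Y n \<rightarrow> Y (n-1) \<rightarrow> \<dots>\<close> with differentials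
  \<open>d n : Y n \<rightarrow> Y (n-1)\<close> is spliced from triangles \<open>K (n+1) \<rightarrow> Y n \<rightarrow> K n\<close> in \<open>\<Theta>\<close>.
\<close>

definition spliced :: "('o, 'm, 'e) tri set \<Rightarrow> (int \<Rightarrow> 'o) \<Rightarrow> (int \<Rightarrow> 'm) \<Rightarrow> (int \<Rightarrow> 'o) \<Rightarrow> bool" where
  "spliced \<Theta> Y d K \<longleftrightarrow>
     (\<exists>g f \<delta>. \<forall>n. (K (n + 1), Y n, K n, g n, f n, \<delta> n) \<in> \<Theta> \<and> d n = g (n - 1) \<cdot> f n)"

definition complete_xi_proj_resolution ::
  "('o, 'm, 'e) tri set \<Rightarrow> (int \<Rightarrow> 'o) \<Rightarrow> (int \<Rightarrow> 'm) \<Rightarrow> (int \<Rightarrow> 'o) \<Rightarrow> bool" where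
  "complete_xi_proj_resolution \<xi> Y d K \<longleftrightarrow>
     (\<forall>n. Y n \<in> xi_proj \<xi>) \<and>
     spliced {T \<in> \<xi>. \<forall>W \<in> xi_proj \<xi>. contra_exact W T} Y d K"

definition xi_Gproj :: "('o, 'm, 'e) tri set \<Rightarrow> 'o set" where
  "xi_Gproj \<xi> = {G. \<exists>Y d K n. complete_xi_proj_resolution \<xi> Y d K \<and> G = K n}"

primrec xi_Gpd_le :: "('o, 'm, 'e) tri set \<Rightarrow> nat \<Rightarrow> 'o \<Rightarrow> bool" where
  "xi_Gpd_le \<xi> 0 A \<longleftrightarrow> A \<in> xi_Gproj \<xi>"
| "xi_Gpd_le \<xi> (Suc n) A \<longleftrightarrow>
     (\<exists>K G x y \<delta>. (K, G, A, x, y, \<delta>) \<in> \<xi> \<and> G \<in> xi_Gproj \<xi> \<and> xi_Gpd_le \<xi> n K)"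

definition xi_Gpd :: "('o, 'm, 'e) tri set \<Rightarrow> 'o \<Rightarrow> enat" where
  "xi_Gpd \<xi> A = Inf {enat n | n. xi_Gpd_le \<xi> n A}"

definition Gproj_exact_tris :: "('o, 'm, 'e) tri set \<Rightarrow> ('o, 'm, 'e) tri set" where
  "Gproj_exact_tris \<xi> = {T \<in> \<xi>. \<forall>G \<in> xi_Gproj \<xi>. cov_exact G T}"

end

section \<open>Resolutions and cohomology\<close>

text \<open>An augmented complex \<open>\<dots> \<rightarrow> trm 1 \<rightarrow> trm 0 \<rightarrow> M\<close> with \<open>diff n : trm (n+1) \<rightarrow> trm n\<close>.\<close>

record ('o, 'm) aug_complex =
  trm :: "nat \<Rightarrow> 'o"
  diff :: "nat \<Rightarrow> 'm"
  aug :: 'm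

context
  fixes X :: "('o, 'm, 'e, 'z) extricat_scheme" (structure)
begin

text \<open>Resolutions of \<open>M\<close> with terms in \<open>\<W>\<close>, spliced from triangles in \<open>\<Theta>\<close> beginning with \<open>K 0 = M\<close>.\<close>

definition resolution ::
  "('o, 'm, 'e) tri set \<Rightarrow> 'o set \<Rightarrow> 'o \<Rightarrow> ('o, 'm) aug_complex \<Rightarrow> bool" where
  "resolution \<Theta> \<W> M R \<longleftrightarrow>
     (\<exists>K g f \<delta>. K 0 = M \<and> aug R = f 0 \<and>
        (\<forall>n. trm R n \<in> \<W> \<and> (K (Suc n), trm R n, K n, g n, f n, \<delta> n) \<in> \<Theta> \<and>
             diff R n = g n \<cdot> f (Suc n)))"

definition xi_proj_resolution :: "('o, 'm, 'e) tri set \<Rightarrow> 'o \<Rightarrow> ('o, 'm) aug_complex \<Rightarrow> bool" where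
  "xi_proj_resolution \<xi> = resolution \<xi> (xi_proj X \<xi>)"

definition xi_Gproj_resolution :: "('o, 'm, 'e) tri set \<Rightarrow> 'o \<Rightarrow> ('o, 'm) aug_complex \<Rightarrow> bool" where
  "xi_Gproj_resolution \<xi> = resolution (Gproj_exact_tris X \<xi>) (xi_Gproj X \<xi>)"

text \<open>Cohomology of the complex \<open>Hom (trm R _) N\<close>.\<close>

definition cocycles :: "('o, 'm) aug_complex \<Rightarrow> 'o \<Rightarrow> nat \<Rightarrow> 'm set" where
  "cocycles R N n = kernel (Hom X (trm R n) N) (Hom X (trm R (Suc n)) N) (\<lambda>h. h \<cdot> diff R n)"

primrec coboundaries :: "('o, 'm) aug_complex \<Rightarrow> 'o \<Rightarrow> nat \<Rightarrow> 'm set" where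
  "coboundaries R N 0 = {\<one>\<^bsub>Hom X (trm R 0) N\<^esub>}"
| "coboundaries R N (Suc n) = (\<lambda>h. h \<cdot> diff R n) ` Mor X (trm R n) N"

definition cohomology :: "('o, 'm) aug_complex \<Rightarrow> 'o \<Rightarrow> nat \<Rightarrow> 'm set monoid" where
  "cohomology R N n =
     (Hom X (trm R n) N)\<lparr>carrier := cocycles R N n\<rparr> Mod coboundaries R N n"

definition coh_class :: "('o, 'm) aug_complex \<Rightarrow> 'o \<Rightarrow> nat \<Rightarrow> 'm \<Rightarrow> 'm set" where
  "coh_class R N n z = coboundaries R N n #>\<^bsub>Hom X (trm R n) N\<^esub> z"

text \<open>\<open>\<phi>\<close> is a chain map \<open>R \<rightarrow> S\<close> of augmented complexes lifting \<open>f\<close>.\<close>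

definition lifts :: "('o, 'm) aug_complex \<Rightarrow> ('o, 'm) aug_complex \<Rightarrow> 'm \<Rightarrow> (nat \<Rightarrow> 'm) \<Rightarrow> bool" where
  "lifts R S f \<phi> \<longleftrightarrow>
     (\<forall>n. \<phi> n \<in> Mor X (trm R n) (trm S n)) \<and>
     aug S \<cdot> \<phi> 0 = f \<cdot> aug R \<and>
     (\<forall>n. diff S n \<cdot> \<phi> (Suc n) = \<phi> n \<cdot> diff R n)"

text \<open>
  The map \<open>cohomology S N n \<rightarrow> cohomology R N n\<close> induced by any chain map \<open>R \<rightarrow> S\<close> lifting \<open>f\<close>.
  For resolutions \<open>R\<close>, \<open>S\<close> of objects \<open>A\<close>, \<open>B\<close> and \<open>f : A \<rightarrow> B\<close> this is the functorial action
  when both are of the same kind, and the comparison map when \<open>R\<close> is a projective and \<open>S\<close> a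
  Gorenstein projective resolution of the same object and \<open>f\<close> its identity.
\<close>

definition coh_pull ::
  "('o, 'm) aug_complex \<Rightarrow> ('o, 'm) aug_complex \<Rightarrow> 'm \<Rightarrow> 'o \<Rightarrow> nat \<Rightarrow> 'm set \<Rightarrow> 'm set" where
  "coh_pull R S f N n \<alpha> =
     (THE \<beta>. \<exists>\<phi> z. lifts R S f \<phi> \<and> z \<in> cocycles S N n \<and>
        \<alpha> = coh_class S N n z \<and> \<beta> = coh_class R N n (z \<cdot> \<phi> n))"

text \<open>The map \<open>cohomology R N n \<rightarrow> cohomology R N' n\<close> induced by \<open>g : N \<rightarrow> N'\<close>.\<close>

definition coh_push ::
  "('o, 'm) aug_complex \<Rightarrow> 'o \<Rightarrow> 'o \<Rightarrow> 'm \<Rightarrow> nat \<Rightarrow> 'm set \<Rightarrow> 'm set" where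
  "coh_push R N N' g n \<alpha> =
     (THE \<beta>. \<exists>z. z \<in> cocycles R N n \<and> \<alpha> = coh_class R N n z \<and> \<beta> = coh_class R N' n (g \<cdot> z))"

text \<open>
  A degreewise split sequence \<open>R \<rightarrow> R' \<rightarrow> R''\<close> of projective resolutions lifting the triangle,
  with chain maps \<open>\<iota>\<close> and \<open>\<pi>\<close>.
\<close>

fun horseshoe ::
  "('o, 'm, 'e) tri set \<Rightarrow> ('o, 'm, 'e) tri \<Rightarrow> ('o, 'm) aug_complex \<Rightarrow> ('o, 'm) aug_complex \<Rightarrow>
   ('o, 'm) aug_complex \<Rightarrow> (nat \<Rightarrow> 'm) \<Rightarrow> (nat \<Rightarrow> 'm) \<Rightarrow> bool" where
  "horseshoe \<xi> (A, B, C, x, y, \<delta>) R R' R'' \<iota> \<pi> \<longleftrightarrow>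
     xi_proj_resolution \<xi> A R \<and> xi_proj_resolution \<xi> B R' \<and> xi_proj_resolution \<xi> C R'' \<and>
     lifts R R' x \<iota> \<and> lifts R' R'' y \<pi> \<and>
     (\<forall>n. \<exists>s r. biprod X (trm R n) (trm R'' n) (trm R' n, \<iota> n, s, r, \<pi> n))"

text \<open>
  The connecting map \<open>cohomology R N n \<rightarrow> cohomology R'' N (n+1)\<close>: extend a cocycle \<open>z\<close> along
  \<open>\<iota> n\<close> to \<open>w\<close>, and factor \<open>w \<cdot> diff R' n\<close> as \<open>v \<cdot> \<pi> (n+1)\<close>; the result is the class of \<open>v\<close>.
\<close>

definition xi_connecting ::
  "('o, 'm, 'e) tri set \<Rightarrow> ('o, 'm, 'e) tri \<Rightarrow> ('o, 'm) aug_complex \<Rightarrow> ('o, 'm) aug_complex \<Rightarrow>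
   'o \<Rightarrow> nat \<Rightarrow> 'm set \<Rightarrow> 'm set" where
  "xi_connecting \<xi> T R R'' N n \<alpha> =
     (THE \<beta>. \<exists>R' \<iota> \<pi> z w v. horseshoe \<xi> T R R' R'' \<iota> \<pi> \<and>
        z \<in> cocycles R N n \<and> \<alpha> = coh_class R N n z \<and>
        w \<in> Mor X (trm R' n) N \<and> w \<cdot> \<iota> n = z \<and>
        v \<in> Mor X (trm R'' (Suc n)) N \<and> v \<cdot> \<pi> (Suc n) = w \<cdot> diff R' n \<and>
        \<beta> = coh_class R'' N (Suc n) v)"

text \<open>
  A choice of resolutions for all objects that admit one. Cohomology \<open>xt Res n M N\<close> of an object
  is taken with respect to such a choice.
\<close>

definition resolution_choice ::
  "('o \<Rightarrow> ('o, 'm) aug_complex \<Rightarrow> bool) \<Rightarrow> ('o \<Rightarrow> ('o, 'm) aug_complex) \<Rightarrow> bool" where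
  "resolution_choice is_res Res \<longleftrightarrow> (\<forall>A R. is_res A R \<longrightarrow> is_res A (Res A))"

definition xt :: "('o \<Rightarrow> ('o, 'm) aug_complex) \<Rightarrow> nat \<Rightarrow> 'o \<Rightarrow> 'o \<Rightarrow> 'm set monoid" where
  "xt Res n M N = cohomology (Res M) N n"

definition xt_contra ::
  "('o \<Rightarrow> ('o, 'm) aug_complex) \<Rightarrow> nat \<Rightarrow> 'o \<Rightarrow> 'o \<Rightarrow> 'm \<Rightarrow> 'o \<Rightarrow> 'm set \<Rightarrow> 'm set" where
  "xt_contra Res n A B f N = coh_pull (Res A) (Res B) f N n"

definition xt_cov ::
  "('o \<Rightarrow> ('o, 'm) aug_complex) \<Rightarrow> nat \<Rightarrow> 'o \<Rightarrow> 'o \<Rightarrow> 'o \<Rightarrow> 'm \<Rightarrow> 'm set \<Rightarrow> 'm set" where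
  "xt_cov Res n M N N' g = coh_push (Res M) N N' g n"

text \<open>The triangles to which the long exact sequence applies.\<close>

definition finite_Gpd_tris :: "('o, 'm, 'e) tri set \<Rightarrow> ('o, 'm, 'e) tri set" where
  "finite_Gpd_tris \<xi> = {(A, B, C, x, y, \<delta>). (A, B, C, x, y, \<delta>) \<in> Gproj_exact_tris X \<xi> \<and>
     xi_Gpd X \<xi> A < \<infinity> \<and> xi_Gpd X \<xi> C < \<infinity>}"

end

end

theory Submission
  imports Defs
begin

text \<open>
  Morphisms and \<open>\<bbbE>\<close>-extensions are put into one partial graded calculus in which push-out and
  pull-back of extensions are compositions \<open>a \<bullet> \<delta>\<close> and \<open>\<delta> \<bullet> c\<close>; its axioms are self-dual.

  By saturation and enough \<open>\<xi>\<close>-projectives, an \<open>\<bbbE>\<close>-triangle lies in \<open>\<xi>\<close> iff every morphism from a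
  \<open>\<xi>\<close>-projective to its last term lifts to its middle term. Two pullback squares and one octahedron
  (ET4)\<open>\<^sup>o\<^sup>p\<close> produce the horseshoe diagram over a triangle, and this criterion shows that the new
  triangles lie in \<open>\<xi>\<close> again. An object \<open>M\<close> of finite \<open>\<G>\<close>-dimension has an approximation \<open>K \<rightarrow> G \<rightarrow> M\<close> with
  \<open>G\<close> Gorenstein projective and \<open>K\<close> of finite projective dimension; such triangles are
  \<open>\<C>(\<G>\<P>(\<xi>), -)\<close>-exact, so iterating them resolves \<open>M\<close>.

  Given two horseshoe resolutions and a morphism between their triangles, any lift of the middle
  morphism can be corrected by a null-homotopic chain map so that it respects both horseshoes
  strictly. Since projective objects also lift along \<open>\<C>(\<G>\<P>(\<xi>), -)\<close>-exact triangles, the resolutions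
  may be of different kinds; well-definedness of the connecting map, its naturality and the
  comparison square of (2) are then instances of one statement. The long exact sequence follows by
  comparing the given resolution of the middle term with the one in the horseshoe.
\<close>

section \<open>Arrow calculus\<close>

text \<open>The inflation of an E-triangle need not be a monomorphism (in a triangulated category it
  hardly ever is), so Hom(W, -) is in general exact only at the middle term. The short exact
  sequences defining projectives and exact triangles therefore contain an injectivity clause that
  every chase has to establish anew and that is available for special test objects only. This is why
  maps into a first term are so often tested on projectives, and why lifts are built by correction
  terms instead of uniqueness.

  Self-duality supplies the weak cokernels, the pushouts and the left half of the five lemma. It
  also supplies a dual horseshoe, which builds the coresolution when Gorenstein projectives are
  shown to be closed under extensions. That closure is the pivot: it makes the approximating objects
  and the middle terms of the horseshoes Gorenstein projective.

  The constructions with resolutions are parametrized by the class of test objects, because the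
  comparison with ordinary cohomology mixes a projective source with a Gorenstein projective
  target.\<close>

text \<open>\<open>isx\<close> tells extensions from morphisms; an extension in \<open>\<bbbE>(C, A)\<close> has source \<open>C\<close> and target \<open>A\<close>.
  The laws without premises hold for incomposable arrows as well, all of which have the same junk
  composite.\<close>

locale arrow_calculus =
  fixes ob :: "'o \<Rightarrow> bool"
    and val :: "'a \<Rightarrow> bool"
    and isx :: "'a \<Rightarrow> bool"
    and src tgt :: "'a \<Rightarrow> 'o"
    and mul :: "'a \<Rightarrow> 'a \<Rightarrow> 'a" (infixr \<open>\<bullet>\<close> 70)
    and add :: "'a \<Rightarrow> 'a \<Rightarrow> 'a" (infixl \<open>\<boxplus>\<close> 65)
    and neg :: "'a \<Rightarrow> 'a" (\<open>\<boxminus> _\<close> [81] 80)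
    and idn :: "'o \<Rightarrow> 'a"
    and zr :: "bool \<Rightarrow> 'o \<Rightarrow> 'o \<Rightarrow> 'a"
  assumes mul_assoc [simp]: "(f \<bullet> g) \<bullet> h = f \<bullet> (g \<bullet> h)"
    and add_assoc: "(f \<boxplus> g) \<boxplus> h = f \<boxplus> (g \<boxplus> h)"
    and add_comm: "f \<boxplus> g = g \<boxplus> f"
    and distl [simp]: "f \<bullet> (g \<boxplus> h) = f \<bullet> g \<boxplus> f \<bullet> h"
    and distr [simp]: "(g \<boxplus> h) \<bullet> f = g \<bullet> f \<boxplus> h \<bullet> f"
    and mul_neg [simp]: "f \<bullet> (\<boxminus> g) = \<boxminus> (f \<bullet> g)"
    and neg_mul [simp]: "(\<boxminus> f) \<bullet> g = \<boxminus> (f \<bullet> g)"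
    and neg_add [simp]: "\<boxminus> (f \<boxplus> g) = (\<boxminus> f) \<boxplus> (\<boxminus> g)"
    and val_ob: "val f \<Longrightarrow> ob (src f) \<and> ob (tgt f)"
    and val_mul [simp]:
      "val (g \<bullet> f) \<longleftrightarrow> val g \<and> val f \<and> src g = tgt f \<and> \<not> (isx g \<and> isx f)"
    and src_mul: "val (g \<bullet> f) \<Longrightarrow> src (g \<bullet> f) = src f"
    and tgt_mul: "val (g \<bullet> f) \<Longrightarrow> tgt (g \<bullet> f) = tgt g"
    and isx_mul: "val (g \<bullet> f) \<Longrightarrow> isx (g \<bullet> f) \<longleftrightarrow> isx g \<or> isx f"
    and val_add [simp]:
      "val (f \<boxplus> g) \<longleftrightarrow> val f \<and> val g \<and> src f = src g \<and> tgt f = tgt g \<and> isx f = isx g"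
    and src_add: "val (f \<boxplus> g) \<Longrightarrow> src (f \<boxplus> g) = src f"
    and tgt_add: "val (f \<boxplus> g) \<Longrightarrow> tgt (f \<boxplus> g) = tgt f"
    and isx_add: "val (f \<boxplus> g) \<Longrightarrow> isx (f \<boxplus> g) = isx f"
    and val_neg [simp]: "val (\<boxminus> f) = val f"
    and src_neg [simp]: "val f \<Longrightarrow> src (\<boxminus> f) = src f"
    and tgt_neg [simp]: "val f \<Longrightarrow> tgt (\<boxminus> f) = tgt f"
    and isx_neg [simp]: "val f \<Longrightarrow> isx (\<boxminus> f) = isx f"
    and val_idn [simp]: "val (idn A) = ob A"
    and typ_idn: "ob A \<Longrightarrow> src (idn A) = A \<and> tgt (idn A) = A \<and> \<not> isx (idn A)"
    and idn_l: "val f \<Longrightarrow> idn (tgt f) \<bullet> f = f"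
    and idn_r: "val f \<Longrightarrow> f \<bullet> idn (src f) = f"
    and val_zr [simp]: "val (zr e A B) \<longleftrightarrow> ob A \<and> ob B"
    and typ_zr: "ob A \<Longrightarrow> ob B \<Longrightarrow> src (zr e A B) = A \<and> tgt (zr e A B) = B \<and> isx (zr e A B) = e"
    and add_zr': "val f \<Longrightarrow> f \<boxplus> zr (isx f) (src f) (tgt f) = f"
    and add_neg' [simp]: "val f \<Longrightarrow> f \<boxplus> \<boxminus> f = zr (isx f) (src f) (tgt f)"
    and zero_ob: "\<exists>Z. ob Z \<and> (\<forall>f. val f \<and> \<not> isx f \<longrightarrow>
         (src f = Z \<or> tgt f = Z) \<longrightarrow> f = zr False (src f) (tgt f))"
    and biproduct: "ob A \<Longrightarrow> ob B \<Longrightarrow> \<exists>S i j p q. ob S \<and>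
         (val i \<and> \<not> isx i \<and> src i = A \<and> tgt i = S) \<and> (val j \<and> \<not> isx j \<and> src j = B \<and> tgt j = S) \<and>
         (val p \<and> \<not> isx p \<and> src p = S \<and> tgt p = A) \<and> (val q \<and> \<not> isx q \<and> src q = S \<and> tgt q = B) \<and>
         p \<bullet> i = idn A \<and> q \<bullet> j = idn B \<and> q \<bullet> i = zr False A B \<and> p \<bullet> j = zr False B A \<and>
         i \<bullet> p \<boxplus> j \<bullet> q = idn S"
begin

abbreviation hm :: "'o \<Rightarrow> 'o \<Rightarrow> 'a \<Rightarrow> bool" where
  "hm A B f \<equiv> ob A \<and> ob B \<and> val f \<and> \<not> isx f \<and> src f = A \<and> tgt f = B"

abbreviation xt :: "'o \<Rightarrow> 'o \<Rightarrow> 'a \<Rightarrow> bool" where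
  "xt C A d \<equiv> ob C \<and> ob A \<and> val d \<and> isx d \<and> src d = C \<and> tgt d = A"

abbreviation invp :: "'o \<Rightarrow> 'o \<Rightarrow> 'a \<Rightarrow> 'a \<Rightarrow> bool" where
  "invp A B b c \<equiv> hm A B b \<and> hm B A c \<and> b \<bullet> c = idn B \<and> c \<bullet> b = idn A"

definition bip :: "'o \<Rightarrow> 'o \<Rightarrow> 'o \<Rightarrow> 'a \<Rightarrow> 'a \<Rightarrow> 'a \<Rightarrow> 'a \<Rightarrow> bool" where
  "bip A B S i j p q \<longleftrightarrow> hm A S i \<and> hm B S j \<and> hm S A p \<and> hm S B q \<and>
     p \<bullet> i = idn A \<and> q \<bullet> j = idn B \<and> q \<bullet> i = zr False A B \<and> p \<bullet> j = zr False B A \<and>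
     i \<bullet> p \<boxplus> j \<bullet> q = idn S"

lemma bip_ex: "ob A \<Longrightarrow> ob B \<Longrightarrow> \<exists>S i j p q. bip A B S i j p q"
  using biproduct[of A B] unfolding bip_def by blast

lemma bipD:
  assumes "bip A B S i j p q"
  shows "hm A S i" "hm B S j" "hm S A p" "hm S B q"
    "p \<bullet> i = idn A" "q \<bullet> j = idn B" "q \<bullet> i = zr False A B" "p \<bullet> j = zr False B A"
    "i \<bullet> p \<boxplus> j \<bullet> q = idn S"
  using assms unfolding bip_def by auto

lemma bip_swap: "bip A B S i j p q \<Longrightarrow> bip B A S j i q p"
proof -
  assume b: "bip A B S i j p q"
  note B = bipD[OF b]
  have "j \<bullet> q \<boxplus> i \<bullet> p = idn S" using B(9) by (subst add_comm)
  then show ?thesis unfolding bip_def using B by blast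
qed

lemma ob_src [simp]: "val f \<Longrightarrow> ob (src f)" and ob_tgt [simp]: "val f \<Longrightarrow> ob (tgt f)"
  using val_ob by auto

lemma src_mul' [simp]: "val g \<Longrightarrow> val f \<Longrightarrow> src g = tgt f \<Longrightarrow> \<not> (isx g \<and> isx f) \<Longrightarrow> src (g \<bullet> f) = src f"
  and tgt_mul' [simp]: "val g \<Longrightarrow> val f \<Longrightarrow> src g = tgt f \<Longrightarrow> \<not> (isx g \<and> isx f) \<Longrightarrow> tgt (g \<bullet> f) = tgt g"
  and isx_mul' [simp]: "val g \<Longrightarrow> val f \<Longrightarrow> src g = tgt f \<Longrightarrow> \<not> (isx g \<and> isx f) \<Longrightarrow> isx (g \<bullet> f) = (isx g \<or> isx f)"
  using src_mul tgt_mul isx_mul by auto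

lemma src_add' [simp]: "val f \<Longrightarrow> val g \<Longrightarrow> src f = src g \<Longrightarrow> tgt f = tgt g \<Longrightarrow> isx f = isx g \<Longrightarrow> src (f \<boxplus> g) = src f"
  and tgt_add' [simp]: "val f \<Longrightarrow> val g \<Longrightarrow> src f = src g \<Longrightarrow> tgt f = tgt g \<Longrightarrow> isx f = isx g \<Longrightarrow> tgt (f \<boxplus> g) = tgt f"
  and isx_add' [simp]: "val f \<Longrightarrow> val g \<Longrightarrow> src f = src g \<Longrightarrow> tgt f = tgt g \<Longrightarrow> isx f = isx g \<Longrightarrow> isx (f \<boxplus> g) = isx f"
  using src_add tgt_add isx_add by auto

lemma src_idn [simp]: "ob A \<Longrightarrow> src (idn A) = A" and tgt_idn [simp]: "ob A \<Longrightarrow> tgt (idn A) = A"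
  and isx_idn [simp]: "ob A \<Longrightarrow> \<not> isx (idn A)"
  using typ_idn by auto

lemma src_zr [simp]: "ob A \<Longrightarrow> ob B \<Longrightarrow> src (zr e A B) = A"
  and tgt_zr [simp]: "ob A \<Longrightarrow> ob B \<Longrightarrow> tgt (zr e A B) = B"
  and isx_zr [simp]: "ob A \<Longrightarrow> ob B \<Longrightarrow> isx (zr e A B) = e"
  using typ_zr by auto

lemma idn_mul [simp]: "val f \<Longrightarrow> tgt f = A \<Longrightarrow> idn A \<bullet> f = f"
  and mul_idn [simp]: "val f \<Longrightarrow> src f = A \<Longrightarrow> f \<bullet> idn A = f"
  using idn_l idn_r by auto

text \<open>Composites are normalized to the right, where \<open>f \<bullet> g\<close> is not a
  subterm of \<open>f \<bullet> g \<bullet> t\<close>; this form lets an equation act on the front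
  of a longer composite.\<close>

lemma re: "f \<bullet> g = h \<Longrightarrow> f \<bullet> g \<bullet> t = h \<bullet> t"
  by (metis mul_assoc)

lemma add_left_comm: "f \<boxplus> (g \<boxplus> h) = g \<boxplus> (f \<boxplus> h)"
  by (metis add_assoc add_comm)

lemmas add_ac = add_assoc add_comm add_left_comm

lemma add_zr [simp]: "val f \<Longrightarrow> src f = A \<Longrightarrow> tgt f = B \<Longrightarrow> isx f = e \<Longrightarrow> f \<boxplus> zr e A B = f"
  using add_zr' by auto

lemma zr_add [simp]: "val f \<Longrightarrow> src f = A \<Longrightarrow> tgt f = B \<Longrightarrow> isx f = e \<Longrightarrow> zr e A B \<boxplus> f = f"
  by (subst add_comm) simp

lemma neg_add_self [simp]: "val f \<Longrightarrow> \<boxminus> f \<boxplus> f = zr (isx f) (src f) (tgt f)"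
  by (subst add_comm) simp

lemma add_cancel: "val h \<Longrightarrow> val f \<Longrightarrow> val g \<Longrightarrow> src f = src h \<Longrightarrow> tgt f = tgt h \<Longrightarrow> isx f = isx h
   \<Longrightarrow> src g = src h \<Longrightarrow> tgt g = tgt h \<Longrightarrow> isx g = isx h \<Longrightarrow> h \<boxplus> f = h \<boxplus> g \<Longrightarrow> f = g"
  by (metis add_assoc neg_add_self zr_add)

lemma idem_zr: "val f \<Longrightarrow> f \<boxplus> f = f \<Longrightarrow> f = zr (isx f) (src f) (tgt f)"
  by (rule add_cancel[of f]) simp_all

lemma zr_zr [simp]: "ob A \<Longrightarrow> ob B \<Longrightarrow> zr e A B \<boxplus> zr e A B = zr e A B"
  by (rule add_zr) auto

lemma mul_zr [simp]:
  assumes "val g" "src g = B" "\<not> (isx g \<and> e)" "ob A" shows "g \<bullet> zr e A B = zr (isx g \<or> e) A (tgt g)"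
proof -
  have B: "ob B" using assms by auto
  have "g \<bullet> zr e A B \<boxplus> g \<bullet> zr e A B = g \<bullet> zr e A B"
    using assms B by (metis distl zr_zr)
  then show ?thesis using idem_zr[of "g \<bullet> zr e A B"] assms B by simp
qed

lemma zr_mul [simp]:
  assumes "val g" "tgt g = A" "\<not> (e \<and> isx g)" "ob B" shows "zr e A B \<bullet> g = zr (e \<or> isx g) (src g) B"
proof -
  have A: "ob A" using assms by auto
  have "zr e A B \<bullet> g \<boxplus> zr e A B \<bullet> g = zr e A B \<bullet> g"
    using assms A by (metis distr zr_zr)
  then show ?thesis using idem_zr[of "zr e A B \<bullet> g"] assms A by simp
qed

lemma neg_zr [simp]: "ob A \<Longrightarrow> ob B \<Longrightarrow> \<boxminus> (zr e A B) = zr e A B"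
  by (rule add_cancel[of "zr e A B"]) auto

lemma neg_neg [simp]: "val f \<Longrightarrow> \<boxminus> (\<boxminus> f) = f"
  by (rule add_cancel[of "\<boxminus> f"]) auto

text \<open>The injectivity clauses of \<open>cov\<close> and \<open>con\<close> speak of zero maps
  only, so equalities are reached through differences. The indices of the zero arrow may be left
  free because the types of \<open>a\<close> and \<open>b\<close> force them.\<close>

lemma sub_zr: "a \<boxplus> \<boxminus> b = zr e A B \<Longrightarrow> val a \<Longrightarrow> val b \<Longrightarrow> src a = src b \<Longrightarrow> tgt a = tgt b \<Longrightarrow> isx a = isx b \<Longrightarrow> a = b"
proof -
  assume *: "a \<boxplus> \<boxminus> b = zr e A B" "val a" "val b" "src a = src b" "tgt a = tgt b" "isx a = isx b"
  then have v: "val (zr e A B)" by (metis val_add val_neg src_neg tgt_neg isx_neg)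
  then have "e = isx b" "A = src b" "B = tgt b"
    using * by (metis isx_zr val_zr isx_add' isx_neg src_neg tgt_neg val_neg, metis src_zr val_zr src_add' isx_neg src_neg tgt_neg val_neg,
       metis tgt_zr val_zr tgt_add' isx_neg src_neg tgt_neg val_neg)
  then have "a \<boxplus> \<boxminus> b = b \<boxplus> \<boxminus> b" using * by simp
  then have "\<boxminus> b \<boxplus> a = \<boxminus> b \<boxplus> b" by (metis add_comm)
  then show ?thesis by (rule add_cancel[rotated -1]) (use * in simp_all)
qed

lemma add_sub1 [simp]: "val a \<Longrightarrow> val b \<Longrightarrow> src a = src b \<Longrightarrow> tgt a = tgt b \<Longrightarrow> isx a = isx b \<Longrightarrow> a \<boxplus> b \<boxplus> \<boxminus> b = a"
  by (simp add: add_assoc)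

lemma add_sub2 [simp]: "val a \<Longrightarrow> val b \<Longrightarrow> src a = src b \<Longrightarrow> tgt a = tgt b \<Longrightarrow> isx a = isx b \<Longrightarrow> a \<boxplus> \<boxminus> b \<boxplus> b = a"
  by (simp add: add_assoc)

lemma add_sub3 [simp]: "val a \<Longrightarrow> val b \<Longrightarrow> src a = src b \<Longrightarrow> tgt a = tgt b \<Longrightarrow> isx a = isx b \<Longrightarrow> b \<boxplus> (a \<boxplus> \<boxminus> b) = a"
  by (subst add_left_comm) simp

lemma add_sub5 [simp]: "val a \<Longrightarrow> val b \<Longrightarrow> src a = src b \<Longrightarrow> tgt a = tgt b \<Longrightarrow> isx a = isx b \<Longrightarrow> \<boxminus> b \<boxplus> (b \<boxplus> a) = a"
  by (simp flip: add_assoc)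

lemma add_sub6 [simp]: "val a \<Longrightarrow> val b \<Longrightarrow> src a = src b \<Longrightarrow> tgt a = tgt b \<Longrightarrow> isx a = isx b \<Longrightarrow> \<boxminus> b \<boxplus> (a \<boxplus> b) = a"
  by (subst add_left_comm) simp

lemma sub_eq: "a = b \<boxplus> c \<Longrightarrow> val c \<Longrightarrow> val b \<Longrightarrow> src c = src b \<Longrightarrow> tgt c = tgt b \<Longrightarrow> isx c = isx b \<Longrightarrow> a \<boxplus> \<boxminus> c = b"
  by simp

definition zob :: "'o \<Rightarrow> bool" where
  "zob Z \<longleftrightarrow> ob Z \<and> (\<forall>A f. (hm Z A f \<longrightarrow> f = zr False Z A) \<and> (hm A Z f \<longrightarrow> f = zr False A Z))"

lemma zobD:
  assumes "zob Z"
  shows "ob Z" "hm Z A f \<Longrightarrow> f = zr False Z A" "hm A Z f \<Longrightarrow> f = zr False A Z"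
  using assms unfolding zob_def by blast+

lemma zob_ex: "\<exists>Z. zob Z"
  using zero_ob unfolding zob_def by metis

lemma bip_zob:
  assumes "zob Z" "ob A"
  shows "bip Z A A (zr False Z A) (idn A) (zr False A Z) (idn A)"
proof -
  note Z = zobD[OF assms(1)]
  have "zr False Z Z = idn Z" using Z(2)[of Z "idn Z"] Z(1) by simp
  then show ?thesis using assms(2) Z(1) unfolding bip_def by simp
qed

lemma inv_unique:
  assumes "hm A B b" "hm B A l" "hm B A r" "l \<bullet> b = idn A" "b \<bullet> r = idn B"
  shows "invp A B b l"
proof -
  have "l = l \<bullet> b \<bullet> r" using assms by simp
  also have "\<dots> = r" using re[OF assms(4), of r] assms(1-3) by simp
  finally have "b \<bullet> l = idn B" using assms(5) by simp
  then show ?thesis using assms by blast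
qed

end

text \<open>The realization is a relation, stable under isomorphic change of the middle term
  (\<open>tri_equiv\<close>); that two triangles of the same class are equivalent is recovered in
  \<open>tri_unique\<close>.\<close>

locale extri = arrow_calculus +
  fixes tri :: "'b \<Rightarrow> 'b \<Rightarrow> 'b \<Rightarrow> bool"
  assumes tri_typ: "tri x y d \<Longrightarrow> val x \<and> val y \<and> val d \<and> \<not> isx x \<and> \<not> isx y \<and> isx d \<and>
        src y = tgt x \<and> src d = tgt y \<and> tgt d = src x"
    and tri_ex: "val d \<Longrightarrow> isx d \<Longrightarrow> \<exists>x y. tri x y d"
    and tri_equiv: "tri x y d \<Longrightarrow> invp (tgt x) B b c \<Longrightarrow> tri (b \<bullet> x) (y \<bullet> c) d"
    and tri_split: "bip A C S i j p q \<Longrightarrow> tri i q (zr True C A)"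
    and tri_mor: "tri x y d \<Longrightarrow> tri x' y' d' \<Longrightarrow> hm (src x) (src x') a \<Longrightarrow> hm (tgt y) (tgt y') c \<Longrightarrow>
        a \<bullet> d = d' \<bullet> c \<Longrightarrow> \<exists>b. hm (tgt x) (tgt x') b \<and> b \<bullet> x = x' \<bullet> a \<and> y' \<bullet> b = c \<bullet> y"
    and ET3: "tri x y d \<Longrightarrow> tri x' y' d' \<Longrightarrow> hm (src x) (src x') a \<Longrightarrow> hm (tgt x) (tgt x') b \<Longrightarrow>
        b \<bullet> x = x' \<bullet> a \<Longrightarrow> \<exists>c. hm (tgt y) (tgt y') c \<and> c \<bullet> y = y' \<bullet> b \<and> a \<bullet> d = d' \<bullet> c"
    and ET3_op: "tri x y d \<Longrightarrow> tri x' y' d' \<Longrightarrow> hm (src y) (src y') b \<Longrightarrow> hm (tgt y) (tgt y') c \<Longrightarrow>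
        c \<bullet> y = y' \<bullet> b \<Longrightarrow> \<exists>a. hm (src x) (src x') a \<and> b \<bullet> x = x' \<bullet> a \<and> a \<bullet> d = d' \<bullet> c"
    and ET4: "tri f f' d \<Longrightarrow> tri g g' d' \<Longrightarrow> src g = tgt f \<Longrightarrow>
        \<exists>h u e d''. tri (g \<bullet> f) h d'' \<and> tri u e (f' \<bullet> d') \<and> h \<bullet> g = u \<bullet> f' \<and> e \<bullet> h = g' \<and>
          d'' \<bullet> u = d \<and> f \<bullet> d'' = d' \<bullet> e"
    and ET4_op: "tri f' f d \<Longrightarrow> tri g' g d' \<Longrightarrow> src f = tgt g \<Longrightarrow>
        \<exists>h u e d''. tri h (f \<bullet> g) d'' \<and> tri e u (d' \<bullet> f') \<and> g \<bullet> h = f' \<bullet> u \<and> h \<bullet> e = g' \<and>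
          u \<bullet> d'' = d \<and> d'' \<bullet> f = e \<bullet> d'"
begin

text \<open>Reversing arrows exchanges source and target, the order of composition, and the two maps
  of a triangle, while the extension stays the same element. Interpreting the locale in this
  opposite structure yields the mirror image of any lemma proved so far.\<close>

lemma dual: "extri ob val isx tgt src (\<lambda>f g. g \<bullet> f) add neg idn (\<lambda>e A B. zr e B A) (\<lambda>x y d. tri y x d)"
proof -
  interpret op: arrow_calculus ob val isx tgt src "\<lambda>f g. g \<bullet> f" add neg idn "\<lambda>e A B. zr e B A"
  proof unfold_locales
    fix A B assume "ob A" "ob B"
    then show "\<exists>S i j p q. ob S \<and>
         (val i \<and> \<not> isx i \<and> tgt i = A \<and> src i = S) \<and> (val j \<and> \<not> isx j \<and> tgt j = B \<and> src j = S) \<and>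
         (val p \<and> \<not> isx p \<and> tgt p = S \<and> src p = A) \<and> (val q \<and> \<not> isx q \<and> tgt q = S \<and> src q = B) \<and>
         i \<bullet> p = idn A \<and> j \<bullet> q = idn B \<and> i \<bullet> q = zr False B A \<and> j \<bullet> p = zr False A B \<and>
         p \<bullet> i \<boxplus> q \<bullet> j = idn S"
      using biproduct[of A B] by blast
  next
    show "\<exists>Z. ob Z \<and> (\<forall>f. val f \<and> \<not> isx f \<longrightarrow>
         (tgt f = Z \<or> src f = Z) \<longrightarrow> f = zr False (src f) (tgt f))"
      using zero_ob by blast
  qed (auto simp: add_ac)
  have bip_op: "op.bip A B S i j p q = bip A B S p q i j" for A B S i j p q
    unfolding op.bip_def bip_def by auto
  show ?thesis
  proof (unfold_locales, goal_cases)
    case (1 x y d) then show ?case using tri_typ[of y x d] by auto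
  next
    case (2 d) then show ?case using tri_ex by blast
  next
    case (3 x y d B b c)
    then show ?case using tri_equiv[of y x d B c b] tri_typ[of y x d] by simp
  next
    case (4 A C S i j p q)
    then show ?case using bip_swap tri_split unfolding bip_op by metis
  next
    case (5 x y d x' y' d' a c)
    then show ?case using tri_mor[of y' x' d' y x d c a] tri_typ[of y x d] tri_typ[of y' x' d'] by metis
  next
    case (6 x y d x' y' d' a b)
    then show ?case using ET3_op[of y' x' d' y x d b a] tri_typ[of y x d] tri_typ[of y' x' d'] by metis
  next
    case (7 x y d x' y' d' b c)
    then show ?case using ET3[of y' x' d' y x d c b] tri_typ[of y x d] tri_typ[of y' x' d'] by metis
  next
    case (8 f f' d g g' d')
    then show ?case using ET4_op[of f' f d g' g d'] by metis
  next
    case (9 f' f d g' g d')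
    then show ?case using ET4[of f f' d g g' d'] by metis
  qed
qed

end

section \<open>Exactness, pullbacks and pushouts\<close>

context extri begin

section \<open>Triangles with explicit objects, and the octahedral axioms for them\<close>

abbreviation etr :: "'a \<Rightarrow> 'a \<Rightarrow> 'a \<Rightarrow> 'b \<Rightarrow> 'b \<Rightarrow> 'b \<Rightarrow> bool" where
  "etr A B C x y d \<equiv> ob A \<and> ob B \<and> ob C \<and> hm A B x \<and> hm B C y \<and> xt C A d \<and> tri x y d"

lemma etr_typ: "tri x y d \<Longrightarrow> etr (src x) (tgt x) (tgt y) x y d"
  using tri_typ by auto

lemma etr_ex: "xt C A d \<Longrightarrow> \<exists>B x y. etr A B C x y d"
proof -
  assume d: "xt C A d"
  then obtain x y where "tri x y d" using tri_ex by blast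
  then show ?thesis using etr_typ[of x y d] d by auto
qed

lemma etr_mor:
  assumes "etr A B C x y d" "etr A' B' C' x' y' d'" "hm A A' a" "hm C C' c" "a \<bullet> d = d' \<bullet> c"
  obtains b where "hm B B' b" "b \<bullet> x = x' \<bullet> a" "y' \<bullet> b = c \<bullet> y"
proof -
  have "\<exists>b. hm (tgt x) (tgt x') b \<and> b \<bullet> x = x' \<bullet> a \<and> y' \<bullet> b = c \<bullet> y"
    by (rule tri_mor[of x y d x' y' d']) (use assms in auto)
  then show thesis using assms that by auto
qed

lemma etr_ET3:
  assumes "etr A B C x y d" "etr A' B' C' x' y' d'" "hm A A' a" "hm B B' b" "b \<bullet> x = x' \<bullet> a"
  obtains c where "hm C C' c" "c \<bullet> y = y' \<bullet> b" "a \<bullet> d = d' \<bullet> c"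
proof -
  have "\<exists>c. hm (tgt y) (tgt y') c \<and> c \<bullet> y = y' \<bullet> b \<and> a \<bullet> d = d' \<bullet> c"
    by (rule ET3[of x y d x' y' d']) (use assms in auto)
  then show thesis using assms that by auto
qed

lemma etr_ET3_op:
  assumes "etr A B C x y d" "etr A' B' C' x' y' d'" "hm B B' b" "hm C C' c" "c \<bullet> y = y' \<bullet> b"
  obtains a where "hm A A' a" "b \<bullet> x = x' \<bullet> a" "a \<bullet> d = d' \<bullet> c"
proof -
  have "\<exists>a. hm (src x) (src x') a \<and> b \<bullet> x = x' \<bullet> a \<and> a \<bullet> d = d' \<bullet> c"
    by (rule ET3_op[of x y d x' y' d']) (use assms in auto)
  then show thesis using assms that by auto
qed

lemma etr_ET4:
  assumes "etr A B D f f' d" "etr B C F g g' d'"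
  obtains E h u e d'' where "etr A C E (g \<bullet> f) h d''" "etr D E F u e (f' \<bullet> d')" "h \<bullet> g = u \<bullet> f'"
    "e \<bullet> h = g'" "d'' \<bullet> u = d" "f \<bullet> d'' = d' \<bullet> e"
proof -
  obtain h u e d'' where *: "tri (g \<bullet> f) h d''" "tri u e (f' \<bullet> d')" "h \<bullet> g = u \<bullet> f'"
    "e \<bullet> h = g'" "d'' \<bullet> u = d" "f \<bullet> d'' = d' \<bullet> e"
    using ET4[of f f' d g g' d'] assms by auto
  \<comment> \<open>Since this composite equals \<open>d\<close>, it is defined, and that identifies
    the target of \<open>u\<close> with the last term of the first new triangle.\<close>
  have "val (d'' \<bullet> u)" using *(5) assms by simp
  then have "etr A C (tgt u) (g \<bullet> f) h d''" "etr D (tgt u) F u e (f' \<bullet> d')"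
    using etr_typ[OF *(1)] etr_typ[OF *(2)] assms by simp_all
  then show thesis using * that by blast
qed

lemma etr_ET4_op:
  assumes "etr D B A f' f d" "etr F C B g' g d'"
  obtains E h u e d'' where "etr E C A h (f \<bullet> g) d''" "etr F E D e u (d' \<bullet> f')" "g \<bullet> h = f' \<bullet> u"
    "h \<bullet> e = g'" "u \<bullet> d'' = d" "d'' \<bullet> f = e \<bullet> d'"
proof -
  interpret op: extri ob val isx tgt src "\<lambda>f g. g \<bullet> f" add neg idn "\<lambda>e A B. zr e B A" "\<lambda>x y d. tri y x d"
    by (rule dual)
  obtain E h u e d'' where "op.etr A C E (f \<bullet> g) h d''" "op.etr D E F u e (d' \<bullet> f')" "g \<bullet> h = f' \<bullet> u"
    "h \<bullet> e = g'" "u \<bullet> d'' = d" "d'' \<bullet> f = e \<bullet> d'"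
    by (rule op.etr_ET4[of A B D f f' d C F g g' d']) (use assms in auto)
  then show thesis by (intro that[of E h d'' e u]) auto
qed

section \<open>Exact sequences of morphisms and extensions attached to a triangle\<close>

lemma split_id:
  assumes "zob Z" "ob A"
  shows "etr Z A A (zr False Z A) (idn A) (zr True A Z)" "etr A A Z (idn A) (zr False A Z) (zr True Z A)"
  using tri_split[OF bip_zob[OF assms]] tri_split[OF bip_swap[OF bip_zob[OF assms]]] assms zobD(1)[OF assms(1)]
  by simp_all

text \<open>In each case a comparison with a trivial triangle, one of whose ends is a zero object,
  makes the composite factor through a zero morphism or a zero extension.\<close>

lemma tri_zero:
  assumes T: "etr A B C x y d"
  shows "y \<bullet> x = zr False A C" "d \<bullet> y = zr True B A" "x \<bullet> d = zr True C B"
proof -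
  have o: "ob A" "ob B" "ob C" using T by auto
  obtain Z where Z: "zob Z" using zob_ex by blast
  note Z' = zobD[OF Z]
  obtain c where c: "hm Z C c" "c \<bullet> zr False A Z = y \<bullet> x"
    by (rule etr_ET3[OF split_id(2)[OF Z o(1)] T, of "idn A" x]) (use T in auto)
  show "y \<bullet> x = zr False A C" using c T Z' o by simp
  obtain a where a: "hm Z A a" "a \<bullet> zr True B Z = d \<bullet> y"
    by (rule etr_ET3_op[OF split_id(1)[OF Z o(2)] T, of "idn B" y]) (use T in auto)
  show "d \<bullet> y = zr True B A" using a T Z' o by simp
  obtain a where a: "hm C Z a" "x \<bullet> d = zr True Z B \<bullet> a"
    by (rule etr_ET3[OF T split_id(2)[OF Z o(2)], of x "idn B"]) (use T in auto)
  show "x \<bullet> d = zr True C B" using a T Z' o by simp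
qed

text \<open>The hypothesis makes \<open>g\<close> part of a morphism from the split triangle with
  ends \<open>A\<close> and \<open>W\<close>; the middle component, restricted to the summand
  \<open>W\<close>, is the lift.\<close>

lemma tri_lift:
  assumes T: "etr A B C x y d" and g: "hm W C g" "d \<bullet> g = zr True W A"
  obtains h where "hm W B h" "y \<bullet> h = g"
proof -
  have o: "ob A" "ob W" using T g by auto
  obtain S i j p q where b: "bip A W S i j p q" using bip_ex[OF o] by blast
  note B = bipD[OF b]
  obtain h where h: "hm S B h" "y \<bullet> h = g \<bullet> q"
    by (rule etr_mor[of A S W i q "zr True W A" A B C x y d "idn A" g]) (use T g B tri_split[OF b] o in auto)
  show thesis by (rule that[of "h \<bullet> j"]) (use h B T g re[OF h(2)] in auto)
qed

text \<open>The trivial triangle \<open>W\<close> to \<open>W\<close> to zero maps to the given one,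
  with \<open>g\<close> as middle component; (ET3)^op supplies the factor on the first
  terms.\<close>

lemma tri_ker:
  assumes T: "etr A B C x y d" and g: "hm W B g" "y \<bullet> g = zr False W C"
  obtains h where "hm W A h" "x \<bullet> h = g"
proof -
  have o: "ob W" "ob B" using g by auto
  obtain Z where Z: "zob Z" using zob_ex by blast
  obtain a where "hm W A a" "g \<bullet> idn W = x \<bullet> a"
    by (rule etr_ET3_op[OF split_id(2)[OF Z o(1)] T, of g "zr False Z C"]) (use T g zobD(1)[OF Z] in auto)
  then show thesis using that[of a] g by simp
qed

text \<open>Realize \<open>s\<close> by a triangle with middle term \<open>E\<close>. Since
  \<open>s\<close> dies on \<open>B\<close>, the map \<open>y\<close> lifts to \<open>E\<close>, and
  (ET3)^op turns the lift into a map from \<open>A\<close> to \<open>W\<close> carrying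
  \<open>d\<close> to \<open>s\<close>.\<close>

lemma tri_xcoker:
  assumes T: "etr A B C x y d" and s: "xt C W s" "s \<bullet> y = zr True B W"
  obtains h where "hm A W h" "h \<bullet> d = s"
proof -
  obtain E u v where E: "etr W E C u v s" using etr_ex[OF s(1)] by blast
  obtain k where k: "hm B E k" "v \<bullet> k = y" by (rule tri_lift[OF E, of B y]) (use T s in auto)
  obtain a where "hm A W a" "a \<bullet> d = s \<bullet> idn C"
    by (rule etr_ET3_op[OF T E, of k "idn C"]) (use T k in auto)
  then show thesis using that[of a] s by simp
qed

lemma tri_ext:
  assumes T: "etr A B C x y d" and g: "hm A W g" "g \<bullet> d = zr True C W"
  obtains h where "hm B W h" "h \<bullet> x = g"
proof -
  interpret op: extri ob val isx tgt src "\<lambda>f g. g \<bullet> f" add neg idn "\<lambda>e A B. zr e B A" "\<lambda>x y d. tri y x d"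
    by (rule dual)
  show thesis by (rule op.tri_lift[of C B A y x d W g]) (use assms that in auto)
qed

lemma tri_coker:
  assumes T: "etr A B C x y d" and g: "hm B W g" "g \<bullet> x = zr False A W"
  obtains h where "hm C W h" "h \<bullet> y = g"
proof -
  interpret op: extri ob val isx tgt src "\<lambda>f g. g \<bullet> f" add neg idn "\<lambda>e A B. zr e B A" "\<lambda>x y d. tri y x d"
    by (rule dual)
  show thesis by (rule op.tri_ker[of C B A y x d W g]) (use assms that in auto)
qed

text \<open>Half of the five lemma. The map \<open>s\<close> inverts \<open>b\<close> on the right
  up to something killed by \<open>y'\<close>; that error factors through \<open>x'\<close> as
  \<open>t\<close> and is absorbed by the correction
  \<open>x \<bullet> a' \<bullet> t\<close>.\<close>

lemma tri_inv_r:
  assumes T: "etr A B C x y d" and T': "etr A' B' C' x' y' d'"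
    and m: "hm B B' b" "b \<bullet> x = x' \<bullet> a" "y' \<bullet> b = c \<bullet> y" "a \<bullet> d = d' \<bullet> c"
    and i: "invp A A' a a'" "invp C C' c c'"
  obtains r where "hm B' B r" "b \<bullet> r = idn B'"
proof -
  have "d \<bullet> c' \<bullet> y' = (a' \<bullet> a) \<bullet> d \<bullet> c' \<bullet> y'" using T T' m i by simp
  also have "\<dots> = a' \<bullet> (a \<bullet> d) \<bullet> c' \<bullet> y'" by simp
  also have "\<dots> = a' \<bullet> d' \<bullet> (c \<bullet> c') \<bullet> y'" unfolding m(4) by simp
  also have "\<dots> = a' \<bullet> (d' \<bullet> y')" using T' m i by simp
  also have "\<dots> = zr True B' A" using tri_zero(2)[OF T'] T' m i by simp
  finally have 0: "d \<bullet> c' \<bullet> y' = zr True B' A" .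
  obtain s where s: "hm B' B s" "y \<bullet> s = c' \<bullet> y'" by (rule tri_lift[OF T _ 0]) (use T' m i in auto)
  have "y' \<bullet> b \<bullet> s = c \<bullet> y \<bullet> s" using re[OF m(3)] by simp
  also have "\<dots> = (c \<bullet> c') \<bullet> y'" using s by simp
  also have "\<dots> = y'" using T' m i by (simp del: mul_assoc)
  finally have 1: "y' \<bullet> b \<bullet> s = y'" .
  obtain t where t: "hm B' A' t" "x' \<bullet> t = idn B' \<boxplus> \<boxminus> (b \<bullet> s)"
    by (rule tri_ker[OF T', of B' "idn B' \<boxplus> \<boxminus> (b \<bullet> s)"]) (use T' m s 1 in auto)
  have "b \<bullet> x \<bullet> a' \<bullet> t = x' \<bullet> (a \<bullet> a') \<bullet> t" using re[OF m(2), of "a' \<bullet> t"] by simp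
  also have "\<dots> = x' \<bullet> t" using t(1) i(1) T' by simp
  finally have "b \<bullet> (s \<boxplus> x \<bullet> a' \<bullet> t) = b \<bullet> s \<boxplus> (idn B' \<boxplus> \<boxminus> (b \<bullet> s))" using t(2) by simp
  also have "\<dots> = idn B'" using s(1) m(1) T' by simp
  finally have *: "b \<bullet> (s \<boxplus> x \<bullet> a' \<bullet> t) = idn B'" .
  show thesis by (rule that[OF _ *]) (use s(1) T i(1) t(1) T' in simp)
qed

lemma tri_inv:
  assumes T: "etr A B C x y d" and T': "etr A' B' C' x' y' d'"
    and m: "hm B B' b" "b \<bullet> x = x' \<bullet> a" "y' \<bullet> b = c \<bullet> y" "a \<bullet> d = d' \<bullet> c"
    and i: "invp A A' a a'" "invp C C' c c'"
  obtains b' where "invp B B' b b'"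
proof -
  interpret op: extri ob val isx tgt src "\<lambda>f g. g \<bullet> f" add neg idn "\<lambda>e A B. zr e B A" "\<lambda>x y d. tri y x d"
    by (rule dual)
  obtain r where r: "hm B' B r" "b \<bullet> r = idn B'" by (rule tri_inv_r[OF assms])
  have *: "op.etr C' B' A' y' x' d'" "op.etr C B A y x d" "op.invp C' C c c'" "op.invp A' A a a'" "op.hm B' B b"
    using T T' m(1) i by auto
  obtain l where l: "op.hm B B' l" "l \<bullet> b = idn B"
    by (rule op.tri_inv_r[OF *(1,2,5) m(3,2) m(4)[symmetric] *(3,4)])
  have "invp B B' b l" by (rule inv_unique[OF m(1) _ r(1) l(2) r(2)]) (use l in auto)
  then show thesis by (rule that)
qed

lemma tri_unique:
  assumes T: "etr A B C x y d" and T': "etr A B' C x' y' d"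
  obtains b b' where "invp B B' b b'" "b \<bullet> x = x'" "y' \<bullet> b = y"
proof -
  obtain b where b: "hm B B' b" "b \<bullet> x = x' \<bullet> idn A" "y' \<bullet> b = idn C \<bullet> y"
    by (rule etr_mor[OF T T', of "idn A" "idn C"]) (use T in auto)
  obtain b' where "invp B B' b b'"
    by (rule tri_inv[OF T T' b, of "idn A" "idn C"]) (use T in auto)
  then show thesis by (rule that) (use b T T' in auto)
qed

text \<open>The transported class has some realization; the five lemma identifies its middle term
  with \<open>B\<close>, and \<open>tri_equiv\<close> moves the triangle back to
  \<open>B\<close>.\<close>

lemma tri_iso_end:
  assumes T: "etr A B C x y d" and c: "invp C C' c c'"
  shows "etr A B C' x (c \<bullet> y) (d \<bullet> c')"
proof -
  obtain E u v where E: "etr A E C' u v (d \<bullet> c')" using etr_ex[of C' A "d \<bullet> c'"] T c by auto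
  obtain b where b: "hm B E b" "b \<bullet> x = u \<bullet> idn A" "v \<bullet> b = c \<bullet> y"
    by (rule etr_mor[OF T E, of "idn A" c]) (use T c in auto)
  obtain b' where b': "invp B E b b'"
    by (rule tri_inv[OF T E b, of "idn A" c']) (use T c in auto)
  have "b' \<bullet> u = b' \<bullet> b \<bullet> x" using b E by simp
  also have "\<dots> = x" using b' T re[of b' b "idn B" x] by simp
  finally have "b' \<bullet> u = x" .
  moreover have "tri (b' \<bullet> u) (v \<bullet> b) (d \<bullet> c')" by (rule tri_equiv[of _ _ _ B]) (use E b' in auto)
  ultimately show ?thesis using T c b by simp
qed

text \<open>Converse of \<open>tri_split\<close>, by transporting the structure of some biproduct
  along the isomorphism of \<open>tri_unique\<close>; only the maps \<open>m\<close> and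
  \<open>e\<close> are prescribed.\<close>

lemma etr_split:
  assumes T: "etr A M W m e (zr True W A)"
  obtains s r where "bip A W M m s r e"
proof -
  have o: "ob A" "ob W" using T by auto
  obtain S i j p q where b: "bip A W S i j p q" using bip_ex[OF o] by blast
  note B = bipD[OF b]
  have T0: "etr A S W i q (zr True W A)" using tri_split[OF b] B o by simp
  obtain b b' where b: "invp S M b b'" "b \<bullet> i = m" "e \<bullet> b = q"
    by (rule tri_unique[OF T0 T])
  have e: "e = q \<bullet> b'" using b T re[OF b(3), of b'] by simp
  have bb: "b' \<bullet> b \<bullet> t = t" if "val t" "tgt t = S" for t
    using b that re[of b' b "idn S" t] by simp
  have q: "q \<bullet> b' \<bullet> b = q" and p: "p \<bullet> b' \<bullet> b = p" using b B by simp_all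
  have "bip A W M (b \<bullet> i) (b \<bullet> j) (p \<bullet> b') (q \<bullet> b')"
  proof -
    have "b \<bullet> (i \<bullet> p \<boxplus> j \<bullet> q) \<bullet> b' = idn M" unfolding B(9) using b by simp
    then have "b \<bullet> i \<bullet> p \<bullet> b' \<boxplus> b \<bullet> j \<bullet> q \<bullet> b' = idn M" by simp
    then show ?thesis using b(1) B(1-8) T0 unfolding bip_def by (simp add: bb)
  qed
  then show thesis using that b e by metis
qed

text \<open>The pullback is the middle term of the extension of \<open>C\<close> by the biproduct
  with components \<open>d1\<close> and \<open>d2\<close>. The octahedron over this and the split
  triangle of the biproduct contains a triangle of class \<open>p2 \<bullet> ?\<mu> = d2\<close>,
  which \<open>tri_unique\<close> identifies with the second given one; the other new triangle
  becomes the base change of \<open>d1\<close> along \<open>y2\<close>.\<close>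

lemma pullback_half:
  assumes T1: "etr A1 B1 C x1 y1 d1" and T2: "etr A2 B2 C x2 y2 d2"
    and b: "bip A1 A2 S i1 i2 p1 p2" and T: "etr S M C u v (i1 \<bullet> d1 \<boxplus> i2 \<bullet> d2)"
  obtains e1 where "etr A1 M B2 (u \<bullet> i1) e1 (d1 \<bullet> y2)" "e1 \<bullet> u = x2 \<bullet> p2" "y2 \<bullet> e1 = v"
proof -
  note B = bipD[OF b]
  have o: "ob A1" "ob A2" using T1 T2 by auto
  let ?\<mu> = "i1 \<bullet> d1 \<boxplus> i2 \<bullet> d2"
  have T0: "etr A1 S A2 i1 p2 (zr True A2 A1)" using tri_split[OF b] B o by simp
  obtain E h t e \<theta> where E: "etr A1 M E (u \<bullet> i1) h \<theta>" "etr A2 E C t e (p2 \<bullet> ?\<mu>)" "h \<bullet> u = t \<bullet> p2"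
    "e \<bullet> h = v" "i1 \<bullet> \<theta> = ?\<mu> \<bullet> e"
    by (rule etr_ET4[OF T0 T])
  have 2: "p2 \<bullet> ?\<mu> = d2" and 1: "p1 \<bullet> ?\<mu> = d1"
    using re[OF B(7), of d1] re[OF B(6), of d2] re[OF B(5), of d1] re[OF B(8), of d2] T1 T2 B o by simp_all
  obtain b b' where b: "invp E B2 b b'" "b \<bullet> t = x2" "y2 \<bullet> b = e"
    by (rule tri_unique[OF E(2)[unfolded 2] T2])
  \<comment> \<open>The octahedron determines \<open>\<theta>\<close> only after \<open>i1\<close>,
    so it is recovered with the retraction \<open>p1\<close>.\<close>
  have "\<theta> = p1 \<bullet> i1 \<bullet> \<theta>" using re[OF B(5), of \<theta>] E by simp
  also have "\<dots> = (p1 \<bullet> ?\<mu>) \<bullet> e" using E(5) by (simp del: distl distr)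
  also have "\<dots> = d1 \<bullet> y2 \<bullet> b" unfolding 1 b(3) ..
  finally have "\<theta> \<bullet> b' = d1 \<bullet> y2 \<bullet> b \<bullet> b'" by simp
  then have "\<theta> \<bullet> b' = d1 \<bullet> y2" using b(1) T2 T1 by simp
  then have *: "etr A1 M B2 (u \<bullet> i1) (b \<bullet> h) (d1 \<bullet> y2)" using tri_iso_end[OF E(1) b(1)] by simp
  show thesis
    by (rule that[OF *]) (use b E re[OF b(2), of p2] re[OF b(3), of h] in auto)
qed

text \<open>Both halves are applied to the same realization \<open>M\<close> of the combined class.
  The square commutes because both of its composites are the deflation \<open>v\<close> of that
  realization.\<close>

lemma pullback:
  assumes T1: "etr A1 B1 C x1 y1 d1" and T2: "etr A2 B2 C x2 y2 d2"
  obtains M m1 e1 m2 e2 where "etr A1 M B2 m1 e1 (d1 \<bullet> y2)" "etr A2 M B1 m2 e2 (d2 \<bullet> y1)"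
    "e2 \<bullet> m1 = x1" "e1 \<bullet> m2 = x2" "y1 \<bullet> e2 = y2 \<bullet> e1"
proof -
  have o: "ob A1" "ob A2" using T1 T2 by auto
  obtain S i1 i2 p1 p2 where b: "bip A1 A2 S i1 i2 p1 p2" using bip_ex[OF o] by blast
  note B = bipD[OF b]
  obtain M u v where M: "etr S M C u v (i1 \<bullet> d1 \<boxplus> i2 \<bullet> d2)"
    using etr_ex[of C S "i1 \<bullet> d1 \<boxplus> i2 \<bullet> d2"] T1 T2 B by auto
  obtain e1 where e1: "etr A1 M B2 (u \<bullet> i1) e1 (d1 \<bullet> y2)" "e1 \<bullet> u = x2 \<bullet> p2" "y2 \<bullet> e1 = v"
    by (rule pullback_half[OF T1 T2 b M])
  obtain e2 where e2: "etr A2 M B1 (u \<bullet> i2) e2 (d2 \<bullet> y1)" "e2 \<bullet> u = x1 \<bullet> p1" "y1 \<bullet> e2 = v"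
    by (rule pullback_half[OF T2 T1 bip_swap[OF b], of M u v]) (use M in \<open>simp add: add_comm\<close>)
  show thesis
    by (rule that[OF e1(1) e2(1)]) (use e1 e2 B T1 T2 re[OF e1(2)] re[OF e2(2)] in auto)
qed

lemma pushout:
  assumes T1: "etr A B1 C1 x1 y1 d1" and T2: "etr A B2 C2 x2 y2 d2"
  obtains M m1 e1 m2 e2 where "etr B2 M C1 m1 e1 (x2 \<bullet> d1)" "etr B1 M C2 m2 e2 (x1 \<bullet> d2)"
    "e1 \<bullet> m2 = y1" "e2 \<bullet> m1 = y2" "m2 \<bullet> x1 = m1 \<bullet> x2"
proof -
  interpret op: extri ob val isx tgt src "\<lambda>f g. g \<bullet> f" add neg idn "\<lambda>e A B. zr e B A" "\<lambda>x y d. tri y x d"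
    by (rule dual)
  obtain M m1 e1 m2 e2 where "op.etr C1 M B2 m1 e1 (x2 \<bullet> d1)" "op.etr C2 M B1 m2 e2 (x1 \<bullet> d2)"
    "m1 \<bullet> e2 = y1" "m2 \<bullet> e1 = y2" "e2 \<bullet> x1 = e1 \<bullet> x2"
    by (rule op.pullback[of C1 B1 A y1 x1 d1 C2 B2 y2 x2 d2]) (use assms in auto)
  then show thesis by (intro that[of M e1 m1 e2 m2]) auto
qed

end

section \<open>The horseshoe diagram\<close>

context extri begin

text \<open>Exactness at the middle term is automatic for \<open>\<bbbE>\<close>-triangles, hence omitted from \<open>cov\<close> and \<open>con\<close>.\<close>

definition cov :: "'a \<Rightarrow> 'a \<Rightarrow> 'a \<Rightarrow> 'a \<Rightarrow> 'b \<Rightarrow> 'b \<Rightarrow> bool" where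
  "cov G A B C x y \<longleftrightarrow>
     (\<forall>h. hm G A h \<longrightarrow> x \<bullet> h = zr False G B \<longrightarrow> h = zr False G A) \<and>
     (\<forall>h. hm G C h \<longrightarrow> (\<exists>h'. hm G B h' \<and> y \<bullet> h' = h))"

definition con :: "'a \<Rightarrow> 'a \<Rightarrow> 'a \<Rightarrow> 'a \<Rightarrow> 'b \<Rightarrow> 'b \<Rightarrow> bool" where
  "con W A B C x y \<longleftrightarrow>
     (\<forall>h. hm C W h \<longrightarrow> h \<bullet> y = zr False B W \<longrightarrow> h = zr False C W) \<and>
     (\<forall>h. hm A W h \<longrightarrow> (\<exists>h'. hm B W h' \<and> h' \<bullet> x = h))"

lemma cov_inj: "cov G A B C x y \<Longrightarrow> hm G A h \<Longrightarrow> x \<bullet> h = zr False G B \<Longrightarrow> h = zr False G A"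
  unfolding cov_def by blast

lemma cov_surj:
  assumes "cov G A B C x y" "hm G C h"
  obtains h' where "hm G B h'" "y \<bullet> h' = h"
  using assms unfolding cov_def by blast

lemma con_inj: "con W A B C x y \<Longrightarrow> hm C W h \<Longrightarrow> h \<bullet> y = zr False B W \<Longrightarrow> h = zr False C W"
  unfolding con_def by blast

lemma con_surj:
  assumes "con W A B C x y" "hm A W h"
  obtains h' where "hm B W h'" "h' \<bullet> x = h"
  using assms unfolding con_def by blast

lemma cov_con_dual:
  "extri.cov ob val isx tgt src (\<lambda>f g. g \<bullet> f) (\<lambda>e A B. zr e B A) W C B A y x = con W A B C x y"
  "extri.con ob val isx tgt src (\<lambda>f g. g \<bullet> f) (\<lambda>e A B. zr e B A) W C B A y x = cov W A B C x y"
  unfolding extri.cov_def[OF dual] extri.con_def[OF dual] cov_def con_def by auto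

text \<open>A commutative diagram with exact rows \<open>KA \<rightarrow> K \<rightarrow> KC\<close>, \<open>WA \<rightarrow> S \<rightarrow> WC\<close> (split), \<open>A \<rightarrow> B \<rightarrow> C\<close>.\<close>

definition horse :: "'a \<Rightarrow> 'a \<Rightarrow> 'a \<Rightarrow> 'b \<Rightarrow> 'b \<Rightarrow> 'b \<Rightarrow> 'a \<Rightarrow> 'a \<Rightarrow> 'b \<Rightarrow> 'b \<Rightarrow> 'b \<Rightarrow> 'a \<Rightarrow> 'a \<Rightarrow> 'b \<Rightarrow> 'b \<Rightarrow> 'b
    \<Rightarrow> 'a \<Rightarrow> 'b \<Rightarrow> 'b \<Rightarrow> 'b \<Rightarrow> 'b \<Rightarrow> 'a \<Rightarrow> 'b \<Rightarrow> 'b \<Rightarrow> 'b \<Rightarrow> 'b \<Rightarrow> 'b \<Rightarrow> 'b \<Rightarrow> bool" where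
  "horse A B C x y d KA WA kA fA dA KC WC kC fC dC S i s r p K k f dk e t dt \<longleftrightarrow>
     etr A B C x y d \<and> etr KA WA A kA fA dA \<and> etr KC WC C kC fC dC \<and> bip WA WC S i s r p \<and>
     etr K S B k f dk \<and> etr KA K KC e t dt \<and>
     f \<bullet> i = x \<bullet> fA \<and> y \<bullet> f = fC \<bullet> p \<and> i \<bullet> kA = k \<bullet> e \<and> p \<bullet> k = kC \<bullet> t"

text \<open>The pullback \<open>M\<close> of \<open>y\<close> and \<open>fC\<close> has class
  \<open>d \<bullet> fC = 0\<close> as an extension of \<open>WC\<close> by \<open>A\<close>, so it
  splits. The pullback \<open>S\<close> of its retraction to \<open>A\<close> and of
  \<open>fA\<close> is an extension of \<open>WA\<close> by \<open>WC\<close>, again split. The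
  composite of the deflations from \<open>S\<close> to \<open>M\<close> and from \<open>M\<close> to
  \<open>B\<close> then has a kernel \<open>K\<close> that is itself an extension of
  \<open>KC\<close> by \<open>KA\<close>.\<close>

lemma horse_ex:
  assumes T: "etr A B C x y d" and TA: "etr KA WA A kA fA dA" and TC: "etr KC WC C kC fC dC"
    and 0: "d \<bullet> fC = zr True WC A"
  obtains S i s r p K k f dk e t dt
  where "horse A B C x y d KA WA kA fA dA KC WC kC fC dC S i s r p K k f dk e t dt"
proof -
  obtain M m e n' n where M: "etr A M WC m e (d \<bullet> fC)" "etr KC M B n' n (dC \<bullet> y)"
    "n \<bullet> m = x" "e \<bullet> n' = kC" "y \<bullet> n = fC \<bullet> e"
    by (rule pullback[OF T TC])
  obtain s r where b: "bip A WC M m s r e" by (rule etr_split[OF M(1)[unfolded 0]])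
  note B = bipD[OF b]
  have o: "ob A" "ob WC" using T TC by auto
  \<comment> \<open>Swapping the summands turns the retraction \<open>r\<close> into a deflation, so
    that it can be pulled back along \<open>fA\<close>.\<close>
  have Ts: "etr WC M A s r (zr True A WC)" using tri_split[OF bip_swap[OF b]] B o by simp
  obtain S j p kS t where S: "etr WC S WA j p (zr True A WC \<bullet> fA)" "etr KA S M kS t (dA \<bullet> r)"
    "t \<bullet> j = s" "p \<bullet> kS = kA" "r \<bullet> t = fA \<bullet> p"
    by (rule pullback[OF Ts TA])
  have 1: "zr True A WC \<bullet> fA = zr True WA WC" using TA o by simp
  obtain i0 q0 where b2: "bip WC WA S j i0 q0 p" by (rule etr_split[OF S(1)[unfolded 1]])
  note B2 = bipD[OF b2]
  obtain K h e' u d'' where K: "etr K S B h (n \<bullet> t) d''" "etr KA K KC e' u ((dA \<bullet> r) \<bullet> n')" "t \<bullet> h = n' \<bullet> u"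
    "h \<bullet> e' = kS"
    by (rule etr_ET4_op[OF M(2) S(2)])
  \<comment> \<open>The projection to \<open>WC\<close> that is compatible with \<open>y\<close> and
    \<open>fC\<close> is \<open>e \<bullet> t\<close>, whereas the splitting \<open>q0\<close> is
    arbitrary. Removing from \<open>i0\<close> its part along \<open>j\<close> gives an injection of
    \<open>WA\<close> killed by the new projection.\<close>
  define \<pi> where "\<pi> = e \<bullet> t"
  define \<iota> where "\<iota> = i0 \<boxplus> \<boxminus> (j \<bullet> \<pi> \<bullet> i0)"
  have ty: "hm S WC \<pi>" "hm WA S \<iota>" unfolding \<pi>_def \<iota>_def using B B2 S by simp_all
  have \<pi>j: "\<pi> \<bullet> j = idn WC" unfolding \<pi>_def using S(3) B by simp
  have \<pi>j': "\<pi> \<bullet> j \<bullet> z = z" if "val z" "tgt z = WC" for z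
    using re[OF \<pi>j, of z] that by simp
  have \<pi>\<iota>: "\<pi> \<bullet> \<iota> = zr False WA WC"
    unfolding \<iota>_def using B2 ty by (simp add: \<pi>j')
  have p\<iota>: "p \<bullet> \<iota> = idn WA"
    unfolding \<iota>_def using B2 ty re[OF B2(7), of "\<pi> \<bullet> i0"] by simp
  have sum: "\<iota> \<bullet> p \<boxplus> j \<bullet> \<pi> = idn S"
  proof -
    have i0p: "i0 \<bullet> p = idn S \<boxplus> \<boxminus> (j \<bullet> q0)" using B2 sub_eq[of "idn S" "i0 \<bullet> p" "j \<bullet> q0"] by (simp add: add_comm)
    have "\<iota> \<bullet> p = i0 \<bullet> p \<boxplus> \<boxminus> (j \<bullet> \<pi> \<bullet> (i0 \<bullet> p))" unfolding \<iota>_def by simp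
    also have "\<dots> = idn S \<boxplus> \<boxminus> (j \<bullet> \<pi>)"
      unfolding i0p using B2 ty by (simp add: \<pi>j' add_assoc)
    finally show ?thesis using B2 ty by simp
  qed
  have b3: "bip WA WC S \<iota> j p \<pi>" unfolding bip_def using ty B2 p\<iota> \<pi>j \<pi>\<iota> sum by simp
  have t\<iota>: "t \<bullet> \<iota> = m \<bullet> fA"
  proof -
    have "t \<bullet> \<iota> = (m \<bullet> r \<boxplus> s \<bullet> e) \<bullet> t \<bullet> \<iota>" unfolding B(9) using S(2) ty by simp
    also have "\<dots> = m \<bullet> (r \<bullet> t) \<bullet> \<iota> \<boxplus> s \<bullet> (\<pi> \<bullet> \<iota>)" unfolding \<pi>_def by simp
    also have "\<dots> = m \<bullet> fA" unfolding S(5) \<pi>\<iota> using p\<iota> B TA by simp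
    finally show ?thesis .
  qed
  have \<iota>k: "\<iota> \<bullet> kA = kS"
  proof -
    have "\<pi> \<bullet> kS = zr False KA WC" unfolding \<pi>_def using tri_zero(1)[OF S(2)] B TA by simp
    moreover have "kS = (\<iota> \<bullet> p \<boxplus> j \<bullet> \<pi>) \<bullet> kS" unfolding sum using S(2) by simp
    then have "kS = \<iota> \<bullet> p \<bullet> kS \<boxplus> j \<bullet> \<pi> \<bullet> kS" by simp
    ultimately show ?thesis using S(4) ty TA B2 by simp
  qed
  have "horse A B C x y d KA WA kA fA dA KC WC kC fC dC S \<iota> j p \<pi> K h (n \<bullet> t) d'' e' u ((dA \<bullet> r) \<bullet> n')"
    unfolding horse_def
  proof (intro conjI)
    show "(n \<bullet> t) \<bullet> \<iota> = x \<bullet> fA" using t\<iota> re[OF M(3), of fA] by simp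
    show "y \<bullet> n \<bullet> t = fC \<bullet> \<pi>" unfolding \<pi>_def using re[OF M(5), of t] by simp
    show "\<iota> \<bullet> kA = h \<bullet> e'" using \<iota>k K(4) by simp
    show "\<pi> \<bullet> h = kC \<bullet> u" unfolding \<pi>_def using K(3) re[OF M(4), of u] by simp
  qed (use T TA TC b3 K in blast)+
  then show thesis by (rule that)
qed

lemma horseD:
  assumes "horse A B C x y d KA WA kA fA dA KC WC kC fC dC S i s r p K k f dk e t dt"
  shows "etr A B C x y d" "etr KA WA A kA fA dA" "etr KC WC C kC fC dC" "bip WA WC S i s r p"
    "etr K S B k f dk" "etr KA K KC e t dt" "f \<bullet> i = x \<bullet> fA" "y \<bullet> f = fC \<bullet> p" "i \<bullet> kA = k \<bullet> e" "p \<bullet> k = kC \<bullet> t"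
  using assms unfolding horse_def by blast+

text \<open>A nine lemma for Hom(G, -) by chasing. The left end needs a chase of its own: a map into
  \<open>KA\<close> that dies in \<open>S\<close> already dies in \<open>WA\<close>, because
  \<open>i\<close> is a split monomorphism.\<close>

lemma horse_cov:
  assumes H: "horse A B C x y d KA WA kA fA dA KC WC kC fC dC S i s r p K k f dk e t dt"
    and c: "cov G A B C x y" "cov G KA WA A kA fA" "cov G KC WC C kC fC"
  shows "cov G KA K KC e t" "cov G K S B k f"
proof -
  note T = horseD(1-6)[OF H] and E = horseD(7-10)[OF H] and B = bipD[OF horseD(4)[OF H]]
  have inj0: "h = zr False G KA" if h: "hm G KA h" "k \<bullet> e \<bullet> h = zr False G S" for h
  proof -
    have "kA \<bullet> h = r \<bullet> i \<bullet> kA \<bullet> h" using re[OF B(5), of "kA \<bullet> h"] T(2) h by simp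
    also have "\<dots> = zr False G WA" using re[OF E(3), of h] h B by simp
    finally show ?thesis using cov_inj[OF c(2) h(1)] by simp
  qed
  have lift: "\<exists>v. hm G WA v \<and> x \<bullet> fA \<bullet> v = b" if b: "hm G B b" "y \<bullet> b = zr False G C" for b
  proof -
    obtain a where a: "hm G A a" "x \<bullet> a = b" by (rule tri_ker[OF T(1) b])
    obtain v where "hm G WA v" "fA \<bullet> v = a" by (rule cov_surj[OF c(2) a(1)])
    then show ?thesis using a by auto
  qed
  show "cov G KA K KC e t" unfolding cov_def
  proof (intro conjI allI impI)
    fix h assume "hm G KA h" "e \<bullet> h = zr False G K"
    then show "h = zr False G KA" using inj0[of h] T(5) by simp
  next
    fix g assume g: "hm G KC g"
    \<comment> \<open>\<open>s \<bullet> kC \<bullet> g\<close> is a first lift of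
      \<open>kC \<bullet> g\<close> to \<open>S\<close>. Its image in \<open>B\<close> is killed by
      \<open>y\<close> and hence comes from \<open>WA\<close>; subtracting that part gives a map
      that factors through \<open>K\<close>.\<close>
    have f: "y \<bullet> f \<bullet> s \<bullet> kC \<bullet> g = zr False G C"
      using re[OF E(2), of "s \<bullet> kC \<bullet> g"] re[OF B(6), of "kC \<bullet> g"] re[OF tri_zero(1)[OF T(3)], of g] T g B by simp
    obtain v where v: "hm G WA v" "x \<bullet> fA \<bullet> v = f \<bullet> s \<bullet> kC \<bullet> g"
      using lift[of "f \<bullet> s \<bullet> kC \<bullet> g"] f T g B by auto
    have "f \<bullet> (s \<bullet> kC \<bullet> g \<boxplus> \<boxminus> (i \<bullet> v)) = zr False G B"
      using re[OF E(1), of v] v T g B by simp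
    then obtain l where l: "hm G K l" "k \<bullet> l = s \<bullet> kC \<bullet> g \<boxplus> \<boxminus> (i \<bullet> v)"
      using tri_ker[OF T(5), of G "s \<bullet> kC \<bullet> g \<boxplus> \<boxminus> (i \<bullet> v)"] v T g B by auto
    have "kC \<bullet> t \<bullet> l = p \<bullet> k \<bullet> l" using re[OF E(4), of l] by simp
    also have "\<dots> = kC \<bullet> g" unfolding l(2)
      using re[OF B(6), of "kC \<bullet> g"] re[OF B(7), of v] T(3) g v(1) B(1-4) by simp
    finally have "kC \<bullet> (t \<bullet> l \<boxplus> \<boxminus> g) = zr False G WC" using T(3) T(6) g l(1) by simp
    then have "t \<bullet> l \<boxplus> \<boxminus> g = zr False G KC" using cov_inj[OF c(3), of "t \<bullet> l \<boxplus> \<boxminus> g"] T(6) g l(1) by simp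
    then have "t \<bullet> l = g" by (rule sub_zr) (use T(6) g l(1) in auto)
    then show "\<exists>l. hm G K l \<and> t \<bullet> l = g" using l(1) by blast
  qed
  show "cov G K S B k f" unfolding cov_def
  proof (intro conjI allI impI)
    fix h assume h: "hm G K h" "k \<bullet> h = zr False G S"
    have "kC \<bullet> t \<bullet> h = zr False G WC" using re[OF E(4), of h] h B by simp
    then have "t \<bullet> h = zr False G KC" using cov_inj[OF c(3), of "t \<bullet> h"] T(6) h(1) by simp
    then obtain h0 where h0: "hm G KA h0" "e \<bullet> h0 = h" using tri_ker[OF T(6) h(1)] by blast
    then have "h0 = zr False G KA" using inj0[OF h0(1)] h by simp
    then show "h = zr False G K" using h0(2) T(6) h0(1) by auto
  next
    fix b assume b: "hm G B b"
    have "hm G C (y \<bullet> b)" using T(1) b by simp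
    then obtain w where w: "hm G WC w" "fC \<bullet> w = y \<bullet> b" by (rule cov_surj[OF c(3)])
    have "y \<bullet> (b \<boxplus> \<boxminus> (f \<bullet> s \<bullet> w)) = zr False G C"
      using re[OF E(2), of "s \<bullet> w"] re[OF B(6), of w] T(1,3,5) w B(1-4) b by simp
    then obtain v where v: "hm G WA v" "x \<bullet> fA \<bullet> v = b \<boxplus> \<boxminus> (f \<bullet> s \<bullet> w)"
      using lift[of "b \<boxplus> \<boxminus> (f \<bullet> s \<bullet> w)"] T(5) B(1-4) w(1) b by auto
    have "f \<bullet> (i \<bullet> v \<boxplus> s \<bullet> w) = b" using re[OF E(1), of v] v(2) T(5) B(1-4) w(1) b by simp
    then show "\<exists>h. hm G S h \<and> f \<bullet> h = b" using v(1) w(1) B(1-4)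
      by (intro exI[of _ "i \<bullet> v \<boxplus> s \<bullet> w"]) simp
  qed
qed

text \<open>Exactness is assumed for the outer columns. The outer rows and the middle column
  contribute their weak cokernels (\<open>tri_coker\<close>), and the splitting of the middle row
  extends and cancels maps.\<close>

lemma horse_con:
  assumes H: "horse A B C x y d KA WA kA fA dA KC WC kC fC dC S i s r p K k f dk e t dt"
    and c: "con W KA WA A kA fA" "con W KC WC C kC fC"
  shows "con W KA K KC e t" "con W K S B k f"
proof -
  note T = horseD(1-6)[OF H] and E = horseD(7-10)[OF H] and B = bipD[OF horseD(4)[OF H]]
  have fac: "\<exists>v'. hm C W v' \<and> v' \<bullet> y = v" if v: "hm B W v" "v \<bullet> f \<bullet> i = zr False WA W" for v
  proof -
    have "(v \<bullet> x) \<bullet> fA = zr False WA W" using v E(1) by simp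
    then have "v \<bullet> x = zr False A W" using con_inj[OF c(1), of "v \<bullet> x"] v(1) T(1) by simp
    then show ?thesis using tri_coker[OF T(1) v(1)] by blast
  qed
  have can: "q = z" if "hm WC D q" "hm WC D z" "q \<bullet> p = z \<bullet> p" for q z D
  proof -
    have "q \<bullet> p \<bullet> s = z \<bullet> p \<bullet> s" using re[OF that(3), of s] by simp
    then show ?thesis using that(1,2) B(6) by simp
  qed
  show "con W KA K KC e t" unfolding con_def
  proof (intro conjI allI impI)
    fix q assume q: "hm KC W q" "q \<bullet> t = zr False K W"
    obtain q' where q': "hm WC W q'" "q' \<bullet> kC = q" by (rule con_surj[OF c(2) q(1)])
    have "(q' \<bullet> p) \<bullet> k = zr False K W" using re[OF q'(2), of t] q E(4) by simp
    then obtain v where v: "hm B W v" "v \<bullet> f = q' \<bullet> p"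
      using tri_coker[OF T(5), of W "q' \<bullet> p"] q'(1) B(1-4) by auto
    have "v \<bullet> f \<bullet> i = zr False WA W" using re[OF v(2), of i] B q'(1) by simp
    then obtain v' where v': "hm C W v'" "v' \<bullet> y = v" using fac v(1) by blast
    have "q' \<bullet> p = (v' \<bullet> fC) \<bullet> p" using v(2) re[OF v'(2), of f] E(2) by simp
    then have "q' = v' \<bullet> fC" by (intro can[of W q' "v' \<bullet> fC"]) (use q'(1) v'(1) T(3) in auto)
    then have "q = v' \<bullet> fC \<bullet> kC" using q'(2) by simp
    then show "q = zr False KC W" using tri_zero(1)[OF T(3)] v'(1) T(3) by simp
  next
    fix h assume h: "hm KA W h"
    obtain r0 where r0: "hm WA W r0" "r0 \<bullet> kA = h" by (rule con_surj[OF c(1) h])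
    have "(r0 \<bullet> r \<bullet> k) \<bullet> e = h" using E(3) re[OF B(5), of kA] T(2) r0 by simp
    then show "\<exists>h'. hm K W h' \<and> h' \<bullet> e = h" using r0(1) B(1-4) T(5) by (intro exI[of _ "r0 \<bullet> r \<bullet> k"]) simp
  qed
  show "con W K S B k f" unfolding con_def
  proof (intro conjI allI impI)
    fix q assume q: "hm B W q" "q \<bullet> f = zr False S W"
    have "q \<bullet> f \<bullet> i = zr False WA W" using re[OF q(2), of i] q(1) B(1-4) by simp
    then obtain q' where q': "hm C W q'" "q' \<bullet> y = q" using fac q(1) by blast
    have "(q' \<bullet> fC) \<bullet> p = zr False WC W \<bullet> p" using re[OF q'(2), of f] E(2) q B(1-4) by simp
    then have "q' \<bullet> fC = zr False WC W"
      by (intro can[of W "q' \<bullet> fC"]) (use q'(1) T(3) in auto)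
    then have "q' = zr False C W" using con_inj[OF c(2) q'(1)] by simp
    then show "q = zr False B W" using q' T(1) by auto
  next
    fix u assume u: "hm K W u"
    have "hm KA W (u \<bullet> e)" using u T(6) by simp
    then obtain r0 where r0: "hm WA W r0" "r0 \<bullet> kA = u \<bullet> e" by (rule con_surj[OF c(1)])
    have "r0 \<bullet> r \<bullet> k \<bullet> e = u \<bullet> e" using E(3) re[OF B(5), of kA] T(2) r0 by simp
    then have "(u \<boxplus> \<boxminus> (r0 \<bullet> r \<bullet> k)) \<bullet> e = zr False KA W" using u T(6) by simp
    then obtain v where v: "hm KC W v" "v \<bullet> t = u \<boxplus> \<boxminus> (r0 \<bullet> r \<bullet> k)"
      using tri_coker[OF T(6), of W "u \<boxplus> \<boxminus> (r0 \<bullet> r \<bullet> k)"] u r0(1) B(1-4) T(5) by auto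
    obtain v0 where v0: "hm WC W v0" "v0 \<bullet> kC = v" by (rule con_surj[OF c(2) v(1)])
    have "v0 \<bullet> p \<bullet> k = u \<boxplus> \<boxminus> (r0 \<bullet> r \<bullet> k)" using E(4) re[OF v0(2), of t] v(2) by simp
    then have "(v0 \<bullet> p \<boxplus> r0 \<bullet> r) \<bullet> k = u" using u r0(1) B(1-4) T(5) by simp
    then show "\<exists>h. hm S W h \<and> h \<bullet> k = u" using r0(1) v0(1) B(1-4)
      by (intro exI[of _ "v0 \<bullet> p \<boxplus> r0 \<bullet> r"]) simp
  qed
qed

end

section \<open>Gorenstein projectives\<close>

locale proper_extri = extri +
  fixes xi :: "'b \<Rightarrow> 'b \<Rightarrow> 'b \<Rightarrow> bool"
  assumes xi_tri: "xi x y d \<Longrightarrow> tri x y d"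
    and xi_split: "tri x y (zr True C A) \<Longrightarrow> ob C \<Longrightarrow> ob A \<Longrightarrow> xi x y (zr True C A)"
    and xi_base: "xi x y d \<Longrightarrow> tri x' y' (d \<bullet> c) \<Longrightarrow> xi x' y' (d \<bullet> c)"
    and xi_cobase: "xi x y d \<Longrightarrow> tri x' y' (a \<bullet> d) \<Longrightarrow> xi x' y' (a \<bullet> d)"
    and xi_sat: "tri x1 y1 d1 \<Longrightarrow> xi x2 y2 d2 \<Longrightarrow> xi m e (d1 \<bullet> y2) \<Longrightarrow> xi x1 y1 d1"
begin

section \<open>Relative projectives and classes of exact triangles\<close>

abbreviation exi :: "'a \<Rightarrow> 'a \<Rightarrow> 'a \<Rightarrow> 'b \<Rightarrow> 'b \<Rightarrow> 'b \<Rightarrow> bool" where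
  "exi A B C x y d \<equiv> etr A B C x y d \<and> xi x y d"

definition prj :: "'a \<Rightarrow> bool" where
  "prj P \<longleftrightarrow> ob P \<and> (\<forall>A B C x y d. exi A B C x y d \<longrightarrow> cov P A B C x y)"

text \<open>The class of test objects is a parameter: \<open>prj\<close> gives back all of
  \<open>xi\<close> (\<open>th_prj\<close>), and \<open>gp\<close> gives the triangles used in
  Gorenstein projective resolutions.\<close>

definition th :: "('a \<Rightarrow> bool) \<Rightarrow> 'a \<Rightarrow> 'a \<Rightarrow> 'a \<Rightarrow> 'b \<Rightarrow> 'b \<Rightarrow> 'b \<Rightarrow> bool" where
  "th \<W> A B C x y d \<longleftrightarrow> exi A B C x y d \<and> (\<forall>W. \<W> W \<longrightarrow> cov W A B C x y)"

definition cxi :: "'a \<Rightarrow> 'a \<Rightarrow> 'a \<Rightarrow> 'b \<Rightarrow> 'b \<Rightarrow> 'b \<Rightarrow> bool" where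
  "cxi A B C x y d \<longleftrightarrow> exi A B C x y d \<and> (\<forall>W. prj W \<longrightarrow> con W A B C x y)"

lemma prj_ob: "prj P \<Longrightarrow> ob P"
  unfolding prj_def by blast

lemma prj_cov: "prj P \<Longrightarrow> exi A B C x y d \<Longrightarrow> cov P A B C x y"
  unfolding prj_def by blast

lemma th_prj: "th prj A B C x y d \<longleftrightarrow> exi A B C x y d"
  unfolding th_def using prj_cov by blast

lemma thD: "th \<W> A B C x y d \<Longrightarrow> exi A B C x y d" "th \<W> A B C x y d \<Longrightarrow> \<W> W \<Longrightarrow> cov W A B C x y"
  unfolding th_def by blast+

lemma cxiD: "cxi A B C x y d \<Longrightarrow> exi A B C x y d" "cxi A B C x y d \<Longrightarrow> prj W \<Longrightarrow> con W A B C x y"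
  unfolding cxi_def by blast+

lemma cov_bip:
  assumes b: "bip G H S i j p q" and T: "etr A B C x y d" and c: "cov G A B C x y" "cov H A B C x y"
  shows "cov S A B C x y"
  unfolding cov_def
proof (intro conjI allI impI)
  note B = bipD[OF b]
  fix h assume h: "hm S A h" "x \<bullet> h = zr False S B"
  have "h \<bullet> i = zr False G A" "h \<bullet> j = zr False H A"
    by (rule cov_inj[OF c(1)] cov_inj[OF c(2)], use h B T re[OF h(2), of i] re[OF h(2), of j] in simp_all)+
  then have *: "h \<bullet> i \<bullet> p = zr False S A" "h \<bullet> j \<bullet> q = zr False S A"
    using re[of h i "zr False G A" p] re[of h j "zr False H A" q] B h T by simp_all
  have "h = h \<bullet> (i \<bullet> p \<boxplus> j \<bullet> q)" unfolding B(9) using h by simp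
  also have "\<dots> = zr False S A" using * h(1) by simp
  finally show "h = zr False S A" .
next
  note B = bipD[OF b]
  fix h assume h: "hm S C h"
  have "hm G C (h \<bullet> i)" "hm H C (h \<bullet> j)" using h B by simp_all
  then obtain u v where u: "hm G B u" "y \<bullet> u = h \<bullet> i" and v: "hm H B v" "y \<bullet> v = h \<bullet> j"
    using cov_surj[OF c(1)] cov_surj[OF c(2)] by metis
  have "y \<bullet> (u \<bullet> p \<boxplus> v \<bullet> q) = h \<bullet> (i \<bullet> p \<boxplus> j \<bullet> q)" using re[OF u(2), of p] re[OF v(2), of q] by simp
  also have "\<dots> = h" unfolding B(9) using h by simp
  finally show "\<exists>h'. hm S B h' \<and> y \<bullet> h' = h" using u(1) v(1) B(1-4)
    by (intro exI[of _ "u \<bullet> p \<boxplus> v \<bullet> q"]) simp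
qed

lemma prj_bip: "bip G H S i j p q \<Longrightarrow> prj G \<Longrightarrow> prj H \<Longrightarrow> prj S"
proof -
  assume b: "bip G H S i j p q" and p: "prj G" "prj H"
  have "cov S A B C x y" if T: "exi A B C x y d" for A B C x y d
    by (rule cov_bip[OF b conjunct1[OF T] prj_cov[OF p(1) T] prj_cov[OF p(2) T]])
  then show ?thesis unfolding prj_def using bipD(1)[OF b] by blast
qed

lemma prj_zob: "zob Z \<Longrightarrow> prj Z"
proof -
  assume Z: "zob Z"
  have "cov Z A B C x y" if "etr A B C x y d" for A B C x y d
    unfolding cov_def
  proof (intro conjI allI impI)
    fix h assume "hm Z A h" then show "h = zr False Z A" by (rule zobD(2)[OF Z])
  next
    fix h assume "hm Z C h" then have "h = zr False Z C" by (rule zobD(2)[OF Z])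
    then show "\<exists>h'. hm Z B h' \<and> y \<bullet> h' = h" using that zobD(1)[OF Z]
      by (intro exI[of _ "zr False Z B"]) simp
  qed
  then show ?thesis unfolding prj_def using zobD(1)[OF Z] by blast
qed

text \<open>\<open>pdf\<close> and \<open>gpf\<close> mean finite projective and finite Gorenstein projective dimension. A complete
  resolution is unfolded at \<open>A\<close> one step in each direction, so \<open>gp\<close> is coinductive.\<close>

inductive pdf :: "'a \<Rightarrow> bool" where
  pdf_prj: "prj P \<Longrightarrow> pdf P"
| pdf_step: "exi K P A x y d \<Longrightarrow> prj P \<Longrightarrow> pdf K \<Longrightarrow> pdf A"

coinductive gp :: "'a \<Rightarrow> bool" where
  "cxi A1 P A g f \<delta> \<Longrightarrow> prj P \<Longrightarrow> gp A1 \<Longrightarrow> cxi A Q A' u v \<epsilon> \<Longrightarrow> prj Q \<Longrightarrow> gp A' \<Longrightarrow> gp A"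

inductive gpf :: "'a \<Rightarrow> bool" where
  gpf_gp: "gp A \<Longrightarrow> gpf A"
| gpf_step: "exi K G A x y d \<Longrightarrow> gp G \<Longrightarrow> gpf K \<Longrightarrow> gpf A"

section \<open>Vanishing of extensions of Gorenstein projectives\<close>

lemma gp_down:
  assumes "gp A"
  obtains A1 P g f \<delta> where "cxi A1 P A g f \<delta>" "prj P" "gp A1"
  using assms by (cases rule: gp.cases) blast

lemma gp_up:
  assumes "gp A"
  obtains A' P u v \<epsilon> where "cxi A P A' u v \<epsilon>" "prj P" "gp A'"
  using assms by (cases rule: gp.cases) blast

lemma gp_ob: "gp A \<Longrightarrow> ob A"
  by (erule gp_down) (use cxiD(1) in blast)

text \<open>The map \<open>s\<close> extends along \<open>g\<close>, and
  \<open>g \<bullet> \<delta>\<close> vanishes.\<close>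

lemma ex_ext_zero:
  assumes T: "etr A1 P A g f \<delta>" and c: "con L A1 P A g f" and s: "hm A1 L s"
  shows "s \<bullet> \<delta> = zr True A L"
proof -
  obtain s' where s': "hm P L s'" "s' \<bullet> g = s" by (rule con_surj[OF c s])
  then have "s \<bullet> \<delta> = s' \<bullet> g \<bullet> \<delta>" by auto
  then show ?thesis using tri_zero(3)[OF T] s'(1) T by simp
qed

text \<open>Dimension shifting along a complete resolution. For \<open>K\<close> to \<open>Q\<close>
  to \<open>L\<close> with \<open>Q\<close> projective, a map to \<open>L\<close> lifts to
  \<open>Q\<close> once its product with \<open>\<theta>\<close> vanishes; that product is a pushout
  of \<open>\<delta>\<close> or of \<open>\<delta>1\<close> to \<open>K\<close>, which vanishes by
  induction. The induction hypothesis is applied at \<open>A\<close> and one syzygy further down, so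
  the triangle is kept arbitrary.\<close>

lemma pdf_con:
  assumes "pdf L"
  shows "exi A1 P A g f \<delta> \<Longrightarrow> (\<And>W. prj W \<Longrightarrow> con W A1 P A g f) \<Longrightarrow> prj P \<Longrightarrow> gp A1 \<Longrightarrow> con L A1 P A g f"
  using assms
proof (induction arbitrary: A1 P A g f \<delta> rule: pdf.induct)
  case (pdf_prj Q)
  then show ?case by blast
next
  case (pdf_step K Q L a b \<theta> A1 P A g f \<delta>)
  note T = conjunct1[OF pdf_step.prems(1)] and \<theta> = conjunct1[OF pdf_step.hyps(1)]
  have covQ: "cov R K Q L a b" if "prj R" for R using prj_cov[OF that pdf_step.hyps(1)] .
  obtain A2 P1 g1 f1 \<delta>1 where D: "cxi A2 P1 A1 g1 f1 \<delta>1" "prj P1" "gp A2"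
    by (rule gp_down[OF pdf_step.prems(4)])
  note T1 = conjunct1[OF cxiD(1)[OF D(1)]]
  have K: "con K A1 P A g f" "con K A2 P1 A1 g1 f1"
    using pdf_step.IH[OF pdf_step.prems] pdf_step.IH[OF cxiD(1)[OF D(1)] cxiD(2)[OF D(1)] D(2,3)] by blast+
  note conQ = pdf_step.prems(2)[OF pdf_step.hyps(2)]
  show ?case unfolding con_def
  proof (intro conjI allI impI)
    fix k assume k: "hm A L k" "k \<bullet> f = zr False P L"
    have "xt A K (\<theta> \<bullet> k)" "(\<theta> \<bullet> k) \<bullet> f = zr True P K" using k \<theta> T by simp_all
    then obtain s where s: "hm A1 K s" "s \<bullet> \<delta> = \<theta> \<bullet> k" by (rule tri_xcoker[OF T])
    then have "\<theta> \<bullet> k = zr True A K" using ex_ext_zero[OF T K(1) s(1)] by simp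
    then obtain k' where k': "hm A Q k'" "b \<bullet> k' = k" by (rule tri_lift[OF \<theta> k(1)])
    \<comment> \<open>It remains to factor \<open>k'\<close> through \<open>a\<close>, because
      \<open>b \<bullet> a\<close> vanishes.\<close>
    have "hm P Q (k' \<bullet> f)" "b \<bullet> k' \<bullet> f = zr False P L" using k' T re[OF k'(2), of f] k(2) by simp_all
    then obtain t where t: "hm P K t" "a \<bullet> t = k' \<bullet> f" by (rule tri_ker[OF \<theta>])
    \<comment> \<open>Injectivity of \<open>a\<close> is available on projective sources only, so
      \<open>t \<bullet> g\<close> is tested on the projective \<open>P1\<close> that covers
      \<open>A1\<close>.\<close>
    have "a \<bullet> t \<bullet> g \<bullet> f1 = zr False P1 Q"
      using re[OF t(2), of "g \<bullet> f1"] re[OF tri_zero(1)[OF T], of f1] T T1 k'(1) by simp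
    then have "(t \<bullet> g) \<bullet> f1 = zr False P1 K"
      using cov_inj[OF covQ[OF D(2)], of "t \<bullet> g \<bullet> f1"] t(1) T T1 by simp
    then have "t \<bullet> g = zr False A1 K" using con_inj[OF K(2), of "t \<bullet> g"] t(1) T by simp
    then obtain t' where t': "hm A K t'" "t' \<bullet> f = t" by (rule tri_coker[OF T t(1)])
    have "(k' \<boxplus> \<boxminus> (a \<bullet> t')) \<bullet> f = zr False P Q" using t(2) t' k'(1) T \<theta> by simp
    then have "k' \<boxplus> \<boxminus> (a \<bullet> t') = zr False A Q"
      using con_inj[OF conQ, of "k' \<boxplus> \<boxminus> (a \<bullet> t')"] k'(1) \<theta> t'(1) by simp
    then have "k' = a \<bullet> t'" by (rule sub_zr) (use k'(1) \<theta> t'(1) in auto)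
    then have "k = b \<bullet> a \<bullet> t'" using k'(2) by simp
    then show "k = zr False A L" using re[OF tri_zero(1)[OF \<theta>], of t'] t'(1) \<theta> by simp
  next
    fix s assume s: "hm A1 L s"
    have "hm P1 L (s \<bullet> f1)" using s T1 by simp
    then obtain w where w: "hm P1 Q w" "b \<bullet> w = s \<bullet> f1" by (rule cov_surj[OF covQ[OF D(2)]])
    have "\<theta> \<bullet> s \<bullet> f1 = \<theta> \<bullet> b \<bullet> w" using w(2) by simp
    also have "\<dots> = zr True P1 K" using re[OF tri_zero(2)[OF \<theta>], of w] w(1) \<theta> by simp
    finally have "(\<theta> \<bullet> s) \<bullet> f1 = zr True P1 K" by simp
    moreover have "xt A1 K (\<theta> \<bullet> s)" using s \<theta> by simp
    ultimately obtain r where r: "hm A2 K r" "r \<bullet> \<delta>1 = \<theta> \<bullet> s" using tri_xcoker[OF T1] by metis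
    then have "\<theta> \<bullet> s = zr True A1 K" using ex_ext_zero[OF T1 K(2) r(1)] by simp
    then obtain s' where s': "hm A1 Q s'" "b \<bullet> s' = s" by (rule tri_lift[OF \<theta> s])
    obtain s'' where s'': "hm P Q s''" "s'' \<bullet> g = s'" by (rule con_surj[OF conQ s'(1)])
    show "\<exists>h'. hm P L h' \<and> h' \<bullet> g = s" using s'' s' \<theta> by (intro exI[of _ "b \<bullet> s''"]) simp
  qed
qed

text \<open>Along a projective cover \<open>f\<close> of \<open>G\<close> everything lifts. The
  obstruction \<open>\<theta> \<bullet> h\<close> to lifting \<open>h\<close> itself is killed by
  \<open>f\<close>, hence is a pushout of \<open>\<delta>\<close> to \<open>K\<close>, and those
  vanish by \<open>pdf_con\<close>.\<close>

lemma gp_cov: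
  assumes G: "gp G" and T: "exi K B L a b \<theta>" and K: "pdf K"
  shows "cov G K B L a b"
proof -
  obtain G1 P g f \<delta> where D: "cxi G1 P G g f \<delta>" "prj P" "gp G1" by (rule gp_down[OF G])
  note T1 = conjunct1[OF cxiD(1)[OF D(1)]] and T0 = conjunct1[OF T]
  have c: "con K G1 P G g f" by (rule pdf_con[OF K cxiD(1)[OF D(1)] cxiD(2)[OF D(1)] D(2,3)])
  note cP = prj_cov[OF D(2) T]
  show ?thesis unfolding cov_def
  proof (intro conjI allI impI)
    fix h assume h: "hm G K h" "a \<bullet> h = zr False G B"
    have "h \<bullet> f = zr False P K"
      using cov_inj[OF cP, of "h \<bullet> f"] re[OF h(2), of f] h(1) T1 T0 by simp
    then show "h = zr False G K" using con_inj[OF c h(1)] by simp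
  next
    fix h assume h: "hm G L h"
    have "hm P L (h \<bullet> f)" using h T1 by simp
    then obtain w where w: "hm P B w" "b \<bullet> w = h \<bullet> f" by (rule cov_surj[OF cP])
    have "\<theta> \<bullet> h \<bullet> f = \<theta> \<bullet> b \<bullet> w" using w(2) by simp
    also have "\<dots> = zr True P K" using re[OF tri_zero(2)[OF T0], of w] w(1) T0 by simp
    finally have "(\<theta> \<bullet> h) \<bullet> f = zr True P K" by simp
    moreover have "xt G K (\<theta> \<bullet> h)" using h T0 by simp
    ultimately obtain r where r: "hm G1 K r" "r \<bullet> \<delta> = \<theta> \<bullet> h" using tri_xcoker[OF T1] by metis
    then have "\<theta> \<bullet> h = zr True G K" using ex_ext_zero[OF T1 c r(1)] by simp
    then obtain s' where "hm G B s'" "b \<bullet> s' = h" by (rule tri_lift[OF T0 h])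
    then show "\<exists>h'. hm G B h' \<and> b \<bullet> h' = h" by blast
  qed
qed

text \<open>Passes from the triangles of a complete resolution to every triangle of
  \<open>xi\<close> that ends in \<open>G\<close>: the cover \<open>f\<close> lifts to
  \<open>B\<close>, so each pushout of \<open>\<sigma>\<close> to \<open>W\<close> is killed by
  \<open>f\<close>, hence is a pushout of \<open>\<delta>\<close> and vanishes.\<close>

lemma gp_con_prj:
  assumes G: "gp G" and T: "exi A B G x y \<sigma>" and W: "prj W"
  shows "con W A B G x y"
proof -
  obtain G1 P g f \<delta> where D: "cxi G1 P G g f \<delta>" "prj P" "gp G1" by (rule gp_down[OF G])
  note T1 = conjunct1[OF cxiD(1)[OF D(1)]] and T0 = conjunct1[OF T] and c = cxiD(2)[OF D(1) W]
  obtain h where h: "hm P B h" "y \<bullet> h = f" by (rule cov_surj[OF prj_cov[OF D(2) T], of f]) (use T1 in auto)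
  show ?thesis unfolding con_def
  proof (intro conjI allI impI)
    fix k assume k: "hm G W k" "k \<bullet> y = zr False B W"
    have "k \<bullet> f = zr False P W" using re[OF k(2), of h] h k(1) by simp
    then show "k = zr False G W" by (rule con_inj[OF c k(1)])
  next
    fix s assume s: "hm A W s"
    have "s \<bullet> \<sigma> \<bullet> f = s \<bullet> (\<sigma> \<bullet> y) \<bullet> h" using h(2) by simp
    also have "\<dots> = zr True P W" unfolding tri_zero(2)[OF T0] using s h(1) T0 by simp
    finally have "(s \<bullet> \<sigma>) \<bullet> f = zr True P W" by simp
    moreover have "xt G W (s \<bullet> \<sigma>)" using s T0 by simp
    ultimately obtain r where r: "hm G1 W r" "r \<bullet> \<delta> = s \<bullet> \<sigma>" using tri_xcoker[OF T1] by metis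
    then have "s \<bullet> \<sigma> = zr True G W" using ex_ext_zero[OF T1 c r(1)] by simp
    then obtain u where "hm B W u" "u \<bullet> x = s" by (rule tri_ext[OF T0 s])
    then show "\<exists>h'. hm B W h' \<and> h' \<bullet> x = s" by blast
  qed
qed

text \<open>The complete resolution is built from the identity of \<open>P\<close>. Its neighbouring
  syzygies are \<open>P\<close> and a zero object, both projective, so the coinduction over all
  projectives closes up.\<close>

lemma prj_gp:
  assumes "prj P" shows "gp P"
  using assms
proof (coinduction arbitrary: P rule: gp.coinduct)
  case (gp P)
  obtain Z where Z: "zob Z" using zob_ex by blast
  note S = split_id[OF Z prj_ob[OF gp]] and o = prj_ob[OF gp] zobD(1)[OF Z]
  have 1: "cxi Z P P (zr False Z P) (idn P) (zr True P Z)"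
    unfolding cxi_def
  proof (intro conjI allI impI)
    show "con W Z P P (zr False Z P) (idn P)" if "prj W" for W
      unfolding con_def using zobD(2)[OF Z, of W] o prj_ob[OF that]
      by (auto intro!: exI[of _ "zr False P W"])
  qed (use S(1) xi_split o in blast)+
  have 2: "cxi P P Z (idn P) (zr False P Z) (zr True Z P)"
    unfolding cxi_def
  proof (intro conjI allI impI)
    show "con W P P Z (idn P) (zr False P Z)" if "prj W" for W
      unfolding con_def using zobD(2)[OF Z, of W] o prj_ob[OF that] by auto
  qed (use S(2) xi_split o in blast)+
  show ?case using 1 2 gp prj_zob[OF Z] by blast
qed

end

section \<open>The membership criterion, closure under extensions, approximations\<close>

locale proper_extri_proj = proper_extri +
  assumes enough: "ob A \<Longrightarrow> \<exists>K P x y d. exi K P A x y d \<and> prj P"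
begin

text \<open>A projective cover \<open>v\<close> of \<open>C\<close> lifts to \<open>B\<close>, so
  the base change \<open>d \<bullet> v\<close> vanishes. Its realization is split and thus in
  \<open>xi\<close>, and saturation along the cover puts the original triangle in
  \<open>xi\<close>.\<close>

lemma xi_char:
  assumes T: "etr A B C x y d" and l: "\<And>P h. prj P \<Longrightarrow> hm P C h \<Longrightarrow> \<exists>h'. hm P B h' \<and> y \<bullet> h' = h"
  shows "xi x y d"
proof -
  have "ob C" using T by simp
  from enough[OF this] obtain K P u v \<theta> where P: "exi K P C u v \<theta>" "prj P" by blast
  have v: "hm P C v" using P(1) by simp
  from l[OF P(2) v] obtain h where h: "hm P B h" "y \<bullet> h = v" by blast
  have "d \<bullet> v = d \<bullet> y \<bullet> h" using h by simp
  also have "\<dots> = zr True P A" using re[OF tri_zero(2)[OF T], of h] h(1) T by simp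
  finally have 0: "d \<bullet> v = zr True P A" .
  have o: "ob P" "ob A" using P T by simp_all
  then obtain M m e where "etr A M P m e (zr True P A)" using etr_ex[of P A "zr True P A"] by auto
  then have "xi m e (zr True P A)" using xi_split o by blast
  then show ?thesis using xi_sat[of x y d u v \<theta> m e] T P(1) 0 by simp
qed

lemma xi_char_cov:
  assumes T: "etr A B C x y d" and c: "\<And>P. prj P \<Longrightarrow> cov P A B C x y"
  shows "xi x y d"
proof (rule xi_char[OF T])
  fix P h assume "prj P" "hm P C h"
  then obtain h' where "hm P B h'" "y \<bullet> h' = h" using cov_surj[OF c] by metis
  then show "\<exists>h'. hm P B h' \<and> y \<bullet> h' = h" by blast
qed

lemma cov_ext_zero:
  assumes T: "etr A B C x y d" and c: "cov W A B C x y" and f: "hm W C f"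
  shows "d \<bullet> f = zr True W A"
proof -
  obtain h where h: "hm W B h" "y \<bullet> h = f" by (rule cov_surj[OF c f])
  then have "d \<bullet> f = d \<bullet> y \<bullet> h" by simp
  then show ?thesis using re[OF tri_zero(2)[OF T], of h] h(1) T by simp
qed

text \<open>Exactness of the bottom row on \<open>WC\<close> makes the extension pulled back along
  \<open>fC\<close> split; projectives then detect that the two new triangles lie in
  \<open>xi\<close>.\<close>

lemma horse_th:
  assumes T: "exi A B C x y d" and TA: "exi KA WA A kA fA dA" and TC: "exi KC WC C kC fC dC"
    and c: "cov WC A B C x y"
  obtains S i s r p K k f dk e t dt
  where "horse A B C x y d KA WA kA fA dA KC WC kC fC dC S i s r p K k f dk e t dt"
    "exi K S B k f dk" "exi KA K KC e t dt"
proof -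
  have "hm WC C fC" using TC by simp
  then have "d \<bullet> fC = zr True WC A" using cov_ext_zero[OF conjunct1[OF T] c] by blast
  then obtain S i s r p K k f dk e t dt where H:
    "horse A B C x y d KA WA kA fA dA KC WC kC fC dC S i s r p K k f dk e t dt"
    using horse_ex[OF conjunct1[OF T] conjunct1[OF TA] conjunct1[OF TC]] by blast
  have "cov P KA K KC e t \<and> cov P K S B k f" if "prj P" for P
    using horse_cov[OF H] prj_cov[OF that T] prj_cov[OF that TA] prj_cov[OF that TC] by blast
  then have "exi K S B k f dk" "exi KA K KC e t dt"
    using horseD(5,6)[OF H] xi_char_cov[OF horseD(5)[OF H]] xi_char_cov[OF horseD(6)[OF H]] by blast+
  then show thesis using that H by blast
qed

text \<open>The coinduction runs over all extensions of two Gorenstein projectives. The horseshoe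
  gives a syzygy \<open>K\<close> and the dual horseshoe a cosyzygy \<open>L\<close>, each again an
  extension of Gorenstein projectives.\<close>

lemma gp_ext:
  assumes "exi G X G'' x y \<sigma>" "gp G" "gp G''"
  shows "gp X"
  using assms
proof (coinduction arbitrary: G X G'' x y \<sigma> rule: gp.coinduct)
  case (gp G X G'' x y \<sigma>)
  note T = gp(1)
  obtain G1 Q g f \<delta> where D: "cxi G1 Q G g f \<delta>" "prj Q" "gp G1" by (rule gp_down[OF gp(2)])
  obtain G1' Q' g' f' \<delta>' where D': "cxi G1' Q' G'' g' f' \<delta>'" "prj Q'" "gp G1'" by (rule gp_down[OF gp(3)])
  obtain S i s r p K k ff dk e t dt
    where H: "horse G X G'' x y \<sigma> G1 Q g f \<delta> G1' Q' g' f' \<delta>' S i s r p K k ff dk e t dt"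
    "exi K S X k ff dk" "exi G1 K G1' e t dt"
    by (rule horse_th[OF T cxiD(1)[OF D(1)] cxiD(1)[OF D'(1)] prj_cov[OF D'(2) T]])
  have 1: "cxi K S X k ff dk" unfolding cxi_def
    using H(2) horse_con(2)[OF H(1) cxiD(2)[OF D(1)] cxiD(2)[OF D'(1)]] by blast
  have S: "prj S" by (rule prj_bip[OF horseD(4)[OF H(1)] D(2) D'(2)])
  obtain H0 R u v \<epsilon> where U: "cxi G R H0 u v \<epsilon>" "prj R" "gp H0" by (rule gp_up[OF gp(2)])
  obtain H1 R' u' v' \<epsilon>' where U': "cxi G'' R' H1 u' v' \<epsilon>'" "prj R'" "gp H1" by (rule gp_up[OF gp(3)])
  interpret op: extri ob val isx tgt src "\<lambda>f g. g \<bullet> f" add neg idn "\<lambda>e A B. zr e B A" "\<lambda>x y d. tri y x d"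
    by (rule dual)
  note T0 = conjunct1[OF T] and TU = conjunct1[OF cxiD(1)[OF U(1)]] and TU' = conjunct1[OF cxiD(1)[OF U'(1)]]
  have *: "op.etr G'' X G y x \<sigma>" "op.etr H1 R' G'' v' u' \<epsilon>'" "op.etr H0 R G v u \<epsilon>" using T0 TU TU' by auto
  \<comment> \<open>The dual horseshoe requires \<open>u \<bullet> \<sigma> = 0\<close>. This holds
    because \<open>u\<close> extends along \<open>x\<close>, its target \<open>R\<close> being
    projective and \<open>G''\<close> Gorenstein projective.\<close>
  have u: "hm G R u" using TU by blast
  then obtain w where w: "hm X R w" "w \<bullet> x = u" by (rule con_surj[OF gp_con_prj[OF gp(3) T U(2)]])
  then have "u \<bullet> \<sigma> = w \<bullet> x \<bullet> \<sigma>" by auto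
  then have 0: "u \<bullet> \<sigma> = zr True G'' R" using tri_zero(3)[OF T0] T0 w(1) by simp
  obtain S2 i2 s2 r2 p2 L k2 f2 dk2 e2 t2 dt2
    where H2: "op.horse G'' X G y x \<sigma> H1 R' v' u' \<epsilon>' H0 R v u \<epsilon> S2 i2 s2 r2 p2 L k2 f2 dk2 e2 t2 dt2"
    by (rule op.horse_ex[OF * 0])
  note HD = op.horseD[OF H2]
  have E: "etr X S2 L f2 k2 dk2" "etr H0 L H1 t2 e2 dt2" using HD(5,6) by auto
  have "bip R' R S2 r2 p2 i2 s2" using HD(4) unfolding op.bip_def bip_def by auto
  then have S2: "prj S2" using prj_bip U'(2) U(2) by blast
  \<comment> \<open>Read in the original category, the dual of \<open>horse_con\<close> gives
    covariant exactness on projectives, hence membership in \<open>xi\<close>; the dual of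
    \<open>horse_cov\<close> gives the contravariant exactness below.\<close>
  have "cov P X S2 L f2 k2 \<and> cov P H0 L H1 t2 e2" if P: "prj P" for P
    using op.horse_con[OF H2, of P] unfolding cov_con_dual
    using prj_cov[OF P cxiD(1)[OF U(1)]] prj_cov[OF P cxiD(1)[OF U'(1)]] by blast
  then have E': "exi X S2 L f2 k2 dk2" "exi H0 L H1 t2 e2 dt2"
    using E xi_char_cov[OF E(1)] xi_char_cov[OF E(2)] by blast+
  have "con W X S2 L f2 k2" if W: "prj W" for W
    using op.horse_cov(2)[OF H2, of W] unfolding cov_con_dual
    using gp_con_prj[OF gp(3) T W] cxiD(2)[OF U(1) W] cxiD(2)[OF U'(1) W] by blast
  then have 2: "cxi X S2 L f2 k2 dk2" unfolding cxi_def using E'(1) by blast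
  show ?case using 1 S 2 S2 H(3) D(3) D'(3) E'(2) U(3) U'(3) by blast
qed

text \<open>The Auslander-Buchweitz construction. By induction \<open>K\<close> has an approximation
  \<open>L\<close> to \<open>G'\<close> to \<open>K\<close>. Embed \<open>G'\<close> into a
  projective \<open>P\<close> with Gorenstein projective cokernel \<open>G''\<close>. The octahedron
  yields \<open>L\<close> to \<open>P\<close> to \<open>E\<close>, so \<open>E\<close> has finite
  projective dimension, together with \<open>K\<close> to \<open>E\<close> to \<open>G''\<close>.
  The pushout \<open>M1\<close> of \<open>G\<close> and \<open>E\<close> under \<open>K\<close> maps
  onto \<open>M\<close> with kernel \<open>E\<close> and is an extension of \<open>G''\<close> by
  \<open>G\<close>, hence Gorenstein projective.\<close>

lemma gpf_approx:
  assumes "gpf M"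
  shows "\<exists>K G x y d. exi K G M x y d \<and> gp G \<and> pdf K"
  using assms
proof induction
  case (gpf_gp A)
  obtain Z where Z: "zob Z" using zob_ex by blast
  note o = gp_ob[OF gpf_gp] zobD(1)[OF Z]
  have "exi Z A A (zr False Z A) (idn A) (zr True A Z)" using split_id(1)[OF Z o(1)] xi_split o by blast
  then show ?case using gpf_gp pdf_prj[OF prj_zob[OF Z]] by blast
next
  case (gpf_step K G M x y \<delta>)
  obtain L G' l m \<kappa> where I: "exi L G' K l m \<kappa>" "gp G'" "pdf L" using gpf_step.IH by blast
  obtain G'' P u v \<epsilon> where U: "cxi G' P G'' u v \<epsilon>" "prj P" "gp G''" by (rule gp_up[OF I(2)])
  note T = conjunct1[OF gpf_step.hyps(1)] and TI = conjunct1[OF I(1)] and TU = cxiD(1)[OF U(1)]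
  obtain E h w e d'' where E: "etr L P E (u \<bullet> l) h d''" "etr K E G'' w e (m \<bullet> \<epsilon>)" "h \<bullet> u = w \<bullet> m" "e \<bullet> h = v"
    by (rule etr_ET4[OF TI conjunct1[OF TU]])
  have KE: "xi w e (m \<bullet> \<epsilon>)" using xi_cobase E(2) TU by blast
  \<comment> \<open>(ET4) says nothing about \<open>xi\<close>, so the criterion is used: lift the
    image of \<open>p0\<close> in \<open>G''\<close> to \<open>P\<close>, and correct by a map that
    comes from \<open>K\<close> and lifts to \<open>G'\<close>.\<close>
  have "xi (u \<bullet> l) h d''"
  proof (rule xi_char[OF E(1)])
    fix P0 p0 assume P0: "prj P0" "hm P0 E p0"
    have "hm P0 G'' (e \<bullet> p0)" using P0 E(2) by simp
    then obtain c where c: "hm P0 P c" "v \<bullet> c = e \<bullet> p0" by (rule cov_surj[OF prj_cov[OF P0(1) TU]])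
    have "e \<bullet> (p0 \<boxplus> \<boxminus> (h \<bullet> c)) = zr False P0 G''"
      using re[OF E(4), of c] c P0(2) E(1,2) by simp
    moreover have "hm P0 E (p0 \<boxplus> \<boxminus> (h \<bullet> c))" using c(1) P0(2) E(1) by simp
    ultimately obtain q where q: "hm P0 K q" "w \<bullet> q = p0 \<boxplus> \<boxminus> (h \<bullet> c)" using tri_ker[OF E(2)] by metis
    obtain q' where q': "hm P0 G' q'" "m \<bullet> q' = q" by (rule cov_surj[OF prj_cov[OF P0(1) I(1)] q(1)])
    have "h \<bullet> (u \<bullet> q' \<boxplus> c) = p0" using re[OF E(3), of q'] q q' c(1) P0(2) E(1) by simp
    then show "\<exists>h'. hm P0 P h' \<and> h \<bullet> h' = p0" using q'(1) c(1) TU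
      by (intro exI[of _ "u \<bullet> q' \<boxplus> c"]) simp
  qed
  then have pE: "pdf E" using pdf_step[OF _ U(2) I(3)] E(1) by blast
  obtain M1 m1 e1 m2 e2 where M: "etr E M1 M m1 e1 (w \<bullet> \<delta>)" "etr G M1 G'' m2 e2 (x \<bullet> m \<bullet> \<epsilon>)"
    by (rule pushout[OF T E(2)])
  have "xi m1 e1 (w \<bullet> \<delta>)" using xi_cobase M(1) gpf_step.hyps(1) by blast
  moreover have "xi m2 e2 (x \<bullet> m \<bullet> \<epsilon>)" using xi_cobase M(2) KE by blast
  then have "gp M1" using gp_ext M(2) gpf_step.hyps(2) U(3) by blast
  ultimately show ?case using M(1) pE by blast
qed

text \<open>The kernel is again of finite Gorenstein dimension, which allows iteration to a
  resolution.\<close>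

lemma gpf_th:
  assumes "gpf M"
  shows "\<exists>K G x y d. th gp K G M x y d \<and> gp G \<and> gpf K"
proof -
  obtain K G x y d where *: "exi K G M x y d" "gp G" "pdf K" using gpf_approx[OF assms] by blast
  have "gpf K" using *(3)
  proof induction
    case (pdf_prj P) then show ?case by (intro gpf_gp prj_gp)
  next
    case (pdf_step K P A x y d) then show ?case using gpf_step prj_gp by blast
  qed
  then show ?thesis using * gp_cov[OF _ *(1,3)] unfolding th_def by blast
qed

end

section \<open>Resolutions and chain maps\<close>

context proper_extri_proj begin

definition res :: "('a \<Rightarrow> bool) \<Rightarrow> 'a \<Rightarrow> ('a, 'b) aug_complex \<Rightarrow> bool" where
  "res \<W> M R \<longleftrightarrow> (\<exists>K g f \<delta>. K 0 = M \<and> aug R = f 0 \<and>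
     (\<forall>n. \<W> (trm R n) \<and> th \<W> (K (Suc n)) (trm R n) (K n) (g n) (f n) (\<delta> n) \<and>
          diff R n = g n \<bullet> f (Suc n)))"

definition cpx :: "'a \<Rightarrow> ('a, 'b) aug_complex \<Rightarrow> bool" where
  "cpx M R \<longleftrightarrow> ob M \<and> (\<forall>n. ob (trm R n) \<and> hm (trm R (Suc n)) (trm R n) (diff R n) \<and>
      diff R n \<bullet> diff R (Suc n) = zr False (trm R (Suc (Suc n))) (trm R n)) \<and>
     hm (trm R 0) M (aug R) \<and> aug R \<bullet> diff R 0 = zr False (trm R (Suc 0)) M"

text \<open>Hom(P, -) applied to the augmented complex is exact. Lifting of chain maps and
  homotopies rests on this alone, so it works for both kinds of resolutions.\<close>

definition acy :: "'a \<Rightarrow> 'a \<Rightarrow> ('a, 'b) aug_complex \<Rightarrow> bool" where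
  "acy P M R \<longleftrightarrow> (\<forall>h. hm P M h \<longrightarrow> (\<exists>h'. hm P (trm R 0) h' \<and> aug R \<bullet> h' = h)) \<and>
     (\<forall>h. hm P (trm R 0) h \<longrightarrow> aug R \<bullet> h = zr False P M \<longrightarrow>
        (\<exists>h'. hm P (trm R (Suc 0)) h' \<and> diff R 0 \<bullet> h' = h)) \<and>
     (\<forall>n h. hm P (trm R (Suc n)) h \<longrightarrow> diff R n \<bullet> h = zr False P (trm R n) \<longrightarrow>
        (\<exists>h'. hm P (trm R (Suc (Suc n))) h' \<and> diff R (Suc n) \<bullet> h' = h))"

definition lft :: "('a, 'b) aug_complex \<Rightarrow> ('a, 'b) aug_complex \<Rightarrow> 'b \<Rightarrow> (nat \<Rightarrow> 'b) \<Rightarrow> bool" where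
  "lft R S m \<phi> \<longleftrightarrow> (\<forall>n. hm (trm R n) (trm S n) (\<phi> n)) \<and> aug S \<bullet> \<phi> 0 = m \<bullet> aug R \<and>
     (\<forall>n. diff S n \<bullet> \<phi> (Suc n) = \<phi> n \<bullet> diff R n)"

definition cyc :: "('a, 'b) aug_complex \<Rightarrow> 'a \<Rightarrow> nat \<Rightarrow> 'b \<Rightarrow> bool" where
  "cyc R N n z \<longleftrightarrow> hm (trm R n) N z \<and> z \<bullet> diff R n = zr False (trm R (Suc n)) N"

primrec cob :: "('a, 'b) aug_complex \<Rightarrow> 'a \<Rightarrow> nat \<Rightarrow> 'b \<Rightarrow> bool" where
  "cob R N 0 z \<longleftrightarrow> z = zr False (trm R 0) N"
| "cob R N (Suc n) z \<longleftrightarrow> (\<exists>h. hm (trm R n) N h \<and> z = h \<bullet> diff R n)"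

text \<open>Chain maps may go from complexes with \<open>\<V>\<close>-terms to
  \<open>\<W>\<close>-resolutions. The cases that occur are equal classes and \<open>prj\<close>
  against an arbitrary \<open>\<W>\<close>.\<close>

definition cmpw :: "('a \<Rightarrow> bool) \<Rightarrow> ('a \<Rightarrow> bool) \<Rightarrow> bool" where
  "cmpw \<V> \<W> \<longleftrightarrow> (\<forall>W A B C x y d. \<V> W \<longrightarrow> th \<W> A B C x y d \<longrightarrow> cov W A B C x y)"

lemma cmpw_refl: "cmpw \<W> \<W>"
  unfolding cmpw_def using thD by blast

lemma cmpw_prj: "cmpw prj \<W>"
  unfolding cmpw_def using thD(1) prj_cov by blast

section \<open>Comparison of resolutions by chain maps and homotopies\<close>

lemma cpxD:
  assumes "cpx M R"
  shows "ob M" "ob (trm R n)" "hm (trm R (Suc n)) (trm R n) (diff R n)"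
    "diff R n \<bullet> diff R (Suc n) = zr False (trm R (Suc (Suc n))) (trm R n)"
    "hm (trm R 0) M (aug R)" "aug R \<bullet> diff R 0 = zr False (trm R (Suc 0)) M"
  using assms unfolding cpx_def by blast+

lemma lftD:
  assumes "lft R S m \<phi>"
  shows "hm (trm R n) (trm S n) (\<phi> n)" "aug S \<bullet> \<phi> 0 = m \<bullet> aug R"
    "diff S n \<bullet> \<phi> (Suc n) = \<phi> n \<bullet> diff R n"
  using assms unfolding lft_def by blast+

lemma res_cpx:
  assumes "res \<W> M R" shows "cpx M R"
proof -
  obtain K g f \<delta> where K: "K 0 = M" "aug R = f 0"
    and T: "\<And>n. th \<W> (K (Suc n)) (trm R n) (K n) (g n) (f n) (\<delta> n)"
    and D: "\<And>n. diff R n = g n \<bullet> f (Suc n)"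
    using assms unfolding res_def by blast
  note E = conjunct1[OF thD(1)[OF T]]
  show ?thesis unfolding cpx_def
  proof (intro conjI allI)
    fix n
    show "diff R n \<bullet> diff R (Suc n) = zr False (trm R (Suc (Suc n))) (trm R n)"
      unfolding D using re[OF tri_zero(1)[OF E[of "Suc n"]], of "f (Suc (Suc n))"] E[of n] E[of "Suc n"] E[of "Suc (Suc n)"]
      by simp
  next
    show "aug R \<bullet> diff R 0 = zr False (trm R (Suc 0)) M"
      unfolding D K(2) using re[OF tri_zero(1)[OF E[of 0]], of "f (Suc 0)"] E[of 0] E[of "Suc 0"] K(1) by simp
  qed (use E[of 0] K E D in simp_all)
qed

lemma res_acy:
  assumes R: "res \<W> M R" and c: "\<And>A B C x y d. th \<W> A B C x y d \<Longrightarrow> cov P A B C x y"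
  shows "acy P M R"
proof -
  obtain K g f \<delta> where K: "K 0 = M" "aug R = f 0"
    and T: "\<And>n. th \<W> (K (Suc n)) (trm R n) (K n) (g n) (f n) (\<delta> n)"
    and D: "\<And>n. diff R n = g n \<bullet> f (Suc n)"
    using R unfolding res_def by blast
  note E = conjunct1[OF thD(1)[OF T]] and cv = c[OF T]
  have lift: "\<exists>h'. hm P (trm R (Suc n)) h' \<and> g n \<bullet> f (Suc n) \<bullet> h' = h"
    if h: "hm P (trm R n) h" "f n \<bullet> h = zr False P (K n)" for n h
  proof -
    obtain k where k: "hm P (K (Suc n)) k" "g n \<bullet> k = h" by (rule tri_ker[OF E h])
    obtain h' where "hm P (trm R (Suc n)) h'" "f (Suc n) \<bullet> h' = k" by (rule cov_surj[OF cv k(1)])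
    then show ?thesis using k by auto
  qed
  show ?thesis unfolding acy_def
  proof (intro conjI allI impI)
    fix h assume "hm P M h"
    then show "\<exists>h'. hm P (trm R 0) h' \<and> aug R \<bullet> h' = h"
      using cov_surj[OF cv[of 0]] K by metis
  next
    fix h assume "hm P (trm R 0) h" "aug R \<bullet> h = zr False P M"
    then show "\<exists>h'. hm P (trm R (Suc 0)) h' \<and> diff R 0 \<bullet> h' = h"
      using lift[of 0 h] K unfolding D by simp
  next
    fix n h assume h: "hm P (trm R (Suc n)) h" "diff R n \<bullet> h = zr False P (trm R n)"
    have "g n \<bullet> (f (Suc n) \<bullet> h) = zr False P (trm R n)" using h(2) unfolding D by simp
    then have "f (Suc n) \<bullet> h = zr False P (K (Suc n))"
      by (rule cov_inj[OF cv[of n], rotated]) (use h(1) E[of "Suc n"] in simp)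
    then show "\<exists>h'. hm P (trm R (Suc (Suc n))) h' \<and> diff R (Suc n) \<bullet> h' = h"
      using lift[OF h(1)] unfolding D by simp
  qed
qed

lemma res_acy_cmpw: "res \<W> M R \<Longrightarrow> cmpw \<V> \<W> \<Longrightarrow> \<V> P \<Longrightarrow> acy P M R"
  unfolding cmpw_def by (rule res_acy) blast+

lemma res_trm: "res \<W> M R \<Longrightarrow> \<W> (trm R n)"
  unfolding res_def by blast

lemma acyD:
  assumes "acy P M R"
  shows "hm P M h \<Longrightarrow> \<exists>h'. hm P (trm R 0) h' \<and> aug R \<bullet> h' = h"
    "hm P (trm R 0) h \<Longrightarrow> aug R \<bullet> h = zr False P M \<Longrightarrow> \<exists>h'. hm P (trm R (Suc 0)) h' \<and> diff R 0 \<bullet> h' = h"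
    "hm P (trm R (Suc n)) h \<Longrightarrow> diff R n \<bullet> h = zr False P (trm R n) \<Longrightarrow>
        \<exists>h'. hm P (trm R (Suc (Suc n))) h' \<and> diff R (Suc n) \<bullet> h' = h"
  using assms unfolding acy_def by blast+

lemma lft_ex:
  assumes R: "cpx A R" and S: "cpx B S" and ac: "\<And>n. acy (trm R n) B S" and m: "hm A B m"
  shows "\<exists>\<phi>. lft R S m \<phi>"
proof -
  note CR = cpxD[OF R] and CS = cpxD[OF S]
  \<comment> \<open>Dependent choice sees only the current component. The invariant records that
    \<open>\<phi> \<bullet> diff R n\<close> has zero boundary, without naming the previous
    component; degree 0 refers to the augmentation instead.\<close>
  define ok where "ok n \<phi> \<longleftrightarrow> hm (trm R n) (trm S n) \<phi> \<and> (n = 0 \<longrightarrow> aug S \<bullet> \<phi> = m \<bullet> aug R) \<and>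
    (\<forall>k. n = Suc k \<longrightarrow> diff S k \<bullet> \<phi> \<bullet> diff R (Suc k) = zr False (trm R (Suc (Suc k))) (trm S k))" for n \<phi>
  have "\<exists>f. \<forall>n. ok n (f n) \<and> diff S n \<bullet> f (Suc n) = f n \<bullet> diff R n"
  proof (rule dependent_nat_choice)
    have "hm (trm R 0) B (m \<bullet> aug R)" using m CR(2,5) by simp
    then show "\<exists>\<phi>. ok 0 \<phi>" using acyD(1)[OF ac] unfolding ok_def by fastforce
  next
    fix \<phi> n assume o: "ok n \<phi>"
    have h: "hm (trm R (Suc n)) (trm S n) (\<phi> \<bullet> diff R n)" using o CR(3)[of n] CR(2) unfolding ok_def by simp
    have "\<exists>h. hm (trm R (Suc n)) (trm S (Suc n)) h \<and> diff S n \<bullet> h = \<phi> \<bullet> diff R n"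
    proof (cases n)
      case 0
      have "aug S \<bullet> \<phi> \<bullet> diff R 0 = m \<bullet> aug R \<bullet> diff R 0"
        using o re[of "aug S" \<phi> "m \<bullet> aug R" "diff R 0"] 0 unfolding ok_def by simp
      then show ?thesis using acyD(2)[OF ac h[unfolded 0]] CR m 0 by simp
    next
      case (Suc k)
      then show ?thesis using acyD(3)[OF ac h[unfolded Suc]] o unfolding ok_def by simp
    qed
    then obtain h where h: "hm (trm R (Suc n)) (trm S (Suc n)) h" "diff S n \<bullet> h = \<phi> \<bullet> diff R n" by blast
    have "diff S n \<bullet> h \<bullet> diff R (Suc n) = zr False (trm R (Suc (Suc n))) (trm S n)"
      using re[OF h(2), of "diff R (Suc n)"] CR(4)[of n] CR(2) CS(2) o unfolding ok_def by simp
    then show "\<exists>y. ok (Suc n) y \<and> diff S n \<bullet> y = \<phi> \<bullet> diff R n" using h unfolding ok_def by blast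
  qed
  then show ?thesis unfolding lft_def ok_def by blast
qed

lemma lft_id: "cpx A R \<Longrightarrow> lft R R (idn A) (\<lambda>n. idn (trm R n))"
  unfolding lft_def using cpxD[of A R] by simp

lemma lft_cmp:
  assumes f: "lft R S f \<phi>" and g: "lft S T g \<psi>"
  shows "lft R T (g \<bullet> f) (\<lambda>n. \<psi> n \<bullet> \<phi> n)"
proof -
  note F = lftD[OF f] and G = lftD[OF g]
  have "diff T n \<bullet> \<psi> (Suc n) \<bullet> \<phi> (Suc n) = \<psi> n \<bullet> \<phi> n \<bullet> diff R n" for n
    using re[OF G(3), of n "\<phi> (Suc n)"] F(3) by simp
  then show ?thesis unfolding lft_def using F(1) G(1) F(2) re[OF G(2), of "\<phi> 0"] by simp
qed

lemma lft_diff: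
  assumes "cpx A R" "cpx B S" "hm A B m" "lft R S m \<phi>" "lft R S m \<psi>"
  shows "lft R S (zr False A B) (\<lambda>n. \<phi> n \<boxplus> \<boxminus> \<psi> n)"
  unfolding lft_def
  using lftD[OF assms(4)] lftD[OF assms(5)] cpxD[OF assms(1)] cpxD[OF assms(2)] assms(3) by simp

lemma homotopy:
  assumes R: "cpx A R" and S: "cpx B S" and ac: "\<And>n. acy (trm R n) B S"
    and l: "lft R S (zr False A B) \<psi>"
  shows "\<exists>\<sigma>. (\<forall>n. hm (trm R n) (trm S (Suc n)) (\<sigma> n)) \<and> \<psi> 0 = diff S 0 \<bullet> \<sigma> 0 \<and>
    (\<forall>n. \<psi> (Suc n) = diff S (Suc n) \<bullet> \<sigma> (Suc n) \<boxplus> \<sigma> n \<bullet> diff R n)"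
proof -
  note CR = cpxD[OF R] and CS = cpxD[OF S] and L = lftD[OF l]
  \<comment> \<open>The last conjunct says that \<open>\<psi> (Suc n)\<close> minus
    \<open>\<sigma> \<bullet> diff R n\<close> is killed by \<open>diff S n\<close>, so the next
    component of the homotopy exists.\<close>
  define ok where "ok n \<sigma> \<longleftrightarrow> hm (trm R n) (trm S (Suc n)) \<sigma> \<and> (n = 0 \<longrightarrow> \<psi> 0 = diff S 0 \<bullet> \<sigma>) \<and>
    diff S n \<bullet> \<sigma> \<bullet> diff R n = \<psi> n \<bullet> diff R n" for n \<sigma>
  have "\<exists>f. \<forall>n. ok n (f n) \<and> \<psi> (Suc n) = diff S (Suc n) \<bullet> f (Suc n) \<boxplus> f n \<bullet> diff R n"
  proof (rule dependent_nat_choice)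
    have "aug S \<bullet> \<psi> 0 = zr False (trm R 0) B" using L(2) CR CS by simp
    then obtain s where s: "hm (trm R 0) (trm S (Suc 0)) s" "diff S 0 \<bullet> s = \<psi> 0"
      using acyD(2)[OF ac L(1)[of 0]] by blast
    then show "\<exists>\<sigma>. ok 0 \<sigma>" unfolding ok_def using re[OF s(2), of "diff R 0"] by auto
  next
    fix \<sigma> n assume o: "ok n \<sigma>"
    then have s: "hm (trm R n) (trm S (Suc n)) \<sigma>" and e: "diff S n \<bullet> \<sigma> \<bullet> diff R n = \<psi> n \<bullet> diff R n"
      unfolding ok_def by auto
    let ?h = "\<psi> (Suc n) \<boxplus> \<boxminus> (\<sigma> \<bullet> diff R n)"
    have h: "hm (trm R (Suc n)) (trm S (Suc n)) ?h" using s CR(2) CR(3)[of n] L(1)[of "Suc n"] by simp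
    have "diff S n \<bullet> ?h = zr False (trm R (Suc n)) (trm S n)"
      using e L(3)[of n] L(1)[of n] CR(3)[of n] CR(2) by simp
    then obtain t where t: "hm (trm R (Suc n)) (trm S (Suc (Suc n))) t" "diff S (Suc n) \<bullet> t = ?h"
      using acyD(3)[OF ac h] by blast
    have "\<psi> (Suc n) = diff S (Suc n) \<bullet> t \<boxplus> \<sigma> \<bullet> diff R n"
      unfolding t(2) using s CR(2) CR(3)[of n] L(1)[of "Suc n"] by simp
    moreover have "diff S (Suc n) \<bullet> t \<bullet> diff R (Suc n) = \<psi> (Suc n) \<bullet> diff R (Suc n)"
      using re[OF t(2), of "diff R (Suc n)"] s CR(4)[of n] CR(2) CS(2) CR(3)[of "Suc n"] L(1)[of "Suc n"] by simp
    ultimately show "\<exists>y. ok (Suc n) y \<and> \<psi> (Suc n) = diff S (Suc n) \<bullet> y \<boxplus> \<sigma> \<bullet> diff R n"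
      using t(1) unfolding ok_def by blast
  qed
  then show ?thesis unfolding ok_def by blast
qed

section \<open>Cocycles modulo coboundaries\<close>

lemma cycD: "cyc R N n z \<Longrightarrow> hm (trm R n) N z" "cyc R N n z \<Longrightarrow> z \<bullet> diff R n = zr False (trm R (Suc n)) N"
  unfolding cyc_def by blast+

lemma cob_hm: "cpx M R \<Longrightarrow> ob N \<Longrightarrow> cob R N n z \<Longrightarrow> hm (trm R n) N z"
proof (cases n)
  case (Suc k)
  assume "cpx M R" "ob N" "cob R N n z"
  then show ?thesis using Suc cpxD(2,3)[of M R] by auto
qed (use cpxD(2)[of M R] in auto)

lemma cob_cyc:
  assumes R: "cpx M R" and "ob N" "cob R N n z" shows "cyc R N n z"
proof -
  have "z \<bullet> diff R n = zr False (trm R (Suc n)) N"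
  proof (cases n)
    case 0 then show ?thesis using assms cpxD[OF R] by simp
  next
    case (Suc k)
    then obtain h where "hm (trm R k) N h" "z = h \<bullet> diff R k" using assms by auto
    then show ?thesis using cpxD(2)[OF R] cpxD(4)[OF R, of k] Suc assms(2) by simp
  qed
  then show ?thesis using cob_hm[OF assms] unfolding cyc_def by blast
qed

lemma cob_zr: "cpx M R \<Longrightarrow> ob N \<Longrightarrow> cob R N n (zr False (trm R n) N)"
proof (cases n)
  case (Suc k)
  assume "cpx M R" "ob N"
  then show ?thesis using Suc cpxD(2,3)[of M R] by (auto intro!: exI[of _ "zr False (trm R k) N"])
qed simp

lemma cob_add:
  assumes R: "cpx M R" and N: "ob N" and u: "cob R N n u" and v: "cob R N n v"
  shows "cob R N n (u \<boxplus> v)"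
proof (cases n)
  case 0 then show ?thesis using u v cpxD(2)[OF R] N by simp
next
  case (Suc k)
  then obtain h h' where "hm (trm R k) N h" "u = h \<bullet> diff R k" "hm (trm R k) N h'" "v = h' \<bullet> diff R k"
    using u v by auto
  then show ?thesis using Suc by (auto intro!: exI[of _ "h \<boxplus> h'"])
qed

lemma cob_neg:
  assumes R: "cpx M R" and N: "ob N" and u: "cob R N n u"
  shows "cob R N n (\<boxminus> u)"
proof (cases n)
  case 0 then show ?thesis using u cpxD(2)[OF R] N by simp
next
  case (Suc k)
  then obtain h where "hm (trm R k) N h" "u = h \<bullet> diff R k" using u by auto
  then show ?thesis using Suc by (auto intro!: exI[of _ "\<boxminus> h"])
qed

lemma cyc_add: "cpx M R \<Longrightarrow> cyc R N n u \<Longrightarrow> cyc R N n v \<Longrightarrow> cyc R N n (u \<boxplus> v)"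
  unfolding cyc_def using cpxD(2)[of M R] by simp

lemma cyc_neg: "cpx M R \<Longrightarrow> cyc R N n u \<Longrightarrow> cyc R N n (\<boxminus> u)"
  unfolding cyc_def using cpxD(2)[of M R] by simp

lemma cob_pull:
  assumes R: "cpx A R" and N: "ob N" and l: "lft R S m \<phi>" and u: "cob S N n u"
  shows "cob R N n (u \<bullet> \<phi> n)"
proof (cases n)
  case 0 then show ?thesis using u lftD(1)[OF l, of 0] N by simp
next
  case (Suc k)
  then obtain h where h: "hm (trm S k) N h" "u = h \<bullet> diff S k" using u by auto
  then have "u \<bullet> \<phi> (Suc k) = (h \<bullet> \<phi> k) \<bullet> diff R k" using lftD(3)[OF l] by simp
  then show ?thesis using Suc h(1) lftD(1)[OF l, of k] by (auto intro!: exI[of _ "h \<bullet> \<phi> k"])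
qed

lemma cyc_pull:
  assumes R: "cpx A R" and l: "lft R S m \<phi>" and u: "cyc S N n u"
  shows "cyc R N n (u \<bullet> \<phi> n)"
proof -
  have "u \<bullet> \<phi> n \<bullet> diff R n = u \<bullet> diff S n \<bullet> \<phi> (Suc n)" using lftD(3)[OF l] by simp
  also have "\<dots> = zr False (trm R (Suc n)) N"
    using re[OF cycD(2)[OF u], of "\<phi> (Suc n)"] lftD(1)[OF l, of "Suc n"] cycD(1)[OF u] by simp
  finally show ?thesis unfolding cyc_def using lftD(1)[OF l, of n] cycD(1)[OF u] by simp
qed

text \<open>The cocycle kills the summand of the homotopy that starts with a differential of
  \<open>S\<close>; the other summand is a coboundary of \<open>R\<close>, absent in degree
  0.\<close>

lemma null_cob:
  assumes R: "cpx A R" and S: "cpx B S" and ac: "\<And>n. acy (trm R n) B S"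
    and l: "lft R S (zr False A B) \<psi>" and z: "cyc S N n z"
  shows "cob R N n (z \<bullet> \<psi> n)"
proof -
  obtain \<sigma> where s: "\<And>n. hm (trm R n) (trm S (Suc n)) (\<sigma> n)" "\<psi> 0 = diff S 0 \<bullet> \<sigma> 0"
    "\<And>n. \<psi> (Suc n) = diff S (Suc n) \<bullet> \<sigma> (Suc n) \<boxplus> \<sigma> n \<bullet> diff R n"
    using homotopy[OF R S ac l] by blast
  note Z = cycD[OF z]
  have 0: "z \<bullet> diff S n \<bullet> \<sigma> n = zr False (trm R n) N" using re[OF Z(2), of "\<sigma> n"] s(1)[of n] Z(1) by simp
  show ?thesis
  proof (cases n)
    case 0 then show ?thesis using \<open>z \<bullet> diff S n \<bullet> \<sigma> n = _\<close> s(2) by simp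
  next
    case (Suc k)
    have "z \<bullet> \<psi> (Suc k) = (z \<bullet> \<sigma> k) \<bullet> diff R k"
      using 0 s(3)[of k] s(1)[of k] s(1)[of "Suc k"] Suc Z(1) cpxD(3)[OF R, of k] by simp
    then show ?thesis using Suc s(1)[of k] Z(1) by (auto intro!: exI[of _ "z \<bullet> \<sigma> k"])
  qed
qed

lemma lft_cob:
  assumes R: "cpx A R" and S: "cpx B S" and ac: "\<And>n. acy (trm R n) B S" and m: "hm A B m"
    and l: "lft R S m \<phi>" "lft R S m \<psi>" and z: "cyc S N n z"
  shows "cob R N n (z \<bullet> \<phi> n \<boxplus> \<boxminus> (z \<bullet> \<psi> n))"
  using null_cob[OF R S ac lft_diff[OF R S m l] z] by simp

definition eqc :: "('a, 'b) aug_complex \<Rightarrow> 'a \<Rightarrow> nat \<Rightarrow> 'b \<Rightarrow> 'b \<Rightarrow> bool" where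
  "eqc R N n u v \<longleftrightarrow> hm (trm R n) N u \<and> hm (trm R n) N v \<and> cob R N n (u \<boxplus> \<boxminus> v)"

lemma eqc_refl: "cpx A R \<Longrightarrow> hm (trm R n) N u \<Longrightarrow> eqc R N n u u"
  unfolding eqc_def using cob_zr[of A R N n] by simp

lemma eqc_sym:
  assumes R: "cpx A R" and e: "eqc R N n u v" shows "eqc R N n v u"
proof -
  have t: "hm (trm R n) N u" "hm (trm R n) N v" "cob R N n (u \<boxplus> \<boxminus> v)" using e unfolding eqc_def by auto
  then have "cob R N n (\<boxminus> (u \<boxplus> \<boxminus> v))" using cob_neg[OF R] by blast
  then show ?thesis using t unfolding eqc_def by (simp add: add_comm)
qed

lemma eqc_trans:
  assumes R: "cpx A R" and e: "eqc R N n u v" "eqc R N n v w" shows "eqc R N n u w"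
proof -
  have t: "hm (trm R n) N u" "hm (trm R n) N v" "hm (trm R n) N w" "cob R N n (u \<boxplus> \<boxminus> v)" "cob R N n (v \<boxplus> \<boxminus> w)"
    using e unfolding eqc_def by auto
  then have "cob R N n ((u \<boxplus> \<boxminus> v) \<boxplus> (v \<boxplus> \<boxminus> w))" using cob_add[OF R] by blast
  moreover have "(u \<boxplus> \<boxminus> v) \<boxplus> (v \<boxplus> \<boxminus> w) = u \<boxplus> \<boxminus> w" using t(1-3) by (simp add: add_assoc)
  ultimately show ?thesis using t unfolding eqc_def by simp
qed

lemma eqc_cob:
  assumes R: "cpx A R" and N: "ob N"
  shows "eqc R N n u (zr False (trm R n) N) \<longleftrightarrow> cob R N n u"
  using cob_hm[OF R N, of n u] cpxD(2)[OF R] N unfolding eqc_def by auto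

lemma eqc_pull:
  assumes R: "cpx A R" and l: "lft R S m \<phi>" and e: "eqc S N n u v"
  shows "eqc R N n (u \<bullet> \<phi> n) (v \<bullet> \<phi> n)"
  using cob_pull[OF R _ l, of N n "u \<boxplus> \<boxminus> v"] e lftD(1)[OF l, of n] unfolding eqc_def by simp

lemma eqc_lft:
  assumes R: "cpx A R" and S: "cpx B S" and ac: "\<And>n. acy (trm R n) B S" and m: "hm A B m"
    and l: "lft R S m \<phi>" "lft R S m \<psi>" and z: "cyc S N n z"
  shows "eqc R N n (z \<bullet> \<phi> n) (z \<bullet> \<psi> n)"
  using lft_cob[OF assms] lftD(1)[OF l(1), of n] lftD(1)[OF l(2), of n] cycD(1)[OF z] unfolding eqc_def by simp

lemma eqc_sub:
  assumes R: "cpx A R" and N: "ob N" and u: "hm (trm R n) N u" and c: "cob R N n c"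
  shows "eqc R N n (u \<boxplus> \<boxminus> c) u"
proof -
  have h: "hm (trm R n) N c" by (rule cob_hm[OF R N c])
  have "u \<boxplus> \<boxminus> c \<boxplus> \<boxminus> u = \<boxminus> c" using u h by (simp add: add_comm[of u] add_assoc)
  then show ?thesis using cob_neg[OF R N c] u h unfolding eqc_def by simp
qed

end

section \<open>Horseshoe resolutions and connecting data\<close>

context proper_extri_proj begin

definition hshoe :: "('a \<Rightarrow> bool) \<Rightarrow> 'a \<Rightarrow> 'a \<Rightarrow> 'a \<Rightarrow> 'b \<Rightarrow> 'b \<Rightarrow> ('a, 'b) aug_complex \<Rightarrow>
    ('a, 'b) aug_complex \<Rightarrow> ('a, 'b) aug_complex \<Rightarrow> (nat \<Rightarrow> 'b) \<Rightarrow> (nat \<Rightarrow> 'b) \<Rightarrow> bool" where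
  "hshoe \<W> A B C x y R R' R'' \<iota> \<pi> \<longleftrightarrow> res \<W> A R \<and> res \<W> B R' \<and> res \<W> C R'' \<and>
     lft R R' x \<iota> \<and> lft R' R'' y \<pi> \<and>
     (\<forall>n. \<exists>s r. bip (trm R n) (trm R'' n) (trm R' n) (\<iota> n) s r (\<pi> n))"

lemma hshoeD:
  assumes "hshoe \<W> A B C x y R R' R'' \<iota> \<pi>"
  shows "res \<W> A R" "res \<W> B R'" "res \<W> C R''" "lft R R' x \<iota>" "lft R' R'' y \<pi>"
  using assms unfolding hshoe_def by blast+

lemma hshoe_bip:
  assumes "hshoe \<W> A B C x y R R' R'' \<iota> \<pi>"
  shows "\<exists>s r. \<forall>n. bip (trm R n) (trm R'' n) (trm R' n) (\<iota> n) (s n) (r n) (\<pi> n)"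
  using assms unfolding hshoe_def by metis

text \<open>Iterates \<open>horse_th\<close>: by \<open>horse_cov\<close> the row of syzygies is
  again a triangle of the class \<open>th \<W>\<close>, so the next step applies to it.\<close>

lemma hshoe_ex:
  assumes T: "th \<W> A B C x y d" and R: "res \<W> A R" and R'': "res \<W> C R''"
    and sm: "\<And>G H S i j p q. bip G H S i j p q \<Longrightarrow> \<W> G \<Longrightarrow> \<W> H \<Longrightarrow> \<W> S"
  shows "\<exists>R' \<iota> \<pi>. hshoe \<W> A B C x y R R' R'' \<iota> \<pi>"
proof -
  obtain K g f \<delta> where K: "K 0 = A" "aug R = f 0"
    and TK: "\<And>n. th \<W> (K (Suc n)) (trm R n) (K n) (g n) (f n) (\<delta> n)"
    and D: "\<And>n. \<W> (trm R n)" "\<And>n. diff R n = g n \<bullet> f (Suc n)"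
    using R unfolding res_def by blast
  obtain L g'' f'' \<delta>'' where L: "L 0 = C" "aug R'' = f'' 0"
    and TL: "\<And>n. th \<W> (L (Suc n)) (trm R'' n) (L n) (g'' n) (f'' n) (\<delta>'' n)"
    and D'': "\<And>n. \<W> (trm R'' n)" "\<And>n. diff R'' n = g'' n \<bullet> f'' (Suc n)"
    using R'' unfolding res_def by blast
  \<comment> \<open>The state is the current row of syzygies. The projective or Gorenstein
    projective row between two consecutive states is only asserted to exist here and is chosen at
    the end.\<close>
  define step where "step n X S i p k e \<longleftrightarrow> (case X of ((B, x, y, d), (B', x', y', d')) \<Rightarrow>
     \<exists>s r dk. bip (trm R n) (trm R'' n) S i s r p \<and> th \<W> B' S B k e dk \<and>
       e \<bullet> i = x \<bullet> f n \<and> y \<bullet> e = f'' n \<bullet> p \<and> i \<bullet> g n = k \<bullet> x' \<and> p \<bullet> k = g'' n \<bullet> y')"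
    for n and X :: "('a \<times> 'b \<times> 'b \<times> 'b) \<times> ('a \<times> 'b \<times> 'b \<times> 'b)" and S i p k e
  \<comment> \<open>Inside the case expression the names are bound anew; in the second conjunct they
    denote the given triangle, which anchors the recursion.\<close>
  define ok where "ok n X \<longleftrightarrow> (case X of (B, x, y, d) \<Rightarrow> th \<W> (K n) B (L n) x y d) \<and> (n = 0 \<longrightarrow> X = (B, x, y, d))"
    for n X
  have "\<exists>F. \<forall>n. ok n (F n) \<and> (\<exists>S i p k e. step n (F n, F (Suc n)) S i p k e)"
  proof (rule dependent_nat_choice)
    show "\<exists>X. ok 0 X" unfolding ok_def using T K(1) L(1) by (intro exI[of _ "(B, x, y, d)"]) simp
  next
    fix X n assume "ok n X"
    then obtain B x y d where X: "X = (B, x, y, d)" "th \<W> (K n) B (L n) x y d"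
      unfolding ok_def by (cases X) auto
    obtain S i s r p K' k ff dk e t dt
      where H: "horse (K n) B (L n) x y d (K (Suc n)) (trm R n) (g n) (f n) (\<delta> n)
           (L (Suc n)) (trm R'' n) (g'' n) (f'' n) (\<delta>'' n) S i s r p K' k ff dk e t dt"
        "exi K' S B k ff dk" "exi (K (Suc n)) K' (L (Suc n)) e t dt"
      by (rule horse_th[OF thD(1)[OF X(2)] thD(1)[OF TK[of n]] thD(1)[OF TL[of n]] thD(2)[OF X(2) D''(1)]])
    have "cov W (K (Suc n)) K' (L (Suc n)) e t \<and> cov W K' S B k ff" if "\<W> W" for W
      using horse_cov[OF H(1) thD(2)[OF X(2) that] thD(2)[OF TK[of n] that] thD(2)[OF TL[of n] that]] by blast
    then have th: "th \<W> (K (Suc n)) K' (L (Suc n)) e t dt" "th \<W> K' S B k ff dk"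
      unfolding th_def using H(2,3) by blast+
    have "step n (X, (K', e, t, dt)) S i p k ff"
      unfolding step_def X(1) prod.case using horseD(4,7-10)[OF H(1)] th(2) by blast
    moreover have "ok (Suc n) (K', e, t, dt)" unfolding ok_def using th(1) by simp
    ultimately show "\<exists>Y. ok (Suc n) Y \<and> (\<exists>S i p k e. step n (X, Y) S i p k e)" by blast
  qed
  then obtain F where F: "\<And>n. ok n (F n)" "\<And>n. \<exists>S i p k e. step n (F n, F (Suc n)) S i p k e" by blast
  define B' x' y' where "B' n = fst (F n)" and "x' n = fst (snd (F n))" and "y' n = fst (snd (snd (F n)))" for n
  have F0: "B' 0 = B" "x' 0 = x" "y' 0 = y" using F(1)[of 0] unfolding ok_def B'_def x'_def y'_def by auto
  have *: "\<forall>n. \<exists>S i p k e dk s r. bip (trm R n) (trm R'' n) S i s r p \<and> th \<W> (B' (Suc n)) S (B' n) k e dk \<and>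
       e \<bullet> i = x' n \<bullet> f n \<and> y' n \<bullet> e = f'' n \<bullet> p \<and> i \<bullet> g n = k \<bullet> x' (Suc n) \<and> p \<bullet> k = g'' n \<bullet> y' (Suc n)"
  proof
    fix n
    obtain S i p k e where "step n (F n, F (Suc n)) S i p k e" using F(2) by blast
    then show "\<exists>S i p k e dk s r. bip (trm R n) (trm R'' n) S i s r p \<and> th \<W> (B' (Suc n)) S (B' n) k e dk \<and>
       e \<bullet> i = x' n \<bullet> f n \<and> y' n \<bullet> e = f'' n \<bullet> p \<and> i \<bullet> g n = k \<bullet> x' (Suc n) \<and> p \<bullet> k = g'' n \<bullet> y' (Suc n)"
      unfolding step_def B'_def x'_def y'_def by (cases "F n", cases "F (Suc n)") (simp, blast)
  qed
  obtain S i p k e dk s r where E: "\<And>n. bip (trm R n) (trm R'' n) (S n) (i n) (s n) (r n) (p n)"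
    "\<And>n. th \<W> (B' (Suc n)) (S n) (B' n) (k n) (e n) (dk n)"
    "\<And>n. e n \<bullet> i n = x' n \<bullet> f n" "\<And>n. y' n \<bullet> e n = f'' n \<bullet> p n"
    "\<And>n. i n \<bullet> g n = k n \<bullet> x' (Suc n)" "\<And>n. p n \<bullet> k n = g'' n \<bullet> y' (Suc n)"
    using choice[OF *] by (elim exE) (drule choice, elim exE, drule choice, elim exE, drule choice, elim exE,
      drule choice, elim exE, drule choice, elim exE, drule choice, elim exE, drule choice, elim exE, blast)
  define R' where "R' = \<lparr>trm = S, diff = (\<lambda>n. k n \<bullet> e (Suc n)), aug = e 0\<rparr>"
  have "res \<W> B R'" unfolding res_def
    unfolding R'_def
    by (rule exI[of _ B'], rule exI[of _ k], rule exI[of _ e], rule exI[of _ dk])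
      (use E(2) F0(1) sm[OF E(1) D(1) D''(1)] in simp)
  moreover have "lft R R' x i" unfolding lft_def
  proof (intro conjI allI)
    show "aug R' \<bullet> i 0 = x \<bullet> aug R" unfolding R'_def using E(3)[of 0] F0 K(2) by simp
    show "diff R' n \<bullet> i (Suc n) = i n \<bullet> diff R n" for n
      unfolding R'_def D(2) using E(3)[of "Suc n"] re[OF E(5)[of n], of "f (Suc n)"] by simp
  qed (use bipD(1)[OF E(1)] in \<open>simp_all add: R'_def\<close>)
  moreover have "lft R' R'' y p" unfolding lft_def
  proof (intro conjI allI)
    show "aug R'' \<bullet> p 0 = y \<bullet> aug R'" unfolding R'_def using E(4)[of 0] F0 L(2) by simp
    show "diff R'' n \<bullet> p (Suc n) = p n \<bullet> diff R' n" for n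
      unfolding R'_def D''(2) using E(4)[of "Suc n"] re[OF E(6)[of n], of "e (Suc n)"] by simp
  qed (use bipD(4)[OF E(1)] in \<open>simp_all add: R'_def\<close>)
  moreover have "\<forall>n. \<exists>s r. bip (trm R n) (trm R'' n) (trm R' n) (i n) s r (p n)"
    using E(1) unfolding R'_def by auto
  ultimately show ?thesis unfolding hshoe_def using R R'' by blast
qed

text \<open>The zigzag of the snake lemma: \<open>w\<close> extends the cocycle \<open>z\<close>, and \<open>v\<close> represents the image of \<open>z\<close>
  under the connecting map.\<close>

definition cdat :: "('a, 'b) aug_complex \<Rightarrow> ('a, 'b) aug_complex \<Rightarrow> ('a, 'b) aug_complex \<Rightarrow>
    (nat \<Rightarrow> 'b) \<Rightarrow> (nat \<Rightarrow> 'b) \<Rightarrow> 'a \<Rightarrow> nat \<Rightarrow> 'b \<Rightarrow> 'b \<Rightarrow> 'b \<Rightarrow> bool" where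
  "cdat R R' R'' \<iota> \<pi> N n z w v \<longleftrightarrow> cyc R N n z \<and> hm (trm R' n) N w \<and> w \<bullet> \<iota> n = z \<and>
     hm (trm R'' (Suc n)) N v \<and> v \<bullet> \<pi> (Suc n) = w \<bullet> diff R' n"

lemma cdatD:
  assumes "cdat R R' R'' \<iota> \<pi> N n z w v"
  shows "cyc R N n z" "hm (trm R' n) N w" "w \<bullet> \<iota> n = z" "hm (trm R'' (Suc n)) N v"
    "v \<bullet> \<pi> (Suc n) = w \<bullet> diff R' n"
  using assms unfolding cdat_def by blast+

section \<open>The snake zigzag, its choices and its naturality\<close>

lemma bip_epi:
  assumes b: "bip A B S i j p q" and "hm B N u" "hm B N v" "u \<bullet> q = v \<bullet> q"
  shows "u = v"
  using re[OF assms(4), of j] bipD[OF b] assms(2,3) by simp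

lemma bip_factor:
  assumes b: "bip A B S i j p q" and u: "hm S N u" "u \<bullet> i = zr False A N"
  shows "(u \<bullet> j) \<bullet> q = u"
proof -
  note B = bipD[OF b]
  have "u = u \<bullet> (i \<bullet> p \<boxplus> j \<bullet> q)" unfolding B(9) using u(1) by simp
  also have "\<dots> = u \<bullet> j \<bullet> q" using re[OF u(2), of p] u(1) B(1-4) by simp
  finally show ?thesis by simp
qed

lemma hshoe_epi:
  assumes H: "hshoe \<W> A B C x y R R' R'' \<iota> \<pi>" and "hm (trm R'' n) N u" "hm (trm R'' n) N v" "u \<bullet> \<pi> n = v \<bullet> \<pi> n"
  shows "u = v"
proof -
  obtain s r where b: "\<And>n. bip (trm R n) (trm R'' n) (trm R' n) (\<iota> n) (s n) (r n) (\<pi> n)" using hshoe_bip[OF H] by blast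
  show ?thesis by (rule bip_epi[OF b assms(2-4)])
qed

lemma hshoe_factor:
  assumes H: "hshoe \<W> A B C x y R R' R'' \<iota> \<pi>" and u: "hm (trm R' n) N u" "u \<bullet> \<iota> n = zr False (trm R n) N"
  obtains v where "hm (trm R'' n) N v" "v \<bullet> \<pi> n = u"
proof -
  obtain s r where b: "\<And>n. bip (trm R n) (trm R'' n) (trm R' n) (\<iota> n) (s n) (r n) (\<pi> n)" using hshoe_bip[OF H] by blast
  show thesis by (rule that[OF _ bip_factor[OF b u]]) (use u bipD(2)[OF b] in simp)
qed

lemma hshoe_extend:
  assumes H: "hshoe \<W> A B C x y R R' R'' \<iota> \<pi>" and u: "hm (trm R n) N u"
  obtains w where "hm (trm R' n) N w" "w \<bullet> \<iota> n = u"
proof -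
  obtain s r where b: "\<And>n. bip (trm R n) (trm R'' n) (trm R' n) (\<iota> n) (s n) (r n) (\<pi> n)" using hshoe_bip[OF H] by blast
  show thesis by (rule that[of "u \<bullet> r n"]) (use u bipD[OF b] in simp_all)
qed

lemma hshoe_cpx:
  assumes H: "hshoe \<W> A B C x y R R' R'' \<iota> \<pi>"
  shows "cpx A R" "cpx B R'" "cpx C R''"
  using hshoeD(1-3)[OF H] res_cpx by blast+

lemma cdat_ex:
  assumes H: "hshoe \<W> A B C x y R R' R'' \<iota> \<pi>" and z: "cyc R N n z"
  obtains w v where "cdat R R' R'' \<iota> \<pi> N n z w v"
proof -
  note c = hshoe_cpx[OF H] and l = lftD[OF hshoeD(4)[OF H]]
  obtain w where w: "hm (trm R' n) N w" "w \<bullet> \<iota> n = z" by (rule hshoe_extend[OF H cycD(1)[OF z]])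
  have "(w \<bullet> diff R' n) \<bullet> \<iota> (Suc n) = zr False (trm R (Suc n)) N"
    using l(3)[of n] re[OF w(2), of "diff R n"] cycD(2)[OF z] by simp
  moreover have "hm (trm R' (Suc n)) N (w \<bullet> diff R' n)" using w cpxD(2,3)[OF c(2)] by simp
  ultimately obtain v where "hm (trm R'' (Suc n)) N v" "v \<bullet> \<pi> (Suc n) = w \<bullet> diff R' n"
    using hshoe_factor[OF H] by metis
  then show thesis using that[of w v] w z unfolding cdat_def by blast
qed

lemma cdat_cyc:
  assumes H: "hshoe \<W> A B C x y R R' R'' \<iota> \<pi>" and d: "cdat R R' R'' \<iota> \<pi> N n z w v"
  shows "cyc R'' N (Suc n) v"
proof -
  note c = hshoe_cpx[OF H] and l = lftD[OF hshoeD(5)[OF H]] and d = cdatD[OF d]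
  have "v \<bullet> diff R'' (Suc n) = zr False (trm R'' (Suc (Suc n))) N"
  proof (rule hshoe_epi[OF H, where N = N])
    have "(v \<bullet> diff R'' (Suc n)) \<bullet> \<pi> (Suc (Suc n)) = v \<bullet> \<pi> (Suc n) \<bullet> diff R' (Suc n)" using l(3) by simp
    also have "\<dots> = zr False (trm R' (Suc (Suc n))) N"
      using re[OF d(5), of "diff R' (Suc n)"] cpxD(2)[OF c(2)] cpxD(4)[OF c(2), of n] d(2) by simp
    finally show "(v \<bullet> diff R'' (Suc n)) \<bullet> \<pi> (Suc (Suc n)) = zr False (trm R'' (Suc (Suc n))) N \<bullet> \<pi> (Suc (Suc n))"
      using l(1)[of "Suc (Suc n)"] d(2) by simp
  qed (use cpxD(2,3)[OF c(3)] d in simp_all)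
  then show ?thesis unfolding cyc_def using d by blast
qed

lemma cdat_add:
  assumes H: "hshoe \<W> A B C x y R R' R'' \<iota> \<pi>"
    and d: "cdat R R' R'' \<iota> \<pi> N n z w v" "cdat R R' R'' \<iota> \<pi> N n z' w' v'"
  shows "cdat R R' R'' \<iota> \<pi> N n (z \<boxplus> z') (w \<boxplus> w') (v \<boxplus> v')"
  using cyc_add[OF hshoe_cpx(1)[OF H]] cdatD[OF d(1)] cdatD[OF d(2)] unfolding cdat_def by simp

lemma cdat_neg:
  assumes H: "hshoe \<W> A B C x y R R' R'' \<iota> \<pi>" and d: "cdat R R' R'' \<iota> \<pi> N n z w v"
  shows "cdat R R' R'' \<iota> \<pi> N n (\<boxminus> z) (\<boxminus> w) (\<boxminus> v)"
  using cyc_neg[OF hshoe_cpx(1)[OF H]] cdatD[OF d(1)] unfolding cdat_def by simp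

lemma cdat_push:
  assumes H: "hshoe \<W> A B C x y R R' R'' \<iota> \<pi>" and d: "cdat R R' R'' \<iota> \<pi> N n z w v" and g: "hm N N' g"
  shows "cdat R R' R'' \<iota> \<pi> N' n (g \<bullet> z) (g \<bullet> w) (g \<bullet> v)"
  using cdatD[OF d] g cpxD(2)[OF hshoe_cpx(1)[OF H]] unfolding cdat_def cyc_def by simp

text \<open>A coboundary extends to a coboundary, by extending the cochain it bounds. Subtracting
  the extension makes a middle cochain vanish on the subcomplex without changing its boundary or
  class.\<close>

lemma cob_extend:
  assumes H: "hshoe \<W> A B C x y R R' R'' \<iota> \<pi>" and N: "ob N" and z: "cob R N n z"
  obtains c where "cob R' N n c" "c \<bullet> \<iota> n = z"
proof (cases n)
  case 0
  then show thesis using that[of "zr False (trm R' 0) N"] z N lftD(1)[OF hshoeD(4)[OF H], of 0]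
    cpxD(2)[OF hshoe_cpx(2)[OF H]] by simp
next
  case (Suc k)
  then obtain h where h: "hm (trm R k) N h" "z = h \<bullet> diff R k" using z by auto
  obtain w where w: "hm (trm R' k) N w" "w \<bullet> \<iota> k = h" by (rule hshoe_extend[OF H h(1)])
  have "(w \<bullet> diff R' k) \<bullet> \<iota> (Suc k) = z"
    using lftD(3)[OF hshoeD(4)[OF H], of k] re[OF w(2), of "diff R k"] h by simp
  then show thesis using that[of "w \<bullet> diff R' k"] w(1) Suc by auto
qed

text \<open>Subtract from \<open>w\<close> a coboundary \<open>u\<close> that extends
  \<open>z\<close>. The difference vanishes on the subcomplex, hence equals
  \<open>t \<bullet> \<pi> n\<close>, and since \<open>u\<close> is a cocycle, \<open>v\<close> is
  the coboundary of \<open>t\<close>.\<close>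

lemma cdat_cob:
  assumes H: "hshoe \<W> A B C x y R R' R'' \<iota> \<pi>" and d: "cdat R R' R'' \<iota> \<pi> N n z w v" and z: "cob R N n z"
  shows "cob R'' N (Suc n) v"
proof -
  note c = hshoe_cpx[OF H] and l = lftD[OF hshoeD(5)[OF H]] and d = cdatD[OF d]
  have N: "ob N" using d(2) by simp
  obtain u where u: "cob R' N n u" "u \<bullet> \<iota> n = z" by (rule cob_extend[OF H N z])
  note u' = cycD[OF cob_cyc[OF c(2) N u(1)]]
  have "(w \<boxplus> \<boxminus> u) \<bullet> \<iota> n = zr False (trm R n) N" using u(2) d(3) cycD(1)[OF d(1)] by simp
  moreover have "hm (trm R' n) N (w \<boxplus> \<boxminus> u)" using d(2) u' by simp
  ultimately obtain t where t: "hm (trm R'' n) N t" "t \<bullet> \<pi> n = w \<boxplus> \<boxminus> u"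
    using hshoe_factor[OF H] by metis
  have "v = t \<bullet> diff R'' n"
  proof (rule hshoe_epi[OF H, where N = N])
    have "(t \<bullet> diff R'' n) \<bullet> \<pi> (Suc n) = t \<bullet> \<pi> n \<bullet> diff R' n" using l(3) by simp
    also have "\<dots> = w \<bullet> diff R' n" using re[OF t(2), of "diff R' n"] u' d(2) cpxD(3)[OF c(2), of n] by simp
    finally show "v \<bullet> \<pi> (Suc n) = (t \<bullet> diff R'' n) \<bullet> \<pi> (Suc n)" using d(5) by simp
  qed (use d t(1) cpxD(2,3)[OF c(3)] in simp_all)
  then show ?thesis using t(1) by auto
qed

lemma cdat_eqc:
  assumes H: "hshoe \<W> A B C x y R R' R'' \<iota> \<pi>"
    and d: "cdat R R' R'' \<iota> \<pi> N n z w v" "cdat R R' R'' \<iota> \<pi> N n z' w' v'" and e: "eqc R N n z z'"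
  shows "eqc R'' N (Suc n) v v'"
  using cdat_cob[OF H cdat_add[OF H d(1) cdat_neg[OF H d(2)]]] e cdatD(4)[OF d(1)] cdatD(4)[OF d(2)]
  unfolding eqc_def by simp

text \<open>Zigzags can be transported only along maps that commute exactly with both horseshoes.
  The obstruction \<open>\<pi>2 \<bullet> \<psi> \<bullet> \<iota>1\<close> lifts
  \<open>c \<bullet> y1 \<bullet> x1 = 0\<close>, hence is null-homotopic; once it is removed, the
  middle map determines the outer ones.\<close>

lemma strict_lft:
  assumes H1: "hshoe \<V> A1 B1 C1 x1 y1 R1 R1' R1'' \<iota>1 \<pi>1"
    and H2: "hshoe \<W> A2 B2 C2 x2 y2 R2 R2' R2'' \<iota>2 \<pi>2"
    and T1: "exi A1 B1 C1 x1 y1 d1" and T2: "th \<W> A2 B2 C2 x2 y2 d2" and cm: "cmpw \<V> \<W>"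
    and m: "hm A1 A2 a" "hm B1 B2 b" "hm C1 C2 c" "b \<bullet> x1 = x2 \<bullet> a" "y2 \<bullet> b = c \<bullet> y1"
  shows "\<exists>\<phi> \<phi>' \<phi>''. lft R1 R2 a \<phi> \<and> lft R1' R2' b \<phi>' \<and> lft R1'' R2'' c \<phi>'' \<and>
    (\<forall>n. \<phi>' n \<bullet> \<iota>1 n = \<iota>2 n \<bullet> \<phi> n) \<and> (\<forall>n. \<phi>'' n \<bullet> \<pi>1 n = \<pi>2 n \<bullet> \<phi>' n)"
proof -
  note E1 = conjunct1[OF T1] and E2 = conjunct1[OF thD(1)[OF T2]]
  note c1 = hshoe_cpx[OF H1] and c2 = hshoe_cpx[OF H2]
  note D1 = hshoeD[OF H1] and D2 = hshoeD[OF H2]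
  have ac': "acy (trm R1' n) B2 R2'" for n by (rule res_acy_cmpw[OF D2(2) cm res_trm[OF D1(2)]])
  have ac'': "acy (trm R1 n) C2 R2''" for n by (rule res_acy_cmpw[OF D2(3) cm res_trm[OF D1(1)]])
  obtain \<psi> where \<psi>: "lft R1' R2' b \<psi>" using lft_ex[OF c1(2) c2(2) ac' m(2)] by blast
  note P = lftD[OF \<psi>] and I1 = lftD[OF D1(4)] and I2 = lftD[OF D2(4)] and Q1 = lftD[OF D1(5)] and Q2 = lftD[OF D2(5)]
  have "lft R1 R2'' ((y2 \<bullet> b) \<bullet> x1) (\<lambda>n. (\<pi>2 n \<bullet> \<psi> n) \<bullet> \<iota>1 n)"
    by (rule lft_cmp[OF D1(4) lft_cmp[OF \<psi> D2(5)]])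
  moreover have "(y2 \<bullet> b) \<bullet> x1 = zr False A1 C2"
    unfolding m(5) using tri_zero(1)[OF E1] E1 m(3) by simp
  ultimately have l0: "lft R1 R2'' (zr False A1 C2) (\<lambda>n. \<pi>2 n \<bullet> \<psi> n \<bullet> \<iota>1 n)" by simp
  obtain \<sigma> where s: "\<And>n. hm (trm R1 n) (trm R2'' (Suc n)) (\<sigma> n)" "\<pi>2 0 \<bullet> \<psi> 0 \<bullet> \<iota>1 0 = diff R2'' 0 \<bullet> \<sigma> 0"
    "\<And>n. \<pi>2 (Suc n) \<bullet> \<psi> (Suc n) \<bullet> \<iota>1 (Suc n) = diff R2'' (Suc n) \<bullet> \<sigma> (Suc n) \<boxplus> \<sigma> n \<bullet> diff R1 n"
    using homotopy[OF c1(1) c2(3) ac'' l0] by blast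
  obtain s1 r1 where b1: "\<And>n. bip (trm R1 n) (trm R1'' n) (trm R1' n) (\<iota>1 n) (s1 n) (r1 n) (\<pi>1 n)"
    using hshoe_bip[OF H1] by blast
  obtain s2 r2 where b2: "\<And>n. bip (trm R2 n) (trm R2'' n) (trm R2' n) (\<iota>2 n) (s2 n) (r2 n) (\<pi>2 n)"
    using hshoe_bip[OF H2] by blast
  note B1 = bipD[OF b1] and B2 = bipD[OF b2]
  \<comment> \<open>The composite \<open>\<pi>2 \<bullet> \<psi> \<bullet> \<iota>1\<close> is null-homotopic through \<open>\<sigma>\<close>; subtracting from \<open>\<psi>\<close> the null-homotopic map
    built from \<open>t\<close> makes it vanish.\<close>
  define t where "t n = s2 (Suc n) \<bullet> \<sigma> n \<bullet> r1 n" for n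
  have t: "hm (trm R1' n) (trm R2' (Suc n)) (t n)" for n unfolding t_def using B2(2)[of "Suc n"] B1(3)[of n] s(1)[of n] by simp
  have \<pi>t: "\<pi>2 (Suc n) \<bullet> t n = \<sigma> n \<bullet> r1 n" for n
    unfolding t_def using re[OF B2(6)[of "Suc n"], of "\<sigma> n \<bullet> r1 n"] s(1)[of n] B1(3)[of n] by simp
  have t\<iota>: "t n \<bullet> \<iota>1 n = s2 (Suc n) \<bullet> \<sigma> n" for n
    unfolding t_def using B1(5)[of n] s(1)[of n] by simp
  define h where "h n = (case n of 0 \<Rightarrow> diff R2' 0 \<bullet> t 0 | Suc k \<Rightarrow> diff R2' (Suc k) \<bullet> t (Suc k) \<boxplus> t k \<bullet> diff R1' k)" for n
  have h0: "h 0 = diff R2' 0 \<bullet> t 0" and hS: "h (Suc k) = diff R2' (Suc k) \<bullet> t (Suc k) \<boxplus> t k \<bullet> diff R1' k" for k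
    unfolding h_def by simp_all
  note d1 = cpxD(2,3)[OF c1(2)] and d2 = cpxD(2,3)[OF c2(2)]
  have hh: "hm (trm R1' n) (trm R2' n) (h n)" for n
    by (cases n) (use h0 hS t d1 d2 in simp_all)
  define \<phi>' where "\<phi>' n = \<psi> n \<boxplus> \<boxminus> h n" for n
  have \<phi>'h: "hm (trm R1' n) (trm R2' n) (\<phi>' n)" for n unfolding \<phi>'_def using hh P(1) by simp
  have dh: "diff R2' n \<bullet> h (Suc n) = h n \<bullet> diff R1' n" for n
  proof (cases n)
    case 0
    have "diff R2' 0 \<bullet> diff R2' (Suc 0) \<bullet> t (Suc 0) = zr False (trm R1' (Suc 0)) (trm R2' 0)"
      using re[OF cpxD(4)[OF c2(2), of 0], of "t (Suc 0)"] t[of "Suc 0"] d2(1) by simp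
    then show ?thesis unfolding 0 h0 hS using t[of 0] d1(2)[of 0] d2(2)[of 0] by simp
  next
    case (Suc k)
    have "diff R2' n \<bullet> diff R2' (Suc n) \<bullet> t (Suc n) = zr False (trm R1' (Suc n)) (trm R2' n)"
      using re[OF cpxD(4)[OF c2(2), of n], of "t (Suc n)"] t[of "Suc n"] d2(1) by simp
    moreover have "t k \<bullet> diff R1' k \<bullet> diff R1' n = zr False (trm R1' (Suc n)) (trm R2' n)"
      unfolding Suc using cpxD(4)[OF c1(2), of k] t[of k] d1(1) by simp
    ultimately show ?thesis using hS[of n] hS[of k] t[of n] d1(2)[of n] d2(2)[of n] unfolding Suc by simp
  qed
  have l': "lft R1' R2' b \<phi>'" unfolding lft_def
  proof (intro conjI allI)
    have "aug R2' \<bullet> h 0 = zr False (trm R1' 0) B2"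
      unfolding h0 using re[OF cpxD(6)[OF c2(2)], of "t 0"] t[of 0] cpxD(1)[OF c2(2)] by simp
    then show "aug R2' \<bullet> \<phi>' 0 = b \<bullet> aug R1'"
      unfolding \<phi>'_def using P(2) m(2) cpxD(5)[OF c1(2)] by simp
    show "diff R2' n \<bullet> \<phi>' (Suc n) = \<phi>' n \<bullet> diff R1' n" for n
      unfolding \<phi>'_def using P(3) dh by simp
  qed (use \<phi>'h d1 d2 in simp_all)
  note P' = lftD[OF l']
  have z: "\<pi>2 n \<bullet> \<phi>' n \<bullet> \<iota>1 n = zr False (trm R1 n) (trm R2'' n)" for n
  proof (cases n)
    case 0
    have "\<pi>2 0 \<bullet> h 0 \<bullet> \<iota>1 0 = diff R2'' 0 \<bullet> \<sigma> 0"
      unfolding h0 using re[OF Q2(3)[of 0, symmetric], of "t 0 \<bullet> \<iota>1 0"] re[OF \<pi>t[of 0], of "\<iota>1 0"] B1(5)[of 0] s(1)[of 0]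
      by simp
    then show ?thesis unfolding 0 \<phi>'_def using s(2) s(1)[of 0] cpxD(2,3)[OF c2(3)] by simp
  next
    case (Suc k)
    have "\<pi>2 n \<bullet> diff R2' n \<bullet> t n \<bullet> \<iota>1 n = diff R2'' n \<bullet> \<sigma> n"
      using re[OF Q2(3)[of n, symmetric], of "t n \<bullet> \<iota>1 n"] re[OF \<pi>t[of n], of "\<iota>1 n"] B1(5)[of n] s(1)[of n]
      by simp
    moreover have "\<pi>2 n \<bullet> t k \<bullet> diff R1' k \<bullet> \<iota>1 n = \<sigma> k \<bullet> diff R1 k"
      unfolding Suc using re[OF \<pi>t[of k], of "diff R1' k \<bullet> \<iota>1 (Suc k)"] I1(3)[of k] re[OF B1(5)[of k], of "diff R1 k"]
        s(1)[of k] cpxD(3)[OF c1(1), of k] by simp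
    ultimately have "\<pi>2 n \<bullet> h n \<bullet> \<iota>1 n = diff R2'' n \<bullet> \<sigma> n \<boxplus> \<sigma> k \<bullet> diff R1 k"
      unfolding Suc hS by simp
    then have "\<pi>2 n \<bullet> h n \<bullet> \<iota>1 n = \<pi>2 n \<bullet> \<psi> n \<bullet> \<iota>1 n" using s(3)[of k] unfolding Suc by simp
    then show ?thesis unfolding \<phi>'_def using P(1)[of n] B1(1)[of n] B2(4)[of n] by simp
  qed
  \<comment> \<open>Since \<open>\<phi>'\<close> now maps the subcomplex into the subcomplex, a
    retraction of \<open>\<iota>2\<close> and a section of \<open>\<pi>1\<close> read off the
    induced maps.\<close>
  define \<phi> where "\<phi> n = r2 n \<bullet> \<phi>' n \<bullet> \<iota>1 n" for n
  define \<phi>'' where "\<phi>'' n = \<pi>2 n \<bullet> \<phi>' n \<bullet> s1 n" for n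
  have ty: "hm (trm R1 n) (trm R2 n) (\<phi> n)" "hm (trm R1'' n) (trm R2'' n) (\<phi>'' n)" for n
    unfolding \<phi>_def \<phi>''_def using B1(1-4)[of n] B2(1-4)[of n] P'(1)[of n] by simp_all
  have c\<iota>: "\<phi>' n \<bullet> \<iota>1 n = \<iota>2 n \<bullet> \<phi> n" for n
  proof -
    have "\<phi>' n \<bullet> \<iota>1 n = (\<iota>2 n \<bullet> r2 n \<boxplus> s2 n \<bullet> \<pi>2 n) \<bullet> \<phi>' n \<bullet> \<iota>1 n"
      unfolding B2(9) using P'(1)[of n] B1(1)[of n] by simp
    then show ?thesis unfolding \<phi>_def using z[of n] B2(1-4)[of n] P'(1)[of n] B1(1)[of n] by simp
  qed
  have c\<pi>: "\<phi>'' n \<bullet> \<pi>1 n = \<pi>2 n \<bullet> \<phi>' n" for n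
    unfolding \<phi>''_def using bip_factor[OF b1[of n], of "trm R2'' n" "\<pi>2 n \<bullet> \<phi>' n"] z[of n] P'(1)[of n] B2(4)[of n] by simp
  have "lft R1 R2 a \<phi>" unfolding lft_def
  proof (intro conjI allI)
    have "x2 \<bullet> aug R2 \<bullet> \<phi> 0 = aug R2' \<bullet> \<iota>2 0 \<bullet> \<phi> 0" using re[OF I2(2), of "\<phi> 0"] by simp
    also have "\<dots> = b \<bullet> aug R1' \<bullet> \<iota>1 0" unfolding c\<iota>[symmetric] using re[OF P'(2), of "\<iota>1 0"] by simp
    also have "\<dots> = x2 \<bullet> a \<bullet> aug R1" using I1(2) re[OF m(4), of "aug R1"] by simp
    finally have e: "x2 \<bullet> (aug R2 \<bullet> \<phi> 0 \<boxplus> \<boxminus> (a \<bullet> aug R1)) = zr False (trm R1 0) B2"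
      using E2 m(1) cpxD(5)[OF c1(1)] by simp
    \<comment> \<open>Only the equality after \<open>x2\<close> is known, and \<open>x2\<close> need
      not be a monomorphism; it is injective on maps from \<open>trm R1 0\<close> by the
      compatibility of \<open>\<V>\<close> with \<open>\<W>\<close>.\<close>
    have "cov (trm R1 0) A2 B2 C2 x2 y2" using cm T2 res_trm[OF D1(1)] unfolding cmpw_def by blast
    then have "aug R2 \<bullet> \<phi> 0 \<boxplus> \<boxminus> (a \<bullet> aug R1) = zr False (trm R1 0) A2"
      by (rule cov_inj[OF _ _ e]) (use m(1) cpxD(5)[OF c1(1)] cpxD(5)[OF c2(1)] ty(1)[of 0] in simp)
    then show "aug R2 \<bullet> \<phi> 0 = a \<bullet> aug R1"
      by (rule sub_zr) (use m(1) cpxD(5)[OF c1(1)] cpxD(5)[OF c2(1)] ty(1)[of 0] in simp_all)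
  next
    fix n
    have "\<iota>2 n \<bullet> diff R2 n \<bullet> \<phi> (Suc n) = diff R2' n \<bullet> \<phi>' (Suc n) \<bullet> \<iota>1 (Suc n)"
      unfolding c\<iota> using re[OF I2(3)[of n], of "\<phi> (Suc n)"] by simp
    also have "\<dots> = \<phi>' n \<bullet> \<iota>1 n \<bullet> diff R1 n" using re[OF P'(3)[of n], of "\<iota>1 (Suc n)"] I1(3)[of n] by simp
    also have "\<dots> = \<iota>2 n \<bullet> \<phi> n \<bullet> diff R1 n" using re[OF c\<iota>[of n], of "diff R1 n"] by simp
    finally have e: "r2 n \<bullet> \<iota>2 n \<bullet> diff R2 n \<bullet> \<phi> (Suc n) = r2 n \<bullet> \<iota>2 n \<bullet> \<phi> n \<bullet> diff R1 n" by simp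
    have cancel: "r2 n \<bullet> \<iota>2 n \<bullet> u = u" if "val u" "tgt u = trm R2 n" for u
      using re[OF B2(5)[of n], of u] that by simp
    show "diff R2 n \<bullet> \<phi> (Suc n) = \<phi> n \<bullet> diff R1 n"
      using e cancel[of "diff R2 n \<bullet> \<phi> (Suc n)"] cancel[of "\<phi> n \<bullet> diff R1 n"] ty(1)[of n] ty(1)[of "Suc n"]
        cpxD(3)[OF c1(1), of n] cpxD(3)[OF c2(1), of n] by simp
  qed (use ty cpxD(2)[OF c1(1)] cpxD(2)[OF c2(1)] in simp_all)
  moreover have "lft R1'' R2'' c \<phi>''" unfolding lft_def
  proof (intro conjI allI)
    show "aug R2'' \<bullet> \<phi>'' 0 = c \<bullet> aug R1''"
    proof (rule bip_epi[OF b1[of 0], where N = C2])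
      show "(aug R2'' \<bullet> \<phi>'' 0) \<bullet> \<pi>1 0 = (c \<bullet> aug R1'') \<bullet> \<pi>1 0"
        using c\<pi>[of 0] re[OF Q2(2), of "\<phi>' 0"] P'(2) re[OF m(5), of "aug R1'"] Q1(2) by simp
    qed (use m(3) cpxD(5)[OF c1(3)] cpxD(5)[OF c2(3)] ty(2)[of 0] in simp_all)
  next
    fix n
    show "diff R2'' n \<bullet> \<phi>'' (Suc n) = \<phi>'' n \<bullet> diff R1'' n"
    proof (rule bip_epi[OF b1[of "Suc n"], where N = "trm R2'' n"])
      show "(diff R2'' n \<bullet> \<phi>'' (Suc n)) \<bullet> \<pi>1 (Suc n) = (\<phi>'' n \<bullet> diff R1'' n) \<bullet> \<pi>1 (Suc n)"
        using c\<pi>[of "Suc n"] re[OF Q2(3)[of n], of "\<phi>' (Suc n)"] P'(3)[of n] Q1(3)[of n] re[OF c\<pi>[of n], of "diff R1' n"]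
        by simp
    qed (use cpxD(3)[OF c1(3), of n] cpxD(3)[OF c2(3), of n] ty(2)[of n] ty(2)[of "Suc n"] in simp_all)
  qed (use ty cpxD(2)[OF c1(3)] cpxD(2)[OF c2(3)] in simp_all)
  ultimately show ?thesis using l' c\<iota> c\<pi> by blast
qed

text \<open>Strict lifts carry the zigzag of the second horseshoe to one of the first. The
  prescribed lifts \<open>\<phi>\<close> and \<open>\<psi>\<close> differ from the strict ones by
  homotopies, which classes do not see. The classes \<open>\<V>\<close> and \<open>\<W>\<close>
  differ only in the comparison with ordinary cohomology.\<close>

lemma connecting_natural:
  assumes H1: "hshoe \<V> A1 B1 C1 x1 y1 R1 R1' R1'' \<iota>1 \<pi>1"
    and H2: "hshoe \<W> A2 B2 C2 x2 y2 R2 R2' R2'' \<iota>2 \<pi>2"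
    and T1: "exi A1 B1 C1 x1 y1 d1" and T2: "th \<W> A2 B2 C2 x2 y2 d2" and cm: "cmpw \<V> \<W>"
    and m: "hm A1 A2 a" "hm B1 B2 b" "hm C1 C2 c" "b \<bullet> x1 = x2 \<bullet> a" "y2 \<bullet> b = c \<bullet> y1"
    and l: "lft R1 R2 a \<phi>" "lft R1'' R2'' c \<psi>"
    and d: "cdat R1 R1' R1'' \<iota>1 \<pi>1 N n z1 w1 v1" "cdat R2 R2' R2'' \<iota>2 \<pi>2 N n z2 w2 v2"
    and e: "eqc R1 N n z1 (z2 \<bullet> \<phi> n)"
  shows "eqc R1'' N (Suc n) v1 (v2 \<bullet> \<psi> (Suc n))"
proof -
  note c1 = hshoe_cpx[OF H1] and c2 = hshoe_cpx[OF H2]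
  have ac: "acy (trm R1 n) A2 R2" for n by (rule res_acy_cmpw[OF hshoeD(1)[OF H2] cm res_trm[OF hshoeD(1)[OF H1]]])
  have ac'': "acy (trm R1'' n) C2 R2''" for n by (rule res_acy_cmpw[OF hshoeD(3)[OF H2] cm res_trm[OF hshoeD(3)[OF H1]]])
  obtain f f' f'' where L: "lft R1 R2 a f" "lft R1' R2' b f'" "lft R1'' R2'' c f''"
    and C: "\<And>n. f' n \<bullet> \<iota>1 n = \<iota>2 n \<bullet> f n" "\<And>n. f'' n \<bullet> \<pi>1 n = \<pi>2 n \<bullet> f' n"
    using strict_lft[OF H1 H2 T1 T2 cm m] by blast
  note D = cdatD[OF d(2)]
  have d': "cdat R1 R1' R1'' \<iota>1 \<pi>1 N n (z2 \<bullet> f n) (w2 \<bullet> f' n) (v2 \<bullet> f'' (Suc n))"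
    unfolding cdat_def
  proof (intro conjI)
    show "cyc R1 N n (z2 \<bullet> f n)" by (rule cyc_pull[OF c1(1) L(1) D(1)])
    show "(w2 \<bullet> f' n) \<bullet> \<iota>1 n = z2 \<bullet> f n" using C(1)[of n] re[OF D(3), of "f n"] by simp
    show "(v2 \<bullet> f'' (Suc n)) \<bullet> \<pi>1 (Suc n) = (w2 \<bullet> f' n) \<bullet> diff R1' n"
      using C(2)[of "Suc n"] re[OF D(5), of "f' (Suc n)"] lftD(3)[OF L(2), of n] by simp
  qed (use D lftD(1)[OF L(2), of n] lftD(1)[OF L(3), of "Suc n"] in simp_all)
  have "eqc R1 N n z1 (z2 \<bullet> f n)"
    by (rule eqc_trans[OF c1(1) e eqc_lft[OF c1(1) c2(1) ac m(1) l(1) L(1) D(1)]])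
  then have "eqc R1'' N (Suc n) v1 (v2 \<bullet> f'' (Suc n))" by (rule cdat_eqc[OF H1 d(1) d'])
  then show ?thesis
    by (rule eqc_trans[OF c1(3) _ eqc_lft[OF c1(3) c2(3) ac'' m(3) L(3) l(2) cdat_cyc[OF H2 d(2)]]])
qed

lemma res_acy_self: "res \<W> M S \<Longrightarrow> res \<W> A R \<Longrightarrow> acy (trm R n) M S"
  by (rule res_acy_cmpw[OF _ cmpw_refl res_trm])

lemma hshoe_self:
  assumes H: "hshoe \<W> A B C x y R R' R'' \<iota> \<pi>"
  shows "acy (trm R n) A R" "acy (trm R n) B R'" "acy (trm R n) C R''"
    "acy (trm R' n) B R'" "acy (trm R' n) C R''" "acy (trm R'' n) C R''"
  by (rule res_acy_self; rule hshoeD[OF H])+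

section \<open>Exactness with an arbitrary resolution of the middle term\<close>

context
  fixes \<W> A B C x y d R R' R'' \<iota> \<pi> S N \<phi> \<psi>
  assumes T: "th \<W> A B C x y d" and H: "hshoe \<W> A B C x y R R' R'' \<iota> \<pi>" and S: "res \<W> B S" and N: "ob N"
    and \<phi>: "lft R S x \<phi>" and \<psi>: "lft S R'' y \<psi>"
begin

lemma les_ac:
  "cpx B S" "acy (trm R n) B S" "acy (trm S n) B S" "acy (trm S n) B R'" "acy (trm R' n) B S" "acy (trm S n) C R''"
  by (rule res_cpx[OF S]) (rule res_acy_self; rule S hshoeD[OF H])+

text \<open>\<open>S\<close> is an arbitrary resolution of the middle term, which need not be part of a horseshoe.\<close>

definition mutual_lifts :: "(nat \<Rightarrow> 'b) \<Rightarrow> (nat \<Rightarrow> 'b) \<Rightarrow> bool" where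
  "mutual_lifts \<alpha> \<beta> \<longleftrightarrow> lft S R' (idn B) \<alpha> \<and> lft R' S (idn B) \<beta> \<and>
    (\<forall>n z. cyc S N n z \<longrightarrow> eqc S N n (z \<bullet> \<beta> n \<bullet> \<alpha> n) z) \<and>
    (\<forall>n z. cyc S N n z \<longrightarrow> eqc R N n (z \<bullet> \<beta> n \<bullet> \<iota> n) (z \<bullet> \<phi> n)) \<and>
    (\<forall>n z. cyc R' N n z \<longrightarrow> eqc R N n (z \<bullet> \<alpha> n \<bullet> \<phi> n) (z \<bullet> \<iota> n)) \<and>
    (\<forall>n v. cyc R'' N n v \<longrightarrow> eqc S N n (v \<bullet> \<pi> n \<bullet> \<alpha> n) (v \<bullet> \<psi> n)) \<and>
    (\<forall>n v. cyc R'' N n v \<longrightarrow> eqc R' N n (v \<bullet> \<psi> n \<bullet> \<beta> n) (v \<bullet> \<pi> n))"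

lemma mutual_liftsD:
  assumes "mutual_lifts \<alpha> \<beta>"
  shows "lft S R' (idn B) \<alpha>" "lft R' S (idn B) \<beta>"
    "\<And>n z. cyc S N n z \<Longrightarrow> eqc S N n (z \<bullet> \<beta> n \<bullet> \<alpha> n) z"
    "\<And>n z. cyc S N n z \<Longrightarrow> eqc R N n (z \<bullet> \<beta> n \<bullet> \<iota> n) (z \<bullet> \<phi> n)"
    "\<And>n z. cyc R' N n z \<Longrightarrow> eqc R N n (z \<bullet> \<alpha> n \<bullet> \<phi> n) (z \<bullet> \<iota> n)"
    "\<And>n v. cyc R'' N n v \<Longrightarrow> eqc S N n (v \<bullet> \<pi> n \<bullet> \<alpha> n) (v \<bullet> \<psi> n)"
    "\<And>n v. cyc R'' N n v \<Longrightarrow> eqc R' N n (v \<bullet> \<psi> n \<bullet> \<beta> n) (v \<bullet> \<pi> n)"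
  using assms unfolding mutual_lifts_def by blast+

text \<open>Each of the five congruences compares two chain maps that lift the same morphism, so
  \<open>eqc_lft\<close> applies to all of them.\<close>

lemma mutual_lifts_ex: "\<exists>\<alpha> \<beta>. mutual_lifts \<alpha> \<beta>"
proof -
  note c = hshoe_cpx[OF H] and D = hshoeD[OF H] and E = conjunct1[OF thD(1)[OF T]]
  have i: "hm B B (idn B)" and x: "hm A B x" and y: "hm B C y" using E by simp_all
  obtain \<alpha> where a: "lft S R' (idn B) \<alpha>" using lft_ex[OF les_ac(1) c(2) les_ac(4) i] by blast
  obtain \<beta> where b: "lft R' S (idn B) \<beta>" using lft_ex[OF c(2) les_ac(1,5) i] by blast
  have 1: "lft S S (idn B) (\<lambda>n. \<beta> n \<bullet> \<alpha> n)" using lft_cmp[OF a b] i by simp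
  have 2: "lft R S x (\<lambda>n. \<beta> n \<bullet> \<iota> n)" using lft_cmp[OF D(4) b] x by simp
  have 3: "lft R R' x (\<lambda>n. \<alpha> n \<bullet> \<phi> n)" using lft_cmp[OF \<phi> a] x by simp
  have 4: "lft S R'' y (\<lambda>n. \<pi> n \<bullet> \<alpha> n)" using lft_cmp[OF a D(5)] y by simp
  have 5: "lft R' R'' y (\<lambda>n. \<psi> n \<bullet> \<beta> n)" using lft_cmp[OF b \<psi>] y by simp
  show ?thesis unfolding mutual_lifts_def
  proof (intro exI conjI allI impI, rule a, rule b)
    show "eqc S N n (z \<bullet> \<beta> n \<bullet> \<alpha> n) z" if "cyc S N n z" for n z
      using eqc_lft[OF les_ac(1,1,3) i 1 lft_id[OF les_ac(1)] that] cycD(1)[OF that] by simp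
  qed (rule eqc_lft[OF c(1) les_ac(1,2) x 2 \<phi>] eqc_lft[OF c(1,2) hshoe_self(2)[OF H] x 3 D(4)]
      eqc_lft[OF les_ac(1) c(3) les_ac(6) y 4 \<psi>] eqc_lft[OF c(2,3) hshoe_self(5)[OF H] y 5 D(5)]; assumption)+
qed

lemma les_mid1:
  assumes v: "cyc R'' N n v" shows "cob R N n (v \<bullet> \<psi> n \<bullet> \<phi> n)"
proof -
  have "y \<bullet> x = zr False A C" using tri_zero(1) thD(1)[OF T] by blast
  then have "lft R R'' (zr False A C) (\<lambda>n. \<psi> n \<bullet> \<phi> n)" using lft_cmp[OF \<phi> \<psi>] by simp
  then show ?thesis by (rule null_cob[OF hshoe_cpx(1,3)[OF H] hshoe_self(3)[OF H] _ v])
qed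

text \<open>Move \<open>z\<close> to the horseshoe along \<open>\<beta>\<close>. Its restriction to
  \<open>R\<close> is a coboundary; subtracting an extension of it leaves a cocycle that factors
  through \<open>\<pi>\<close>, and \<open>\<alpha>\<close> brings the congruence back to
  \<open>S\<close>.\<close>

lemma les_mid2:
  assumes z: "cyc S N n z" and k: "cob R N n (z \<bullet> \<phi> n)"
  shows "\<exists>v. cyc R'' N n v \<and> eqc S N n z (v \<bullet> \<psi> n)"
proof -
  obtain \<alpha> \<beta> where "mutual_lifts \<alpha> \<beta>" using mutual_lifts_ex by blast
  note M = mutual_liftsD[OF this]
  note c = hshoe_cpx[OF H] and D = hshoeD[OF H]
  have "eqc R N n (z \<bullet> \<phi> n) (zr False (trm R n) N)" using eqc_cob[OF c(1) N] k by blast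
  then have "cob R N n (z \<bullet> \<beta> n \<bullet> \<iota> n)" using eqc_trans[OF c(1) M(4)[OF z]] eqc_cob[OF c(1) N] by blast
  then obtain u where u: "cob R' N n u" "u \<bullet> \<iota> n = z \<bullet> \<beta> n \<bullet> \<iota> n" by (rule cob_extend[OF H N])
  note uc = cob_cyc[OF c(2) N u(1)]
  have zb: "cyc R' N n (z \<bullet> \<beta> n)" by (rule cyc_pull[OF c(2) M(2) z])
  let ?w = "z \<bullet> \<beta> n \<boxplus> \<boxminus> u"
  have w: "cyc R' N n ?w" by (rule cyc_add[OF c(2) zb cyc_neg[OF c(2) uc]])
  have "?w \<bullet> \<iota> n = zr False (trm R n) N"
    using u(2) cycD(1)[OF z] lftD(1)[OF D(4), of n] lftD(1)[OF M(2), of n] by simp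
  then obtain v where v: "hm (trm R'' n) N v" "v \<bullet> \<pi> n = ?w" by (rule hshoe_factor[OF H cycD(1)[OF w]])
  have vc: "cyc R'' N n v" unfolding cyc_def
  proof (intro conjI)
    show "v \<bullet> diff R'' n = zr False (trm R'' (Suc n)) N"
    proof (rule hshoe_epi[OF H, where N = N])
      show "(v \<bullet> diff R'' n) \<bullet> \<pi> (Suc n) = zr False (trm R'' (Suc n)) N \<bullet> \<pi> (Suc n)"
        using lftD(3)[OF D(5), of n] re[OF v(2), of "diff R' n"] cycD(2)[OF w] lftD(1)[OF D(5), of "Suc n"] N by simp
    qed (use v(1) cpxD(2,3)[OF c(3)] in simp_all)
  qed (use v(1) in simp_all)
  have "eqc R' N n ?w (z \<bullet> \<beta> n)" by (rule eqc_sub[OF c(2) N cycD(1)[OF zb] u(1)])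
  from eqc_pull[OF les_ac(1) M(1) this] have "eqc S N n (?w \<bullet> \<alpha> n) (z \<bullet> \<beta> n \<bullet> \<alpha> n)" by simp
  then have "eqc S N n (v \<bullet> \<pi> n \<bullet> \<alpha> n) (z \<bullet> \<beta> n \<bullet> \<alpha> n)" using re[OF v(2), of "\<alpha> n"] by simp
  then have "eqc S N n z (v \<bullet> \<psi> n)"
    using eqc_trans[OF les_ac(1)] eqc_sym[OF les_ac(1)] M(3)[OF z] M(6)[OF vc] by blast
  then show ?thesis using vc by blast
qed

text \<open>Transported to the horseshoe, \<open>z\<close> is a cocycle that serves as the extension
  of its own restriction; the zigzag of that restriction ends in zero.\<close>

lemma les_left1:
  assumes z: "cyc S N n z" and d: "cdat R R' R'' \<iota> \<pi> N n z' w v" and e: "eqc R N n z' (z \<bullet> \<phi> n)"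
  shows "cob R'' N (Suc n) v"
proof -
  obtain \<alpha> \<beta> where "mutual_lifts \<alpha> \<beta>" using mutual_lifts_ex by blast
  note M = mutual_liftsD[OF this]
  note c = hshoe_cpx[OF H] and D = hshoeD[OF H]
  have zb: "cyc R' N n (z \<bullet> \<beta> n)" by (rule cyc_pull[OF c(2) M(2) z])
  have "cdat R R' R'' \<iota> \<pi> N n ((z \<bullet> \<beta> n) \<bullet> \<iota> n) (z \<bullet> \<beta> n) (zr False (trm R'' (Suc n)) N)"
    unfolding cdat_def using cyc_pull[OF c(1) D(4) zb] cycD[OF zb] N cpxD(2)[OF c(3)] lftD(1)[OF D(5), of "Suc n"]
    by simp
  moreover have "eqc R N n z' ((z \<bullet> \<beta> n) \<bullet> \<iota> n)"
    using eqc_trans[OF c(1) e eqc_sym[OF c(1) M(4)[OF z]]] by simp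
  ultimately have "eqc R'' N (Suc n) v (zr False (trm R'' (Suc n)) N)" by (rule cdat_eqc[OF H d])
  then show ?thesis using eqc_cob[OF c(3) N] by blast
qed

text \<open>If \<open>v\<close> is the coboundary of \<open>t\<close>, then \<open>w\<close> minus
  \<open>t \<bullet> \<pi> n\<close> is a cocycle with the same restriction \<open>z\<close>,
  because \<open>\<pi>\<close> kills the subcomplex. Its image under \<open>\<alpha>\<close> is the
  preimage.\<close>

lemma les_left2:
  assumes d: "cdat R R' R'' \<iota> \<pi> N n z w v" and k: "cob R'' N (Suc n) v"
  shows "\<exists>z'. cyc S N n z' \<and> eqc R N n z (z' \<bullet> \<phi> n)"
proof -
  obtain \<alpha> \<beta> where "mutual_lifts \<alpha> \<beta>" using mutual_lifts_ex by blast
  note M = mutual_liftsD[OF this]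
  note c = hshoe_cpx[OF H] and D = hshoeD[OF H] and d = cdatD[OF d]
  obtain t where t: "hm (trm R'' n) N t" "v = t \<bullet> diff R'' n" using k by auto
  let ?w = "w \<boxplus> \<boxminus> (t \<bullet> \<pi> n)"
  have w: "cyc R' N n ?w" unfolding cyc_def
    using d(2,5) t lftD(1)[OF D(5), of n] lftD(3)[OF D(5), of n] cpxD(2,3)[OF c(2)] by simp
  obtain s r where b: "\<And>n. bip (trm R n) (trm R'' n) (trm R' n) (\<iota> n) (s n) (r n) (\<pi> n)" using hshoe_bip[OF H] by blast
  have w\<iota>: "?w \<bullet> \<iota> n = z" using d(3) cycD(1)[OF d(1)] bipD(7)[OF b, of n] t(1) cpxD(2)[OF c(1)] by simp
  have z': "cyc S N n (?w \<bullet> \<alpha> n)" by (rule cyc_pull[OF les_ac(1) M(1) w])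
  have "eqc R N n z (?w \<bullet> \<alpha> n \<bullet> \<phi> n)" using eqc_sym[OF c(1) M(5)[OF w]] unfolding w\<iota> by simp
  then have "eqc R N n z ((?w \<bullet> \<alpha> n) \<bullet> \<phi> n)" by simp
  then show ?thesis using z' by blast
qed

lemma les_right1:
  assumes d: "cdat R R' R'' \<iota> \<pi> N n z w v"
  shows "cob S N (Suc n) (v \<bullet> \<psi> (Suc n))"
proof -
  obtain \<alpha> \<beta> where "mutual_lifts \<alpha> \<beta>" using mutual_lifts_ex by blast
  note M = mutual_liftsD[OF this]
  note vc = cdat_cyc[OF H d] and d = cdatD[OF d]
  have "v \<bullet> \<pi> (Suc n) \<bullet> \<alpha> (Suc n) = (w \<bullet> \<alpha> n) \<bullet> diff S n"
    using re[OF d(5), of "\<alpha> (Suc n)"] lftD(3)[OF M(1), of n] by simp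
  then have "cob S N (Suc n) (v \<bullet> \<pi> (Suc n) \<bullet> \<alpha> (Suc n))"
    using d(2) lftD(1)[OF M(1), of n] by (auto intro!: exI[of _ "w \<bullet> \<alpha> n"])
  then show ?thesis
    using eqc_trans[OF les_ac(1) eqc_sym[OF les_ac(1) M(6)[OF vc]]] eqc_cob[OF les_ac(1) N] by blast
qed

lemma cob_pi:
  assumes v: "cyc R'' N n v" and k: "cob S N n (v \<bullet> \<psi> n)" shows "cob R' N n (v \<bullet> \<pi> n)"
proof -
  obtain \<alpha> \<beta> where "mutual_lifts \<alpha> \<beta>" using mutual_lifts_ex by blast
  note M = mutual_liftsD[OF this]
  note c = hshoe_cpx[OF H]
  have "cob R' N n (v \<bullet> \<psi> n \<bullet> \<beta> n)" using cob_pull[OF c(2) N M(2) k] by simp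
  then show ?thesis using eqc_trans[OF c(2) eqc_sym[OF c(2) M(7)[OF v]]] eqc_cob[OF c(2) N] by blast
qed

text \<open>A cochain \<open>w\<close> that bounds \<open>v \<bullet> \<pi> (Suc n)\<close> is
  already the middle of a zigzag: its restriction to \<open>R\<close> is a cocycle since
  \<open>\<pi>\<close> kills the subcomplex.\<close>

lemma les_right2:
  assumes v: "cyc R'' N (Suc n) v" and k: "cob S N (Suc n) (v \<bullet> \<psi> (Suc n))"
  shows "\<exists>z w. cdat R R' R'' \<iota> \<pi> N n z w v"
proof -
  note c = hshoe_cpx[OF H] and D = hshoeD[OF H]
  obtain w where w: "hm (trm R' n) N w" "v \<bullet> \<pi> (Suc n) = w \<bullet> diff R' n" using cob_pi[OF v k] by auto
  obtain s r where b: "\<And>n. bip (trm R n) (trm R'' n) (trm R' n) (\<iota> n) (s n) (r n) (\<pi> n)" using hshoe_bip[OF H] by blast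
  have "(w \<bullet> \<iota> n) \<bullet> diff R n = v \<bullet> \<pi> (Suc n) \<bullet> \<iota> (Suc n)"
    using lftD(3)[OF D(4), of n] re[OF w(2), of "\<iota> (Suc n)"] by simp
  also have "\<dots> = zr False (trm R (Suc n)) N" using bipD(7)[OF b, of "Suc n"] cycD(1)[OF v] cpxD(2)[OF c(1)] by simp
  finally have "cyc R N n (w \<bullet> \<iota> n)" unfolding cyc_def using w(1) lftD(1)[OF D(4), of n] by simp
  then show ?thesis unfolding cdat_def using w cycD(1)[OF v] by blast
qed

text \<open>Zero is the only coboundary in degree 0, and \<open>\<pi> 0\<close> is a split
  epimorphism.\<close>

lemma les_inj:
  assumes v: "cyc R'' N 0 v" and k: "cob S N 0 (v \<bullet> \<psi> 0)"
  shows "cob R'' N 0 v"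
proof -
  have "v \<bullet> \<pi> 0 = zr False (trm R' 0) N" using cob_pi[OF v k] by simp
  then show ?thesis unfolding cob.simps
    by (intro hshoe_epi[OF H cycD(1)[OF v]])
      (use N lftD(1)[OF hshoeD(5)[OF H], of 0] cpxD(2)[OF hshoe_cpx(3)[OF H]] in simp_all)
qed

end

end

section \<open>The arrows of an extriangulated category\<close>

text \<open>Incompatible compositions and sums are \<open>Und\<close>, which makes associativity and distributivity unconditional.\<close>

datatype ('o, 'm, 'e) arrow = Hm 'o 'm 'o | Ex 'o 'e 'o | Und

primrec ar_src :: "('o, 'm, 'e) arrow \<Rightarrow> 'o" where
  "ar_src (Hm A f B) = A" | "ar_src (Ex C \<delta> A) = C" | "ar_src Und = undefined"

primrec ar_tgt :: "('o, 'm, 'e) arrow \<Rightarrow> 'o" where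
  "ar_tgt (Hm A f B) = B" | "ar_tgt (Ex C \<delta> A) = A" | "ar_tgt Und = undefined"

primrec ar_ext :: "('o, 'm, 'e) arrow \<Rightarrow> bool" where
  "ar_ext (Hm A f B) = False" | "ar_ext (Ex C \<delta> A) = True" | "ar_ext Und = False"

context
  fixes X :: "('o, 'm, 'e, 'z) extricat_scheme" (structure)
begin

primrec ar_val :: "('o, 'm, 'e) arrow \<Rightarrow> bool" where
  "ar_val (Hm A f B) \<longleftrightarrow> A \<in> Obj X \<and> B \<in> Obj X \<and> f \<in> Mor X A B"
| "ar_val (Ex C \<delta> A) \<longleftrightarrow> C \<in> Obj X \<and> A \<in> Obj X \<and> \<delta> \<in> carrier (Ext X C A)"
| "ar_val Und \<longleftrightarrow> False"

fun ar_mul :: "('o, 'm, 'e) arrow \<Rightarrow> ('o, 'm, 'e) arrow \<Rightarrow> ('o, 'm, 'e) arrow" where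
  "ar_mul (Hm B g C) (Hm A f B') =
     (if ar_val (Hm B g C) \<and> ar_val (Hm A f B') \<and> B = B' then Hm A (g \<cdot> f) C else Und)"
| "ar_mul (Hm A a A') (Ex C \<delta> A'') =
     (if ar_val (Hm A a A') \<and> ar_val (Ex C \<delta> A'') \<and> A = A'' then Ex C (push X C a \<delta>) A' else Und)"
| "ar_mul (Ex C \<delta> A) (Hm C' c C'') =
     (if ar_val (Ex C \<delta> A) \<and> ar_val (Hm C' c C'') \<and> C = C'' then Ex C' (pull X A c \<delta>) A else Und)"
| "ar_mul _ _ = Und"

fun ar_add :: "('o, 'm, 'e) arrow \<Rightarrow> ('o, 'm, 'e) arrow \<Rightarrow> ('o, 'm, 'e) arrow" where
  "ar_add (Hm A f B) (Hm A' g B') =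
     (if ar_val (Hm A f B) \<and> ar_val (Hm A' g B') \<and> A = A' \<and> B = B' then Hm A (f \<otimes>\<^bsub>Hom X A B\<^esub> g) B else Und)"
| "ar_add (Ex A f B) (Ex A' g B') =
     (if ar_val (Ex A f B) \<and> ar_val (Ex A' g B') \<and> A = A' \<and> B = B' then Ex A (f \<otimes>\<^bsub>Ext X A B\<^esub> g) B else Und)"
| "ar_add _ _ = Und"

fun ar_neg :: "('o, 'm, 'e) arrow \<Rightarrow> ('o, 'm, 'e) arrow" where
  "ar_neg (Hm A f B) = (if ar_val (Hm A f B) then Hm A (inv\<^bsub>Hom X A B\<^esub> f) B else Und)"
| "ar_neg (Ex A f B) = (if ar_val (Ex A f B) then Ex A (inv\<^bsub>Ext X A B\<^esub> f) B else Und)"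
| "ar_neg Und = Und"

definition ar_idn :: "'o \<Rightarrow> ('o, 'm, 'e) arrow" where
  "ar_idn A = Hm A (Idm X A) A"

definition ar_zr :: "bool \<Rightarrow> 'o \<Rightarrow> 'o \<Rightarrow> ('o, 'm, 'e) arrow" where
  "ar_zr e A B = (if e then Ex A \<one>\<^bsub>Ext X A B\<^esub> B else Hm A \<one>\<^bsub>Hom X A B\<^esub> B)"

definition ar_tri :: "('o, 'm, 'e) arrow \<Rightarrow> ('o, 'm, 'e) arrow \<Rightarrow> ('o, 'm, 'e) arrow \<Rightarrow> bool" where
  "ar_tri a b c \<longleftrightarrow> (\<exists>A B C x y \<delta>. a = Hm A x B \<and> b = Hm B y C \<and> c = Ex C \<delta> A \<and> etri X (A, B, C, x, y, \<delta>))"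

end

context extriangulated_category
begin

section \<open>Group laws for morphisms and extensions\<close>

lemma hom_group [simp]: "A \<in> Obj X \<Longrightarrow> B \<in> Obj X \<Longrightarrow> group (Hom X A B)"
  and ext_group [simp]: "A \<in> Obj X \<Longrightarrow> B \<in> Obj X \<Longrightarrow> group (Ext X A B)"
  using hom_comm_group ext_comm_group by (auto simp: comm_group_def)

lemma hom_closed [simp]:
  assumes "A \<in> Obj X" "B \<in> Obj X"
  shows "\<one>\<^bsub>Hom X A B\<^esub> \<in> Mor X A B" "f \<in> Mor X A B \<Longrightarrow> inv\<^bsub>Hom X A B\<^esub> f \<in> Mor X A B"
    "f \<in> Mor X A B \<Longrightarrow> g \<in> Mor X A B \<Longrightarrow> f \<otimes>\<^bsub>Hom X A B\<^esub> g \<in> Mor X A B"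
proof -
  interpret comm_group "Hom X A B" by (rule hom_comm_group[OF assms])
  show "\<one>\<^bsub>Hom X A B\<^esub> \<in> Mor X A B" "f \<in> Mor X A B \<Longrightarrow> inv\<^bsub>Hom X A B\<^esub> f \<in> Mor X A B"
    "f \<in> Mor X A B \<Longrightarrow> g \<in> Mor X A B \<Longrightarrow> f \<otimes>\<^bsub>Hom X A B\<^esub> g \<in> Mor X A B" by auto
qed

lemma ext_closed [simp]:
  assumes "A \<in> Obj X" "B \<in> Obj X"
  shows "\<one>\<^bsub>Ext X A B\<^esub> \<in> carrier (Ext X A B)" "f \<in> carrier (Ext X A B) \<Longrightarrow> inv\<^bsub>Ext X A B\<^esub> f \<in> carrier (Ext X A B)"
    "f \<in> carrier (Ext X A B) \<Longrightarrow> g \<in> carrier (Ext X A B) \<Longrightarrow> f \<otimes>\<^bsub>Ext X A B\<^esub> g \<in> carrier (Ext X A B)"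
proof -
  interpret comm_group "Ext X A B" by (rule ext_comm_group[OF assms(2,1)])
  show "\<one>\<^bsub>Ext X A B\<^esub> \<in> carrier (Ext X A B)" "f \<in> carrier (Ext X A B) \<Longrightarrow> inv\<^bsub>Ext X A B\<^esub> f \<in> carrier (Ext X A B)"
    "f \<in> carrier (Ext X A B) \<Longrightarrow> g \<in> carrier (Ext X A B) \<Longrightarrow> f \<otimes>\<^bsub>Ext X A B\<^esub> g \<in> carrier (Ext X A B)" by auto
qed

lemma extmap_closed:
  assumes "A \<in> Obj X" "A' \<in> Obj X" "C \<in> Obj X" "C' \<in> Obj X" "a \<in> Mor X A A'" "c \<in> Mor X C' C"
    "\<delta> \<in> carrier (Ext X C A)"
  shows "ExtMap X c a \<delta> \<in> carrier (Ext X C' A')"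
  using hom_in_carrier[OF ext_map_hom[OF assms(1-6)] assms(7)] .

lemma push_closed:
  "\<lbrakk>\<delta> \<in> carrier (Ext X C A); a \<in> Mor X A A'; A \<in> Obj X; A' \<in> Obj X; C \<in> Obj X\<rbrakk>
    \<Longrightarrow> push X C a \<delta> \<in> carrier (Ext X C A')"
  unfolding push_def by (rule extmap_closed) (auto intro: id_closed)

lemma pull_closed:
  "\<lbrakk>\<delta> \<in> carrier (Ext X C A); c \<in> Mor X C' C; A \<in> Obj X; C \<in> Obj X; C' \<in> Obj X\<rbrakk>
    \<Longrightarrow> pull X A c \<delta> \<in> carrier (Ext X C' A)"
  unfolding pull_def by (rule extmap_closed) (auto intro: id_closed)

lemma push_push:
  "\<lbrakk>\<delta> \<in> carrier (Ext X C A); a \<in> Mor X A A'; a' \<in> Mor X A' A''; A \<in> Obj X; A' \<in> Obj X; A'' \<in> Obj X; C \<in> Obj X\<rbrakk>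
    \<Longrightarrow> push X C (a' \<cdot> a) \<delta> = push X C a' (push X C a \<delta>)"
  unfolding push_def
  by (subst ext_map_cmp[symmetric, of A A' A'' C C C]) (auto intro: id_closed simp: id_left[OF _ _ id_closed])

lemma pull_pull:
  "\<lbrakk>\<delta> \<in> carrier (Ext X C A); c \<in> Mor X C' C; c' \<in> Mor X C'' C'; A \<in> Obj X; C \<in> Obj X; C' \<in> Obj X; C'' \<in> Obj X\<rbrakk>
    \<Longrightarrow> pull X A (c \<cdot> c') \<delta> = pull X A c' (pull X A c \<delta>)"
  unfolding pull_def
  by (subst ext_map_cmp[symmetric, of A A A C C' C'']) (auto intro: id_closed simp: id_left[OF _ _ id_closed])

lemma push_pull:
  "\<lbrakk>\<delta> \<in> carrier (Ext X C A); a \<in> Mor X A A'; c \<in> Mor X C' C; A \<in> Obj X; A' \<in> Obj X; C \<in> Obj X; C' \<in> Obj X\<rbrakk>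
    \<Longrightarrow> push X C' a (pull X A c \<delta>) = pull X A' c (push X C a \<delta>)"
  unfolding push_def pull_def
  using ext_map_cmp[of A A A' C C' C' "Idm X A" a c "Idm X C'" \<delta>] ext_map_cmp[of A A' A' C C C' a "Idm X A'" "Idm X C" c \<delta>]
  by (simp add: id_closed id_left[of A A'] id_left[of C' C] id_right[of A A'] id_right[of C' C])

lemma push_id: "\<lbrakk>\<delta> \<in> carrier (Ext X C A); A \<in> Obj X; C \<in> Obj X\<rbrakk> \<Longrightarrow> push X C (Idm X A) \<delta> = \<delta>"
  and pull_id: "\<lbrakk>\<delta> \<in> carrier (Ext X C A); A \<in> Obj X; C \<in> Obj X\<rbrakk> \<Longrightarrow> pull X A (Idm X C) \<delta> = \<delta>"
  unfolding push_def pull_def by (rule ext_map_id; assumption)+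

text \<open>Additivity of all products in either factor, put in the uniform form of group
  homomorphisms; distributivity and compatibility with inverses are then read off together.\<close>

lemma bihom:
  "\<lbrakk>g \<in> Mor X B C; A \<in> Obj X; B \<in> Obj X; C \<in> Obj X\<rbrakk> \<Longrightarrow> (\<lambda>f. g \<cdot> f) \<in> hom (Hom X A B) (Hom X A C)"
  "\<lbrakk>f \<in> Mor X A B; A \<in> Obj X; B \<in> Obj X; C \<in> Obj X\<rbrakk> \<Longrightarrow> (\<lambda>g. g \<cdot> f) \<in> hom (Hom X B C) (Hom X A C)"
  "\<lbrakk>a \<in> Mor X A A'; A \<in> Obj X; A' \<in> Obj X; C \<in> Obj X\<rbrakk> \<Longrightarrow> push X C a \<in> hom (Ext X C A) (Ext X C A')"
  "\<lbrakk>c \<in> Mor X C' C; A \<in> Obj X; C \<in> Obj X; C' \<in> Obj X\<rbrakk> \<Longrightarrow> pull X A c \<in> hom (Ext X C A) (Ext X C' A)"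
  "\<lbrakk>\<delta> \<in> carrier (Ext X C A); A \<in> Obj X; A' \<in> Obj X; C \<in> Obj X\<rbrakk> \<Longrightarrow> (\<lambda>a. push X C a \<delta>) \<in> hom (Hom X A A') (Ext X C A')"
  "\<lbrakk>\<delta> \<in> carrier (Ext X C A); A \<in> Obj X; C \<in> Obj X; C' \<in> Obj X\<rbrakk> \<Longrightarrow> (\<lambda>c. pull X A c \<delta>) \<in> hom (Hom X C' C) (Ext X C' A)"
proof goal_cases
  case 1 then show ?case by (auto intro!: homI cmp_add_right[of A B C] intro: cmp_closed)
next
  case 2 then show ?case by (auto intro!: homI cmp_add_left[of A B C] intro: cmp_closed)
next
  case 3 then show ?case using ext_map_hom[of A A' C C a "Idm X C"] id_closed unfolding push_def by (simp add: eta_contract_eq)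
next
  case 4 then show ?case using ext_map_hom[of A A C C' "Idm X A" c] id_closed unfolding pull_def by (simp add: eta_contract_eq)
next
  case 5 then show ?case
    by (intro homI push_closed[of \<delta> C A]) (auto simp: push_def intro!: ext_map_add_right[of A A' C C] id_closed)
next
  case 6 then show ?case
    by (intro homI pull_closed[of \<delta> C A]) (auto simp: pull_def intro!: ext_map_add_left[of A A C C'] id_closed)
qed

lemma grp_hom_inv: "\<lbrakk>h \<in> hom G H; group G; group H; x \<in> carrier G\<rbrakk> \<Longrightarrow> h (inv\<^bsub>G\<^esub> x) = inv\<^bsub>H\<^esub> (h x)"
  by (rule group_hom.hom_inv) (auto simp: group_hom_def group_hom_axioms_def)

lemmas bihom_mult = bihom[THEN hom_mult]
lemmas bihom_inv = bihom[THEN grp_hom_inv]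

section \<open>The arrow operations satisfy the calculus\<close>

lemma ar_val_mul:
  "ar_val X (ar_mul X g f) \<longleftrightarrow> ar_val X g \<and> ar_val X f \<and> ar_src g = ar_tgt f \<and> \<not> (ar_ext g \<and> ar_ext f)"
  by (cases g; cases f) (auto intro: cmp_closed push_closed pull_closed)

lemma ar_typ_mul:
  assumes "ar_val X (ar_mul X g f)"
  shows "ar_src (ar_mul X g f) = ar_src f" "ar_tgt (ar_mul X g f) = ar_tgt g"
    "ar_ext (ar_mul X g f) \<longleftrightarrow> ar_ext g \<or> ar_ext f"
  using assms by (cases g; cases f; auto split: if_splits)+

lemma ar_val_add:
  "ar_val X (ar_add X f g) \<longleftrightarrow> ar_val X f \<and> ar_val X g \<and> ar_src f = ar_src g \<and> ar_tgt f = ar_tgt g \<and> ar_ext f = ar_ext g"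
  by (cases g; cases f) auto

lemma ar_mul_und: "\<not> ar_val X (ar_mul X g f) \<Longrightarrow> ar_mul X g f = Und"
  by (cases g; cases f) (auto intro: cmp_closed push_closed pull_closed)

text \<open>A composable triple contains at most one extension, which leaves four patterns. With the
  extension in the middle, associativity is the commutation of pushout and pullback
  (\<open>push_pull\<close>).\<close>

lemma ar_mul_assoc_cases:
  "\<lbrakk>ar_val X (Hm C f D); ar_val X (Hm B g C); ar_val X (Hm A h B)\<rbrakk> \<Longrightarrow>
    ar_mul X (ar_mul X (Hm C f D) (Hm B g C)) (Hm A h B) = ar_mul X (Hm C f D) (ar_mul X (Hm B g C) (Hm A h B))"
  "\<lbrakk>ar_val X (Ex C \<delta> D); ar_val X (Hm B g C); ar_val X (Hm A h B)\<rbrakk> \<Longrightarrow>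
    ar_mul X (ar_mul X (Ex C \<delta> D) (Hm B g C)) (Hm A h B) = ar_mul X (Ex C \<delta> D) (ar_mul X (Hm B g C) (Hm A h B))"
  "\<lbrakk>ar_val X (Hm C f D); ar_val X (Ex B \<delta> C); ar_val X (Hm A h B)\<rbrakk> \<Longrightarrow>
    ar_mul X (ar_mul X (Hm C f D) (Ex B \<delta> C)) (Hm A h B) = ar_mul X (Hm C f D) (ar_mul X (Ex B \<delta> C) (Hm A h B))"
  "\<lbrakk>ar_val X (Hm C f D); ar_val X (Hm B g C); ar_val X (Ex A \<delta> B)\<rbrakk> \<Longrightarrow>
    ar_mul X (ar_mul X (Hm C f D) (Hm B g C)) (Ex A \<delta> B) = ar_mul X (Hm C f D) (ar_mul X (Hm B g C) (Ex A \<delta> B))"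
  by (simp_all add: cmp_closed[of A B C] cmp_closed[of B C D] cmp_closed[of A B D] cmp_closed[of A C D]
      cmp_assoc[of A B C D] push_closed[of _ A B] push_closed[of _ A C] push_closed[of _ B C] pull_closed[of _ C D]
      pull_closed[of _ B C] pull_closed[of _ B D] pull_pull[of _ C D _ B _ A] push_push[of _ A B _ C _ D] push_pull[of _ B C _ D _ A])

text \<open>One bracketing is defined exactly if the other is; otherwise both sides are
  \<open>Und\<close>.\<close>

lemma ar_mul_assoc: "ar_mul X (ar_mul X f g) h = ar_mul X f (ar_mul X g h)"
proof (cases "ar_val X (ar_mul X (ar_mul X f g) h)")
  case True
  then have fg: "ar_val X (ar_mul X f g)" using ar_val_mul by blast
  have *: "ar_val X f" "ar_val X g" "ar_val X h" "ar_src f = ar_tgt g" "ar_src g = ar_tgt h"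
    "\<not> (ar_ext f \<and> ar_ext g)" "\<not> (ar_ext f \<and> ar_ext h)" "\<not> (ar_ext g \<and> ar_ext h)"
    using True fg unfolding ar_val_mul ar_typ_mul[OF fg] by auto
  then show ?thesis
    by (cases f; cases g; cases h) (simp_all del: ar_val.simps(1,2) ar_mul.simps add: ar_mul_assoc_cases)
next
  case False
  have "\<not> ar_val X (ar_mul X f (ar_mul X g h))"
  proof
    assume R: "ar_val X (ar_mul X f (ar_mul X g h))"
    then have gh: "ar_val X (ar_mul X g h)" using ar_val_mul by blast
    have *: "ar_val X f" "ar_val X g" "ar_val X h" "ar_src f = ar_tgt g" "ar_src g = ar_tgt h"
      "\<not> (ar_ext f \<and> ar_ext g)" "\<not> (ar_ext f \<and> ar_ext h)" "\<not> (ar_ext g \<and> ar_ext h)"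
      using R gh unfolding ar_val_mul ar_typ_mul[OF gh] by auto
    then have fg: "ar_val X (ar_mul X f g)" using ar_val_mul by blast
    show False using False * fg unfolding ar_val_mul[of "ar_mul X f g"] ar_typ_mul[OF fg] by blast
  qed
  then show ?thesis using False ar_mul_und by metis
qed

lemma hom_ac:
  assumes "A \<in> Obj X" "B \<in> Obj X" "f \<in> Mor X A B" "g \<in> Mor X A B"
  shows "h \<in> Mor X A B \<Longrightarrow> f \<otimes>\<^bsub>Hom X A B\<^esub> g \<otimes>\<^bsub>Hom X A B\<^esub> h = f \<otimes>\<^bsub>Hom X A B\<^esub> (g \<otimes>\<^bsub>Hom X A B\<^esub> h)"
    "f \<otimes>\<^bsub>Hom X A B\<^esub> g = g \<otimes>\<^bsub>Hom X A B\<^esub> f"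
    "inv\<^bsub>Hom X A B\<^esub> (f \<otimes>\<^bsub>Hom X A B\<^esub> g) = inv\<^bsub>Hom X A B\<^esub> f \<otimes>\<^bsub>Hom X A B\<^esub> inv\<^bsub>Hom X A B\<^esub> g"
proof -
  interpret comm_group "Hom X A B" by (rule hom_comm_group[OF assms(1,2)])
  show "h \<in> Mor X A B \<Longrightarrow> f \<otimes>\<^bsub>Hom X A B\<^esub> g \<otimes>\<^bsub>Hom X A B\<^esub> h = f \<otimes>\<^bsub>Hom X A B\<^esub> (g \<otimes>\<^bsub>Hom X A B\<^esub> h)"
    "f \<otimes>\<^bsub>Hom X A B\<^esub> g = g \<otimes>\<^bsub>Hom X A B\<^esub> f"
    "inv\<^bsub>Hom X A B\<^esub> (f \<otimes>\<^bsub>Hom X A B\<^esub> g) = inv\<^bsub>Hom X A B\<^esub> f \<otimes>\<^bsub>Hom X A B\<^esub> inv\<^bsub>Hom X A B\<^esub> g"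
    using assms(3,4) by (auto simp: m_assoc inv_mult intro: m_comm)
qed

lemma ext_ac:
  assumes "A \<in> Obj X" "B \<in> Obj X" "f \<in> carrier (Ext X A B)" "g \<in> carrier (Ext X A B)"
  shows "h \<in> carrier (Ext X A B) \<Longrightarrow> f \<otimes>\<^bsub>Ext X A B\<^esub> g \<otimes>\<^bsub>Ext X A B\<^esub> h = f \<otimes>\<^bsub>Ext X A B\<^esub> (g \<otimes>\<^bsub>Ext X A B\<^esub> h)"
    "f \<otimes>\<^bsub>Ext X A B\<^esub> g = g \<otimes>\<^bsub>Ext X A B\<^esub> f"
    "inv\<^bsub>Ext X A B\<^esub> (f \<otimes>\<^bsub>Ext X A B\<^esub> g) = inv\<^bsub>Ext X A B\<^esub> f \<otimes>\<^bsub>Ext X A B\<^esub> inv\<^bsub>Ext X A B\<^esub> g"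
proof -
  interpret comm_group "Ext X A B" by (rule ext_comm_group[OF assms(2,1)])
  show "h \<in> carrier (Ext X A B) \<Longrightarrow> f \<otimes>\<^bsub>Ext X A B\<^esub> g \<otimes>\<^bsub>Ext X A B\<^esub> h = f \<otimes>\<^bsub>Ext X A B\<^esub> (g \<otimes>\<^bsub>Ext X A B\<^esub> h)"
    "f \<otimes>\<^bsub>Ext X A B\<^esub> g = g \<otimes>\<^bsub>Ext X A B\<^esub> f"
    "inv\<^bsub>Ext X A B\<^esub> (f \<otimes>\<^bsub>Ext X A B\<^esub> g) = inv\<^bsub>Ext X A B\<^esub> f \<otimes>\<^bsub>Ext X A B\<^esub> inv\<^bsub>Ext X A B\<^esub> g"
    using assms(3,4) by (auto simp: m_assoc inv_mult intro: m_comm)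
qed

lemma ar_add_und: "\<not> ar_val X (ar_add X g f) \<Longrightarrow> ar_add X g f = Und"
  by (cases g; cases f) auto

lemma ar_typ_add:
  assumes "ar_val X (ar_add X f g)"
  shows "ar_src (ar_add X f g) = ar_src f" "ar_tgt (ar_add X f g) = ar_tgt f"
    "ar_ext (ar_add X f g) = ar_ext f"
  using assms by (cases g; cases f; auto split: if_splits)+

lemma ar_distl: "ar_mul X f (ar_add X g h) = ar_add X (ar_mul X f g) (ar_mul X f h)"
proof (cases "ar_val X f \<and> ar_val X g \<and> ar_val X h \<and> ar_src g = ar_src h \<and> ar_tgt g = ar_tgt h \<and>
    ar_ext g = ar_ext h \<and> ar_src f = ar_tgt g \<and> \<not> (ar_ext f \<and> ar_ext g)")
  case True
  then show ?thesis
    by (cases f; cases g; cases h) (auto simp: bihom_mult intro: cmp_closed push_closed pull_closed)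
next
  case False
  have "\<not> ar_val X (ar_mul X f (ar_add X g h))"
    using False ar_typ_add[of g h] unfolding ar_val_mul ar_val_add by metis
  moreover have "\<not> ar_val X (ar_add X (ar_mul X f g) (ar_mul X f h))"
    using False ar_typ_mul[of f g] ar_typ_mul[of f h] unfolding ar_val_mul ar_val_add by metis
  ultimately show ?thesis using ar_mul_und ar_add_und by metis
qed

lemma ar_distr: "ar_mul X (ar_add X g h) f = ar_add X (ar_mul X g f) (ar_mul X h f)"
proof (cases "ar_val X f \<and> ar_val X g \<and> ar_val X h \<and> ar_src g = ar_src h \<and> ar_tgt g = ar_tgt h \<and>
    ar_ext g = ar_ext h \<and> ar_src g = ar_tgt f \<and> \<not> (ar_ext f \<and> ar_ext g)")
  case True
  then show ?thesis
    by (cases f; cases g; cases h) (auto simp: bihom_mult intro: cmp_closed push_closed pull_closed)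
next
  case False
  have "\<not> ar_val X (ar_mul X (ar_add X g h) f)"
    using False ar_typ_add[of g h] unfolding ar_val_mul ar_val_add by metis
  moreover have "\<not> ar_val X (ar_add X (ar_mul X g f) (ar_mul X h f))"
    using False ar_typ_mul[of g f] ar_typ_mul[of h f] unfolding ar_val_mul ar_val_add by metis
  ultimately show ?thesis using ar_mul_und ar_add_und by metis
qed

lemma ar_calc:
  "arrow_calculus (\<lambda>A. A \<in> Obj X) (ar_val X) ar_ext ar_src ar_tgt (ar_mul X) (ar_add X) (ar_neg X) (ar_idn X) (ar_zr X)"
proof (unfold_locales, goal_cases)
  case (1 f g h) show ?case by (rule ar_mul_assoc)
next
  case (2 f g h) show ?case
    by (cases f; cases g; cases h) (auto simp: hom_ac(1) ext_ac(1))
next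
  case (3 f g) show ?case
    by (cases f; cases g) (auto intro: hom_ac(2) ext_ac(2))
next
  case (4 f g h) show ?case by (rule ar_distl)
next
  case (5 g h f) show ?case by (rule ar_distr)
next
  case (6 f g) show ?case
    by (cases f; cases g) (auto simp: bihom_inv intro: cmp_closed push_closed pull_closed)
next
  case (7 f g) show ?case
    by (cases f; cases g) (auto simp: bihom_inv intro: cmp_closed push_closed pull_closed)
next
  case (8 f g) show ?case
    by (cases f; cases g) (simp_all add: hom_ac(3) ext_ac(3))
next
  case (9 f) then show ?case by (cases f) auto
next
  case (10 g f) show ?case by (rule ar_val_mul)
next
  case (11 g f) then show ?case by (rule ar_typ_mul)
next
  case (12 g f) then show ?case by (rule ar_typ_mul)
next
  case (13 g f) then show ?case by (rule ar_typ_mul)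
next
  case (14 g f) show ?case by (rule ar_val_add)
next
  case (15 g f) then show ?case by (cases g; cases f) (auto split: if_splits)
next
  case (16 g f) then show ?case by (cases g; cases f) (auto split: if_splits)
next
  case (17 g f) then show ?case by (cases g; cases f) (auto split: if_splits)
next
  case (18 f) show ?case by (cases f) auto
next
  case (19 f) then show ?case by (cases f) auto
next
  case (20 f) then show ?case by (cases f) auto
next
  case (21 f) then show ?case by (cases f) auto
next
  case (22 A) show ?case by (auto simp: ar_idn_def intro: id_closed)
next
  case (23 A) then show ?case by (auto simp: ar_idn_def)
next
  case (24 f) then show ?case by (cases f) (auto simp: ar_idn_def id_left push_id id_closed)
next
  case (25 f) then show ?case by (cases f) (auto simp: ar_idn_def id_right pull_id id_closed)
next
  case (26 e A B) show ?case by (auto simp: ar_zr_def)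
next
  case (27 A B e) then show ?case by (auto simp: ar_zr_def)
next
  case (28 f) then show ?case
    by (cases f) (auto simp: ar_zr_def monoid.r_one group.is_monoid)
next
  case (29 f) then show ?case by (cases f) (auto simp: ar_zr_def group.r_inv)
next
  case 30
  obtain Z where Z: "Z \<in> Obj X" "\<forall>A \<in> Obj X. Mor X Z A = {\<one>\<^bsub>Hom X Z A\<^esub>} \<and> Mor X A Z = {\<one>\<^bsub>Hom X A Z\<^esub>}"
    using zero_object by blast
  have "f = ar_zr X False (ar_src f) (ar_tgt f)"
    if "ar_val X f" "\<not> ar_ext f" "ar_src f = Z \<or> ar_tgt f = Z" for f
    using that Z(2) by (cases f) (auto simp: ar_zr_def)
  then show ?case using Z(1) by blast
next
  case (31 A B)
  then obtain S i j p q where b: "biprod X A B (S, i, j, p, q)" using biproducts[of A B] by (metis prod_cases5)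
  show ?case
    by (rule exI[of _ S], rule exI[of _ "Hm A i S"], rule exI[of _ "Hm B j S"], rule exI[of _ "Hm S p A"],
        rule exI[of _ "Hm S q B"]) (use b in \<open>auto simp: ar_idn_def ar_zr_def intro: cmp_closed\<close>)
qed

end

context extriangulated_category
begin

section \<open>Realizations as triangles of arrows\<close>

lemma rlz_seqs:
  assumes "A \<in> Obj X" "C \<in> Obj X" "\<delta> \<in> carrier (Ext X C A)"
  obtains s where "s \<in> seqs X A C" "Rlz X C A \<delta> = seq_equiv X A C `` {s}"
  using rlz_class[OF assms] by (auto elim: quotientE)

lemma etri_typ:
  assumes "etri X (A, B, C, x, y, \<delta>)"
  shows "A \<in> Obj X" "B \<in> Obj X" "C \<in> Obj X" "x \<in> Mor X A B" "y \<in> Mor X B C" "\<delta> \<in> carrier (Ext X C A)"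
proof -
  show a: "A \<in> Obj X" "C \<in> Obj X" "\<delta> \<in> carrier (Ext X C A)" using assms by auto
  obtain s where "s \<in> seqs X A C" "Rlz X C A \<delta> = seq_equiv X A C `` {s}" by (rule rlz_seqs[OF a])
  then have "(B, x, y) \<in> seqs X A C" using assms unfolding seq_equiv_def by auto
  then show "B \<in> Obj X" "x \<in> Mor X A B" "y \<in> Mor X B C" unfolding seqs_def by auto
qed

lemma cat_iso_id: "A \<in> Obj X \<Longrightarrow> cat_iso X A A (Idm X A)"
  unfolding cat_iso_def using id_closed id_left[OF _ _ id_closed] by auto

lemma seq_equiv_refl: "A \<in> Obj X \<Longrightarrow> C \<in> Obj X \<Longrightarrow> s \<in> seqs X A C \<Longrightarrow> (s, s) \<in> seq_equiv X A C"
proof -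
  assume *: "A \<in> Obj X" "C \<in> Obj X" "s \<in> seqs X A C"
  obtain B x y where s: "s = (B, x, y)" by (cases s)
  then have "B \<in> Obj X" "x \<in> Mor X A B" "y \<in> Mor X B C" using *(3) unfolding seqs_def by auto
  then have "\<exists>b. cat_iso X B B b \<and> b \<cdot> x = x \<and> y \<cdot> b = y"
    using cat_iso_id[of B] id_left[of A B x] id_right[of B C y] * by (intro exI[of _ "Idm X B"]) simp
  then show ?thesis using *(3) unfolding s seq_equiv_def by auto
qed

lemma cat_iso_cmp:
  assumes f: "cat_iso X A B f" and g: "cat_iso X B C g" and o: "A \<in> Obj X" "B \<in> Obj X" "C \<in> Obj X"
  shows "cat_iso X A C (g \<cdot> f)"
proof -
  obtain f' where f': "f \<in> Mor X A B" "f' \<in> Mor X B A" "f' \<cdot> f = Idm X A" "f \<cdot> f' = Idm X B"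
    using f unfolding cat_iso_def by blast
  obtain g' where g': "g \<in> Mor X B C" "g' \<in> Mor X C B" "g' \<cdot> g = Idm X B" "g \<cdot> g' = Idm X C"
    using g unfolding cat_iso_def by blast
  have "(f' \<cdot> g') \<cdot> (g \<cdot> f) = f' \<cdot> ((g' \<cdot> g) \<cdot> f)"
    using f'(1,2) g'(1,2) o by (simp add: cmp_assoc[of A B C] cmp_assoc[of A C B] cmp_closed[of A B C] cmp_assoc[of A C B A])
  then have 1: "(f' \<cdot> g') \<cdot> (g \<cdot> f) = Idm X A" using f' g'(3) o id_left[of A B] by simp
  have "(g \<cdot> f) \<cdot> (f' \<cdot> g') = g \<cdot> ((f \<cdot> f') \<cdot> g')"
    using f'(1,2) g'(1,2) o by (simp add: cmp_assoc[of C B A B] cmp_assoc[of C A B C] cmp_closed[of C B A])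
  then have 2: "(g \<cdot> f) \<cdot> (f' \<cdot> g') = Idm X C" using f'(4) g' o id_left[of C B] by simp
  show ?thesis unfolding cat_iso_def
    using 1 2 cmp_closed[of A B C f g] cmp_closed[of C B A g' f'] f' g' o by blast
qed

text \<open>A realization is a full equivalence class, so the isomorphism from a representative to
  the old sequence composes with \<open>b\<close> to one onto the new sequence.\<close>

lemma etri_equiv:
  assumes T: "etri X (A, B, C, x, y, \<delta>)" and B': "B' \<in> Obj X" and b: "b \<in> Mor X B B'" "c \<in> Mor X B' B"
    and i: "b \<cdot> c = Idm X B'" "c \<cdot> b = Idm X B"
  shows "etri X (A, B', C, b \<cdot> x, y \<cdot> c, \<delta>)"
proof -
  note t = etri_typ[OF T]
  obtain s where s: "s \<in> seqs X A C" "Rlz X C A \<delta> = seq_equiv X A C `` {s}" by (rule rlz_seqs[OF t(1,3,6)])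
  obtain S u v where S: "s = (S, u, v)" by (cases s) auto
  then have r: "((S, u, v), (B, x, y)) \<in> seq_equiv X A C" using T s by auto
  then obtain h where h: "cat_iso X S B h" "h \<cdot> u = x" "y \<cdot> h = v" unfolding seq_equiv_def by auto
  have u: "S \<in> Obj X" "u \<in> Mor X A S" "v \<in> Mor X S C" using s(1) S unfolding seqs_def by auto
  have hm: "h \<in> Mor X S B" using h(1) unfolding cat_iso_def by blast
  have "cat_iso X B B' b" unfolding cat_iso_def using b i by blast
  then have 1: "cat_iso X S B' (b \<cdot> h)" using cat_iso_cmp[OF h(1)] u t B' by blast
  have 2: "(b \<cdot> h) \<cdot> u = b \<cdot> x" using cmp_assoc[of A S B B' u h b] h(2) u t B' hm b by simp
  have "(y \<cdot> c) \<cdot> (b \<cdot> h) = y \<cdot> ((c \<cdot> b) \<cdot> h)"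
    using cmp_assoc[of S B' B C "b \<cdot> h" c y] cmp_assoc[of S B B' B h b c] u t B' hm b cmp_closed[of S B B' h b] by simp
  then have 3: "(y \<cdot> c) \<cdot> (b \<cdot> h) = v" using i(2) id_left[of S B h] hm u t h(3) by simp
  have "((S, u, v), (B', b \<cdot> x, y \<cdot> c)) \<in> seq_equiv X A C"
    unfolding seq_equiv_def seqs_def
    using 1 2 3 u t B' cmp_closed[of A B B' x b] cmp_closed[of B' B C c y] b by auto
  then show ?thesis using t s(2) S by simp
qed

lemma ar_tri_typ:
  "ar_tri X x y d \<Longrightarrow> ar_val X x \<and> ar_val X y \<and> ar_val X d \<and> \<not> ar_ext x \<and> \<not> ar_ext y \<and> ar_ext d \<and>
     ar_src y = ar_tgt x \<and> ar_src d = ar_tgt y \<and> ar_tgt d = ar_src x"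
proof -
  assume "ar_tri X x y d"
  then obtain A B C u v \<delta> where T: "x = Hm A u B" "y = Hm B v C" "d = Ex C \<delta> A" "etri X (A, B, C, u, v, \<delta>)"
    unfolding ar_tri_def by auto
  then show ?thesis using etri_typ[OF T(4)] by simp
qed

lemma hm_cases:
  assumes "ar_val X f" "\<not> ar_ext f" "ar_src f = A" "ar_tgt f = B"
  obtains f' where "f = Hm A f' B" "f' \<in> Mor X A B" "A \<in> Obj X" "B \<in> Obj X"
  using assms by (cases f) auto

lemma etri_ar: "ar_tri X (Hm A x B) (Hm B' y C) (Ex C' \<delta> A') \<longleftrightarrow> B = B' \<and> C = C' \<and> A = A' \<and> etri X (A, B, C, x, y, \<delta>)"
  unfolding ar_tri_def by auto

lemma ar_extri:
  "extri (\<lambda>A. A \<in> Obj X) (ar_val X) ar_ext ar_src ar_tgt (ar_mul X) (ar_add X) (ar_neg X) (ar_idn X) (ar_zr X) (ar_tri X)"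
proof -
  interpret ar: arrow_calculus "\<lambda>A. A \<in> Obj X" "ar_val X" ar_ext ar_src ar_tgt "ar_mul X" "ar_add X" "ar_neg X" "ar_idn X" "ar_zr X"
    by (rule ar_calc)
  show ?thesis
  proof (unfold_locales, goal_cases)
    case (1 x y d) then show ?case by (rule ar_tri_typ)
  next
    case (2 d)
    then obtain C \<delta> A where d: "d = Ex C \<delta> A" "C \<in> Obj X" "A \<in> Obj X" "\<delta> \<in> carrier (Ext X C A)" by (cases d) auto
    obtain s where s: "s \<in> seqs X A C" "Rlz X C A \<delta> = seq_equiv X A C `` {s}" by (rule rlz_seqs[OF d(3,2,4)])
    obtain B x y where "s = (B, x, y)" by (cases s)
    then have "etri X (A, B, C, x, y, \<delta>)" using s seq_equiv_refl[OF d(3,2) s(1)] d by simp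
    then show ?case using d(1) etri_ar by blast
  next
    case (3 x y d B' b c)
    then obtain A B C x' y' \<delta> where T: "x = Hm A x' B" "y = Hm B y' C" "d = Ex C \<delta> A" "etri X (A, B, C, x', y', \<delta>)"
      unfolding ar_tri_def by auto
    obtain b' where b: "b = Hm B b' B'" "b' \<in> Mor X B B'" "B' \<in> Obj X" by (rule hm_cases[of b B B']) (use 3 T in auto)
    obtain c' where c: "c = Hm B' c' B" "c' \<in> Mor X B' B" by (rule hm_cases[of c B' B]) (use 3 T in auto)
    note t = etri_typ[OF T(4)]
    have "etri X (A, B', C, b' \<cdot> x', y' \<cdot> c', \<delta>)"
      by (rule etri_equiv[OF T(4) b(3,2) c(2)]) (use 3 b c t in \<open>auto simp: ar_idn_def\<close>)
    then show ?case using T b c t by (simp add: etri_ar)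
  next
    case (4 A C S i j p q)
    note B = ar.bipD[OF 4]
    obtain i' where i: "i = Hm A i' S" "i' \<in> Mor X A S" "A \<in> Obj X" "S \<in> Obj X" by (rule hm_cases[of i A S]) (use B in auto)
    obtain j' where j: "j = Hm C j' S" "j' \<in> Mor X C S" "C \<in> Obj X" by (rule hm_cases[of j C S]) (use B in auto)
    obtain p' where p: "p = Hm S p' A" "p' \<in> Mor X S A" by (rule hm_cases[of p S A]) (use B in auto)
    obtain q' where q: "q = Hm S q' C" "q' \<in> Mor X S C" by (rule hm_cases[of q S C]) (use B in auto)
    have "biprod X A C (S, i', j', p', q')"
      using B(5-9) i j p q by (auto simp: ar_idn_def ar_zr_def split: if_splits)
    from rlz_zero[OF this] have "etri X (A, S, C, i', q', \<one>\<^bsub>Ext X C A\<^esub>)"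
      using seq_equiv_refl[of A C "(S, i', q')"] i j q by (simp add: seqs_def)
    then show ?case using i q by (simp add: ar_zr_def etri_ar)
  next
    case (5 x y d x' y' d' a c)
    obtain A B C u v \<delta> where T: "x = Hm A u B" "y = Hm B v C" "d = Ex C \<delta> A" "etri X (A, B, C, u, v, \<delta>)"
      using 5(1) unfolding ar_tri_def by auto
    obtain A' B' C' u' v' \<delta>' where T': "x' = Hm A' u' B'" "y' = Hm B' v' C'" "d' = Ex C' \<delta>' A'" "etri X (A', B', C', u', v', \<delta>')"
      using 5(2) unfolding ar_tri_def by auto
    obtain a' where a: "a = Hm A a' A'" "a' \<in> Mor X A A'" by (rule hm_cases[of a A A']) (use 5 T T' in auto)
    obtain c' where c: "c = Hm C c' C'" "c' \<in> Mor X C C'" by (rule hm_cases[of c C C']) (use 5 T T' in auto)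
    note t = etri_typ[OF T(4)] etri_typ[OF T'(4)]
    have "push X C a' \<delta> = pull X A' c' \<delta>'" using 5(5) T T' a c t by auto
    then obtain b where b: "b \<in> Mor X B B'" "b \<cdot> u = u' \<cdot> a'" "v' \<cdot> b = c' \<cdot> v"
      using rlz_mor[OF T(4) T'(4) a(2) c(2)] by blast
    show ?case by (rule exI[of _ "Hm B b B'"]) (use b T T' a c t in auto)
  next
    case (6 x y d x' y' d' a b)
    obtain A B C u v \<delta> where T: "x = Hm A u B" "y = Hm B v C" "d = Ex C \<delta> A" "etri X (A, B, C, u, v, \<delta>)"
      using 6(1) unfolding ar_tri_def by auto
    obtain A' B' C' u' v' \<delta>' where T': "x' = Hm A' u' B'" "y' = Hm B' v' C'" "d' = Ex C' \<delta>' A'" "etri X (A', B', C', u', v', \<delta>')"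
      using 6(2) unfolding ar_tri_def by auto
    obtain a' where a: "a = Hm A a' A'" "a' \<in> Mor X A A'" by (rule hm_cases[of a A A']) (use 6 T T' in auto)
    obtain b' where b: "b = Hm B b' B'" "b' \<in> Mor X B B'" by (rule hm_cases[of b B B']) (use 6 T T' in auto)
    note t = etri_typ[OF T(4)] etri_typ[OF T'(4)]
    have "b' \<cdot> u = u' \<cdot> a'" using 6(5) T T' a b t by auto
    then obtain c where c: "c \<in> Mor X C C'" "c \<cdot> v = v' \<cdot> b'" "push X C a' \<delta> = pull X A' c \<delta>'"
      using ET3[OF T(4) T'(4) a(2) b(2)] by blast
    show ?case by (rule exI[of _ "Hm C c C'"]) (use c T T' a b t in auto)
  next
    case (7 x y d x' y' d' b c)
    obtain A B C u v \<delta> where T: "x = Hm A u B" "y = Hm B v C" "d = Ex C \<delta> A" "etri X (A, B, C, u, v, \<delta>)"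
      using 7(1) unfolding ar_tri_def by auto
    obtain A' B' C' u' v' \<delta>' where T': "x' = Hm A' u' B'" "y' = Hm B' v' C'" "d' = Ex C' \<delta>' A'" "etri X (A', B', C', u', v', \<delta>')"
      using 7(2) unfolding ar_tri_def by auto
    obtain b' where b: "b = Hm B b' B'" "b' \<in> Mor X B B'" by (rule hm_cases[of b B B']) (use 7 T T' in auto)
    obtain c' where c: "c = Hm C c' C'" "c' \<in> Mor X C C'" by (rule hm_cases[of c C C']) (use 7 T T' in auto)
    note t = etri_typ[OF T(4)] etri_typ[OF T'(4)]
    have "c' \<cdot> v = v' \<cdot> b'" using 7(5) T T' c b t by auto
    then obtain a where a: "a \<in> Mor X A A'" "b' \<cdot> u = u' \<cdot> a" "push X C a \<delta> = pull X A' c' \<delta>'"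
      using ET3_op[OF T(4) T'(4) b(2) c(2)] by blast
    show ?case by (rule exI[of _ "Hm A a A'"]) (use a T T' c b t in auto)
  next
    case (8 f f' d g g' d')
    obtain A B D f1 f2 \<delta> where T: "f = Hm A f1 B" "f' = Hm B f2 D" "d = Ex D \<delta> A" "etri X (A, B, D, f1, f2, \<delta>)"
      using 8(1) unfolding ar_tri_def by auto
    obtain C F g1 g2 \<delta>' where T': "g = Hm B g1 C" "g' = Hm C g2 F" "d' = Ex F \<delta>' B" "etri X (B, C, F, g1, g2, \<delta>')"
      using 8(2,3) T(1) unfolding ar_tri_def by auto
    note t = etri_typ[OF T(4)] etri_typ[OF T'(4)]
    obtain E h u e \<delta>'' where *: "E \<in> Obj X" "h \<in> Mor X C E" "u \<in> Mor X D E" "e \<in> Mor X E F"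
      "h \<cdot> g1 = u \<cdot> f2" "e \<cdot> h = g2" "etri X (A, C, E, g1 \<cdot> f1, h, \<delta>'')" "etri X (D, E, F, u, e, push X F f2 \<delta>')"
      "pull X A u \<delta>'' = \<delta>" "push X E f1 \<delta>'' = pull X B e \<delta>'"
      using ET4[OF T(4) T'(4)] by blast
    show ?case
      by (rule exI[of _ "Hm C h E"], rule exI[of _ "Hm D u E"], rule exI[of _ "Hm E e F"], rule exI[of _ "Ex E \<delta>'' A"])
        (use * T T' t etri_typ[OF *(7)] in \<open>simp add: etri_ar\<close>)
  next
    case (9 f' f d g' g d')
    obtain D B A f2 f1 \<delta> where T: "f' = Hm D f2 B" "f = Hm B f1 A" "d = Ex A \<delta> D" "etri X (D, B, A, f2, f1, \<delta>)"
      using 9(1) unfolding ar_tri_def by auto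
    obtain F C g2 g1 \<delta>' where T': "g' = Hm F g2 C" "g = Hm C g1 B" "d' = Ex B \<delta>' F" "etri X (F, C, B, g2, g1, \<delta>')"
      using 9(2,3) T(2) unfolding ar_tri_def by auto
    note t = etri_typ[OF T(4)] etri_typ[OF T'(4)]
    obtain E h u e \<delta>'' where *: "E \<in> Obj X" "h \<in> Mor X E C" "u \<in> Mor X E D" "e \<in> Mor X F E"
      "g1 \<cdot> h = f2 \<cdot> u" "h \<cdot> e = g2" "etri X (E, C, A, h, f1 \<cdot> g1, \<delta>'')" "etri X (F, E, D, e, u, pull X F f2 \<delta>')"
      "push X A u \<delta>'' = \<delta>" "pull X E f1 \<delta>'' = push X B e \<delta>'"
      using ET4_op[OF T(4) T'(4)] by blast
    show ?case
      by (rule exI[of _ "Hm E h C"], rule exI[of _ "Hm E u D"], rule exI[of _ "Hm F e E"], rule exI[of _ "Ex A \<delta>'' E"])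
        (use * T T' t etri_typ[OF *(7)] in \<open>simp add: etri_ar\<close>)
  qed
qed

end

definition ar_xi :: "('o, 'm, 'e) tri set \<Rightarrow> ('o, 'm, 'e) arrow \<Rightarrow> ('o, 'm, 'e) arrow \<Rightarrow> ('o, 'm, 'e) arrow \<Rightarrow> bool" where
  "ar_xi \<xi> a b c \<longleftrightarrow> (\<exists>A B C x y \<delta>. a = Hm A x B \<and> b = Hm B y C \<and> c = Ex C \<delta> A \<and> (A, B, C, x, y, \<delta>) \<in> \<xi>)"

context proper_class
begin

section \<open>Proper classes as classes of arrow triangles\<close>

lemma xi_ar: "ar_xi \<xi> (Hm A x B) (Hm B' y C) (Ex C' \<delta> A') \<longleftrightarrow> B = B' \<and> C = C' \<and> A = A' \<and> (A, B, C, x, y, \<delta>) \<in> \<xi>"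
  unfolding ar_xi_def by auto

lemma ar_proper:
  "proper_extri (\<lambda>A. A \<in> Obj X) (ar_val X) ar_ext ar_src ar_tgt (ar_mul X) (ar_add X) (ar_neg X) (ar_idn X) (ar_zr X)
    (ar_tri X) (ar_xi \<xi>)"
proof -
  interpret ar: extri "\<lambda>A. A \<in> Obj X" "ar_val X" ar_ext ar_src ar_tgt "ar_mul X" "ar_add X" "ar_neg X" "ar_idn X" "ar_zr X" "ar_tri X"
    by (rule ar_extri)
  show ?thesis
  proof (unfold_locales, goal_cases)
    case (1 x y d) then show ?case unfolding ar_xi_def ar_tri_def using xi_etri by blast
  next
    case (2 x y C A)
    then obtain B u v where "x = Hm A u B" "y = Hm B v C" "etri X (A, B, C, u, v, \<one>\<^bsub>Ext X C A\<^esub>)"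
      unfolding ar_tri_def ar_zr_def by auto
    then show ?case using xi_split by (simp add: ar_zr_def xi_ar)
  next
    case (3 x y d x' y' c)
    obtain A B C u v \<delta> where T: "x = Hm A u B" "y = Hm B v C" "d = Ex C \<delta> A" "(A, B, C, u, v, \<delta>) \<in> \<xi>"
      using 3(1) unfolding ar_xi_def by auto
    \<comment> \<open>Being the class of a triangle, the composite is defined, and this forces
      \<open>c\<close> to be a morphism with target \<open>C\<close>.\<close>
    have "ar_val X (ar_mul X d c)" using ar_tri_typ[OF 3(2)] by blast
    then have "ar_val X c \<and> \<not> ar_ext c \<and> ar_tgt c = C" using T(3) unfolding ar_val_mul by auto
    then obtain C' c' where c: "c = Hm C' c' C" "c' \<in> Mor X C' C" "C' \<in> Obj X" by (cases c) auto
    note t = etri_typ[OF xi_etri[OF T(4)]]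
    have e: "ar_mul X d c = Ex C' (pull X A c' \<delta>) A" using T(3) c t by simp
    obtain B' u' v' where T': "x' = Hm A u' B'" "y' = Hm B' v' C'" "etri X (A, B', C', u', v', pull X A c' \<delta>)"
      using 3(2) unfolding e ar_tri_def by auto
    show ?case unfolding e T' using xi_base_change[OF T(4) c(3,2) T'(3)] by (simp add: xi_ar)
  next
    case (4 x y d x' y' a)
    obtain A B C u v \<delta> where T: "x = Hm A u B" "y = Hm B v C" "d = Ex C \<delta> A" "(A, B, C, u, v, \<delta>) \<in> \<xi>"
      using 4(1) unfolding ar_xi_def by auto
    have "ar_val X (ar_mul X a d)" using ar_tri_typ[OF 4(2)] by blast
    then have "ar_val X a \<and> \<not> ar_ext a \<and> ar_src a = A" using T(3) unfolding ar_val_mul by auto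
    then obtain A' a' where a: "a = Hm A a' A'" "a' \<in> Mor X A A'" "A' \<in> Obj X" by (cases a) auto
    note t = etri_typ[OF xi_etri[OF T(4)]]
    have e: "ar_mul X a d = Ex C (push X C a' \<delta>) A'" using T(3) a t by simp
    obtain B' u' v' where T': "x' = Hm A' u' B'" "y' = Hm B' v' C" "etri X (A', B', C, u', v', push X C a' \<delta>)"
      using 4(2) unfolding e ar_tri_def by auto
    show ?case unfolding e T' using xi_cobase_change[OF T(4) a(3,2) T'(3)] by (simp add: xi_ar)
  next
    case (5 x1 y1 d1 x2 y2 d2 m e)
    obtain A1 B1 C u v \<delta> where T: "x1 = Hm A1 u B1" "y1 = Hm B1 v C" "d1 = Ex C \<delta> A1" "etri X (A1, B1, C, u, v, \<delta>)"
      using 5(1) unfolding ar_tri_def by auto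
    obtain A2 B2 C2 u2 v2 \<delta>2 where T2: "x2 = Hm A2 u2 B2" "y2 = Hm B2 v2 C2" "d2 = Ex C2 \<delta>2 A2" "(A2, B2, C2, u2, v2, \<delta>2) \<in> \<xi>"
      using 5(2) unfolding ar_xi_def by auto
    obtain M m' e' where T3: "ar_mul X d1 y2 = Ex B2 (pull X A1 v2 \<delta>) A1" "C = C2" "(A1, M, B2, m', e', pull X A1 v2 \<delta>) \<in> \<xi>"
      using 5(3) T(3) T2(2) unfolding ar_xi_def by (auto split: if_splits)
    show ?case unfolding T using xi_saturated[OF T(4) T2(4)[folded T3(2)] T3(3)] by (simp add: xi_ar)
  qed
qed

end

section \<open>Translation of exactness and of resolutions\<close>

lemma image_eq_iff: "f ` A \<subseteq> C \<Longrightarrow> f ` A = C \<longleftrightarrow> (\<forall>c \<in> C. \<exists>a \<in> A. f a = c)"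
proof (intro iffI ballI)
  fix c assume "f ` A = C" "c \<in> C"
  then have "c \<in> f ` A" by simp
  then show "\<exists>a \<in> A. f a = c" by blast
next
  assume "f ` A \<subseteq> C" "\<forall>c \<in> C. \<exists>a \<in> A. f a = c"
  then show "f ` A = C" by (intro subset_antisym subsetI) (auto simp: image_iff)
qed

primrec ar_mor :: "('o, 'm, 'e) arrow \<Rightarrow> 'm" where
  "ar_mor (Hm A f B) = f" | "ar_mor (Ex C \<delta> A) = undefined" | "ar_mor Und = undefined"

text \<open>Raw complexes do not record the sources and targets of their maps. The augmented object
  occurs nowhere in the record and has to be supplied as \<open>M\<close>.\<close>

definition wrap :: "'o \<Rightarrow> ('o, 'm) aug_complex \<Rightarrow> ('o, ('o, 'm, 'e) arrow) aug_complex" where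
  "wrap M R = \<lparr>trm = trm R, diff = (\<lambda>n. Hm (trm R (Suc n)) (diff R n) (trm R n)), aug = Hm (trm R 0) (aug R) M\<rparr>"

lemma wrap_simps [simp]:
  "trm (wrap M R) = trm R" "diff (wrap M R) n = Hm (trm R (Suc n)) (diff R n) (trm R n)"
  "aug (wrap M R) = Hm (trm R 0) (aug R) M"
  unfolding wrap_def by simp_all

context extriangulated_category
begin

interpretation ar: extri "\<lambda>A. A \<in> Obj X" "ar_val X" ar_ext ar_src ar_tgt "ar_mul X" "ar_add X" "ar_neg X" "ar_idn X" "ar_zr X" "ar_tri X"
  by (rule ar_extri)

lemma hm_arrow: "ar.hm A B f \<Longrightarrow> f = Hm A (ar_mor f) B \<and> ar_mor f \<in> Mor X A B"
  by (cases f) auto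

lemma all_hm: "(\<forall>h. ar.hm A B h \<longrightarrow> P h) \<longleftrightarrow> (A \<in> Obj X \<longrightarrow> B \<in> Obj X \<longrightarrow> (\<forall>h \<in> Mor X A B. P (Hm A h B)))"
proof (intro iffI impI allI)
  fix h assume "A \<in> Obj X \<longrightarrow> B \<in> Obj X \<longrightarrow> (\<forall>h \<in> Mor X A B. P (Hm A h B))" "ar.hm A B h"
  then show "P h" using hm_arrow[of A B h] by (cases h) auto
qed auto

lemma ex_hm: "(\<exists>h. ar.hm A B h \<and> P h) \<longleftrightarrow> A \<in> Obj X \<and> B \<in> Obj X \<and> (\<exists>h \<in> Mor X A B. P (Hm A h B))"
proof
  assume "\<exists>h. ar.hm A B h \<and> P h"
  then obtain h where "ar.hm A B h" "P h" by blast
  then show "A \<in> Obj X \<and> B \<in> Obj X \<and> (\<exists>h \<in> Mor X A B. P (Hm A h B))" by (cases h) auto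
next
  assume "A \<in> Obj X \<and> B \<in> Obj X \<and> (\<exists>h \<in> Mor X A B. P (Hm A h B))"
  then obtain h where "A \<in> Obj X" "B \<in> Obj X" "h \<in> Mor X A B" "P (Hm A h B)" by blast
  then show "\<exists>h. ar.hm A B h \<and> P h" by (intro exI[of _ "Hm A h B"]) simp
qed

lemma etr_ar:
  assumes "etri X (A, B, C, x, y, \<delta>)"
  shows "ar.etr A B C (Hm A x B) (Hm B y C) (Ex C \<delta> A)"
  using etri_typ[OF assms] assms by (simp add: etri_ar)

lemma etrD_ar:
  assumes "ar.etr A B C x y d"
  shows "\<exists>x' y' \<delta>. x = Hm A x' B \<and> y = Hm B y' C \<and> d = Ex C \<delta> A \<and> etri X (A, B, C, x', y', \<delta>)"
  using assms unfolding ar_tri_def by auto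

text \<open>Exactness at the middle term comes from \<open>tri_zero\<close> and
  \<open>tri_ker\<close>; the conditions that remain, \<open>mon\<close> and \<open>epi\<close>, are
  the two clauses of \<open>cov\<close>.\<close>

lemma cov_exact_ar:
  assumes T: "etri X (A, B, C, x, y, \<delta>)" and W: "W \<in> Obj X"
  shows "cov_exact X W (A, B, C, x, y, \<delta>) \<longleftrightarrow> ar.cov W A B C (Hm A x B) (Hm B y C)"
proof -
  note t = etri_typ[OF T] and E = etr_ar[OF T]
  note hx = bihom(1)[OF t(4) W t(1,2)] and hy = bihom(1)[OF t(5) W t(2,3)]
  have g: "group_hom (Hom X W A) (Hom X W B) (\<lambda>h. x \<cdot> h)"
    unfolding group_hom_def group_hom_axioms_def using hx t W by simp
  have "kernel (Hom X W B) (Hom X W C) (\<lambda>h. y \<cdot> h) = (\<lambda>h. x \<cdot> h) ` Mor X W A"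
  proof (intro equalityI subsetI)
    fix h assume "h \<in> kernel (Hom X W B) (Hom X W C) (\<lambda>h. y \<cdot> h)"
    then have h: "h \<in> Mor X W B" "y \<cdot> h = \<one>\<^bsub>Hom X W C\<^esub>" unfolding kernel_def by auto
    obtain k where k: "ar.hm W A k" "ar_mul X (Hm A x B) k = Hm W h B"
      by (rule ar.tri_ker[OF E, of W "Hm W h B"]) (use h t W in \<open>simp_all add: ar_zr_def\<close>)
    have "k = Hm W (ar_mor k) A" "ar_mor k \<in> Mor X W A" using hm_arrow[OF k(1)] by auto
    then have "x \<cdot> ar_mor k = h" using k(2) t W by (cases k) (auto split: if_splits)
    then show "h \<in> (\<lambda>h. x \<cdot> h) ` Mor X W A" using \<open>ar_mor k \<in> Mor X W A\<close> by blast
  next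
    fix h assume "h \<in> (\<lambda>h. x \<cdot> h) ` Mor X W A"
    then obtain k where k: "k \<in> Mor X W A" "h = x \<cdot> k" by blast
    have "y \<cdot> x = \<one>\<^bsub>Hom X A C\<^esub>" using ar.tri_zero(1)[OF E] t by (simp add: ar_zr_def)
    then have "y \<cdot> (x \<cdot> k) = \<one>\<^bsub>Hom X A C\<^esub> \<cdot> k" using cmp_assoc[of W A B C k x y] k t W by simp
    also have "\<dots> = \<one>\<^bsub>Hom X W C\<^esub>"
      using hom_one[OF bihom(2)[OF k(1) W t(1,3)]] t W by simp
    finally show "h \<in> kernel (Hom X W B) (Hom X W C) (\<lambda>h. y \<cdot> h)"
      unfolding kernel_def using k cmp_closed[of W A B k x] t W by simp
  qed
  then have ex: "exact_seq ([Hom X W C, Hom X W B, Hom X W A], [\<lambda>h. y \<cdot> h, \<lambda>h. x \<cdot> h])"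
    using g hy t W by simp
  have i: "(\<lambda>h. x \<cdot> h) \<in> mon (Hom X W A) (Hom X W B) \<longleftrightarrow> (\<forall>h \<in> Mor X W A. x \<cdot> h = \<one>\<^bsub>Hom X W B\<^esub> \<longrightarrow> h = \<one>\<^bsub>Hom X W A\<^esub>)"
    unfolding mon_def using hx group_hom.inj_on_one_iff[OF g] by auto
  have e: "(\<lambda>h. y \<cdot> h) \<in> epi (Hom X W B) (Hom X W C) \<longleftrightarrow> (\<forall>h \<in> Mor X W C. \<exists>h' \<in> Mor X W B. y \<cdot> h' = h)"
    unfolding epi_def using hy image_eq_iff[of "\<lambda>h. y \<cdot> h" "Mor X W B" "Mor X W C"] cmp_closed[of W B C _ y] t W by auto
  show ?thesis unfolding cov_exact.simps short_exact_sequence_iff ar.cov_def all_hm ex_hm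
    using ex i e t W by (simp add: ar_zr_def conj_commute)
qed

lemma contra_exact_ar:
  assumes T: "etri X (A, B, C, x, y, \<delta>)" and W: "W \<in> Obj X"
  shows "contra_exact X W (A, B, C, x, y, \<delta>) \<longleftrightarrow> ar.con W A B C (Hm A x B) (Hm B y C)"
proof -
  note t = etri_typ[OF T] and E = etr_ar[OF T]
  note hx = bihom(2)[OF t(4) t(1,2) W] and hy = bihom(2)[OF t(5) t(2,3) W]
  have g: "group_hom (Hom X C W) (Hom X B W) (\<lambda>h. h \<cdot> y)"
    unfolding group_hom_def group_hom_axioms_def using hy t W by simp
  have "kernel (Hom X B W) (Hom X A W) (\<lambda>h. h \<cdot> x) = (\<lambda>h. h \<cdot> y) ` Mor X C W"
  proof (intro equalityI subsetI)
    fix h assume "h \<in> kernel (Hom X B W) (Hom X A W) (\<lambda>h. h \<cdot> x)"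
    then have h: "h \<in> Mor X B W" "h \<cdot> x = \<one>\<^bsub>Hom X A W\<^esub>" unfolding kernel_def by auto
    obtain k where k: "ar.hm C W k" "ar_mul X k (Hm B y C) = Hm B h W"
      by (rule ar.tri_coker[OF E, of W "Hm B h W"]) (use h t W in \<open>simp_all add: ar_zr_def\<close>)
    have "k = Hm C (ar_mor k) W" "ar_mor k \<in> Mor X C W" using hm_arrow[OF k(1)] by auto
    then have "ar_mor k \<cdot> y = h" using k(2) t W by (cases k) (auto split: if_splits)
    then show "h \<in> (\<lambda>h. h \<cdot> y) ` Mor X C W" using \<open>ar_mor k \<in> Mor X C W\<close> by blast
  next
    fix h assume "h \<in> (\<lambda>h. h \<cdot> y) ` Mor X C W"
    then obtain k where k: "k \<in> Mor X C W" "h = k \<cdot> y" by blast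
    have "y \<cdot> x = \<one>\<^bsub>Hom X A C\<^esub>" using ar.tri_zero(1)[OF E] t by (simp add: ar_zr_def)
    then have "(k \<cdot> y) \<cdot> x = k \<cdot> \<one>\<^bsub>Hom X A C\<^esub>" using cmp_assoc[of A B C W x y k] k t W by simp
    also have "\<dots> = \<one>\<^bsub>Hom X A W\<^esub>"
      using hom_one[OF bihom(1)[OF k(1) t(1,3) W]] t W by simp
    finally show "h \<in> kernel (Hom X B W) (Hom X A W) (\<lambda>h. h \<cdot> x)"
      unfolding kernel_def using k cmp_closed[of B C W y k] t W by simp
  qed
  then have ex: "exact_seq ([Hom X A W, Hom X B W, Hom X C W], [\<lambda>h. h \<cdot> x, \<lambda>h. h \<cdot> y])"
    using g hx t W by simp
  have i: "(\<lambda>h. h \<cdot> y) \<in> mon (Hom X C W) (Hom X B W) \<longleftrightarrow> (\<forall>h \<in> Mor X C W. h \<cdot> y = \<one>\<^bsub>Hom X B W\<^esub> \<longrightarrow> h = \<one>\<^bsub>Hom X C W\<^esub>)"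
    unfolding mon_def using hy group_hom.inj_on_one_iff[OF g] by auto
  have e: "(\<lambda>h. h \<cdot> x) \<in> epi (Hom X B W) (Hom X A W) \<longleftrightarrow> (\<forall>h \<in> Mor X A W. \<exists>h' \<in> Mor X B W. h' \<cdot> x = h)"
    unfolding epi_def using hx image_eq_iff[of "\<lambda>h. h \<cdot> x" "Mor X B W" "Mor X A W"] cmp_closed[of A B W x] t W by auto
  show ?thesis unfolding contra_exact.simps short_exact_sequence_iff ar.con_def all_hm ex_hm
    using ex i e t W by (simp add: ar_zr_def conj_commute)
qed

end

context proper_class
begin

text \<open>The locale with enough projectives assumes that property in terms of its own
  \<open>prj\<close>. This weaker interpretation makes it possible to identify \<open>prj\<close>
  with \<open>xi_proj\<close> beforehand.\<close>

interpretation ar0: proper_extri "\<lambda>A. A \<in> Obj X" "ar_val X" ar_ext ar_src ar_tgt "ar_mul X" "ar_add X" "ar_neg X" "ar_idn X" "ar_zr X"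
    "ar_tri X" "ar_xi \<xi>"
  by (rule ar_proper)

lemma exi_ar: "ar0.exi A B C (Hm A x B) (Hm B y C) (Ex C \<delta> A) \<longleftrightarrow> (A, B, C, x, y, \<delta>) \<in> \<xi>"
  using etr_ar[OF xi_etri] by (auto simp: xi_ar)

lemma exiD_ar:
  "ar0.exi A B C x y d \<Longrightarrow> \<exists>x' y' \<delta>. x = Hm A x' B \<and> y = Hm B y' C \<and> d = Ex C \<delta> A \<and> (A, B, C, x', y', \<delta>) \<in> \<xi>"
  using etrD_ar[of A B C x y d] exi_ar by fast

lemma prj_ar: "ar0.prj P \<longleftrightarrow> P \<in> xi_proj X \<xi>"
proof
  assume P: "ar0.prj P"
  then have o: "P \<in> Obj X" by (rule ar0.prj_ob)
  have "cov_exact X P T" if "T \<in> \<xi>" for T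
  proof -
    obtain A B C x y \<delta> where T: "T = (A, B, C, x, y, \<delta>)" by (rule prod_cases6)
    have "ar0.cov P A B C (Hm A x B) (Hm B y C)" using ar0.prj_cov[OF P] exi_ar that unfolding T by blast
    then show ?thesis using cov_exact_ar[OF xi_etri o] that unfolding T by blast
  qed
  then show "P \<in> xi_proj X \<xi>" unfolding xi_proj_def using o by blast
next
  assume P: "P \<in> xi_proj X \<xi>"
  then have o: "P \<in> Obj X" unfolding xi_proj_def by blast
  have "ar0.cov P A B C x y" if T: "ar0.exi A B C x y d" for A B C x y d
  proof -
    obtain x' y' \<delta> where *: "x = Hm A x' B" "y = Hm B y' C" "(A, B, C, x', y', \<delta>) \<in> \<xi>" using exiD_ar[OF T] by blast
    then show ?thesis using cov_exact_ar[OF xi_etri[OF *(3)] o] P unfolding xi_proj_def by blast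
  qed
  then show "ar0.prj P" unfolding ar0.prj_def using o by blast
qed

lemma enough_ar:
  assumes "enough_xi_proj X \<xi>" "A \<in> Obj X"
  shows "\<exists>K P x y d. ar0.exi K P A x y d \<and> ar0.prj P"
proof -
  obtain K P x y \<delta> where *: "(K, P, A, x, y, \<delta>) \<in> \<xi>" "P \<in> xi_proj X \<xi>"
    using assms unfolding enough_xi_proj_def by blast
  show ?thesis
    by (rule exI[of _ K], rule exI[of _ P], rule exI[of _ "Hm K x P"], rule exI[of _ "Hm P y A"],
        rule exI[of _ "Ex A \<delta> K"], rule conjI[OF iffD2[OF exi_ar *(1)] iffD2[OF prj_ar *(2)]])
qed

end

locale proper_class_proj = proper_class +
  assumes enough_proj: "enough_xi_proj X \<xi>"
begin

sublocale ar: proper_extri_proj "\<lambda>A. A \<in> Obj X" "ar_val X" ar_ext ar_src ar_tgt "ar_mul X" "ar_add X" "ar_neg X" "ar_idn X" "ar_zr X"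
    "ar_tri X" "ar_xi \<xi>"
  by (intro proper_extri_proj.intro ar_proper proper_extri_proj_axioms.intro) (rule enough_ar[OF enough_proj])

section \<open>Gorenstein projectives and resolutions in terms of arrows\<close>

lemma xi_proj_ob: "P \<in> xi_proj X \<xi> \<Longrightarrow> P \<in> Obj X"
  unfolding xi_proj_def by blast

lemma cxi_ar:
  "ar.cxi A B C (Hm A x B) (Hm B y C) (Ex C \<delta> A) \<longleftrightarrow> (A, B, C, x, y, \<delta>) \<in> {T \<in> \<xi>. \<forall>W \<in> xi_proj X \<xi>. contra_exact X W T}"
proof -
  have "contra_exact X W (A, B, C, x, y, \<delta>) \<longleftrightarrow> ar.con W A B C (Hm A x B) (Hm B y C)"
    if "(A, B, C, x, y, \<delta>) \<in> \<xi>" "W \<in> xi_proj X \<xi>" for W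
    by (rule contra_exact_ar[OF xi_etri[OF that(1)] xi_proj_ob[OF that(2)]])
  then show ?thesis unfolding ar.cxi_def exi_ar prj_ar Ball_def mem_Collect_eq by blast
qed

lemma cxiD_ar:
  "ar.cxi A B C x y d \<Longrightarrow> \<exists>x' y' \<delta>. x = Hm A x' B \<and> y = Hm B y' C \<and> d = Ex C \<delta> A \<and>
     (A, B, C, x', y', \<delta>) \<in> {T \<in> \<xi>. \<forall>W \<in> xi_proj X \<xi>. contra_exact X W T}"
proof -
  assume c: "ar.cxi A B C x y d"
  obtain x' y' \<delta> where e: "x = Hm A x' B" "y = Hm B y' C" "d = Ex C \<delta> A" using exiD_ar[OF ar.cxiD(1)[OF c]] by blast
  show ?thesis using c[unfolded e cxi_ar] e by blast
qed

text \<open>One direction reads the coinductive step off at each index of a complete resolution; the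
  other iterates chosen syzygies and cosyzygies in both directions and splices them at 0.\<close>

lemma gp_ar: "ar.gp G \<longleftrightarrow> G \<in> xi_Gproj X \<xi>"
proof
  assume "G \<in> xi_Gproj X \<xi>"
  then obtain Y d K n where R: "complete_xi_proj_resolution X \<xi> Y d K" "G = K n" unfolding xi_Gproj_def by blast
  then obtain g f \<delta> where T: "\<And>n. (K (n + 1), Y n, K n, g n, f n, \<delta> n) \<in> {T \<in> \<xi>. \<forall>W \<in> xi_proj X \<xi>. contra_exact X W T}"
    and Y: "\<And>n. ar.prj (Y n)"
    unfolding complete_xi_proj_resolution_def spliced_def prj_ar by blast
  \<comment> \<open>The index has to be forgotten, because the invariant of the coinduction is to be
    some syzygy of this fixed resolution.\<close>
  have "\<exists>n. G = K n" using R(2) by blast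
  then show "ar.gp G"
  proof (coinduction arbitrary: G rule: ar.gp.coinduct)
    case (gp G)
    then obtain n where n: "G = K n" by blast
    have d: "ar.cxi (K (n + 1)) (Y n) G (Hm (K (n + 1)) (g n) (Y n)) (Hm (Y n) (f n) G) (Ex G (\<delta> n) (K (n + 1)))"
      unfolding n cxi_ar by (rule T)
    have u: "ar.cxi G (Y (n - 1)) (K (n - 1)) (Hm G (g (n - 1)) (Y (n - 1))) (Hm (Y (n - 1)) (f (n - 1)) (K (n - 1)))
        (Ex (K (n - 1)) (\<delta> (n - 1)) G)"
      unfolding n cxi_ar using T[of "n - 1"] by simp
    show ?case by (intro exI conjI, rule refl, rule d, rule Y, blast, rule u, rule Y, blast)
  qed
next
  assume G: "ar.gp G"
  let ?\<Theta> = "{T \<in> \<xi>. \<forall>W \<in> xi_proj X \<xi>. contra_exact X W T}"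
  have "\<exists>H P g f \<delta>. (H, P, A, g, f, \<delta>) \<in> ?\<Theta> \<and> P \<in> xi_proj X \<xi> \<and> ar.gp H" if A: "ar.gp A" for A
    by (rule ar.gp_down[OF A]) (use cxiD_ar prj_ar in blast)
  then have "\<forall>A. \<exists>H. ar.gp A \<longrightarrow> ar.gp H \<and> (\<exists>P g f \<delta>. (H, P, A, g, f, \<delta>) \<in> ?\<Theta> \<and> P \<in> xi_proj X \<xi>)" by blast
  from choice[OF this] obtain dn where dn: "\<And>A. ar.gp A \<Longrightarrow> ar.gp (dn A) \<and> (\<exists>P g f \<delta>. (dn A, P, A, g, f, \<delta>) \<in> ?\<Theta> \<and> P \<in> xi_proj X \<xi>)"
    by blast
  have "\<exists>H P g f \<delta>. (A, P, H, g, f, \<delta>) \<in> ?\<Theta> \<and> P \<in> xi_proj X \<xi> \<and> ar.gp H" if A: "ar.gp A" for A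
    by (rule ar.gp_up[OF A]) (use cxiD_ar prj_ar in blast)
  then have "\<forall>A. \<exists>H. ar.gp A \<longrightarrow> ar.gp H \<and> (\<exists>P g f \<delta>. (A, P, H, g, f, \<delta>) \<in> ?\<Theta> \<and> P \<in> xi_proj X \<xi>)" by blast
  from choice[OF this] obtain up where up: "\<And>A. ar.gp A \<Longrightarrow> ar.gp (up A) \<and> (\<exists>P g f \<delta>. (A, P, up A, g, f, \<delta>) \<in> ?\<Theta> \<and> P \<in> xi_proj X \<xi>)"
    by blast
  \<comment> \<open>Syzygies sit at the positive indices and cosyzygies at the negative ones; at 0
    both iterations start from \<open>G\<close>.\<close>
  define K :: "int \<Rightarrow> 'a" where "K n = (if 0 \<le> n then (dn ^^ nat n) G else (up ^^ nat (- n)) G)" for n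
  have gd: "ar.gp ((dn ^^ k) G)" and gu: "ar.gp ((up ^^ k) G)" for k
    by (induction k) (use G dn up in auto)
  have "\<exists>P g f \<delta>. (K (n + 1), P, K n, g, f, \<delta>) \<in> ?\<Theta> \<and> P \<in> xi_proj X \<xi>" for n
  proof (cases "0 \<le> n")
    case True
    then have "K (n + 1) = dn (K n)" "ar.gp (K n)" unfolding K_def using gd by (auto simp: nat_add_distrib)
    then show ?thesis using dn[of "K n"] by simp
  next
    case False
    \<comment> \<open>For negative \<open>n\<close> the triangle wanted starts at
      \<open>K (n + 1)\<close> and ends at \<open>K n\<close>, so it is the coresolution step taken
      at \<open>K (n + 1)\<close>.\<close>
    then have "nat (- n) = Suc (nat (- (n + 1)))" by simp
    then have "K n = up (K (n + 1))" unfolding K_def using False by (cases "n = - 1") auto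
    moreover have "ar.gp (K (n + 1))" unfolding K_def using gd gu by auto
    ultimately show ?thesis using up[of "K (n + 1)"] by simp
  qed
  then have "\<forall>n. \<exists>t. (K (n + 1), fst t, K n, fst (snd t), fst (snd (snd t)), snd (snd (snd t))) \<in> ?\<Theta> \<and> fst t \<in> xi_proj X \<xi>"
    by simp
  from choice[OF this] obtain F where F: "\<And>n. (K (n + 1), fst (F n), K n, fst (snd (F n)), fst (snd (snd (F n))),
      snd (snd (snd (F n)))) \<in> ?\<Theta> \<and> fst (F n) \<in> xi_proj X \<xi>" by blast
  define Y g f \<delta> where "Y n = fst (F n)" and "g n = fst (snd (F n))" and "f n = fst (snd (snd (F n)))"
    and "\<delta> n = snd (snd (snd (F n)))" for n
  have *: "(K (n + 1), Y n, K n, g n, f n, \<delta> n) \<in> ?\<Theta>" "Y n \<in> xi_proj X \<xi>" for n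
    using F[of n] unfolding Y_def g_def f_def \<delta>_def by blast+
  then have "complete_xi_proj_resolution X \<xi> Y (\<lambda>n. g (n - 1) \<cdot> f n) K"
    unfolding complete_xi_proj_resolution_def spliced_def by blast
  moreover have "G = K 0" unfolding K_def by simp
  ultimately show "G \<in> xi_Gproj X \<xi>" unfolding xi_Gproj_def by blast
qed

lemma gpf_ar: "xi_Gpd X \<xi> M < \<infinity> \<Longrightarrow> ar.gpf M"
proof -
  assume "xi_Gpd X \<xi> M < \<infinity>"
  \<comment> \<open>Without any bound the dimension is the infimum of the empty set, which is
    infinity.\<close>
  then have "\<exists>n. xi_Gpd_le X \<xi> n M" unfolding xi_Gpd_def by (rule contrapos_pp) (simp add: Inf_enat_def)
  then obtain n where n: "xi_Gpd_le X \<xi> n M" by blast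
  then show "ar.gpf M"
  proof (induction n arbitrary: M)
    case 0 then show ?case using ar.gpf_gp gp_ar by simp
  next
    case (Suc n)
    then obtain K G x y \<delta> where "(K, G, M, x, y, \<delta>) \<in> \<xi>" "G \<in> xi_Gproj X \<xi>" "ar.gpf K" by auto
    then show ?case using ar.gpf_step[of K G M] exi_ar gp_ar by blast
  qed
qed

lemma th_gp_ar:
  "ar.th ar.gp A B C (Hm A x B) (Hm B y C) (Ex C \<delta> A) \<longleftrightarrow> (A, B, C, x, y, \<delta>) \<in> Gproj_exact_tris X \<xi>"
proof -
  have "cov_exact X W (A, B, C, x, y, \<delta>) \<longleftrightarrow> ar.cov W A B C (Hm A x B) (Hm B y C)"
    if "(A, B, C, x, y, \<delta>) \<in> \<xi>" "ar.gp W" for W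
    by (rule cov_exact_ar[OF xi_etri[OF that(1)] ar.gp_ob[OF that(2)]])
  then show ?thesis unfolding ar.th_def exi_ar Gproj_exact_tris_def Ball_def mem_Collect_eq gp_ar[symmetric] by blast
qed

lemma th_prj_ar: "ar.th ar.prj A B C (Hm A x B) (Hm B y C) (Ex C \<delta> A) \<longleftrightarrow> (A, B, C, x, y, \<delta>) \<in> \<xi>"
  unfolding ar.th_prj exi_ar ..

lemma th_hm: "ar.th \<W> A B C x y d \<Longrightarrow> x = Hm A (ar_mor x) B \<and> y = Hm B (ar_mor y) C \<and> (\<exists>\<delta>. d = Ex C \<delta> A)"
  using exiD_ar[OF ar.thD(1), of \<W> A B C x y d] by auto

text \<open>Proved once for both kinds of resolutions. In the converse direction the splicing arrows
  are known to carry the right ends (\<open>th_hm\<close>), so they can be stripped to raw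
  morphisms.\<close>

lemma resolution_ar:
  assumes th: "\<And>A B C x y \<delta>. (A, B, C, x, y, \<delta>) \<in> \<Theta> \<longleftrightarrow> ar.th \<W> A B C (Hm A x B) (Hm B y C) (Ex C \<delta> A)"
    and w: "\<And>W. W \<in> \<V> \<longleftrightarrow> \<W> W"
  shows "resolution X \<Theta> \<V> M R \<longleftrightarrow> ar.res \<W> M (wrap M R)"
proof
  assume "resolution X \<Theta> \<V> M R"
  then obtain K g f \<delta> where K: "K 0 = M" "aug R = f 0" and
    T: "\<And>n. trm R n \<in> \<V>" "\<And>n. (K (Suc n), trm R n, K n, g n, f n, \<delta> n) \<in> \<Theta>"
    "\<And>n. diff R n = g n \<cdot> f (Suc n)" unfolding resolution_def by blast
  have t: "ar.th \<W> (K (Suc n)) (trm R n) (K n) (Hm (K (Suc n)) (g n) (trm R n)) (Hm (trm R n) (f n) (K n))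
      (Ex (K n) (\<delta> n) (K (Suc n)))" for n using T(2) th by blast
  have "diff (wrap M R) n = ar_mul X (Hm (K (Suc n)) (g n) (trm R n)) (Hm (trm R (Suc n)) (f (Suc n)) (K (Suc n)))" for n
    using ar.thD(1)[OF t[of n]] ar.thD(1)[OF t[of "Suc n"]] T(3) by simp
  then show "ar.res \<W> M (wrap M R)" unfolding ar.res_def
    using t T(1) w K
    by (intro exI[of _ K]) (rule exI[of _ "\<lambda>n. Hm (K (Suc n)) (g n) (trm R n)"],
        rule exI[of _ "\<lambda>n. Hm (trm R n) (f n) (K n)"], rule exI[of _ "\<lambda>n. Ex (K n) (\<delta> n) (K (Suc n))"], simp)
next
  assume "ar.res \<W> M (wrap M R)"
  then obtain K g f \<delta> where K: "K 0 = M" "Hm (trm R 0) (aug R) M = f 0"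
    and T: "\<And>n. \<W> (trm R n)" "\<And>n. ar.th \<W> (K (Suc n)) (trm R n) (K n) (g n) (f n) (\<delta> n)"
    "\<And>n. Hm (trm R (Suc n)) (diff R n) (trm R n) = ar_mul X (g n) (f (Suc n))"
    unfolding ar.res_def wrap_simps by blast
  have h: "g n = Hm (K (Suc n)) (ar_mor (g n)) (trm R n)" "f n = Hm (trm R n) (ar_mor (f n)) (K n)"
    "\<exists>d. \<delta> n = Ex (K n) d (K (Suc n))" for n using th_hm[OF T(2)[of n]] by auto
  then obtain \<delta>' where d: "\<And>n. \<delta> n = Ex (K n) (\<delta>' n) (K (Suc n))" by metis
  have t: "(K (Suc n), trm R n, K n, ar_mor (g n), ar_mor (f n), \<delta>' n) \<in> \<Theta>" for n
    unfolding th using T(2)[of n] h(1,2)[of n] d[of n] by simp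
  have dd: "Hm (trm R (Suc n)) (diff R n) (trm R n) =
    ar_mul X (Hm (K (Suc n)) (ar_mor (g n)) (trm R n)) (Hm (trm R (Suc n)) (ar_mor (f (Suc n))) (K (Suc n)))" for n
    using T(3)[of n] h(1)[of n] h(2)[of "Suc n"] by simp
  have "diff R n = ar_mor (g n) \<cdot> ar_mor (f (Suc n))" for n
    using dd[of n] by (simp split: if_splits)
  moreover have "aug R = ar_mor (f 0)" using K(2) by (metis ar_mor.simps(1))
  ultimately show "resolution X \<Theta> \<V> M R" unfolding resolution_def
    using K(1) t T(1) w
    by (intro exI[of _ K]) (rule exI[of _ "\<lambda>n. ar_mor (g n)"], rule exI[of _ "\<lambda>n. ar_mor (f n)"], rule exI[of _ \<delta>'], simp)
qed

lemma proj_res_ar: "xi_proj_resolution X \<xi> M R \<longleftrightarrow> ar.res ar.prj M (wrap M R)"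
  unfolding xi_proj_resolution_def by (rule resolution_ar) (simp_all only: th_prj_ar prj_ar)

lemma Gproj_res_ar: "xi_Gproj_resolution X \<xi> M R \<longleftrightarrow> ar.res ar.gp M (wrap M R)"
  unfolding xi_Gproj_resolution_def by (rule resolution_ar) (simp_all only: th_gp_ar gp_ar)

lemma unwrap:
  assumes "ar.cpx M R"
  shows "\<exists>R0. R = wrap M R0"
proof -
  note C = ar.cpxD[OF assms]
  have "R = wrap M \<lparr>trm = trm R, diff = (\<lambda>n. ar_mor (diff R n)), aug = ar_mor (aug R)\<rparr>"
    using hm_arrow[OF C(3)] hm_arrow[OF C(5)] by (intro aug_complex.equality) auto
  then show ?thesis by blast
qed

text \<open>\<open>\<Y>\<close> is a class of objects that contains the chosen kernels: all objects
  for projective resolutions, finite Gorenstein dimension for the others.\<close>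

lemma res_exists:
  assumes "\<Y> M" and s: "\<And>A. \<Y> A \<Longrightarrow> \<exists>K W x y d. ar.th \<W> K W A x y d \<and> \<W> W \<and> \<Y> K"
  shows "\<exists>R. ar.res \<W> M (wrap M R)"
proof -
  have "\<forall>A. \<exists>K. \<Y> A \<longrightarrow> \<Y> K \<and> (\<exists>W x y d. ar.th \<W> K W A x y d \<and> \<W> W)"
  proof
    fix A
    show "\<exists>K. \<Y> A \<longrightarrow> \<Y> K \<and> (\<exists>W x y d. ar.th \<W> K W A x y d \<and> \<W> W)"
    proof (cases "\<Y> A")
      case True
      from s[OF this] show ?thesis by (elim exE conjE) (intro exI impI conjI)
    qed blast
  qed
  from choice[OF this] obtain k where k: "\<And>A. \<Y> A \<Longrightarrow> \<Y> (k A) \<and> (\<exists>W x y d. ar.th \<W> (k A) W A x y d \<and> \<W> W)"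
    by blast
  define K where "K n = (k ^^ n) M" for n
  have "\<Y> (K n)" for n unfolding K_def by (induction n) (use assms(1) k in auto)
  then have "\<exists>W x y d. ar.th \<W> (K (Suc n)) W (K n) x y d \<and> \<W> W" for n using k unfolding K_def by simp
  then have "\<forall>n. \<exists>t. ar.th \<W> (K (Suc n)) (fst t) (K n) (fst (snd t)) (fst (snd (snd t))) (snd (snd (snd t))) \<and> \<W> (fst t)"
    by auto
  from choice[OF this] obtain F where F: "\<And>n. ar.th \<W> (K (Suc n)) (fst (F n)) (K n) (fst (snd (F n)))
      (fst (snd (snd (F n)))) (snd (snd (snd (F n)))) \<and> \<W> (fst (F n))" by blast
  define T g f \<delta> where "T n = fst (F n)" and "g n = fst (snd (F n))" and "f n = fst (snd (snd (F n)))"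
    and "\<delta> n = snd (snd (snd (F n)))" for n
  have *: "ar.th \<W> (K (Suc n)) (T n) (K n) (g n) (f n) (\<delta> n)" "\<W> (T n)" for n
    using F[of n] unfolding T_def g_def f_def \<delta>_def by blast+
  have r: "ar.res \<W> M \<lparr>trm = T, diff = (\<lambda>n. ar_mul X (g n) (f (Suc n))), aug = f 0\<rparr>"
    unfolding ar.res_def
    by (rule exI[of _ K], rule exI[of _ g], rule exI[of _ f], rule exI[of _ \<delta>]) (simp add: * K_def[of 0])
  obtain R where e: "\<lparr>trm = T, diff = (\<lambda>n. ar_mul X (g n) (f (Suc n))), aug = f 0\<rparr> = wrap M R"
    using unwrap[OF ar.res_cpx[OF r]] by blast
  show ?thesis by (rule exI[of _ R]) (rule r[unfolded e])
qed

lemma Gproj_res_ex: "ar.gpf M \<Longrightarrow> \<exists>R. xi_Gproj_resolution X \<xi> M R"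
  unfolding Gproj_res_ar by (rule res_exists[where \<Y> = ar.gpf]) (use ar.gpf_th in blast)+

lemma proj_res_ex: "M \<in> Obj X \<Longrightarrow> \<exists>R. xi_proj_resolution X \<xi> M R"
  unfolding proj_res_ar
proof (rule res_exists[where \<Y> = "\<lambda>A. A \<in> Obj X"])
  fix A assume "A \<in> Obj X"
  then show "\<exists>K W x y d. ar.th ar.prj K W A x y d \<and> ar.prj W \<and> K \<in> Obj X"
    using ar.enough[of A] unfolding ar.th_prj by blast
qed

end

section \<open>Cohomology classes\<close>

text \<open>Restricting the carrier leaves the multiplication alone, so cosets and their products
  are the same in the subgroup and in the whole group.\<close>

lemma (in comm_group) subquotient:
  assumes Z: "subgroup Z G" and B: "subgroup B G" and BZ: "B \<subseteq> Z"
  shows "group (G\<lparr>carrier := Z\<rparr> Mod B)"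
    "carrier (G\<lparr>carrier := Z\<rparr> Mod B) = (\<lambda>z. B #> z) ` Z"
    "\<one>\<^bsub>G\<lparr>carrier := Z\<rparr> Mod B\<^esub> = B"
    "\<lbrakk>z \<in> Z; z' \<in> Z\<rbrakk> \<Longrightarrow> (B #> z) \<otimes>\<^bsub>G\<lparr>carrier := Z\<rparr> Mod B\<^esub> (B #> z') = B #> (z \<otimes> z')"
    "\<lbrakk>z \<in> carrier G; z' \<in> carrier G\<rbrakk> \<Longrightarrow> B #> z = B #> z' \<longleftrightarrow> z \<otimes> inv z' \<in> B"
proof -
  have "group (G\<lparr>carrier := Z\<rparr>)" by (rule subgroup.subgroup_is_group[OF Z is_group])
  then have "comm_group (G\<lparr>carrier := Z\<rparr>)"
    by (rule group.group_comm_groupI) (use subgroup.subset[OF Z] m_comm in auto)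
  then interpret H: comm_group "G\<lparr>carrier := Z\<rparr>" .
  have n: "B \<lhd> G\<lparr>carrier := Z\<rparr>" by (rule H.subgroup_imp_normal[OF subgroup_incl[OF B Z BZ]])
  have r: "B #>\<^bsub>G\<lparr>carrier := Z\<rparr>\<^esub> z = B #> z" for z unfolding r_coset_def by simp
  have s: "U <#>\<^bsub>G\<lparr>carrier := Z\<rparr>\<^esub> V = U <#> V" for U V unfolding set_mult_def by simp
  show "group (G\<lparr>carrier := Z\<rparr> Mod B)" by (rule normal.factorgroup_is_group[OF n])
  show "carrier (G\<lparr>carrier := Z\<rparr> Mod B) = (\<lambda>z. B #> z) ` Z"
    unfolding FactGroup_def RCOSETS_def r by auto
  show "\<one>\<^bsub>G\<lparr>carrier := Z\<rparr> Mod B\<^esub> = B" unfolding FactGroup_def by simp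
  show "(B #> z) \<otimes>\<^bsub>G\<lparr>carrier := Z\<rparr> Mod B\<^esub> (B #> z') = B #> (z \<otimes> z')" if "z \<in> Z" "z' \<in> Z"
    using normal.rcos_sum[OF n, of z z'] that unfolding FactGroup_def r s by simp
  show "B #> z = B #> z' \<longleftrightarrow> z \<otimes> inv z' \<in> B" if "z \<in> carrier G" "z' \<in> carrier G"
    using subgroup.rcos_module[OF B is_group that(2,1)] rcos_self[OF that(1) B] repr_independence[OF _ that(2) B, of z]
    by auto
qed

context proper_class_proj
begin

section \<open>Cohomology groups as classes of cocycle arrows\<close>

lemma cpx_raw:
  assumes C: "ar.cpx M (wrap M R)"
  shows "trm R n \<in> Obj X" "diff R n \<in> Mor X (trm R (Suc n)) (trm R n)" "aug R \<in> Mor X (trm R 0) M" "M \<in> Obj X"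
  using ar.cpxD(1,2,3,5)[OF C] by auto

lemma cocycles_ar:
  assumes C: "ar.cpx M (wrap M R)" and N: "N \<in> Obj X"
  shows "z \<in> cocycles X R N n \<longleftrightarrow> ar.cyc (wrap M R) N n (Hm (trm R n) z N)"
  using cpx_raw[OF C] N unfolding cocycles_def kernel_def ar.cyc_def by (auto simp: ar_zr_def)

lemma coboundaries_ar:
  assumes C: "ar.cpx M (wrap M R)" and N: "N \<in> Obj X"
  shows "z \<in> coboundaries X R N n \<longleftrightarrow> ar.cob (wrap M R) N n (Hm (trm R n) z N)"
proof (cases n)
  case 0 then show ?thesis using cpx_raw[OF C] N by (auto simp: ar_zr_def)
next
  case (Suc k)
  show ?thesis unfolding Suc coboundaries.simps ar.cob.simps ex_hm
    using cpx_raw[OF C] N by auto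
qed

lemma cyc_cases:
  assumes "ar.cyc (wrap M R) N n a"
  obtains z where "a = Hm (trm R n) z N" "z \<in> Mor X (trm R n) N" "ar_mor a = z"
  using hm_arrow[OF ar.cycD(1)[OF assms]] by auto

lemma subgroups:
  assumes C: "ar.cpx M (wrap M R)" and N: "N \<in> Obj X"
  shows "subgroup (cocycles X R N n) (Hom X (trm R n) N)" "subgroup (coboundaries X R N n) (Hom X (trm R n) N)"
    "coboundaries X R N n \<subseteq> cocycles X R N n"
proof -
  note c = cpx_raw[OF C]
  have g: "group_hom (Hom X (trm R k) N) (Hom X (trm R (Suc k)) N) (\<lambda>h. h \<cdot> diff R k)" for k
    unfolding group_hom_def group_hom_axioms_def using bihom(2)[OF c(2) c(1,1) N] c N by simp
  show "subgroup (cocycles X R N n) (Hom X (trm R n) N)"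
    unfolding cocycles_def by (rule group_hom.subgroup_kernel[OF g])
  show "subgroup (coboundaries X R N n) (Hom X (trm R n) N)"
  proof (cases n)
    case 0 then show ?thesis using group.triv_subgroup[of "Hom X (trm R 0) N"] c N by simp
  next
    case (Suc k) then show ?thesis using group_hom.img_is_subgroup[OF g] by simp
  qed
  show "coboundaries X R N n \<subseteq> cocycles X R N n"
    unfolding subset_iff coboundaries_ar[OF C N] cocycles_ar[OF C N] using ar.cob_cyc[OF C N] by blast
qed

definition cls :: "('a, 'b) aug_complex \<Rightarrow> 'a \<Rightarrow> nat \<Rightarrow> ('a, 'b, 'c) arrow \<Rightarrow> 'b set" where
  "cls R N n a = coh_class X R N n (ar_mor a)"

text \<open>The interface to the quotient groups: equality of classes becomes \<open>eqc\<close> and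
  triviality becomes \<open>cob\<close>, so the results on cocycles and coboundaries of arrows
  apply.\<close>

lemma coh_group:
  assumes C: "ar.cpx M (wrap M R)" and N: "N \<in> Obj X"
  shows "group (cohomology X R N n)"
    "\<alpha> \<in> carrier (cohomology X R N n) \<longleftrightarrow> (\<exists>a. ar.cyc (wrap M R) N n a \<and> \<alpha> = cls R N n a)"
    "\<lbrakk>ar.cyc (wrap M R) N n a; ar.cyc (wrap M R) N n b\<rbrakk> \<Longrightarrow>
       cls R N n a \<otimes>\<^bsub>cohomology X R N n\<^esub> cls R N n b = cls R N n (ar_add X a b)"
    "\<lbrakk>ar.cyc (wrap M R) N n a; ar.cyc (wrap M R) N n b\<rbrakk> \<Longrightarrow> cls R N n a = cls R N n b \<longleftrightarrow> ar.eqc (wrap M R) N n a b"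
    "ar.cyc (wrap M R) N n a \<Longrightarrow> cls R N n a = \<one>\<^bsub>cohomology X R N n\<^esub> \<longleftrightarrow> ar.cob (wrap M R) N n a"
proof -
  note c = cpx_raw[OF C] and S = subgroups[OF C N, of n]
  interpret H: comm_group "Hom X (trm R n) N" by (rule hom_comm_group[OF c(1) N])
  note Q = H.subquotient[OF S]
  show "group (cohomology X R N n)" unfolding cohomology_def by (rule Q(1))
  have "(\<exists>z \<in> cocycles X R N n. \<alpha> = coh_class X R N n z) \<longleftrightarrow> (\<exists>a. ar.cyc (wrap M R) N n a \<and> \<alpha> = cls R N n a)"
  proof
    assume "\<exists>z \<in> cocycles X R N n. \<alpha> = coh_class X R N n z"
    then obtain z where "ar.cyc (wrap M R) N n (Hm (trm R n) z N)" "\<alpha> = coh_class X R N n z"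
      using cocycles_ar[OF C N] by blast
    then show "\<exists>a. ar.cyc (wrap M R) N n a \<and> \<alpha> = cls R N n a"
      unfolding cls_def by (intro exI[of _ "Hm (trm R n) z N"]) simp
  next
    assume "\<exists>a. ar.cyc (wrap M R) N n a \<and> \<alpha> = cls R N n a"
    then obtain a where a: "ar.cyc (wrap M R) N n a" "\<alpha> = cls R N n a" by blast
    obtain z where z: "a = Hm (trm R n) z N" by (rule cyc_cases[OF a(1)])
    show "\<exists>z \<in> cocycles X R N n. \<alpha> = coh_class X R N n z"
      using a unfolding z cls_def by (intro bexI[of _ z]) (simp_all add: cocycles_ar[OF C N])
  qed
  then show "\<alpha> \<in> carrier (cohomology X R N n) \<longleftrightarrow> (\<exists>a. ar.cyc (wrap M R) N n a \<and> \<alpha> = cls R N n a)"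
    unfolding cohomology_def Q(2) coh_class_def image_iff .
  show "cls R N n a \<otimes>\<^bsub>cohomology X R N n\<^esub> cls R N n b = cls R N n (ar_add X a b)"
    if a: "ar.cyc (wrap M R) N n a" and b: "ar.cyc (wrap M R) N n b"
  proof -
    obtain z where z: "a = Hm (trm R n) z N" "z \<in> Mor X (trm R n) N" by (rule cyc_cases[OF a])
    obtain z' where z': "b = Hm (trm R n) z' N" "z' \<in> Mor X (trm R n) N" by (rule cyc_cases[OF b])
    have "z \<in> cocycles X R N n" "z' \<in> cocycles X R N n" using a b unfolding z z' cocycles_ar[OF C N] by auto
    then show ?thesis using Q(4) z z' c N unfolding cohomology_def cls_def coh_class_def by simp
  qed
  show "cls R N n a = cls R N n b \<longleftrightarrow> ar.eqc (wrap M R) N n a b"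
    if a: "ar.cyc (wrap M R) N n a" and b: "ar.cyc (wrap M R) N n b"
  proof -
    obtain z where z: "a = Hm (trm R n) z N" "z \<in> Mor X (trm R n) N" by (rule cyc_cases[OF a])
    obtain z' where z': "b = Hm (trm R n) z' N" "z' \<in> Mor X (trm R n) N" by (rule cyc_cases[OF b])
    show ?thesis unfolding cls_def coh_class_def ar.eqc_def
      using Q(5)[of z z'] coboundaries_ar[OF C N, of _ n] z z' c N by simp
  qed
  show "cls R N n a = \<one>\<^bsub>cohomology X R N n\<^esub> \<longleftrightarrow> ar.cob (wrap M R) N n a" if a: "ar.cyc (wrap M R) N n a"
  proof -
    obtain z where z: "a = Hm (trm R n) z N" "z \<in> Mor X (trm R n) N" by (rule cyc_cases[OF a])
    have "coboundaries X R N n #>\<^bsub>Hom X (trm R n) N\<^esub> z = coboundaries X R N n \<longleftrightarrow> z \<in> coboundaries X R N n"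
      using H.coset_join2[OF z(2) S(2)] H.rcos_self[OF z(2) S(2)] by auto
    then show ?thesis unfolding cls_def coh_class_def cohomology_def Q(3) using coboundaries_ar[OF C N] z by simp
  qed
qed

lemma lifts_ar:
  assumes R: "ar.cpx A (wrap A R)" and S: "ar.cpx B (wrap B S)" and f: "f \<in> Mor X A B"
  shows "lifts X R S f \<phi> \<longleftrightarrow> ar.lft (wrap A R) (wrap B S) (Hm A f B) (\<lambda>n. Hm (trm R n) (\<phi> n) (trm S n))"
proof (cases "\<forall>n. \<phi> n \<in> Mor X (trm R n) (trm S n)")
  case True
  then have t: "\<phi> n \<in> Mor X (trm R n) (trm S n)" for n by blast
  show ?thesis unfolding lifts_def ar.lft_def
    using cpx_raw[OF R] cpx_raw[OF S] f by (simp add: t)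
next
  case False
  then show ?thesis unfolding lifts_def ar.lft_def by auto
qed

lemma lft_raw:
  assumes "ar.lft (wrap A R) (wrap B S) m \<phi>"
  shows "\<phi> = (\<lambda>n. Hm (trm R n) (ar_mor (\<phi> n)) (trm S n))"
proof
  fix n
  have "ar.hm (trm R n) (trm S n) (\<phi> n)" using ar.lftD(1)[OF assms, of n] by simp
  then show "\<phi> n = Hm (trm R n) (ar_mor (\<phi> n)) (trm S n)" using hm_arrow by blast
qed

text \<open>The described value is unique since another representative changes it by a coboundary
  (\<open>eqc_pull\<close>) and another lift of \<open>f\<close> by a homotopy
  (\<open>eqc_lft\<close>).\<close>

lemma coh_pull_cls:
  assumes R: "ar.cpx A (wrap A R)" and S: "ar.cpx B (wrap B S)" and ac: "\<And>n. ar.acy (trm R n) B (wrap B S)"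
    and f: "f \<in> Mor X A B" and N: "N \<in> Obj X"
    and l: "ar.lft (wrap A R) (wrap B S) (Hm A f B) \<phi>" and a: "ar.cyc (wrap B S) N n a"
  shows "coh_pull X R S f N n (cls S N n a) = cls R N n (ar_mul X a (\<phi> n))"
proof -
  note cR = cpx_raw[OF R] and cS = cpx_raw[OF S]
  have o: "ar.hm A B (Hm A f B)" using f cR cS by simp
  have ac': "ar.acy (trm (wrap A R) n) B (wrap B S)" for n using ac by simp
  obtain z where z: "a = Hm (trm S n) z N" "z \<in> Mor X (trm S n) N" by (rule cyc_cases[OF a])
  have v: "cls R N n (ar_mul X (Hm (trm S n) z' N) (Hm (trm R n) h (trm S n))) = coh_class X R N n (z' \<cdot> h)"
    if "z' \<in> Mor X (trm S n) N" "h \<in> Mor X (trm R n) (trm S n)" for z' h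
    using that cR cS N unfolding cls_def by simp
  note e = lft_raw[OF l]
  show ?thesis unfolding coh_pull_def
  proof (rule the_equality)
    have "lifts X R S f (\<lambda>n. ar_mor (\<phi> n))" using l unfolding lifts_ar[OF R S f] e[symmetric] .
    moreover have "z \<in> cocycles X S N n" using a unfolding z cocycles_ar[OF S N] .
    moreover have "cls S N n a = coh_class X S N n z" unfolding cls_def z by simp
    moreover have "cls R N n (ar_mul X a (\<phi> n)) = coh_class X R N n (z \<cdot> ar_mor (\<phi> n))"
    proof -
      have p: "\<phi> n = Hm (trm R n) (ar_mor (\<phi> n)) (trm S n)" "ar_mor (\<phi> n) \<in> Mor X (trm R n) (trm S n)"
        using hm_arrow[OF ar.lftD(1)[OF l, of n]] by auto
      show ?thesis using v[OF z(2) p(2)] z(1) p(1) by metis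
    qed
    ultimately show "\<exists>\<phi>' z. lifts X R S f \<phi>' \<and> z \<in> cocycles X S N n \<and> cls S N n a = coh_class X S N n z \<and>
        cls R N n (ar_mul X a (\<phi> n)) = coh_class X R N n (z \<cdot> \<phi>' n)" by blast
  next
    fix \<beta> assume "\<exists>\<phi> z. lifts X R S f \<phi> \<and> z \<in> cocycles X S N n \<and> cls S N n a = coh_class X S N n z \<and>
        \<beta> = coh_class X R N n (z \<cdot> \<phi> n)"
    then obtain \<psi> u where u: "lifts X R S f \<psi>" "u \<in> cocycles X S N n" "cls S N n a = coh_class X S N n u"
      "\<beta> = coh_class X R N n (u \<cdot> \<psi> n)" by blast
    let ?u = "Hm (trm S n) u N" and ?\<psi> = "\<lambda>n. Hm (trm R n) (\<psi> n) (trm S n)"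
    have c: "ar.cyc (wrap B S) N n ?u" using u(2) cocycles_ar[OF S N] by simp
    have l': "ar.lft (wrap A R) (wrap B S) (Hm A f B) ?\<psi>" using u(1) lifts_ar[OF R S f] by simp
    have "ar.eqc (wrap B S) N n ?u a" using coh_group(4)[OF S N c a] u(3) unfolding cls_def by simp
    then have "ar.eqc (wrap A R) N n (ar_mul X ?u (?\<psi> n)) (ar_mul X a (?\<psi> n))" by (rule ar.eqc_pull[OF R l'])
    then have "ar.eqc (wrap A R) N n (ar_mul X ?u (?\<psi> n)) (ar_mul X a (\<phi> n))"
      by (rule ar.eqc_trans[OF R _ ar.eqc_lft[OF R S ac' o l' l a]])
    then have "cls R N n (ar_mul X ?u (?\<psi> n)) = cls R N n (ar_mul X a (\<phi> n))"
      using coh_group(4)[OF R N ar.cyc_pull[OF R l' c] ar.cyc_pull[OF R l a]] by simp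
    then show "\<beta> = cls R N n (ar_mul X a (\<phi> n))"
      using v[of u "\<psi> n"] u(4) c u(1) by (auto simp: ar.cyc_def lifts_def)
  qed
qed

lemma cyc_push:
  assumes R: "ar.cpx A (wrap A R)" and g: "g \<in> Mor X N N'" "N \<in> Obj X" "N' \<in> Obj X" and a: "ar.cyc (wrap A R) N n a"
  shows "ar.cyc (wrap A R) N' n (ar_mul X (Hm N g N') a)"
proof -
  have g': "ar.hm N N' (Hm N g N')" using g by simp
  show ?thesis using ar.cycD[OF a] g' ar.cpxD(2)[OF R] unfolding ar.cyc_def by (simp del: ar_val.simps)
qed

lemma eqc_push:
  assumes R: "ar.cpx A (wrap A R)" and g: "g \<in> Mor X N N'" "N \<in> Obj X" "N' \<in> Obj X" and e: "ar.eqc (wrap A R) N n a b"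
  shows "ar.eqc (wrap A R) N' n (ar_mul X (Hm N g N') a) (ar_mul X (Hm N g N') b)"
proof -
  have g': "ar.hm N N' (Hm N g N')" using g by simp
  have "ar.cob (wrap A R) N' n (ar_mul X (Hm N g N') u)" if u: "ar.cob (wrap A R) N n u" for u
  proof (cases n)
    case 0 then show ?thesis using u g' ar.cpxD(2)[OF R, of 0] by (simp del: ar_val.simps ar_mul.simps)
  next
    case (Suc k)
    from u[unfolded Suc ar.cob.simps wrap_simps(1)]
    obtain h where h: "ar.hm (trm R k) N h" "u = ar_mul X h (diff (wrap A R) k)" by blast
    have "ar_mul X (Hm N g N') u = ar_mul X (ar_mul X (Hm N g N') h) (diff (wrap A R) k)" unfolding h(2) by (simp del: wrap_simps)
    moreover have "ar.hm (trm R k) N' (ar_mul X (Hm N g N') h)" using h(1) g' by (simp del: ar_val.simps)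
    ultimately show ?thesis unfolding Suc ar.cob.simps wrap_simps(1) by blast
  qed
  from this[of "ar_add X a (ar_neg X b)"] show ?thesis using e g' unfolding ar.eqc_def by (simp del: ar_val.simps)
qed

lemma coh_push_cls:
  assumes R: "ar.cpx A (wrap A R)" and g: "g \<in> Mor X N N'" "N \<in> Obj X" "N' \<in> Obj X" and a: "ar.cyc (wrap A R) N n a"
  shows "coh_push X R N N' g n (cls R N n a) = cls R N' n (ar_mul X (Hm N g N') a)"
proof -
  note c = cpx_raw[OF R]
  have v: "cls R N' n (ar_mul X (Hm N g N') (Hm (trm R n) z N)) = coh_class X R N' n (g \<cdot> z)"
    if "z \<in> Mor X (trm R n) N" for z using that c g unfolding cls_def by simp
  obtain z where z: "a = Hm (trm R n) z N" "z \<in> Mor X (trm R n) N" by (rule cyc_cases[OF a])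
  show ?thesis unfolding coh_push_def
  proof (rule the_equality)
    show "\<exists>z. z \<in> cocycles X R N n \<and> cls R N n a = coh_class X R N n z \<and>
        cls R N' n (ar_mul X (Hm N g N') a) = coh_class X R N' n (g \<cdot> z)"
      using a v[OF z(2)] unfolding z by (intro exI[of _ z]) (simp add: cocycles_ar[OF R g(2)] cls_def)
  next
    fix \<beta> assume "\<exists>z. z \<in> cocycles X R N n \<and> cls R N n a = coh_class X R N n z \<and> \<beta> = coh_class X R N' n (g \<cdot> z)"
    then obtain u where u: "ar.cyc (wrap A R) N n (Hm (trm R n) u N)" "cls R N n a = cls R N n (Hm (trm R n) u N)"
      "\<beta> = coh_class X R N' n (g \<cdot> u)" using cocycles_ar[OF R g(2)] unfolding cls_def by auto
    have "ar.eqc (wrap A R) N n (Hm (trm R n) u N) a" using coh_group(4)[OF R g(2) u(1) a] u(2) by simp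
    from eqc_push[OF R g this]
    have "cls R N' n (ar_mul X (Hm N g N') (Hm (trm R n) u N)) = cls R N' n (ar_mul X (Hm N g N') a)"
      using coh_group(4)[OF R g(3) cyc_push[OF R g u(1)] cyc_push[OF R g a]] by simp
    then show "\<beta> = cls R N' n (ar_mul X (Hm N g N') a)" using v[of u] u(1,3) by (simp add: ar.cyc_def)
  qed
qed

lemma biprod_ar:
  "biprod X A B (S, i, j, p, q) \<longleftrightarrow> ar.bip A B S (Hm A i S) (Hm B j S) (Hm S p A) (Hm S q B)"
  unfolding ar.bip_def biprod.simps by (auto simp: ar_idn_def ar_zr_def intro: cmp_closed)

lemma horseshoe_ar:
  assumes T: "(A, B, C, x, y, \<delta>) \<in> \<xi>"
  shows "horseshoe X \<xi> (A, B, C, x, y, \<delta>) R R' R'' \<iota> \<pi> \<longleftrightarrow>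
    ar.hshoe ar.prj A B C (Hm A x B) (Hm B y C) (wrap A R) (wrap B R') (wrap C R'')
      (\<lambda>n. Hm (trm R n) (\<iota> n) (trm R' n)) (\<lambda>n. Hm (trm R' n) (\<pi> n) (trm R'' n))"
proof -
  note t = etri_typ[OF xi_etri[OF T]]
  have "lifts X R R' x \<iota> \<longleftrightarrow> ar.lft (wrap A R) (wrap B R') (Hm A x B) (\<lambda>n. Hm (trm R n) (\<iota> n) (trm R' n))"
    "lifts X R' R'' y \<pi> \<longleftrightarrow> ar.lft (wrap B R') (wrap C R'') (Hm B y C) (\<lambda>n. Hm (trm R' n) (\<pi> n) (trm R'' n))"
    if "ar.res ar.prj A (wrap A R)" "ar.res ar.prj B (wrap B R')" "ar.res ar.prj C (wrap C R'')"
    using lifts_ar[OF ar.res_cpx[OF that(1)] ar.res_cpx[OF that(2)] t(4)]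
      lifts_ar[OF ar.res_cpx[OF that(2)] ar.res_cpx[OF that(3)] t(5)] by blast+
  moreover have "(\<exists>s r. biprod X (trm R n) (trm R'' n) (trm R' n, \<iota> n, s, r, \<pi> n)) \<longleftrightarrow>
    (\<exists>s r. ar.bip (trm R n) (trm R'' n) (trm R' n) (Hm (trm R n) (\<iota> n) (trm R' n)) s r (Hm (trm R' n) (\<pi> n) (trm R'' n)))" for n
  proof
    assume "\<exists>s r. ar.bip (trm R n) (trm R'' n) (trm R' n) (Hm (trm R n) (\<iota> n) (trm R' n)) s r (Hm (trm R' n) (\<pi> n) (trm R'' n))"
    then obtain s r where b: "ar.bip (trm R n) (trm R'' n) (trm R' n) (Hm (trm R n) (\<iota> n) (trm R' n)) s r
        (Hm (trm R' n) (\<pi> n) (trm R'' n))" by blast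
    have "s = Hm (trm R'' n) (ar_mor s) (trm R' n)" "r = Hm (trm R' n) (ar_mor r) (trm R n)"
      using hm_arrow[OF ar.bipD(2)[OF b]] hm_arrow[OF ar.bipD(3)[OF b]] by blast+
    then show "\<exists>s r. biprod X (trm R n) (trm R'' n) (trm R' n, \<iota> n, s, r, \<pi> n)" using b unfolding biprod_ar by metis
  qed (use biprod_ar in blast)
  ultimately show ?thesis unfolding horseshoe.simps proj_res_ar ar.hshoe_def wrap_simps by blast
qed

text \<open>Naturality for the identity of the triangle, between two horseshoes with the same outer
  resolutions but different middle ones.\<close>

lemma connecting_cls:
  assumes H: "ar.hshoe \<W> A B C x y (wrap A R) R1 (wrap C R'') \<iota> \<pi>"
    and H': "ar.hshoe \<W> A B C x y (wrap A R) R2 (wrap C R'') \<iota>' \<pi>'"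
    and T: "ar.th \<W> A B C x y d" and N: "N \<in> Obj X"
    and d: "ar.cdat (wrap A R) R1 (wrap C R'') \<iota> \<pi> N n z w v"
    and d': "ar.cdat (wrap A R) R2 (wrap C R'') \<iota>' \<pi>' N n z' w' v'" and e: "cls R N n z = cls R N n z'"
  shows "cls R'' N (Suc n) v = cls R'' N (Suc n) v'"
proof -
  note c = ar.hshoe_cpx[OF H] and E = conjunct1[OF ar.thD(1)[OF T]]
  have o: "ar.hm A A (ar_idn X A)" "ar.hm B B (ar_idn X B)" "ar.hm C C (ar_idn X C)"
    "ar_mul X (ar_idn X B) x = ar_mul X x (ar_idn X A)" "ar_mul X y (ar_idn X B) = ar_mul X (ar_idn X C) y"
    using E by simp_all
  note z = ar.cdatD(1)[OF d] and z' = ar.cdatD(1)[OF d']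
  have "ar.eqc (wrap A R) N n z z'" using coh_group(4)[OF c(1) N z z'] e by simp
  moreover have "ar_mul X z' (ar_idn X (trm (wrap A R) n)) = z'" using ar.cycD(1)[OF z'] by simp
  ultimately have "ar.eqc (wrap A R) N n z (ar_mul X z' (ar_idn X (trm (wrap A R) n)))" by simp
  from ar.connecting_natural[OF H H' ar.thD(1)[OF T] T ar.cmpw_refl o ar.lft_id[OF c(1)] ar.lft_id[OF c(3)] d d' this]
  have "ar.eqc (wrap C R'') N (Suc n) v v'" using ar.cdatD(4)[OF d'] by simp
  then show ?thesis using coh_group(4)[OF c(3) N ar.cdat_cyc[OF H d] ar.cdat_cyc[OF H' d']] by simp
qed

text \<open>The given zigzag, stripped to raw morphisms, witnesses the description; any competing
  horseshoe and zigzag give the same class by \<open>connecting_cls\<close>.\<close>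

lemma xi_connecting_cls:
  assumes T: "(A, B, C, x, y, \<delta>) \<in> \<xi>" and N: "N \<in> Obj X"
    and H: "ar.hshoe ar.prj A B C (Hm A x B) (Hm B y C) (wrap A R) R1 (wrap C R'') \<iota> \<pi>"
    and d: "ar.cdat (wrap A R) R1 (wrap C R'') \<iota> \<pi> N n z w v"
  shows "xi_connecting X \<xi> (A, B, C, x, y, \<delta>) R R'' N n (cls R N n z) = cls R'' N (Suc n) v"
proof -
  have th: "ar.th ar.prj A B C (Hm A x B) (Hm B y C) (Ex C \<delta> A)" using T th_prj_ar by blast
  note c = ar.hshoe_cpx[OF H]
  obtain R' where R': "R1 = wrap B R'" using unwrap[OF c(2)] by blast
  note cR = cpx_raw[OF c(1)] cpx_raw[OF c(2)[unfolded R']] cpx_raw[OF c(3)]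
  show ?thesis unfolding xi_connecting_def
  proof (rule the_equality)
    note H1 = H[unfolded R'] and d1 = d[unfolded R']
    have i: "\<iota> = (\<lambda>n. Hm (trm R n) (ar_mor (\<iota> n)) (trm R' n))" by (rule lft_raw[OF ar.hshoeD(4)[OF H1]])
    have p: "\<pi> = (\<lambda>n. Hm (trm R' n) (ar_mor (\<pi> n)) (trm R'' n))" by (rule lft_raw[OF ar.hshoeD(5)[OF H1]])
    have h: "horseshoe X \<xi> (A, B, C, x, y, \<delta>) R R' R'' (\<lambda>n. ar_mor (\<iota> n)) (\<lambda>n. ar_mor (\<pi> n))"
      unfolding horseshoe_ar[OF T] i[symmetric] p[symmetric] by (rule H1)
    note D = ar.cdatD[OF d1, unfolded wrap_simps]
    obtain z0 where z0: "z = Hm (trm R n) z0 N" "z0 \<in> Mor X (trm R n) N" by (rule cyc_cases[OF D(1)])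
    have w0: "w = Hm (trm R' n) (ar_mor w) N" "ar_mor w \<in> Mor X (trm R' n) N" using hm_arrow[OF D(2)] by auto
    have v0: "v = Hm (trm R'' (Suc n)) (ar_mor v) N" "ar_mor v \<in> Mor X (trm R'' (Suc n)) N" using hm_arrow[OF D(4)] by auto
    have i0: "\<iota> n = Hm (trm R n) (ar_mor (\<iota> n)) (trm R' n)" "ar_mor (\<iota> n) \<in> Mor X (trm R n) (trm R' n)"
      using hm_arrow[OF ar.lftD(1)[OF ar.hshoeD(4)[OF H1], of n]] by auto
    have p0: "\<pi> (Suc n) = Hm (trm R' (Suc n)) (ar_mor (\<pi> (Suc n))) (trm R'' (Suc n))" "ar_mor (\<pi> (Suc n)) \<in> Mor X (trm R' (Suc n)) (trm R'' (Suc n))"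
      using hm_arrow[OF ar.lftD(1)[OF ar.hshoeD(5)[OF H1], of "Suc n"]] by auto
    have "ar_mul X (Hm (trm R' n) (ar_mor w) N) (Hm (trm R n) (ar_mor (\<iota> n)) (trm R' n)) = Hm (trm R n) z0 N"
      using D(3) w0(1) i0(1) z0(1) by metis
    then have e1: "ar_mor w \<cdot> ar_mor (\<iota> n) = z0" using w0(2) i0(2) cR N by simp
    have "ar_mul X (Hm (trm R'' (Suc n)) (ar_mor v) N) (Hm (trm R' (Suc n)) (ar_mor (\<pi> (Suc n))) (trm R'' (Suc n))) =
        ar_mul X (Hm (trm R' n) (ar_mor w) N) (Hm (trm R' (Suc n)) (diff R' n) (trm R' n))"
      using D(5) w0(1) v0(1) p0(1) by metis
    then have e2: "ar_mor v \<cdot> ar_mor (\<pi> (Suc n)) = ar_mor w \<cdot> diff R' n" using w0(2) v0(2) p0(2) cR N by simp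
    have e3: "z0 \<in> cocycles X R N n" using D(1) unfolding z0 cocycles_ar[OF c(1) N] .
    have e4: "cls R N n z = coh_class X R N n z0" unfolding cls_def z0 by simp
    show "\<exists>R' \<iota> \<pi> z' w v'. horseshoe X \<xi> (A, B, C, x, y, \<delta>) R R' R'' \<iota> \<pi> \<and> z' \<in> cocycles X R N n \<and>
        cls R N n z = coh_class X R N n z' \<and> w \<in> Mor X (trm R' n) N \<and> w \<cdot> \<iota> n = z' \<and>
        v' \<in> Mor X (trm R'' (Suc n)) N \<and> v' \<cdot> \<pi> (Suc n) = w \<cdot> diff R' n \<and>
        cls R'' N (Suc n) v = coh_class X R'' N (Suc n) v'"
      by (rule exI[of _ R'], rule exI[of _ "\<lambda>n. ar_mor (\<iota> n)"], rule exI[of _ "\<lambda>n. ar_mor (\<pi> n)"],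
          rule exI[of _ z0], rule exI[of _ "ar_mor w"], rule exI[of _ "ar_mor v"])
        (use h e1 e2 e3 e4 w0(2) v0(2) in \<open>simp add: cls_def\<close>)
  next
    fix \<beta>
    assume "\<exists>R' \<iota> \<pi> z' w v'. horseshoe X \<xi> (A, B, C, x, y, \<delta>) R R' R'' \<iota> \<pi> \<and> z' \<in> cocycles X R N n \<and>
        cls R N n z = coh_class X R N n z' \<and> w \<in> Mor X (trm R' n) N \<and> w \<cdot> \<iota> n = z' \<and>
        v' \<in> Mor X (trm R'' (Suc n)) N \<and> v' \<cdot> \<pi> (Suc n) = w \<cdot> diff R' n \<and> \<beta> = coh_class X R'' N (Suc n) v'"
    then obtain S i p z' w' v' where
      h: "horseshoe X \<xi> (A, B, C, x, y, \<delta>) R S R'' i p" and *: "z' \<in> cocycles X R N n"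
        "cls R N n z = coh_class X R N n z'" "w' \<in> Mor X (trm S n) N" "w' \<cdot> i n = z'"
        "v' \<in> Mor X (trm R'' (Suc n)) N" "v' \<cdot> p (Suc n) = w' \<cdot> diff S n" "\<beta> = coh_class X R'' N (Suc n) v'" by blast
    note H2 = h[unfolded horseshoe_ar[OF T]]
    note cS = cpx_raw[OF ar.hshoe_cpx(2)[OF H2]] and l = ar.lftD(1)[OF ar.hshoeD(4)[OF H2], of n]
      ar.lftD(1)[OF ar.hshoeD(5)[OF H2], of "Suc n"]
    have "ar.cdat (wrap A R) (wrap B S) (wrap C R'') (\<lambda>n. Hm (trm R n) (i n) (trm S n)) (\<lambda>n. Hm (trm S n) (p n) (trm R'' n)) N n
       (Hm (trm R n) z' N) (Hm (trm S n) w' N) (Hm (trm R'' (Suc n)) v' N)"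
      unfolding ar.cdat_def using *(1,3-6) cocycles_ar[OF c(1) N, of z' n] cR cS l N by auto
    from connecting_cls[OF H H2 th N d this]
    have "cls R'' N (Suc n) v = cls R'' N (Suc n) (Hm (trm R'' (Suc n)) v' N)" using *(2) by (simp add: cls_def)
    then show "\<beta> = cls R'' N (Suc n) v" using *(7) by (simp add: cls_def)
  qed
qed

end

section \<open>The long exact sequence\<close>

context proper_class_proj
begin

text \<open>A biproduct is a split extension, and split triangles are in \<open>xi\<close>.\<close>

lemma gp_bip:
  assumes b: "ar.bip G H S i j p q" and g: "ar.gp G" "ar.gp H"
  shows "ar.gp S"
proof -
  note B = ar.bipD[OF b]
  have "ar.exi G S H i q (ar_zr X True H G)"
    using ar.tri_split[OF b] ar.xi_split[OF ar.tri_split[OF b]] B by simp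
  then show ?thesis using ar.gp_ext g by blast
qed

lemma coh_pull_hom:
  assumes R: "ar.cpx A (wrap A R)" and S: "ar.cpx B (wrap B S)" and ac: "\<And>n. ar.acy (trm R n) B (wrap B S)"
    and f: "f \<in> Mor X A B" and N: "N \<in> Obj X"
  shows "coh_pull X R S f N n \<in> hom (cohomology X S N n) (cohomology X R N n)"
proof -
  have o: "ar.hm A B (Hm A f B)" using f ar.cpxD(1)[OF R] ar.cpxD(1)[OF S] by simp
  obtain \<phi> where l: "ar.lft (wrap A R) (wrap B S) (Hm A f B) \<phi>" using ar.lft_ex[OF R S _ o] ac by auto
  note P = coh_pull_cls[OF R S ac f N l] and Y = ar.cyc_pull[OF R l]
  show ?thesis
  proof (rule homI)
    fix \<alpha> assume "\<alpha> \<in> carrier (cohomology X S N n)"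
    then obtain a where "ar.cyc (wrap B S) N n a" "\<alpha> = cls S N n a" using coh_group(2)[OF S N] by blast
    then show "coh_pull X R S f N n \<alpha> \<in> carrier (cohomology X R N n)" using P Y coh_group(2)[OF R N] by blast
  next
    fix \<alpha> \<beta> assume "\<alpha> \<in> carrier (cohomology X S N n)" "\<beta> \<in> carrier (cohomology X S N n)"
    then obtain a b where a: "ar.cyc (wrap B S) N n a" "\<alpha> = cls S N n a" and b: "ar.cyc (wrap B S) N n b" "\<beta> = cls S N n b"
      using coh_group(2)[OF S N] by metis
    show "coh_pull X R S f N n (\<alpha> \<otimes>\<^bsub>cohomology X S N n\<^esub> \<beta>) =
        coh_pull X R S f N n \<alpha> \<otimes>\<^bsub>cohomology X R N n\<^esub> coh_pull X R S f N n \<beta>"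
      unfolding a(2) b(2) coh_group(3)[OF S N a(1) b(1)] P[OF a(1)] P[OF b(1)] P[OF ar.cyc_add[OF S a(1) b(1)]]
        coh_group(3)[OF R N Y[OF a(1)] Y[OF b(1)]] by simp
  qed
qed

lemma exact_seq3I:
  assumes "group G1" "group G2" "group G3" "f \<in> hom G1 G2" "g \<in> hom G2 G3"
    and "\<And>a. a \<in> carrier G1 \<Longrightarrow> g (f a) = \<one>\<^bsub>G3\<^esub>"
    and "\<And>b. b \<in> carrier G2 \<Longrightarrow> g b = \<one>\<^bsub>G3\<^esub> \<Longrightarrow> \<exists>a \<in> carrier G1. b = f a"
  shows "exact_seq ([G3, G2, G1], [g, f])"
proof -
  have "kernel G2 G3 g = f ` carrier G1"
    using assms(6,7) hom_in_carrier[OF assms(4)] unfolding kernel_def by blast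
  then show ?thesis using assms(1-5) by (simp add: group_hom_def group_hom_axioms_def)
qed

end

locale chosen_resolutions = proper_class_proj +
  fixes RP RG
  assumes RP: "resolution_choice (xi_proj_resolution X \<xi>) RP"
    and RG: "resolution_choice (xi_Gproj_resolution X \<xi>) RG"
begin

section \<open>Connecting homomorphisms for the chosen resolutions\<close>

lemma RG_res: "ar.gpf M \<Longrightarrow> ar.res ar.gp M (wrap M (RG M))"
  using Gproj_res_ex RG unfolding resolution_choice_def Gproj_res_ar by blast

lemma RP_res: "M \<in> Obj X \<Longrightarrow> ar.res ar.prj M (wrap M (RP M))"
  using proj_res_ex RP unfolding resolution_choice_def proj_res_ar by blast

text \<open>\<open>\<beta>\<close> does not depend on the horseshoe by \<open>connecting_cls\<close>.\<close>

definition eps :: "nat \<Rightarrow> ('a, 'b, 'c) tri \<Rightarrow> 'a \<Rightarrow> 'b set \<Rightarrow> 'b set" where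
  "eps n T N \<alpha> = (case T of (M, M', M'', x, y, \<delta>) \<Rightarrow>
     THE \<beta>. \<exists>R' \<iota> \<pi> z w v.
       ar.hshoe ar.gp M M' M'' (Hm M x M') (Hm M' y M'') (wrap M (RG M)) R' (wrap M'' (RG M'')) \<iota> \<pi> \<and>
       ar.cdat (wrap M (RG M)) R' (wrap M'' (RG M'')) \<iota> \<pi> N n z w v \<and>
       \<alpha> = cls (RG M) N n z \<and> \<beta> = cls (RG M'') N (Suc n) v)"

lemma eps_cls:
  assumes H: "ar.hshoe ar.gp M M' M'' (Hm M x M') (Hm M' y M'') (wrap M (RG M)) R' (wrap M'' (RG M'')) \<iota> \<pi>"
    and T: "ar.th ar.gp M M' M'' (Hm M x M') (Hm M' y M'') d" and N: "N \<in> Obj X"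
    and d: "ar.cdat (wrap M (RG M)) R' (wrap M'' (RG M'')) \<iota> \<pi> N n z w v"
  shows "eps n (M, M', M'', x, y, \<delta>) N (cls (RG M) N n z) = cls (RG M'') N (Suc n) v"
  unfolding eps_def prod.case
proof (rule the_equality)
  show "\<exists>R' \<iota> \<pi> z' w v'.
       ar.hshoe ar.gp M M' M'' (Hm M x M') (Hm M' y M'') (wrap M (RG M)) R' (wrap M'' (RG M'')) \<iota> \<pi> \<and>
       ar.cdat (wrap M (RG M)) R' (wrap M'' (RG M'')) \<iota> \<pi> N n z' w v' \<and>
       cls (RG M) N n z = cls (RG M) N n z' \<and> cls (RG M'') N (Suc n) v = cls (RG M'') N (Suc n) v'"
    by (intro exI conjI, rule H, rule d) (rule refl)+
next
  fix \<beta>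
  assume "\<exists>R' \<iota> \<pi> z' w v'.
       ar.hshoe ar.gp M M' M'' (Hm M x M') (Hm M' y M'') (wrap M (RG M)) R' (wrap M'' (RG M'')) \<iota> \<pi> \<and>
       ar.cdat (wrap M (RG M)) R' (wrap M'' (RG M'')) \<iota> \<pi> N n z' w v' \<and>
       cls (RG M) N n z = cls (RG M) N n z' \<and> \<beta> = cls (RG M'') N (Suc n) v'"
  then obtain S \<iota>' \<pi>' z' w' v' where
    H': "ar.hshoe ar.gp M M' M'' (Hm M x M') (Hm M' y M'') (wrap M (RG M)) S (wrap M'' (RG M'')) \<iota>' \<pi>'"
    and d': "ar.cdat (wrap M (RG M)) S (wrap M'' (RG M'')) \<iota>' \<pi>' N n z' w' v'"
    and e: "cls (RG M) N n z = cls (RG M) N n z'" "\<beta> = cls (RG M'') N (Suc n) v'" by blast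
  show "\<beta> = cls (RG M'') N (Suc n) v" using connecting_cls[OF H H' T N d d' e(1)] e(2) by simp
qed

text \<open>Finite dimension is given for the two outer terms. For the middle term the horseshoe
  over their resolutions provides some resolution, and then the chosen one is a resolution as
  well.\<close>

lemma fin_tri:
  assumes "(M, M', M'', x, y, \<delta>) \<in> finite_Gpd_tris X \<xi>"
  shows "ar.th ar.gp M M' M'' (Hm M x M') (Hm M' y M'') (Ex M'' \<delta> M)"
    "ar.res ar.gp M (wrap M (RG M))" "ar.res ar.gp M' (wrap M' (RG M'))" "ar.res ar.gp M'' (wrap M'' (RG M''))"
    "\<exists>R' \<iota> \<pi>. ar.hshoe ar.gp M M' M'' (Hm M x M') (Hm M' y M'') (wrap M (RG M)) R' (wrap M'' (RG M'')) \<iota> \<pi>"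
    "(M, M', M'', x, y, \<delta>) \<in> \<xi>"
proof -
  show th: "ar.th ar.gp M M' M'' (Hm M x M') (Hm M' y M'') (Ex M'' \<delta> M)"
    using assms unfolding th_gp_ar finite_Gpd_tris_def by blast
  show r: "ar.res ar.gp M (wrap M (RG M))" "ar.res ar.gp M'' (wrap M'' (RG M''))"
    using assms RG_res gpf_ar unfolding finite_Gpd_tris_def by blast+
  show h: "\<exists>R' \<iota> \<pi>. ar.hshoe ar.gp M M' M'' (Hm M x M') (Hm M' y M'') (wrap M (RG M)) R' (wrap M'' (RG M'')) \<iota> \<pi>"
    by (rule ar.hshoe_ex[OF th r gp_bip])
  then obtain R' where R': "ar.res ar.gp M' R'" using ar.hshoeD(2) by blast
  obtain R0 where "R' = wrap M' R0" using unwrap[OF ar.res_cpx[OF R']] by blast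
  then have "xi_Gproj_resolution X \<xi> M' R0" using R' Gproj_res_ar by blast
  then show "ar.res ar.gp M' (wrap M' (RG M'))"
    using RG unfolding resolution_choice_def Gproj_res_ar by blast
  show "(M, M', M'', x, y, \<delta>) \<in> \<xi>" using assms unfolding finite_Gpd_tris_def Gproj_exact_tris_def by blast
qed

text \<open>Equal classes give the functorial action; \<open>prj\<close> as the source class gives
  the maps to ordinary cohomology.\<close>

lemma res_pull:
  assumes R: "ar.res \<V> A (wrap A R)" and S: "ar.res \<W> B (wrap B S)" and c: "ar.cmpw \<V> \<W>"
    and f: "f \<in> Mor X A B" and N: "N \<in> Obj X"
  shows "coh_pull X R S f N n \<in> hom (cohomology X S N n) (cohomology X R N n)"
    "\<exists>\<phi>. ar.lft (wrap A R) (wrap B S) (Hm A f B) \<phi>"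
    "ar.lft (wrap A R) (wrap B S) (Hm A f B) \<phi> \<Longrightarrow> ar.cyc (wrap B S) N n a \<Longrightarrow>
      coh_pull X R S f N n (cls S N n a) = cls R N n (ar_mul X a (\<phi> n))"
proof -
  note cR = ar.res_cpx[OF R] and cS = ar.res_cpx[OF S]
  have ac: "ar.acy (trm R n) B (wrap B S)" for n
    using ar.res_acy_cmpw[OF S c ar.res_trm[OF R]] by simp
  have "ar.hm A B (Hm A f B)" using f ar.cpxD(1)[OF cR] ar.cpxD(1)[OF cS] by simp
  then show "\<exists>\<phi>. ar.lft (wrap A R) (wrap B S) (Hm A f B) \<phi>" using ar.lft_ex[OF cR cS] ac by simp
  show "coh_pull X R S f N n \<in> hom (cohomology X S N n) (cohomology X R N n)"
    by (rule coh_pull_hom[OF cR cS ac f N])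
  show "ar.lft (wrap A R) (wrap B S) (Hm A f B) \<phi> \<Longrightarrow> ar.cyc (wrap B S) N n a \<Longrightarrow>
      coh_pull X R S f N n (cls S N n a) = cls R N n (ar_mul X a (\<phi> n))"
    by (rule coh_pull_cls[OF cR cS ac f N])
qed

lemma eps_hom:
  assumes T: "(M, M', M'', x, y, \<delta>) \<in> finite_Gpd_tris X \<xi>" and N: "N \<in> Obj X"
  shows "eps n (M, M', M'', x, y, \<delta>) N \<in> hom (xt X RG n M N) (xt X RG (Suc n) M'' N)"
proof -
  note F = fin_tri[OF T]
  obtain R' \<iota> \<pi> where H: "ar.hshoe ar.gp M M' M'' (Hm M x M') (Hm M' y M'') (wrap M (RG M)) R' (wrap M'' (RG M'')) \<iota> \<pi>"
    using F(5) by blast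
  note c = ar.hshoe_cpx[OF H]
  note E = eps_cls[OF H F(1) N, where \<delta> = \<delta>]
  show ?thesis unfolding xt_def
  proof (rule homI)
    fix \<alpha> assume "\<alpha> \<in> carrier (cohomology X (RG M) N n)"
    then obtain a where a: "ar.cyc (wrap M (RG M)) N n a" "\<alpha> = cls (RG M) N n a" using coh_group(2)[OF c(1) N] by blast
    obtain w v where d: "ar.cdat (wrap M (RG M)) R' (wrap M'' (RG M'')) \<iota> \<pi> N n a w v" by (rule ar.cdat_ex[OF H a(1)])
    show "eps n (M, M', M'', x, y, \<delta>) N \<alpha> \<in> carrier (cohomology X (RG M'') N (Suc n))"
      unfolding a(2) E[OF d] using ar.cdat_cyc[OF H d] coh_group(2)[OF c(3) N] by blast
  next
    fix \<alpha> \<beta> assume "\<alpha> \<in> carrier (cohomology X (RG M) N n)" "\<beta> \<in> carrier (cohomology X (RG M) N n)"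
    then obtain a b where a: "ar.cyc (wrap M (RG M)) N n a" "\<alpha> = cls (RG M) N n a"
      and b: "ar.cyc (wrap M (RG M)) N n b" "\<beta> = cls (RG M) N n b"
      using coh_group(2)[OF c(1) N] by metis
    obtain w v where d: "ar.cdat (wrap M (RG M)) R' (wrap M'' (RG M'')) \<iota> \<pi> N n a w v" by (rule ar.cdat_ex[OF H a(1)])
    obtain w' v' where d': "ar.cdat (wrap M (RG M)) R' (wrap M'' (RG M'')) \<iota> \<pi> N n b w' v'" by (rule ar.cdat_ex[OF H b(1)])
    show "eps n (M, M', M'', x, y, \<delta>) N (\<alpha> \<otimes>\<^bsub>cohomology X (RG M) N n\<^esub> \<beta>) =
      eps n (M, M', M'', x, y, \<delta>) N \<alpha> \<otimes>\<^bsub>cohomology X (RG M'') N (Suc n)\<^esub> eps n (M, M', M'', x, y, \<delta>) N \<beta>"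
      unfolding a(2) b(2) coh_group(3)[OF c(1) N a(1) b(1)] E[OF d] E[OF d'] E[OF ar.cdat_add[OF H d d']]
        coh_group(3)[OF c(3) N ar.cdat_cyc[OF H d] ar.cdat_cyc[OF H d']] by simp
  qed
qed

lemma long_exact:
  assumes T: "(M, M', M'', x, y, \<delta>) \<in> finite_Gpd_tris X \<xi>" and N: "N \<in> Obj X"
  shows "xt_contra X RG 0 M' M'' y N \<in> mon (xt X RG 0 M'' N) (xt X RG 0 M' N)"
    "exact_seq ([xt X RG n M N, xt X RG n M' N, xt X RG n M'' N],
       [xt_contra X RG n M M' x N, xt_contra X RG n M' M'' y N])"
    "exact_seq ([xt X RG (Suc n) M'' N, xt X RG n M N, xt X RG n M' N],
       [eps n (M, M', M'', x, y, \<delta>) N, xt_contra X RG n M M' x N])"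
    "exact_seq ([xt X RG (Suc n) M' N, xt X RG (Suc n) M'' N, xt X RG n M N],
       [xt_contra X RG (Suc n) M' M'' y N, eps n (M, M', M'', x, y, \<delta>) N])"
proof -
  note F = fin_tri[OF T] and t = etri_typ[OF xi_etri[OF fin_tri(6)[OF T]]]
  obtain R' \<iota> \<pi> where H: "ar.hshoe ar.gp M M' M'' (Hm M x M') (Hm M' y M'') (wrap M (RG M)) R' (wrap M'' (RG M'')) \<iota> \<pi>"
    using F(5) by blast
  note c = ar.hshoe_cpx[OF H] and c' = ar.res_cpx[OF F(3)]
  note Px = res_pull[OF F(2,3) ar.cmpw_refl t(4) N] and Py = res_pull[OF F(3,4) ar.cmpw_refl t(5) N]
  obtain \<phi> where \<phi>: "ar.lft (wrap M (RG M)) (wrap M' (RG M')) (Hm M x M') \<phi>" using Px(2) by blast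
  obtain \<psi> where \<psi>: "ar.lft (wrap M' (RG M')) (wrap M'' (RG M'')) (Hm M' y M'') \<psi>" using Py(2) by blast
  note X = Px(3)[OF \<phi>] and Y = Py(3)[OF \<psi>] and E = eps_cls[OF H F(1) N, where \<delta> = \<delta>]
  note L = F(1) H F(3) N \<phi> \<psi>
  note g = coh_group[OF c(1) N] and g' = coh_group[OF c' N] and g'' = coh_group[OF c(3) N]
  show "xt_contra X RG 0 M' M'' y N \<in> mon (xt X RG 0 M'' N) (xt X RG 0 M' N)"
    unfolding xt_def xt_contra_def mon_def
  proof (intro CollectI conjI)
    have h: "group_hom (cohomology X (RG M'') N 0) (cohomology X (RG M') N 0) (coh_pull X (RG M') (RG M'') y N 0)"
      unfolding group_hom_def group_hom_axioms_def using g''(1) g'(1) Py(1) by blast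
    have "\<alpha> = \<one>\<^bsub>cohomology X (RG M'') N 0\<^esub>"
      if \<alpha>: "\<alpha> \<in> carrier (cohomology X (RG M'') N 0)" "coh_pull X (RG M') (RG M'') y N 0 \<alpha> = \<one>\<^bsub>cohomology X (RG M') N 0\<^esub>" for \<alpha>
    proof -
      obtain a where a: "ar.cyc (wrap M'' (RG M'')) N 0 a" "\<alpha> = cls (RG M'') N 0 a" using \<alpha>(1) g''(2) by blast
      have "ar.cob (wrap M' (RG M')) N 0 (ar_mul X a (\<psi> 0))"
        using \<alpha>(2) unfolding a(2) Y[OF a(1)] g'(5)[OF ar.cyc_pull[OF c' \<psi> a(1)]] .
      from ar.les_inj[OF L a(1) this] show ?thesis unfolding a(2) g''(5)[OF a(1)] .
    qed
    then show "inj_on (coh_pull X (RG M') (RG M'') y N 0) (carrier (cohomology X (RG M'') N 0))"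
      unfolding group_hom.inj_on_one_iff[OF h] by blast
  qed (rule Py(1))
  show "exact_seq ([xt X RG n M N, xt X RG n M' N, xt X RG n M'' N],
       [xt_contra X RG n M M' x N, xt_contra X RG n M' M'' y N])"
    unfolding xt_def xt_contra_def
  proof (rule exact_seq3I[OF g''(1) g'(1) g(1) Py(1) Px(1)])
    fix \<alpha> assume "\<alpha> \<in> carrier (cohomology X (RG M'') N n)"
    then obtain a where a: "ar.cyc (wrap M'' (RG M'')) N n a" "\<alpha> = cls (RG M'') N n a" using g''(2) by blast
    note 1 = ar.cyc_pull[OF c' \<psi> a(1)]
    have "ar.cob (wrap M (RG M)) N n (ar_mul X (ar_mul X a (\<psi> n)) (\<phi> n))" using ar.les_mid1[OF L a(1)] by simp
    then show "coh_pull X (RG M) (RG M') x N n (coh_pull X (RG M') (RG M'') y N n \<alpha>) = \<one>\<^bsub>cohomology X (RG M) N n\<^esub>"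
      unfolding a(2) Y[OF a(1)] X[OF 1] g(5)[OF ar.cyc_pull[OF c(1) \<phi> 1]] .
  next
    fix \<beta> assume \<beta>: "\<beta> \<in> carrier (cohomology X (RG M') N n)" "coh_pull X (RG M) (RG M') x N n \<beta> = \<one>\<^bsub>cohomology X (RG M) N n\<^esub>"
    obtain b where b: "ar.cyc (wrap M' (RG M')) N n b" "\<beta> = cls (RG M') N n b" using \<beta>(1) g'(2) by blast
    have "ar.cob (wrap M (RG M)) N n (ar_mul X b (\<phi> n))"
      using \<beta>(2) unfolding b(2) X[OF b(1)] g(5)[OF ar.cyc_pull[OF c(1) \<phi> b(1)]] .
    then obtain v where v: "ar.cyc (wrap M'' (RG M'')) N n v" "ar.eqc (wrap M' (RG M')) N n b (ar_mul X v (\<psi> n))"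
      using ar.les_mid2[OF L b(1)] by blast
    have "\<beta> = coh_pull X (RG M') (RG M'') y N n (cls (RG M'') N n v)"
      unfolding b(2) Y[OF v(1)] g'(4)[OF b(1) ar.cyc_pull[OF c' \<psi> v(1)]] by (rule v(2))
    then show "\<exists>\<alpha> \<in> carrier (cohomology X (RG M'') N n). \<beta> = coh_pull X (RG M') (RG M'') y N n \<alpha>"
      using g''(2) v(1) by blast
  qed
  show "exact_seq ([xt X RG (Suc n) M'' N, xt X RG n M N, xt X RG n M' N],
       [eps n (M, M', M'', x, y, \<delta>) N, xt_contra X RG n M M' x N])"
    unfolding xt_contra_def xt_def
  proof (rule exact_seq3I[OF g'(1) g(1) g''(1) Px(1) eps_hom[OF T N, unfolded xt_def]])
    fix \<alpha> assume "\<alpha> \<in> carrier (cohomology X (RG M') N n)"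
    then obtain a where a: "ar.cyc (wrap M' (RG M')) N n a" "\<alpha> = cls (RG M') N n a" using g'(2) by blast
    note 1 = ar.cyc_pull[OF c(1) \<phi> a(1)]
    obtain w v where d: "ar.cdat (wrap M (RG M)) R' (wrap M'' (RG M'')) \<iota> \<pi> N n (ar_mul X a (\<phi> n)) w v"
      by (rule ar.cdat_ex[OF H 1])
    show "eps n (M, M', M'', x, y, \<delta>) N (coh_pull X (RG M) (RG M') x N n \<alpha>) = \<one>\<^bsub>cohomology X (RG M'') N (Suc n)\<^esub>"
      unfolding a(2) X[OF a(1)] E[OF d] g''(5)[OF ar.cdat_cyc[OF H d]]
      by (rule ar.les_left1[OF L a(1) d ar.eqc_refl[OF c(1) ar.cycD(1)[OF 1]]])
  next
    fix \<beta> assume \<beta>: "\<beta> \<in> carrier (cohomology X (RG M) N n)"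
      "eps n (M, M', M'', x, y, \<delta>) N \<beta> = \<one>\<^bsub>cohomology X (RG M'') N (Suc n)\<^esub>"
    obtain b where b: "ar.cyc (wrap M (RG M)) N n b" "\<beta> = cls (RG M) N n b" using \<beta>(1) g(2) by blast
    obtain w v where d: "ar.cdat (wrap M (RG M)) R' (wrap M'' (RG M'')) \<iota> \<pi> N n b w v" by (rule ar.cdat_ex[OF H b(1)])
    have "ar.cob (wrap M'' (RG M'')) N (Suc n) v" using \<beta>(2) unfolding b(2) E[OF d] g''(5)[OF ar.cdat_cyc[OF H d]] .
    then obtain z where z: "ar.cyc (wrap M' (RG M')) N n z" "ar.eqc (wrap M (RG M)) N n b (ar_mul X z (\<phi> n))"
      using ar.les_left2[OF L d] by blast
    have "\<beta> = coh_pull X (RG M) (RG M') x N n (cls (RG M') N n z)"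
      unfolding b(2) X[OF z(1)] g(4)[OF b(1) ar.cyc_pull[OF c(1) \<phi> z(1)]] by (rule z(2))
    then show "\<exists>\<alpha> \<in> carrier (cohomology X (RG M') N n). \<beta> = coh_pull X (RG M) (RG M') x N n \<alpha>"
      using g'(2) z(1) by blast
  qed
  show "exact_seq ([xt X RG (Suc n) M' N, xt X RG (Suc n) M'' N, xt X RG n M N],
       [xt_contra X RG (Suc n) M' M'' y N, eps n (M, M', M'', x, y, \<delta>) N])"
    unfolding xt_contra_def xt_def
  proof (rule exact_seq3I[OF g(1) g''(1) g'(1) eps_hom[OF T N, unfolded xt_def] Py(1)])
    fix \<alpha> assume "\<alpha> \<in> carrier (cohomology X (RG M) N n)"
    then obtain a where a: "ar.cyc (wrap M (RG M)) N n a" "\<alpha> = cls (RG M) N n a" using g(2) by blast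
    obtain w v where d: "ar.cdat (wrap M (RG M)) R' (wrap M'' (RG M'')) \<iota> \<pi> N n a w v" by (rule ar.cdat_ex[OF H a(1)])
    note 1 = ar.cdat_cyc[OF H d]
    show "coh_pull X (RG M') (RG M'') y N (Suc n) (eps n (M, M', M'', x, y, \<delta>) N \<alpha>) = \<one>\<^bsub>cohomology X (RG M') N (Suc n)\<^esub>"
      unfolding a(2) E[OF d] Y[OF 1] g'(5)[OF ar.cyc_pull[OF c' \<psi> 1]] by (rule ar.les_right1[OF L d])
  next
    fix \<beta> assume \<beta>: "\<beta> \<in> carrier (cohomology X (RG M'') N (Suc n))"
      "coh_pull X (RG M') (RG M'') y N (Suc n) \<beta> = \<one>\<^bsub>cohomology X (RG M') N (Suc n)\<^esub>"
    obtain b where b: "ar.cyc (wrap M'' (RG M'')) N (Suc n) b" "\<beta> = cls (RG M'') N (Suc n) b" using \<beta>(1) g''(2) by blast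
    have "ar.cob (wrap M' (RG M')) N (Suc n) (ar_mul X b (\<psi> (Suc n)))"
      using \<beta>(2) unfolding b(2) Y[OF b(1)] g'(5)[OF ar.cyc_pull[OF c' \<psi> b(1)]] .
    then obtain z w where d: "ar.cdat (wrap M (RG M)) R' (wrap M'' (RG M'')) \<iota> \<pi> N n z w b"
      using ar.les_right2[OF L b(1)] by blast
    have "\<beta> = eps n (M, M', M'', x, y, \<delta>) N (cls (RG M) N n z)" unfolding b(2) E[OF d] ..
    then show "\<exists>\<alpha> \<in> carrier (cohomology X (RG M) N n). \<beta> = eps n (M, M', M'', x, y, \<delta>) N \<alpha>"
      using g(2) ar.cdatD(1)[OF d] by blast
  qed
qed

section \<open>Naturality, and the comparison with ordinary cohomology\<close>

lemma eps_natural: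
  assumes T1: "(M1, M1', M1'', x1, y1, \<delta>1) \<in> finite_Gpd_tris X \<xi>"
    and T2: "(M2, M2', M2'', x2, y2, \<delta>2) \<in> finite_Gpd_tris X \<xi>" and N: "N \<in> Obj X"
    and m: "tri_mor X (M1, M1', M1'', x1, y1, \<delta>1) (M2, M2', M2'', x2, y2, \<delta>2) (a, b, c)"
    and \<alpha>: "\<alpha> \<in> carrier (xt X RG i M2 N)"
  shows "eps i (M1, M1', M1'', x1, y1, \<delta>1) N (xt_contra X RG i M1 M2 a N \<alpha>) =
    xt_contra X RG (Suc i) M1'' M2'' c N (eps i (M2, M2', M2'', x2, y2, \<delta>2) N \<alpha>)"
proof -
  note F1 = fin_tri[OF T1] and F2 = fin_tri[OF T2]
  note t1 = etri_typ[OF xi_etri[OF F1(6)]] and t2 = etri_typ[OF xi_etri[OF F2(6)]]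
  have ab: "a \<in> Mor X M1 M2" "b \<in> Mor X M1' M2'" "c \<in> Mor X M1'' M2''" "b \<cdot> x1 = x2 \<cdot> a" "y2 \<cdot> b = c \<cdot> y1"
    using m by auto
  obtain R1 i1 p1 where H1: "ar.hshoe ar.gp M1 M1' M1'' (Hm M1 x1 M1') (Hm M1' y1 M1'') (wrap M1 (RG M1)) R1 (wrap M1'' (RG M1'')) i1 p1"
    using F1(5) by blast
  obtain R2 i2 p2 where H2: "ar.hshoe ar.gp M2 M2' M2'' (Hm M2 x2 M2') (Hm M2' y2 M2'') (wrap M2 (RG M2)) R2 (wrap M2'' (RG M2'')) i2 p2"
    using F2(5) by blast
  note c1 = ar.hshoe_cpx[OF H1] and c2 = ar.hshoe_cpx[OF H2]
  note Pa = res_pull[OF F1(2) F2(2) ar.cmpw_refl ab(1) N] and Pc = res_pull[OF F1(4) F2(4) ar.cmpw_refl ab(3) N]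
  obtain \<phi> where \<phi>: "ar.lft (wrap M1 (RG M1)) (wrap M2 (RG M2)) (Hm M1 a M2) \<phi>" using Pa(2) by blast
  obtain \<psi> where \<psi>: "ar.lft (wrap M1'' (RG M1'')) (wrap M2'' (RG M2'')) (Hm M1'' c M2'') \<psi>" using Pc(2) by blast
  obtain z where z: "ar.cyc (wrap M2 (RG M2)) N i z" "\<alpha> = cls (RG M2) N i z"
    using \<alpha> coh_group(2)[OF c2(1) N] unfolding xt_def by blast
  obtain w2 v2 where d2: "ar.cdat (wrap M2 (RG M2)) R2 (wrap M2'' (RG M2'')) i2 p2 N i z w2 v2" by (rule ar.cdat_ex[OF H2 z(1)])
  note 1 = ar.cyc_pull[OF c1(1) \<phi> z(1)]
  \<comment> \<open>The first zigzag starts at the pulled-back cocycle itself, so the congruence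
    required by \<open>connecting_natural\<close> is reflexivity.\<close>
  obtain w1 v1 where d1: "ar.cdat (wrap M1 (RG M1)) R1 (wrap M1'' (RG M1'')) i1 p1 N i (ar_mul X z (\<phi> i)) w1 v1"
    by (rule ar.cdat_ex[OF H1 1])
  have o: "ar.hm M1 M2 (Hm M1 a M2)" "ar.hm M1' M2' (Hm M1' b M2')" "ar.hm M1'' M2'' (Hm M1'' c M2'')"
    "ar_mul X (Hm M1' b M2') (Hm M1 x1 M1') = ar_mul X (Hm M2 x2 M2') (Hm M1 a M2)"
    "ar_mul X (Hm M2' y2 M2'') (Hm M1' b M2') = ar_mul X (Hm M1'' c M2'') (Hm M1' y1 M1'')"
    using ab t1 t2 by simp_all
  have "ar.eqc (wrap M1'' (RG M1'')) N (Suc i) v1 (ar_mul X v2 (\<psi> (Suc i)))"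
    by (rule ar.connecting_natural[OF H1 H2 ar.thD(1)[OF F1(1)] F2(1) ar.cmpw_refl o \<phi> \<psi> d1 d2
          ar.eqc_refl[OF c1(1) ar.cycD(1)[OF 1]]])
  then show ?thesis unfolding xt_contra_def z(2) Pa(3)[OF \<phi> z(1)] eps_cls[OF H1 F1(1) N d1] eps_cls[OF H2 F2(1) N d2]
      Pc(3)[OF \<psi> ar.cdat_cyc[OF H2 d2]]
      coh_group(4)[OF c1(3) N ar.cdat_cyc[OF H1 d1] ar.cyc_pull[OF c1(3) \<psi> ar.cdat_cyc[OF H2 d2]]] .
qed

text \<open>No change of resolution is involved: composing with \<open>g\<close> carries a zigzag to
  a zigzag over the same horseshoe.\<close>

lemma eps_natural_cov:
  assumes T: "(M, M', M'', x, y, \<delta>) \<in> finite_Gpd_tris X \<xi>" and g: "g \<in> Mor X N N'" "N \<in> Obj X" "N' \<in> Obj X"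
    and \<alpha>: "\<alpha> \<in> carrier (xt X RG i M N)"
  shows "eps i (M, M', M'', x, y, \<delta>) N' (xt_cov X RG i M N N' g \<alpha>) =
    xt_cov X RG (Suc i) M'' N N' g (eps i (M, M', M'', x, y, \<delta>) N \<alpha>)"
proof -
  note F = fin_tri[OF T]
  obtain R' \<iota> \<pi> where H: "ar.hshoe ar.gp M M' M'' (Hm M x M') (Hm M' y M'') (wrap M (RG M)) R' (wrap M'' (RG M'')) \<iota> \<pi>"
    using F(5) by blast
  note c = ar.hshoe_cpx[OF H]
  obtain z where z: "ar.cyc (wrap M (RG M)) N i z" "\<alpha> = cls (RG M) N i z"
    using \<alpha> coh_group(2)[OF c(1) g(2)] unfolding xt_def by blast
  obtain w v where d: "ar.cdat (wrap M (RG M)) R' (wrap M'' (RG M'')) \<iota> \<pi> N i z w v" by (rule ar.cdat_ex[OF H z(1)])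
  have "ar.hm N N' (Hm N g N')" using g by simp
  note d' = ar.cdat_push[OF H d this]
  show ?thesis unfolding xt_cov_def z(2) coh_push_cls[OF c(1) g z(1)] eps_cls[OF H F(1) g(3) d'] eps_cls[OF H F(1) g(2) d]
      coh_push_cls[OF c(3) g ar.cdat_cyc[OF H d]] ..
qed

text \<open>Naturality for the identity of the triangle, from a projective horseshoe to a Gorenstein
  projective one; the lifts exist because projectives are compatible with every kind of resolution
  (\<open>cmpw_prj\<close>).\<close>

lemma comparison_square:
  assumes T: "(M, M', M'', x, y, \<delta>) \<in> finite_Gpd_tris X \<xi>" and N: "N \<in> Obj X" and \<alpha>: "\<alpha> \<in> carrier (xt X RG i M N)"
  shows "coh_pull X (RP M'') (RG M'') (Idm X M'') N (Suc i) (eps i (M, M', M'', x, y, \<delta>) N \<alpha>) =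
    xi_connecting X \<xi> (M, M', M'', x, y, \<delta>) (RP M) (RP M'') N i (coh_pull X (RP M) (RG M) (Idm X M) N i \<alpha>)"
proof -
  note F = fin_tri[OF T] and t = etri_typ[OF xi_etri[OF fin_tri(6)[OF T]]]
  note rP = RP_res[OF t(1)] RP_res[OF t(3)]
  have th: "ar.th ar.prj M M' M'' (Hm M x M') (Hm M' y M'') (Ex M'' \<delta> M)" using F(6) th_prj_ar by blast
  have "\<exists>R1 i1 p1. ar.hshoe ar.prj M M' M'' (Hm M x M') (Hm M' y M'') (wrap M (RP M)) R1 (wrap M'' (RP M'')) i1 p1"
    by (rule ar.hshoe_ex[OF th rP ar.prj_bip])
  then obtain R1 i1 p1 where
    H1: "ar.hshoe ar.prj M M' M'' (Hm M x M') (Hm M' y M'') (wrap M (RP M)) R1 (wrap M'' (RP M'')) i1 p1" by blast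
  obtain R2 i2 p2 where H2: "ar.hshoe ar.gp M M' M'' (Hm M x M') (Hm M' y M'') (wrap M (RG M)) R2 (wrap M'' (RG M'')) i2 p2"
    using F(5) by blast
  note c1 = ar.hshoe_cpx[OF H1] and c2 = ar.hshoe_cpx[OF H2]
  note P = res_pull[OF rP(1) F(2) ar.cmpw_prj id_closed[OF t(1)] N]
    and P'' = res_pull[OF rP(2) F(4) ar.cmpw_prj id_closed[OF t(3)] N]
  obtain \<phi> where \<phi>: "ar.lft (wrap M (RP M)) (wrap M (RG M)) (Hm M (Idm X M) M) \<phi>" using P(2) by blast
  obtain \<psi> where \<psi>: "ar.lft (wrap M'' (RP M'')) (wrap M'' (RG M'')) (Hm M'' (Idm X M'') M'') \<psi>" using P''(2) by blast
  obtain z where z: "ar.cyc (wrap M (RG M)) N i z" "\<alpha> = cls (RG M) N i z"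
    using \<alpha> coh_group(2)[OF c2(1) N] unfolding xt_def by blast
  obtain w2 v2 where d2: "ar.cdat (wrap M (RG M)) R2 (wrap M'' (RG M'')) i2 p2 N i z w2 v2" by (rule ar.cdat_ex[OF H2 z(1)])
  note 1 = ar.cyc_pull[OF c1(1) \<phi> z(1)]
  obtain w1 v1 where d1: "ar.cdat (wrap M (RP M)) R1 (wrap M'' (RP M'')) i1 p1 N i (ar_mul X z (\<phi> i)) w1 v1"
    by (rule ar.cdat_ex[OF H1 1])
  have o: "ar.hm M M (Hm M (Idm X M) M)" "ar.hm M' M' (Hm M' (Idm X M') M')" "ar.hm M'' M'' (Hm M'' (Idm X M'') M'')"
    "ar_mul X (Hm M' (Idm X M') M') (Hm M x M') = ar_mul X (Hm M x M') (Hm M (Idm X M) M)"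
    "ar_mul X (Hm M' y M'') (Hm M' (Idm X M') M') = ar_mul X (Hm M'' (Idm X M'') M'') (Hm M' y M'')"
    using t by (simp_all add: id_closed id_left[of M M'] id_left[of M' M''] id_right[of M M'] id_right[of M' M''])
  have "ar.eqc (wrap M'' (RP M'')) N (Suc i) v1 (ar_mul X v2 (\<psi> (Suc i)))"
    by (rule ar.connecting_natural[OF H1 H2 ar.thD(1)[OF th] F(1) ar.cmpw_prj o \<phi> \<psi> d1 d2
          ar.eqc_refl[OF c1(1) ar.cycD(1)[OF 1]]])
  then have "cls (RP M'') N (Suc i) v1 = cls (RP M'') N (Suc i) (ar_mul X v2 (\<psi> (Suc i)))"
    using coh_group(4)[OF c1(3) N ar.cdat_cyc[OF H1 d1] ar.cyc_pull[OF c1(3) \<psi> ar.cdat_cyc[OF H2 d2]]] by blast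
  then show ?thesis unfolding z(2) P(3)[OF \<phi> z(1)] eps_cls[OF H2 F(1) N d2] P''(3)[OF \<psi> ar.cdat_cyc[OF H2 d2]]
      xi_connecting_cls[OF F(6) N H1 d1] by simp
qed

lemma comparison_hom:
  assumes "M \<in> Obj X" "N \<in> Obj X" "xi_Gpd X \<xi> M < \<infinity>"
  shows "coh_pull X (RP M) (RG M) (Idm X M) N i \<in> hom (xt X RG i M N) (xt X RP i M N)"
  unfolding xt_def
  by (rule res_pull(1)[OF RP_res[OF assms(1)] RG_res[OF gpf_ar[OF assms(3)]] ar.cmpw_prj id_closed[OF assms(1)] assms(2)])

end

theorem proposition3p8:
  fixes X :: "('o, 'm, 'e) extricat"
    and \<xi> :: "('o, 'm, 'e) tri set"
    and RP RG :: "'o \<Rightarrow> ('o, 'm) aug_complex"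
  assumes "extriangulated_category X"
    and "WIC X"
    and "proper_class X \<xi>"
    and "enough_xi_proj X \<xi>"
    and "enough_xi_inj X \<xi>"
    and "resolution_choice (xi_proj_resolution X \<xi>) RP"
    and "resolution_choice (xi_Gproj_resolution X \<xi>) RG"
  shows
    "\<exists>\<epsilon> :: nat \<Rightarrow> ('o, 'm, 'e) tri \<Rightarrow> 'o \<Rightarrow> 'm set \<Rightarrow> 'm set.
       (\<forall>M M' M'' x y \<delta>. \<forall>N \<in> Obj X. (M, M', M'', x, y, \<delta>) \<in> finite_Gpd_tris X \<xi> \<longrightarrow>
          (\<forall>i. \<epsilon> i (M, M', M'', x, y, \<delta>) N \<in> hom (xt X RG i M N) (xt X RG (Suc i) M'' N)) \<and>
          xt_contra X RG 0 M' M'' y N \<in> mon (xt X RG 0 M'' N) (xt X RG 0 M' N) \<and>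
          (\<forall>n. exact_seq ([xt X RG n M N, xt X RG n M' N, xt X RG n M'' N],
                 [xt_contra X RG n M M' x N, xt_contra X RG n M' M'' y N])) \<and>
          (\<forall>n. exact_seq ([xt X RG (Suc n) M'' N, xt X RG n M N, xt X RG n M' N],
                 [\<epsilon> n (M, M', M'', x, y, \<delta>) N, xt_contra X RG n M M' x N])) \<and>
          (\<forall>n. exact_seq ([xt X RG (Suc n) M' N, xt X RG (Suc n) M'' N, xt X RG n M N],
                 [xt_contra X RG (Suc n) M' M'' y N, \<epsilon> n (M, M', M'', x, y, \<delta>) N]))) \<and>
       (\<forall>M1 M1' M1'' x1 y1 \<delta>1 M2 M2' M2'' x2 y2 \<delta>2 a b c. \<forall>N \<in> Obj X.
          (M1, M1', M1'', x1, y1, \<delta>1) \<in> finite_Gpd_tris X \<xi> \<longrightarrow>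
          (M2, M2', M2'', x2, y2, \<delta>2) \<in> finite_Gpd_tris X \<xi> \<longrightarrow>
          tri_mor X (M1, M1', M1'', x1, y1, \<delta>1) (M2, M2', M2'', x2, y2, \<delta>2) (a, b, c) \<longrightarrow>
          (\<forall>i. \<forall>\<alpha> \<in> carrier (xt X RG i M2 N).
             \<epsilon> i (M1, M1', M1'', x1, y1, \<delta>1) N (xt_contra X RG i M1 M2 a N \<alpha>) =
             xt_contra X RG (Suc i) M1'' M2'' c N (\<epsilon> i (M2, M2', M2'', x2, y2, \<delta>2) N \<alpha>))) \<and>
       (\<forall>M M' M'' x y \<delta>. \<forall>N \<in> Obj X. \<forall>N' \<in> Obj X. \<forall>g \<in> Mor X N N'.
          (M, M', M'', x, y, \<delta>) \<in> finite_Gpd_tris X \<xi> \<longrightarrow>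
          (\<forall>i. \<forall>\<alpha> \<in> carrier (xt X RG i M N).
             \<epsilon> i (M, M', M'', x, y, \<delta>) N' (xt_cov X RG i M N N' g \<alpha>) =
             xt_cov X RG (Suc i) M'' N N' g (\<epsilon> i (M, M', M'', x, y, \<delta>) N \<alpha>))) \<and>
       (\<exists>\<Delta> :: nat \<Rightarrow> 'o \<Rightarrow> 'o \<Rightarrow> 'm set \<Rightarrow> 'm set.
          (\<forall>M \<in> Obj X. \<forall>N \<in> Obj X. xi_Gpd X \<xi> M < \<infinity> \<longrightarrow>
             (\<forall>i. \<Delta> i M N \<in> hom (xt X RG i M N) (xt X RP i M N) \<and>
                (\<forall>\<alpha> \<in> carrier (xt X RG i M N).
                   \<Delta> i M N \<alpha> = coh_pull X (RP M) (RG M) (Idm X M) N i \<alpha>))) \<and>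
          (\<forall>M M' M'' x y \<delta>. \<forall>N \<in> Obj X. (M, M', M'', x, y, \<delta>) \<in> finite_Gpd_tris X \<xi> \<longrightarrow>
             (\<forall>i. \<forall>\<alpha> \<in> carrier (xt X RG i M N).
                \<Delta> (Suc i) M'' N (\<epsilon> i (M, M', M'', x, y, \<delta>) N \<alpha>) =
                xi_connecting X \<xi> (M, M', M'', x, y, \<delta>) (RP M) (RP M'') N i (\<Delta> i M N \<alpha>))))"
proof -
  interpret C: chosen_resolutions X \<xi> RP RG
    using assms by (intro chosen_resolutions.intro proper_class_proj.intro proper_class_proj_axioms.intro
        chosen_resolutions_axioms.intro)
  show ?thesis
  proof (rule exI[of _ C.eps], intro conjI allI ballI impI exI[of _ "\<lambda>i M N. coh_pull X (RP M) (RG M) (Idm X M) N i"])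
  qed (rule C.eps_hom C.long_exact C.eps_natural C.eps_natural_cov C.comparison_hom C.comparison_square refl; assumption)+
qed

end
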